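(* Let $H$ be a Krull monoid. Then $H = H^{\times} \times \mathcal F (P_0) \times H^*$, where $P_0$ is a set of representatives (up to associates) of the prime elements of $H$, $\mathcal F (P_0) \times H^* \cong H_{\mathrm{red}}$, and $H^*$ is a reduced Krull monoid without prime elements. The class groups $\mathcal C (H)$ of $H$ and $\mathcal C (H^* )$ of $H^*$ are isomorphic, and $H$ is length-factorial if and only if $H^*$ is length-factorial. Let $G_{P^*} \subset \mathcal C (H^* )$ denote the set of classes containing prime divisors. Then $H$ is length-factorial but not factorial if and only if every class of $G_{P^*}$ contains precisely one prime divisor, $H^* \cong \mathcal B (G_{P^*})$, and there exist $t\in \mathbb N_0$ and $k, s_0, s_1,\ldots,s_t\in \mathbb N$ with $k+1\neq s_0+s_1+\ldots+s_t$ and $s_0+s_1+\ldots+s_t\ge 2$, independent elements $e_{1,1},\ldots, e_{1,t}, e_{2,1},\ldots, e_{2,t}, \ldots, e_{k,1},\ldots, e_{k,t}\in \mathcal C(H^* )$ of infinite order, and independent elements $g_1,\ldots, g_k\in \mathcal C(H^* )$, which are of infinite order in case $t>0$ and of finite order in case $t=0$, such that \[ G_{P^*}=\{e_{1,1},\ldots, e_{1,t}, e_{2,1},\ldots, e_{2,t}, \ldots, e_{k,1},\ldots, e_{k,t},g_1,\ldots, g_k,e_{0,1}, \ldots, e_{0,t}, g_0\} \] and \[ \mathcal C(H^* )=\langle e_{1,1},\ldots,e_{1,t},g_1 \rangle \oplus \ldots \oplus \langle e_{k,1},\ldots,e_{k,t},g_k \rangle\cong (\mathbb Z^t\oplus \mathbb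 Z/n\mathbb Z)^k , \] where - $s_0$ is the smallest positive integer such that $s_0g_i\in \langle e_{i,1},\ldots,e_{i,t}\rangle$, and $-s_0g_i=s_1e_{i,1}+\ldots+s_te_{i,t}$, for every $i\in [1,k]$; - $e_{0,j}=-\sum_{i=1}^ke_{i,j}$ for all $j\in [1,t]$, $g_0=-\sum_{i=1}^kg_i$, and $n=\gcd(s_0,\ldots,s_t)$. Moreover (when $H$ is length-factorial but not factorial), $\mathcal C (H^* )$ is a torsion group if and only if $t=0$, and in that case we have $\mathcal C (H^* ) \cong (\mathbb Z/n\mathbb Z)^k$, where $n\ge 2$, $k\in \mathbb N$ with $k+1\neq n$, and $\mathrm{ord}(g_i)=n$ for all $i\in [1,k]$.
   Context: A monoid means a commutative semigroup with identity that is unit-cancellative ($a=au$ implies that $u$ is invertible). $\mathbb N=\{1,2,\ldots\}$, $\mathbb N_0=\mathbb N\cup\{0\}$, and $[a,b]=\{x\in\mathbb Z: a\le x\le b\}$. For a monoid $H$: $H^\times$ is its group of invertible elements; $H$ is reduced if $H^\times=\{1\}$; $H_{\mathrm{red}}=\{aH^\times : a\in H\}$ is the associated reduced monoid. An element $u\notin H^\times$ is prime if $u\mid ab$ implies $u\mid a$ or $u\mid b$; it is an atom if $u=ab$ implies $a\in H^\times$ or $b\in H^\times$. For a set $P$, $\mathcal F(P)$ is the free abelian monoid with basis $P$. The factorization monoid of $H$ is $\mathsf Z(H)=\mathcal F(\mathcal A(H_{\mathrm{red}}))$, where $\mathcal A(\cdot)$ denotes the set of atoms. The factorizations of $a\in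 H$ are the $z\in\mathsf Z(H)$ whose product in $H_{\mathrm{red}}$ equals $aH^\times$; the length of $z$ is the number $|z|$ of its atoms counted with multiplicity. $H$ is atomic if every element has a factorization, factorial if every element has exactly one factorization, and length-factorial if it is atomic and any two distinct factorizations of any element have distinct lengths. A monoid homomorphism $\varphi\colon H\to D$ is a divisor homomorphism if $\varphi(a)\mid\varphi(b)$ in $D$ implies $a\mid b$ in $H$. It is a divisor theory if moreover $D$ is free abelian and every $a\in D$ is of the form $a=\gcd(\varphi(a_1),\ldots,\varphi(a_m))$ with $a_1,\ldots,a_m\in H$. A Krull monoid is a cancellative monoid having a divisor theory (equivalently, a divisor homomorphism to a free abelian monoid). If $H$ is Krull, there is a divisor theory $H_{\mathrm{red}}\hookrightarrow F=\mathcal F(P)$ (unique up to isomorphism); the class group is $\mathcal C(H)=\mathsf q(F)/\mathsf q(H_{\mathrm{red}})$ (quotient groups), written additively. The elements $p\in P$ are the prime divisors, and the class $g\in\mathcal C(H)$ contains the prime divisor $p$ if $[p]=p\,\mathsf q(H_{\mathrm{red}})=g$. Let $G$ be an additive abelian group and $G_0\subset G$. $\langle G_0\rangle$ is the subgroup generated by $G_0$. Elements $e_1,\ldots,e_r\in G$ are independent if all $e_i\neq 0$ and $\langle e_1,\ldots,e_r\rangle=\langle e_1\rangle\oplus\ldots\oplus\langle e_r\rangle$. For $S=g_1\cdot\ldots\cdot g_\ell\in\mathcal F(G_0)$ let $\sigma(S)=g_1+\ldots+g_\ell$. The monoid of zero-sum sequences over $G_0$ is $\mathcal B(G_0)=\{S\in\mathcal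 F(G_0):\sigma(S)=0\}$. *)

theory Defs
  imports
    "HOL-Algebra.Divisibility"
    "HOL-Algebra.Multiplicative_Group"
    "HOL-Algebra.Free_Abelian_Groups"
    "HOL-Library.Multiset"
begin

text \<open>
  Monoids and groups are records of \<open>HOL-Algebra\<close> and are written multiplicatively throughout,
  also the class groups, which the literature writes additively.
\<close>

section \<open>Free abelian monoids and products of multisets\<close>

definition free_abelian_monoid :: "'p set \<Rightarrow> 'p multiset monoid" where
  "free_abelian_monoid P = \<lparr>carrier = {M. set_mset M \<subseteq> P}, monoid.mult = (+), one = {#}\<rparr>"

definition mset_prod :: "('a, 'm) monoid_scheme \<Rightarrow> 'a multiset \<Rightarrow> 'a" where
  "mset_prod G M = finprod G (\<lambda>x. x [^]\<^bsub>G\<^esub> count M x) (set_mset M)"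

section \<open>Factorizations\<close>

definition reduced :: "('a, 'm) monoid_scheme \<Rightarrow> bool" where
  "reduced H \<longleftrightarrow> Units H = {\<one>\<^bsub>H\<^esub>}"

text \<open>The factor construction of the library is stated for arbitrary records; its elements are
  here the cosets of the unit group.\<close>

definition red_monoid :: "('a, 'm) monoid_scheme \<Rightarrow> 'a set monoid" where
  "red_monoid H = H Mod Units H"

definition atoms :: "('a, 'm) monoid_scheme \<Rightarrow> 'a set" where
  "atoms H = {u \<in> carrier H. irreducible H u}"

text \<open>In a cancellative monoid the library's notion of irreducibility is the usual one.\<close>

lemma (in comm_monoid_cancel) atoms_iff:
  "u \<in> atoms G \<longleftrightarrow> u \<in> carrier G \<and> u \<notin> Units G \<and>
     (\<forall>a\<in>carrier G. \<forall>b\<in>carrier G. u = a \<otimes> b \<longrightarrow> a \<in> Units G \<or> b \<in> Units G)"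
proof (cases "u \<in> carrier G \<and> u \<notin> Units G")
  case True
  show ?thesis
  proof
    assume "u \<in> atoms G"
    then show "u \<in> carrier G \<and> u \<notin> Units G \<and>
     (\<forall>a\<in>carrier G. \<forall>b\<in>carrier G. u = a \<otimes> b \<longrightarrow> a \<in> Units G \<or> b \<in> Units G)"
      using True by (auto simp: atoms_def)
  next
    assume *: "u \<in> carrier G \<and> u \<notin> Units G \<and>
     (\<forall>a\<in>carrier G. \<forall>b\<in>carrier G. u = a \<otimes> b \<longrightarrow> a \<in> Units G \<or> b \<in> Units G)"
    have "b \<in> Units G" if b: "b \<in> carrier G" and pf: "properfactor G b u" for b
    proof -
      obtain c where c: "c \<in> carrier G" "u = b \<otimes> c"
        using pf by (auto simp: properfactor_def factor_def)
      have "c \<notin> Units G"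
        using pf c b associatedI2[of c u b] by (auto simp: properfactor_def associated_def)
      then show ?thesis
        using * b c by blast
    qed
    then show "u \<in> atoms G"
      using * by (auto simp: atoms_def irreducible_def)
  qed
qed (auto simp: atoms_def irreducible_def)

definition factorizations :: "('a, 'm) monoid_scheme \<Rightarrow> 'a \<Rightarrow> 'a set multiset set" where
  "factorizations H a =
     {z \<in> carrier (free_abelian_monoid (atoms (red_monoid H))).
        mset_prod (red_monoid H) z = Units H #>\<^bsub>H\<^esub> a}"

definition atomic :: "('a, 'm) monoid_scheme \<Rightarrow> bool" where
  "atomic H \<longleftrightarrow> (\<forall>a\<in>carrier H. factorizations H a \<noteq> {})"

definition factorial :: "('a, 'm) monoid_scheme \<Rightarrow> bool" where
  "factorial H \<longleftrightarrow> (\<forall>a\<in>carrier H. \<exists>!z. z \<in> factorizations H a)"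

definition length_factorial :: "('a, 'm) monoid_scheme \<Rightarrow> bool" where
  "length_factorial H \<longleftrightarrow> atomic H \<and>
     (\<forall>a\<in>carrier H. \<forall>z\<in>factorizations H a. \<forall>z'\<in>factorizations H a.
        z \<noteq> z' \<longrightarrow> size z \<noteq> size z')"

section \<open>Krull monoids\<close>

definition divisor_homomorphism ::
    "('a, 'm) monoid_scheme \<Rightarrow> ('b, 'n) monoid_scheme \<Rightarrow> ('a \<Rightarrow> 'b) \<Rightarrow> bool" where
  "divisor_homomorphism H D \<phi> \<longleftrightarrow> \<phi> \<in> hom H D \<and> \<phi> \<one>\<^bsub>H\<^esub> = \<one>\<^bsub>D\<^esub> \<and>
     (\<forall>a\<in>carrier H. \<forall>b\<in>carrier H. \<phi> a divides\<^bsub>D\<^esub> \<phi> b \<longrightarrow> a divides\<^bsub>H\<^esub> b)"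

definition is_gcd_of :: "('b, 'n) monoid_scheme \<Rightarrow> 'b \<Rightarrow> 'b set \<Rightarrow> bool" where
  "is_gcd_of D d X \<longleftrightarrow> d \<in> carrier D \<and> (\<forall>x\<in>X. d divides\<^bsub>D\<^esub> x) \<and>
     (\<forall>y\<in>carrier D. (\<forall>x\<in>X. y divides\<^bsub>D\<^esub> x) \<longrightarrow> y divides\<^bsub>D\<^esub> d)"

definition divisor_theory ::
    "('a, 'm) monoid_scheme \<Rightarrow> 'p set \<Rightarrow> ('a \<Rightarrow> 'p multiset) \<Rightarrow> bool" where
  "divisor_theory H P \<phi> \<longleftrightarrow> divisor_homomorphism H (free_abelian_monoid P) \<phi> \<and>
     (\<forall>d\<in>carrier (free_abelian_monoid P).
        \<exists>A. finite A \<and> A \<noteq> {} \<and> A \<subseteq> carrier H \<and> is_gcd_of (free_abelian_monoid P) d (\<phi> ` A))"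

text \<open>
  The existential quantifier has to fix a type for the basis. Sets of monoid elements suffice:
  a prime divisor \<open>p\<close> is determined by the set of all \<open>a\<close> with \<open>p\<close> dividing \<open>\<phi> a\<close>. The lemma
  \<open>krull_monoidI\<close> below shows that a divisor theory over any type yields a Krull monoid.
\<close>

definition krull_monoid :: "('a, 'm) monoid_scheme \<Rightarrow> bool" where
  "krull_monoid H \<longleftrightarrow> comm_monoid_cancel H \<and>
     (\<exists>(P :: 'a set set) \<phi>. divisor_theory H P \<phi>)"

lemma divides_free_abelian_monoid_iff:
  assumes "set_mset N \<subseteq> P"
  shows "M divides\<^bsub>free_abelian_monoid P\<^esub> N \<longleftrightarrow> M \<subseteq># N"
  using assms unfolding factor_def free_abelian_monoid_def mset_subset_eq_exists_conv by auto

lemma krull_monoidI: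
  fixes H :: "('a, 'm) monoid_scheme" and P :: "'p set"
  assumes H: "comm_monoid_cancel H" and dt: "divisor_theory H P \<phi>"
  shows "krull_monoid H"
proof -
  define f where "f = (\<lambda>p. {a \<in> carrier H. p \<in># \<phi> a})"
  have hom: "\<phi> \<in> hom H (free_abelian_monoid P)" and one: "\<phi> \<one>\<^bsub>H\<^esub> = {#}"
    and div: "\<And>a b. a \<in> carrier H \<Longrightarrow> b \<in> carrier H \<Longrightarrow>
        \<phi> a divides\<^bsub>free_abelian_monoid P\<^esub> \<phi> b \<Longrightarrow> a divides\<^bsub>H\<^esub> b"
    using dt by (auto simp: divisor_theory_def divisor_homomorphism_def free_abelian_monoid_def)
  have sub: "set_mset (\<phi> a) \<subseteq> P" if "a \<in> carrier H" for a
    using hom that by (auto simp: hom_def free_abelian_monoid_def)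
  have mult: "\<phi> (a \<otimes>\<^bsub>H\<^esub> b) = \<phi> a + \<phi> b" if "a \<in> carrier H" "b \<in> carrier H" for a b
    using hom that by (auto simp: hom_def free_abelian_monoid_def)
  have gcd: "\<exists>A. finite A \<and> A \<noteq> {} \<and> A \<subseteq> carrier H \<and> (\<forall>a\<in>A. d \<subseteq># \<phi> a) \<and>
      (\<forall>y. set_mset y \<subseteq> P \<longrightarrow> (\<forall>a\<in>A. y \<subseteq># \<phi> a) \<longrightarrow> y \<subseteq># d)" if d: "set_mset d \<subseteq> P" for d
  proof -
    obtain A where A: "finite A" "A \<noteq> {}" "A \<subseteq> carrier H" "is_gcd_of (free_abelian_monoid P) d (\<phi> ` A)"
    proof -
      have "d \<in> carrier (free_abelian_monoid P)"
        using d by (simp add: free_abelian_monoid_def)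
      then show thesis
        using dt that unfolding divisor_theory_def by blast
    qed
    have *: "M divides\<^bsub>free_abelian_monoid P\<^esub> \<phi> a \<longleftrightarrow> M \<subseteq># \<phi> a" if "a \<in> A" for a M
      using that A(3) sub by (intro divides_free_abelian_monoid_iff) auto
    have 1: "d \<subseteq># \<phi> a" if "a \<in> A" for a
      using A(4) that unfolding is_gcd_of_def *[OF that, symmetric] by blast
    have 2: "y \<subseteq># d" if y: "set_mset y \<subseteq> P" and all: "\<forall>a\<in>A. y \<subseteq># \<phi> a" for y
    proof -
      have "y \<in> carrier (free_abelian_monoid P)"
        using y by (simp add: free_abelian_monoid_def)
      moreover have "\<forall>x\<in>\<phi> ` A. y divides\<^bsub>free_abelian_monoid P\<^esub> x"
        using all * by simp
      ultimately have "y divides\<^bsub>free_abelian_monoid P\<^esub> d"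
        using A(4) unfolding is_gcd_of_def by blast
      then show ?thesis
        using divides_free_abelian_monoid_iff[OF d] by simp
    qed
    show ?thesis
      using A(1-3) 1 2 by blast
  qed
  have inj: "inj_on f P"
  proof (rule inj_onI)
    fix p q assume pq: "p \<in> P" "q \<in> P" "f p = f q"
    obtain A where A: "A \<subseteq> carrier H" "\<forall>a\<in>A. {#p#} \<subseteq># \<phi> a"
        "\<forall>y. set_mset y \<subseteq> P \<longrightarrow> (\<forall>a\<in>A. y \<subseteq># \<phi> a) \<longrightarrow> y \<subseteq># {#p#}"
      using gcd[of "{#p#}"] pq by auto
    have "\<forall>a\<in>A. {#q#} \<subseteq># \<phi> a"
    proof
      fix a assume "a \<in> A"
      then have "a \<in> f p" using A by (auto simp: f_def)
      then show "{#q#} \<subseteq># \<phi> a" using pq by (auto simp: f_def)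
    qed
    moreover have "set_mset {#q#} \<subseteq> P" using pq by simp
    ultimately have "{#q#} \<subseteq># {#p#}" using A(3) by blast
    then show "p = q" by simp
  qed
  define g where "g = the_inv_into P f"
  have gf: "image_mset g (image_mset f M) = M" if "set_mset M \<subseteq> P" for M
  proof -
    have "image_mset (\<lambda>x. g (f x)) M = image_mset (\<lambda>x. x) M"
      using that inj by (intro image_mset_cong) (auto simp: g_def the_inv_into_f_f)
    then show ?thesis by (simp add: image_mset.compositionality o_def)
  qed
  have fg: "image_mset f (image_mset g M) = M \<and> set_mset (image_mset g M) \<subseteq> P"
    if "set_mset M \<subseteq> f ` P" for M
  proof -
    have "image_mset (\<lambda>x. f (g x)) M = image_mset (\<lambda>x. x) M"
      using that inj by (intro image_mset_cong) (auto simp: g_def f_the_inv_into_f)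
    moreover have "g x \<in> P" if "x \<in> f ` P" for x
      using that inj by (auto simp: g_def the_inv_into_f_f)
    ultimately show ?thesis using that by (auto simp: image_mset.compositionality o_def)
  qed
  have le: "image_mset f M \<subseteq># image_mset f N \<longleftrightarrow> M \<subseteq># N"
    if "set_mset M \<subseteq> P" "set_mset N \<subseteq> P" for M N
    using image_mset_subseteq_mono[of "image_mset f M" "image_mset f N" g] that gf
      image_mset_subseteq_mono[of M N f] by auto
  let ?F = "free_abelian_monoid (f ` P)"
  have subf: "set_mset (image_mset f (\<phi> a)) \<subseteq> f ` P" if "a \<in> carrier H" for a
    using sub[OF that] by auto
  have "divisor_theory H (f ` P) (\<lambda>a. image_mset f (\<phi> a))"
    unfolding divisor_theory_def divisor_homomorphism_def
  proof (intro conjI ballI impI)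
    show "(\<lambda>a. image_mset f (\<phi> a)) \<in> hom H ?F"
      using subf mult by (auto simp: hom_def free_abelian_monoid_def)
    show "image_mset f (\<phi> \<one>\<^bsub>H\<^esub>) = \<one>\<^bsub>?F\<^esub>"
      using one by (simp add: free_abelian_monoid_def)
  next
    fix a b assume ab: "a \<in> carrier H" "b \<in> carrier H"
      "image_mset f (\<phi> a) divides\<^bsub>?F\<^esub> image_mset f (\<phi> b)"
    then have "\<phi> a \<subseteq># \<phi> b"
      by (simp add: divides_free_abelian_monoid_iff[OF subf] le sub)
    then show "a divides\<^bsub>H\<^esub> b"
      by (intro div ab) (simp add: divides_free_abelian_monoid_iff[OF sub] ab)
  next
    fix d assume "d \<in> carrier ?F"
    then have d: "set_mset d \<subseteq> f ` P" by (simp add: free_abelian_monoid_def)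
    obtain A where A: "finite A" "A \<noteq> {}" "A \<subseteq> carrier H" "\<forall>a\<in>A. image_mset g d \<subseteq># \<phi> a"
      "\<forall>y. set_mset y \<subseteq> P \<longrightarrow> (\<forall>a\<in>A. y \<subseteq># \<phi> a) \<longrightarrow> y \<subseteq># image_mset g d"
      using gcd[of "image_mset g d"] fg[OF d] by auto
    have *: "M divides\<^bsub>?F\<^esub> image_mset f (\<phi> a) \<longleftrightarrow> image_mset g M \<subseteq># \<phi> a"
      if "a \<in> A" "set_mset M \<subseteq> f ` P" for a M
    proof -
      have a: "a \<in> carrier H" using that A by auto
      have "M divides\<^bsub>?F\<^esub> image_mset f (\<phi> a) \<longleftrightarrow> M \<subseteq># image_mset f (\<phi> a)"
        by (rule divides_free_abelian_monoid_iff[OF subf[OF a]])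
      also have "\<dots> \<longleftrightarrow> image_mset g M \<subseteq># \<phi> a"
        using le[of "image_mset g M" "\<phi> a"] fg[OF that(2)] sub[OF a] by simp
      finally show ?thesis .
    qed
    have "is_gcd_of ?F d ((\<lambda>a. image_mset f (\<phi> a)) ` A)"
      unfolding is_gcd_of_def
    proof (intro conjI ballI impI)
      show "d \<in> carrier ?F" by fact
      show "d divides\<^bsub>?F\<^esub> x" if "x \<in> (\<lambda>a. image_mset f (\<phi> a)) ` A" for x
        using that * d A(4) by auto
    next
      fix y assume y: "y \<in> carrier ?F"
        and all: "\<forall>x\<in>(\<lambda>a. image_mset f (\<phi> a)) ` A. y divides\<^bsub>?F\<^esub> x"
      have ys: "set_mset y \<subseteq> f ` P" using y by (simp add: free_abelian_monoid_def)
      have "\<forall>a\<in>A. image_mset g y \<subseteq># \<phi> a" using all *[OF _ ys] by auto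
      then have "image_mset g y \<subseteq># image_mset g d" using A(5) fg[OF ys] by blast
      then have "image_mset f (image_mset g y) \<subseteq># image_mset f (image_mset g d)"
        by (rule image_mset_subseteq_mono)
      then have "y \<subseteq># d" using fg[OF ys] fg[OF d] by simp
      then show "y divides\<^bsub>?F\<^esub> d" using divides_free_abelian_monoid_iff[OF d] by blast
    qed
    then show "\<exists>A. finite A \<and> A \<noteq> {} \<and> A \<subseteq> carrier H \<and>
        is_gcd_of ?F d ((\<lambda>a. image_mset f (\<phi> a)) ` A)"
      using A by blast
  qed
  then show ?thesis using H by (auto simp: krull_monoid_def)
qed

text \<open>
  The quotient group of \<open>free_abelian_monoid P\<close> is the library's free abelian group on \<open>P\<close>. As
  \<open>\<phi>\<close> factors through an embedding of \<open>red_monoid H\<close>, the subgroup generated by the image of \<open>\<phi>\<close>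
  is the quotient group of \<open>red_monoid H\<close>.
\<close>

definition mset_to_frag :: "'p multiset \<Rightarrow> 'p \<Rightarrow>\<^sub>0 int" where
  "mset_to_frag M = (\<Sum>p\<in>#M. frag_of p)"

definition principal_subgroup ::
    "('a, 'm) monoid_scheme \<Rightarrow> 'p set \<Rightarrow> ('a \<Rightarrow> 'p multiset) \<Rightarrow> ('p \<Rightarrow>\<^sub>0 int) set" where
  "principal_subgroup H P \<phi> = generate (free_Abelian_group P) ((\<lambda>a. mset_to_frag (\<phi> a)) ` carrier H)"

definition class_group ::
    "('a, 'm) monoid_scheme \<Rightarrow> 'p set \<Rightarrow> ('a \<Rightarrow> 'p multiset) \<Rightarrow> ('p \<Rightarrow>\<^sub>0 int) set monoid" where
  "class_group H P \<phi> = free_Abelian_group P Mod principal_subgroup H P \<phi>"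

definition divisor_class ::
    "('a, 'm) monoid_scheme \<Rightarrow> 'p set \<Rightarrow> ('a \<Rightarrow> 'p multiset) \<Rightarrow> 'p \<Rightarrow> ('p \<Rightarrow>\<^sub>0 int) set" where
  "divisor_class H P \<phi> p = principal_subgroup H P \<phi> #>\<^bsub>free_Abelian_group P\<^esub> frag_of p"

section \<open>Splitting off units and primes\<close>

definition prime_representatives :: "('a, 'm) monoid_scheme \<Rightarrow> 'a set \<Rightarrow> bool" where
  "prime_representatives H P0 \<longleftrightarrow> P0 \<subseteq> {p \<in> carrier H. prime H p} \<and>
     (\<forall>p\<in>carrier H. prime H p \<longrightarrow> (\<exists>!q. q \<in> P0 \<and> q \<sim>\<^bsub>H\<^esub> p))"

text \<open>The product decomposition is internal: the multiplication map is an isomorphism. In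
  particular the submonoid generated by \<open>P0\<close> is free on \<open>P0\<close>.\<close>

definition splits_as :: "('a, 'm) monoid_scheme \<Rightarrow> 'a set \<Rightarrow> 'a set \<Rightarrow> bool" where
  "splits_as H P0 S \<longleftrightarrow> submonoid S H \<and>
     (\<lambda>(u, f, h). u \<otimes>\<^bsub>H\<^esub> mset_prod H f \<otimes>\<^bsub>H\<^esub> h)
       \<in> iso (units_of H \<times>\<times> free_abelian_monoid P0 \<times>\<times> H\<lparr>carrier := S\<rparr>) H"

section \<open>Abelian groups and zero-sum sequences\<close>

definition zero_sum_monoid :: "('c, 'm) monoid_scheme \<Rightarrow> 'c set \<Rightarrow> 'c multiset monoid" where
  "zero_sum_monoid G G0 =
     (free_abelian_monoid G0)\<lparr>carrier := {S \<in> carrier (free_abelian_monoid G0). mset_prod G S = \<one>\<^bsub>G\<^esub>}\<rparr>"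

text \<open>For finite \<open>I\<close>: the subgroup \<open>K\<close> is the internal direct sum of the subgroups \<open>A i\<close>.\<close>

definition internal_direct_sum ::
    "('c, 'm) monoid_scheme \<Rightarrow> 'i set \<Rightarrow> ('i \<Rightarrow> 'c set) \<Rightarrow> 'c set \<Rightarrow> bool" where
  "internal_direct_sum G I A K \<longleftrightarrow>
     (\<lambda>x. finprod G x I) \<in> iso (product_group I (\<lambda>i. G\<lparr>carrier := A i\<rparr>)) (G\<lparr>carrier := K\<rparr>)"

definition independent_elements ::
    "('c, 'm) monoid_scheme \<Rightarrow> 'i set \<Rightarrow> ('i \<Rightarrow> 'c) \<Rightarrow> bool" where
  "independent_elements G I x \<longleftrightarrow> finite I \<and> (\<forall>i\<in>I. x i \<in> carrier G \<and> x i \<noteq> \<one>\<^bsub>G\<^esub>) \<and>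
     internal_direct_sum G I (\<lambda>i. generate G {x i}) (generate G (x ` I))"

definition torsion_group :: "('c, 'm) monoid_scheme \<Rightarrow> bool" where
  "torsion_group G \<longleftrightarrow> (\<forall>x\<in>carrier G. group.ord G x \<noteq> 0)"

text \<open>
  The description of the set \<open>G0\<close> of classes containing prime divisors in the class group \<open>C\<close>. The
  rows \<open>i = 0\<close> of \<open>e\<close> and \<open>g\<close> are the elements defined as inverses of products; values of \<open>e\<close>,
  \<open>g\<close>, \<open>s\<close> outside of the index ranges are irrelevant. Note that \<open>group.ord\<close> is \<open>0\<close> for elements of
  infinite order.
\<close>

definition class_structure ::
    "('c, 'm) monoid_scheme \<Rightarrow> 'c set \<Rightarrow> nat \<Rightarrow> nat \<Rightarrow> (nat \<Rightarrow> nat) \<Rightarrow> (nat \<Rightarrow> nat \<Rightarrow> 'c) \<Rightarrow>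
      (nat \<Rightarrow> 'c) \<Rightarrow> bool" where
  "class_structure C G0 t k s e g \<longleftrightarrow>
     k \<ge> 1 \<and> (\<forall>j\<in>{0..t}. s j \<ge> 1) \<and> k + 1 \<noteq> (\<Sum>j=0..t. s j) \<and> (\<Sum>j=0..t. s j) \<ge> 2 \<and>
     independent_elements C ({1..k} \<times> {1..t}) (\<lambda>(i, j). e i j) \<and>
     (\<forall>i\<in>{1..k}. \<forall>j\<in>{1..t}. group.ord C (e i j) = 0) \<and>
     independent_elements C {1..k} g \<and>
     (\<forall>i\<in>{1..k}. if t > 0 then group.ord C (g i) = 0 else group.ord C (g i) \<noteq> 0) \<and>
     G0 = {e i j | i j. i \<in> {1..k} \<and> j \<in> {1..t}} \<union> {g i | i. i \<in> {1..k}} \<union>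
          {e 0 j | j. j \<in> {1..t}} \<union> {g 0} \<and>
     internal_direct_sum C {1..k} (\<lambda>i. generate C (e i ` {1..t} \<union> {g i})) (carrier C) \<and>
     C \<cong> product_group {1..k} (\<lambda>_. product_group {1..t} (\<lambda>_. integer_group)
                                     \<times>\<times> integer_mod_group (Gcd (s ` {0..t}))) \<and>
     (\<forall>i\<in>{1..k}.
        g i [^]\<^bsub>C\<^esub> s 0 \<in> generate C (e i ` {1..t}) \<and>
        (\<forall>m. 0 < m \<and> m < s 0 \<longrightarrow> g i [^]\<^bsub>C\<^esub> m \<notin> generate C (e i ` {1..t})) \<and>
        inv\<^bsub>C\<^esub> (g i [^]\<^bsub>C\<^esub> s 0) = finprod C (\<lambda>j. e i j [^]\<^bsub>C\<^esub> s j) {1..t}) \<and>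
     (\<forall>j\<in>{1..t}. e 0 j = inv\<^bsub>C\<^esub> (finprod C (\<lambda>i. e i j) {1..k})) \<and>
     g 0 = inv\<^bsub>C\<^esub> (finprod C g {1..k})"

end

theory Submission
  imports Defs
begin

text \<open>
  Passing to the image of \<open>\<phi>\<close>, a Krull monoid becomes a saturated set of multisets of prime divisors.
  Length-factoriality says that a relation between atoms is determined by the difference of the
  lengths of its two sides, so all relations are generated by a single one. Comparing this relation
  with the prime divisors that occur in it shows that one of its sides is a product of \<open>k + 1\<close>
  distinct atoms and the other one of the atoms with multiplicities \<open>s\<^sub>0, \<dots>, s\<^sub>t\<close>, and that the prime divisors
  form a \<open>(k + 1) \<times> (t + 1)\<close> grid: the rows, weighted by \<open>s\<close>, and the columns are the atoms. By
  uniqueness of the divisor theory the classes of the grid have precisely the relations generated by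
  the rows and columns, which gives the structure of the class group; conversely these relations give
  back the grid. The units split off because subgroups of free abelian groups are free.
\<close>

text \<open>The grid is not found by decomposing atoms into prime divisors. Formal products of atoms
  are sent to multisets of prime divisors by multiplying out, and to multisets of grid points by
  \<open>\<theta>\<close>. The generating relation makes both maps induce the same divisibility, and
  on either side all basis elements are gcds of values: the point \<open>(i, j)\<close> is the gcd
  of row \<open>i\<close> and column \<open>j\<close>. Since divisibility alone determines a divisor
  theory up to a bijection of the bases, the prime divisors are the grid. The numerical conditions
  come from the relation: its sides have lengths \<open>k + 1\<close> and the sum of the
  \<open>s j\<close>, which differ because distinct factorizations of equal length are excluded, and
  both are at least 2 because an atom has no second factorization. In the class group the condition
  on \<open>k + 1\<close> reappears: for \<open>k = 1\<close> it keeps the classes of different grid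
  points apart. A complement of the units and primes is not canonical, so every assertion about a
  complement is derived from the product decomposition alone.\<close>

section \<open>Greatest common divisors of sets of multisets\<close>

text \<open>In a free abelian monoid the gcd is the pointwise minimum. Demanding that the minimum be
  attained at every \<open>p\<close> forces \<open>A\<close> to be nonempty and makes the notion
  independent of a basis.\<close>

definition mset_glb :: "'p multiset set \<Rightarrow> 'p multiset \<Rightarrow> bool" where
  "mset_glb A d \<longleftrightarrow> (\<forall>a\<in>A. d \<subseteq># a) \<and> (\<forall>p. \<exists>a\<in>A. count a p = count d p)"

lemma mset_glb_nonempty: "mset_glb A d \<Longrightarrow> A \<noteq> {}"
  by (auto simp: mset_glb_def)

lemma mset_glb_singleton: "mset_glb {a} a"
  by (auto simp: mset_glb_def)

lemma mset_glb_Inf: "A \<noteq> {} \<Longrightarrow> mset_glb A (Inf A)"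
  unfolding mset_glb_def
proof (intro conjI allI ballI)
  fix a assume "A \<noteq> {}" "a \<in> A"
  then show "Inf A \<subseteq># a"
    by (intro mset_subset_eqI) (auto intro!: cINF_lower simp: count_Inf_multiset_nonempty)
next
  fix p assume "A \<noteq> {}"
  then have "Inf ((\<lambda>X. count X p) ` A) \<in> (\<lambda>X. count X p) ` A"
    by (intro Inf_nat_def1) auto
  then show "\<exists>a\<in>A. count a p = count (Inf A) p"
    using \<open>A \<noteq> {}\<close> by (force simp: count_Inf_multiset_nonempty)
qed

text \<open>Translation by \<open>c\<close> commutes with pointwise minima. The translate serves the
  situation in which a cofactor has to be kept beside the values while their gcd is taken.\<close>

lemma mset_glb_greatest:
  assumes "mset_glb A d" "\<And>a. a \<in> A \<Longrightarrow> y \<subseteq># c + a"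
  shows "y \<subseteq># c + d"
proof (rule mset_subset_eqI)
  fix p
  obtain a where "a \<in> A" "count a p = count d p"
    using assms(1) by (auto simp: mset_glb_def)
  then show "count y p \<le> count (c + d) p"
    using mset_subset_eq_count[OF assms(2)[of a], of p] by simp
qed

text \<open>At each \<open>p\<close> the two minima are attained independently of each other, so a
  sum of witnesses attains the sum of the minima.\<close>

lemma mset_glb_add:
  assumes "mset_glb A d" "mset_glb B e"
  shows "mset_glb {a + b |a b. a \<in> A \<and> b \<in> B} (d + e)"
  unfolding mset_glb_def
proof (intro conjI allI ballI)
  fix x assume "x \<in> {a + b |a b. a \<in> A \<and> b \<in> B}"
  then show "d + e \<subseteq># x"
    using assms by (auto simp: mset_glb_def intro: subset_mset.add_mono)
next
  fix p
  obtain a b where "a \<in> A" "count a p = count d p" "b \<in> B" "count b p = count e p"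
    using assms unfolding mset_glb_def by metis
  then show "\<exists>x\<in>{a + b |a b. a \<in> A \<and> b \<in> B}. count x p = count (d + e) p"
    by (intro bexI[of _ "a + b"]) auto
qed

section \<open>Uniqueness of divisor theories\<close>

text \<open>The set \<open>H\<close> carries no operation: \<open>add_ex\<close> only asks that the
  pairs of values be closed under addition. So the locale applies to formal products of atoms as
  well as to the carrier of a monoid.\<close>

locale equivalent_divisors =
  fixes H :: "'x set" and P :: "'p set" and Q :: "'q set"
    and \<phi> :: "'x \<Rightarrow> 'p multiset" and \<psi> :: "'x \<Rightarrow> 'q multiset"
  assumes add_ex: "a \<in> H \<Longrightarrow> b \<in> H \<Longrightarrow> \<exists>c\<in>H. \<phi> c = \<phi> a + \<phi> b \<and> \<psi> c = \<psi> a + \<psi> b"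
    and le_iff: "a \<in> H \<Longrightarrow> b \<in> H \<Longrightarrow> \<phi> a \<subseteq># \<phi> b \<longleftrightarrow> \<psi> a \<subseteq># \<psi> b"
    and supp1: "a \<in> H \<Longrightarrow> set_mset (\<phi> a) \<subseteq> P"
    and supp2: "a \<in> H \<Longrightarrow> set_mset (\<psi> a) \<subseteq> Q"
    and glb1: "set_mset d \<subseteq> P \<Longrightarrow> \<exists>A\<subseteq>H. mset_glb (\<phi> ` A) d"
    and glb2: "set_mset e \<subseteq> Q \<Longrightarrow> \<exists>A\<subseteq>H. mset_glb (\<psi> ` A) e"
begin

lemma swap: "equivalent_divisors H Q P \<psi> \<phi>"
proof
  fix a b assume "a \<in> H" "b \<in> H"
  then show "\<exists>c\<in>H. \<psi> c = \<psi> a + \<psi> b \<and> \<phi> c = \<phi> a + \<phi> b" "\<psi> a \<subseteq># \<psi> b \<longleftrightarrow> \<phi> a \<subseteq># \<phi> b"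
    using add_ex[of a b] le_iff[of a b] by auto
qed (fact supp1 supp2 glb1 glb2)+

text \<open>A relation and not a function, because many sets \<open>A\<close> have the same gcd.
  That the partner does not depend on \<open>A\<close> is the content of
  \<open>corresponding_unique\<close>.\<close>

definition corresponding :: "'p multiset \<Rightarrow> 'q multiset \<Rightarrow> bool" where
  "corresponding d e \<longleftrightarrow> (\<exists>A\<subseteq>H. mset_glb (\<phi> ` A) d \<and> mset_glb (\<psi> ` A) e)"

text \<open>Whether \<open>gcd \<phi>(A)\<close> divides \<open>\<phi> b\<close> depends only on the divisibility relation of \<open>H\<close>: with
  \<open>\<psi> c = e + e'\<close> and \<open>e' = gcd \<psi>(B)\<close>, it forces \<open>c\<close> to divide \<open>y b\<close> for all \<open>y\<close> in \<open>B\<close>.\<close>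

lemma glb_transfer:
  assumes A: "A \<subseteq> H" "mset_glb (\<phi> ` A) d" "mset_glb (\<psi> ` A) e"
    and b: "b \<in> H" "d \<subseteq># \<phi> b"
  shows "e \<subseteq># \<psi> b"
proof -
  obtain c where c: "c \<in> A" using mset_glb_nonempty[OF A(2)] by auto
  define e' where "e' = \<psi> c - e"
  have ec: "e + e' = \<psi> c" using A(3) c unfolding e'_def mset_glb_def by simp
  have "set_mset e' \<subseteq> Q"
    using supp2[of c] c A(1) ec by (metis Un_subset_iff set_mset_union subsetD)
  then obtain B where B: "B \<subseteq> H" "mset_glb (\<psi> ` B) e'" using glb2 by blast
  have "\<psi> c \<subseteq># \<psi> b + \<psi> y" if y: "y \<in> B" for y
  proof -
    have "\<phi> c \<subseteq># \<phi> y + \<phi> a" if a: "a \<in> A" for a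
    proof -
      obtain w where w: "w \<in> H" "\<phi> w = \<phi> y + \<phi> a" "\<psi> w = \<psi> y + \<psi> a"
        using add_ex[of y a] y a A B by blast
      have "\<psi> c \<subseteq># \<psi> w"
        using A(3) B(2) a y unfolding ec[symmetric] w(3)
        by (subst add.commute[of e e']) (auto simp: mset_glb_def intro: subset_mset.add_mono)
      then show ?thesis using le_iff[of c w] c A(1) w by auto
    qed
    \<comment> \<open>Taking the gcd over \<open>a\<close> replaces \<open>\<phi> a\<close> by
      \<open>d\<close>, and \<open>d\<close> divides \<open>\<phi> b\<close>. This is how the
      hypothesis on \<open>b\<close> enters.\<close>
    then have "\<phi> c \<subseteq># \<phi> y + d"
      by (intro mset_glb_greatest[OF A(2)]) auto
    also have "\<dots> \<subseteq># \<phi> y + \<phi> b" using b by simp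
    finally have 1: "\<phi> c \<subseteq># \<phi> y + \<phi> b" .
    obtain w where w: "w \<in> H" "\<phi> w = \<phi> y + \<phi> b" "\<psi> w = \<psi> y + \<psi> b"
      using add_ex[of y b] y b B by blast
    then show ?thesis using le_iff[of c w] 1 c A(1) by (auto simp: add.commute)
  qed
  \<comment> \<open>Now the gcd over \<open>y\<close> is taken; the result says that
    \<open>e + e'\<close> divides \<open>\<psi> b + e'\<close>, and \<open>e'\<close>
    cancels.\<close>
  then have "\<psi> c \<subseteq># \<psi> b + e'"
    by (intro mset_glb_greatest[OF B(2)]) auto
  then show ?thesis unfolding ec[symmetric] by simp
qed

text \<open>By \<open>glb_transfer\<close> each of the two gcds divides all the values whose gcd is
  the other one.\<close>

lemma corresponding_unique:
  assumes "corresponding d e" "corresponding d e'"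
  shows "e = e'"
proof -
  have "e \<subseteq># e'" if T: "corresponding d e" "corresponding d e'" for e e'
  proof -
    obtain A B where A: "A \<subseteq> H" "mset_glb (\<phi> ` A) d" "mset_glb (\<psi> ` A) e"
      and B: "B \<subseteq> H" "mset_glb (\<phi> ` B) d" "mset_glb (\<psi> ` B) e'"
      using T unfolding corresponding_def by auto
    have "e \<subseteq># \<psi> b" if "b \<in> B" for b
      using glb_transfer[OF A, of b] that B by (auto simp: mset_glb_def)
    then show ?thesis
      using mset_glb_greatest[OF B(3), of e "{#}"] by auto
  qed
  then show ?thesis using assms by (meson subset_mset.antisym)
qed

lemma corresponding_total:
  assumes "set_mset d \<subseteq> P"
  shows "\<exists>e. set_mset e \<subseteq> Q \<and> corresponding d e"
proof -
  obtain A where A: "A \<subseteq> H" "mset_glb (\<phi> ` A) d" using glb1[OF assms] by blast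
  then have ne: "A \<noteq> {}" using mset_glb_nonempty by blast
  then have g: "mset_glb (\<psi> ` A) (Inf (\<psi> ` A))" by (intro mset_glb_Inf) auto
  obtain a where "a \<in> A" using ne by auto
  then have "set_mset (Inf (\<psi> ` A)) \<subseteq> Q"
    using g supp2[of a] A(1) unfolding mset_glb_def by (meson image_eqI set_mset_mono subset_trans subsetD)
  then show ?thesis using A g unfolding corresponding_def by blast
qed

lemma corresponding_add:
  assumes "corresponding d e" "corresponding d' e'"
  shows "corresponding (d + d') (e + e')"
proof -
  obtain A B where A: "A \<subseteq> H" "mset_glb (\<phi> ` A) d" "mset_glb (\<psi> ` A) e"
    and B: "B \<subseteq> H" "mset_glb (\<phi> ` B) d'" "mset_glb (\<psi> ` B) e'"
    using assms unfolding corresponding_def by auto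
  define C where "C = {c \<in> H. \<exists>a\<in>A. \<exists>b\<in>B. \<phi> c = \<phi> a + \<phi> b \<and> \<psi> c = \<psi> a + \<psi> b}"
  have ex: "\<exists>c\<in>C. \<phi> c = \<phi> a + \<phi> b \<and> \<psi> c = \<psi> a + \<psi> b" if "a \<in> A" "b \<in> B" for a b
    using add_ex[of a b] that A(1) B(1) unfolding C_def by blast
  have "\<phi> ` C = {a + b |a b. a \<in> \<phi> ` A \<and> b \<in> \<phi> ` B}" "\<psi> ` C = {a + b |a b. a \<in> \<psi> ` A \<and> b \<in> \<psi> ` B}"
    using ex by (auto simp: C_def image_iff) metis+
  then show ?thesis
    unfolding corresponding_def
    using mset_glb_add[OF A(2) B(2)] mset_glb_add[OF A(3) B(3)] by (intro exI[of _ C]) (auto simp: C_def)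
qed

lemma corresponding_value: "a \<in> H \<Longrightarrow> corresponding (\<phi> a) (\<psi> a)"
  unfolding corresponding_def by (intro exI[of _ "{a}"]) (auto simp: mset_glb_singleton)

text \<open>A partner \<open>e\<close> of the empty multiset gives the partner \<open>e + e\<close>
  of the same multiset, so uniqueness leaves only the empty \<open>e\<close>.\<close>

lemma corresponding_empty: "corresponding {#} {#}"
proof -
  obtain e where "corresponding {#} e" using corresponding_total[of "{#}"] by auto
  moreover from this have "corresponding {#} (e + e)" using corresponding_add[of "{#}" e "{#}" e] by simp
  ultimately have "e = e + e" using corresponding_unique by blast
  then show ?thesis using \<open>corresponding {#} e\<close> by simp
qed

end

context equivalent_divisors
begin

interpretation sw: equivalent_divisors H Q P \<psi> \<phi> by (rule swap)

lemma corresponding_swap: "sw.corresponding e d \<longleftrightarrow> corresponding d e"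
  by (auto simp: sw.corresponding_def corresponding_def)

lemma corresponding_unique': "corresponding d e \<Longrightarrow> corresponding d' e \<Longrightarrow> d = d'"
  using sw.corresponding_unique corresponding_swap by blast

text \<open>The correspondence is additive and matches empty multisets only with each other. A
  splitting of the partner into two nonempty parts would therefore split
  \<open>{#p#}\<close>.\<close>

lemma corresponding_single:
  assumes "p \<in> P"
  shows "\<exists>q\<in>Q. corresponding {#p#} {#q#}"
proof -
  obtain e where e: "set_mset e \<subseteq> Q" "corresponding {#p#} e"
    using corresponding_total[of "{#p#}"] assms by auto
  have "e \<noteq> {#}" using corresponding_unique' corresponding_empty e(2) by fastforce
  then obtain q e' where q: "e = {#q#} + e'"
    by (metis multiset_cases add_mset_add_single add.commute)
  have "set_mset {#q#} \<subseteq> Q" "set_mset e' \<subseteq> Q" using q e by auto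
  then obtain d1 d2 where d: "corresponding d1 {#q#}" "corresponding d2 e'"
    using sw.corresponding_total corresponding_swap by metis
  then have "d1 + d2 = {#p#}" using corresponding_add corresponding_unique' e(2) q by blast
  moreover have "d1 \<noteq> {#}" using d(1) corresponding_empty corresponding_unique by fastforce
  ultimately have "d2 = {#}" by (metis union_is_single)
  then have "e' = {#}" using d(2) corresponding_empty corresponding_unique by blast
  then show ?thesis using e q by auto
qed

end

context equivalent_divisors
begin

interpretation sw: equivalent_divisors H Q P \<psi> \<phi> by (rule swap)

text \<open>The matching of single elements extends additively to all multisets. As
  \<open>\<phi> a\<close> and \<open>\<psi> a\<close> are partners too, uniqueness identifies
  \<open>\<psi> a\<close> with the image of \<open>\<phi> a\<close>; surjectivity is
  \<open>corresponding_single\<close> with the roles exchanged.\<close>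

theorem bijection_exists:
  "\<exists>\<beta>. bij_betw \<beta> P Q \<and> (\<forall>a\<in>H. \<psi> a = image_mset \<beta> (\<phi> a))"
proof -
  obtain \<beta> where \<beta>: "\<And>p. p \<in> P \<Longrightarrow> \<beta> p \<in> Q \<and> corresponding {#p#} {#\<beta> p#}"
    using corresponding_single by metis
  have "corresponding d (image_mset \<beta> d)" if "set_mset d \<subseteq> P" for d
    using that
  proof (induction d)
    case empty
    then show ?case by (simp add: corresponding_empty)
  next
    case (add p d)
    then show ?case using corresponding_add[of "{#p#}" "{#\<beta> p#}" d] \<beta>[of p] by simp
  qed
  then have "\<psi> a = image_mset \<beta> (\<phi> a)" if "a \<in> H" for a
    using that supp1 corresponding_unique corresponding_value by blast
  moreover have "inj_on \<beta> P"
    by (rule inj_onI) (metis \<beta> corresponding_unique' single_eq_single)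
  moreover have "q \<in> \<beta> ` P" if "q \<in> Q" for q
  proof -
    obtain p where "p \<in> P" "corresponding {#p#} {#q#}"
      using sw.corresponding_single[OF \<open>q \<in> Q\<close>] by (auto simp: corresponding_def sw.corresponding_def)
    then show ?thesis using \<beta>[of p] corresponding_unique[of "{#p#}" "{#q#}" "{#\<beta> p#}"] by auto
  qed
  ultimately show ?thesis using \<beta> unfolding bij_betw_def by blast
qed

end

section \<open>Saturated submonoids of free abelian monoids\<close>

text \<open>Minimality under inclusion is irreducibility as soon as \<open>R\<close> is saturated:
  the complement of a divisor taken from \<open>R\<close> is then in \<open>R\<close> as
  well.\<close>

definition mset_atoms :: "'q multiset set \<Rightarrow> 'q multiset set" where
  "mset_atoms R = {a \<in> R. a \<noteq> {#} \<and> (\<forall>b\<in>R. b \<subseteq># a \<longrightarrow> b = {#} \<or> b = a)}"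

definition unique_fact :: "'q multiset set \<Rightarrow> bool" where
  "unique_fact R \<longleftrightarrow> (\<forall>z z'. set_mset z \<subseteq> mset_atoms R \<longrightarrow> set_mset z' \<subseteq> mset_atoms R \<longrightarrow>
     \<Sum>\<^sub># z = \<Sum>\<^sub># z' \<longrightarrow> z = z')"

definition unique_length_fact :: "'q multiset set \<Rightarrow> bool" where
  "unique_length_fact R \<longleftrightarrow> (\<forall>z z'. set_mset z \<subseteq> mset_atoms R \<longrightarrow> set_mset z' \<subseteq> mset_atoms R \<longrightarrow>
     \<Sum>\<^sub># z = \<Sum>\<^sub># z' \<longrightarrow> size z = size z' \<longrightarrow> z = z')"

text \<open>The condition \<open>diff\<close> says that the inclusion of \<open>R\<close> into the
  free abelian monoid is a divisor homomorphism.\<close>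

locale saturated =
  fixes R :: "'q multiset set"
  assumes zero: "{#} \<in> R"
    and add: "x \<in> R \<Longrightarrow> y \<in> R \<Longrightarrow> x + y \<in> R"
    and diff: "x \<in> R \<Longrightarrow> y \<in> R \<Longrightarrow> x \<subseteq># y \<Longrightarrow> y - x \<in> R"
begin

lemma sum_mset_closed: "set_mset z \<subseteq> R \<Longrightarrow> \<Sum>\<^sub># z \<in> R"
  by (induction z) (auto simp: zero add)

lemma atoms_subset: "mset_atoms R \<subseteq> R"
  by (auto simp: mset_atoms_def)

lemma factorization_exists:
  assumes "r \<in> R"
  shows "\<exists>z. set_mset z \<subseteq> mset_atoms R \<and> \<Sum>\<^sub># z = r"
  using assms
proof (induction "size r" arbitrary: r rule: less_induct)
  case less
  show ?case
  proof (cases "r = {#} \<or> r \<in> mset_atoms R")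
    case True
    then show ?thesis
    proof
      assume "r = {#}" then show ?thesis by (intro exI[of _ "{#}"]) auto
    next
      assume "r \<in> mset_atoms R" then show ?thesis by (intro exI[of _ "{#r#}"]) auto
    qed
  next
    case False
    then obtain b where b: "b \<in> R" "b \<subseteq># r" "b \<noteq> {#}" "b \<noteq> r"
      using less.prems by (auto simp: mset_atoms_def)
    have r: "r = b + (r - b)" using b by simp
    have "r - b \<in> R" using diff b less.prems by blast
    moreover have "size b < size r" using b by (meson mset_subset_size subset_mset.le_neq_trans)
    moreover have "size (r - b) < size r"
      using b by (metis add_less_same_cancel2 nonempty_has_size r size_union add.commute less_add_same_cancel1)
    ultimately obtain z z' where "set_mset z \<subseteq> mset_atoms R" "\<Sum>\<^sub># z = b"
      "set_mset z' \<subseteq> mset_atoms R" "\<Sum>\<^sub># z' = r - b"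
      using less.hyps b(1) by metis
    then show ?thesis using r by (intro exI[of _ "z + z'"]) auto
  qed
qed

end

section \<open>Length-factorial saturated submonoids\<close>

text \<open>The relation of minimal length difference generates all relations: subtracting a multiple of
  it from a given relation leaves one whose length difference is a remainder.\<close>

lemma (in saturated) generating_relation:
  assumes lf: "unique_length_fact R" and nf: "\<not> unique_fact R"
  obtains x y where "set_mset x \<subseteq> mset_atoms R" "set_mset y \<subseteq> mset_atoms R"
    "set_mset x \<inter> set_mset y = {}" "\<Sum>\<^sub># x = \<Sum>\<^sub># y" "size x \<noteq> size y"
    "\<And>z z'. set_mset z \<subseteq> mset_atoms R \<Longrightarrow> set_mset z' \<subseteq> mset_atoms R \<Longrightarrow> \<Sum>\<^sub># z = \<Sum>\<^sub># z' \<Longrightarrow>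
       \<exists>l::int. \<forall>u. int (count z u) - int (count z' u) = l * (int (count x u) - int (count y u))"
proof -
  define rel where "rel = (\<lambda>x y. set_mset x \<subseteq> mset_atoms R \<and> set_mset y \<subseteq> mset_atoms R \<and>
    \<Sum>\<^sub># x = \<Sum>\<^sub># y)"
  have releq: "x = y" if "rel x y" "size x = size y" for x y
    using lf that unfolding rel_def unique_length_fact_def by blast
  define d where "d = (LEAST n. n > 0 \<and> (\<exists>x y. rel x y \<and> size x = size y + n))"
  obtain x0 y0 where xy0: "rel x0 y0" "x0 \<noteq> y0"
    using nf unfolding unique_fact_def rel_def by blast
  then have "size x0 \<noteq> size y0" using releq by blast
  then have "\<exists>n>0. \<exists>x y. rel x y \<and> size x = size y + n"
  proof (cases "size x0 < size y0")
    case True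
    then show ?thesis using xy0(1)
      by (intro exI[of _ "size y0 - size x0"] conjI exI[of _ y0] exI[of _ x0]) (auto simp: rel_def)
  next
    case False
    then show ?thesis using xy0(1) \<open>size x0 \<noteq> size y0\<close>
      by (intro exI[of _ "size x0 - size y0"] conjI exI[of _ x0] exI[of _ y0]) auto
  qed
  then have dprop: "d > 0 \<and> (\<exists>x y. rel x y \<and> size x = size y + d)"
    unfolding d_def by (rule LeastI_ex)
  have dmin: "d \<le> n" if "n > 0" "rel x y" "size x = size y + n" for n x y
    unfolding d_def using that by (intro Least_le) blast
  obtain x1 y1 where xy1: "rel x1 y1" "size x1 = size y1 + d" using dprop by blast
  \<comment> \<open>Cancelling the common part makes the two sides disjoint and keeps the length
    difference \<open>d\<close>.\<close>
  define x where "x = x1 - x1 \<inter># y1"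
  define y where "y = y1 - x1 \<inter># y1"
  have x1: "x1 = x + x1 \<inter># y1" and y1: "y1 = y + x1 \<inter># y1"
    unfolding x_def y_def by (auto intro!: multiset_eqI)
  have disj: "set_mset x \<inter> set_mset y = {}"
    unfolding x_def y_def by (auto simp: in_diff_count)
  have "\<Sum>\<^sub># x + \<Sum>\<^sub># (x1 \<inter># y1) = \<Sum>\<^sub># y + \<Sum>\<^sub># (x1 \<inter># y1)"
    using xy1(1) unfolding rel_def sum_mset.union[symmetric] x1[symmetric] y1[symmetric] by simp
  then have sumeq: "\<Sum>\<^sub># x = \<Sum>\<^sub># y" by simp
  have sub: "set_mset x \<subseteq> mset_atoms R" "set_mset y \<subseteq> mset_atoms R"
    using xy1(1) unfolding rel_def x_def y_def by (auto dest: in_diffD)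
  have sz: "size x = size y + d"
    using xy1(2) arg_cong[OF x1, of size] arg_cong[OF y1, of size] by simp
  have mult: "\<exists>l::int. \<forall>u. int (count z u) - int (count z' u) = l * (int (count x u) - int (count y u))"
    if r: "rel z z'" for z z'
  proof -
    define L where "L = int (size z) - int (size z')"
    define l where "l = L div int d"
    \<comment> \<open>Subtraction of \<open>l\<close> times the relation, done with natural
      multiplicities: one of \<open>nat (- l)\<close> and \<open>nat l\<close> is 0, and the other
      one decides which sides of the relation are added to \<open>z\<close> and
      \<open>z'\<close>.\<close>
    define w where "w = z + repeat_mset (nat (- l)) x + repeat_mset (nat l) y"
    define w' where "w' = z' + repeat_mset (nat (- l)) y + repeat_mset (nat l) x"
    have sumrep: "\<Sum>\<^sub># (repeat_mset n x) = \<Sum>\<^sub># (repeat_mset n y)" for n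
      by (induction n) (auto simp: sumeq)
    have srep: "set_mset (repeat_mset n x) \<subseteq> mset_atoms R" "set_mset (repeat_mset n y) \<subseteq> mset_atoms R" for n
      using sub by (induction n) auto
    have rw: "rel w w'"
      using r srep unfolding rel_def w_def w'_def by (auto simp: sumrep)
    have "int (size w) - int (size w') = L - l * int d"
      unfolding w_def w'_def L_def using sz
      by (cases "l \<ge> 0") (auto simp: algebra_simps)
    also have "\<dots> = L mod int d" unfolding l_def by (simp add: minus_div_mult_eq_mod)
    finally have diff: "int (size w) - int (size w') = L mod int d" .
    have "L mod int d \<ge> 0" "L mod int d < int d" using dprop by auto
    have "size w = size w'"
    proof (rule ccontr)
      assume "size w \<noteq> size w'"
      then have "size w = size w' + nat (L mod int d)" "nat (L mod int d) > 0"
        using diff \<open>L mod int d \<ge> 0\<close> by linarith+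
      then show False using dmin[OF _ rw] \<open>L mod int d < int d\<close> by fastforce
    qed
    then have "w = w'" using releq rw by blast
    then have *: "count w u = count w' u" for u by simp
    show ?thesis
    proof (intro exI[of _ l] allI)
      fix u
      show "int (count z u) - int (count z' u) = l * (int (count x u) - int (count y u))"
        using arg_cong[OF *[of u], of int] unfolding w_def w'_def
        by (cases "l \<ge> 0") (auto simp: algebra_simps)
    qed
  qed
  show thesis
    using that[of x y] sub disj sumeq sz dprop mult unfolding rel_def by simp
qed

text \<open>One side of the generating relation is squarefree: if \<open>u\<^sup>2\<close> divides the side \<open>x\<close> and \<open>v\<^sup>2\<close> the
  side \<open>y\<close>, then \<open>\<Sum> x - u - v\<close> is a factor, and its factorizations yield an impossible relation.\<close>

lemma (in saturated) generating_relation_squarefree: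
  assumes lf: "unique_length_fact R" and nf: "\<not> unique_fact R"
    and no_prime: "\<And>a. a \<in> mset_atoms R \<Longrightarrow> \<exists>b\<in>R. \<exists>c\<in>R. a \<subseteq># b + c \<and> \<not> a \<subseteq># b \<and> \<not> a \<subseteq># c"
  obtains x y where "mset_atoms R = set_mset x \<union> set_mset y"
    "set_mset x \<inter> set_mset y = {}" "\<Sum>\<^sub># x = \<Sum>\<^sub># y" "size x \<noteq> size y" "\<And>u. count x u \<le> 1"
    "\<And>z z'. set_mset z \<subseteq> mset_atoms R \<Longrightarrow> set_mset z' \<subseteq> mset_atoms R \<Longrightarrow> \<Sum>\<^sub># z = \<Sum>\<^sub># z' \<Longrightarrow>
       \<exists>l::int. \<forall>u. int (count z u) - int (count z' u) = l * (int (count x u) - int (count y u))"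
proof -
  obtain x y where xy: "set_mset x \<subseteq> mset_atoms R" "set_mset y \<subseteq> mset_atoms R"
    "set_mset x \<inter> set_mset y = {}" "\<Sum>\<^sub># x = \<Sum>\<^sub># y" "size x \<noteq> size y"
    and mult: "\<And>z z'. set_mset z \<subseteq> mset_atoms R \<Longrightarrow> set_mset z' \<subseteq> mset_atoms R \<Longrightarrow> \<Sum>\<^sub># z = \<Sum>\<^sub># z' \<Longrightarrow>
       \<exists>l::int. \<forall>u. int (count z u) - int (count z' u) = l * (int (count x u) - int (count y u))"
    by (rule generating_relation[OF lf nf]) (rule that)
  \<comment> \<open>An atom outside the generating relation occurs equally often on both sides of
    every relation. Whenever it divides a sum it then occurs in any factorization of the summands,
    so it would be prime.\<close>
  have "a \<in> set_mset x \<union> set_mset y" if a: "a \<in> mset_atoms R" for a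
  proof (rule ccontr)
    assume na: "a \<notin> set_mset x \<union> set_mset y"
    obtain b c where bc: "b \<in> R" "c \<in> R" "a \<subseteq># b + c" "\<not> a \<subseteq># b" "\<not> a \<subseteq># c"
      using no_prime[OF a] by blast
    obtain zb zc where z: "set_mset zb \<subseteq> mset_atoms R" "\<Sum>\<^sub># zb = b" "set_mset zc \<subseteq> mset_atoms R" "\<Sum>\<^sub># zc = c"
      using factorization_exists bc(1,2) by metis
    have "b + c - a \<in> R" using diff add bc a atoms_subset by blast
    then obtain w where w: "set_mset w \<subseteq> mset_atoms R" "\<Sum>\<^sub># w = b + c - a"
      using factorization_exists by blast
    have "a + (b + c - a) = b + c" using bc(3) by simp
    then obtain l :: int where "\<And>u. int (count (zb + zc) u) - int (count (add_mset a w) u) = l * (int (count x u) - int (count y u))"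
      using mult[of "zb + zc" "add_mset a w"] z w a by auto
    from this[of a] have "count (zb + zc) a = count (add_mset a w) a"
      using na by (simp add: not_in_iff)
    then have "a \<in># zb + zc" by (metis count_add_mset count_greater_zero_iff zero_less_Suc)
    moreover have "a \<subseteq># b" if "a \<in># zb"
      using sum_mset.remove[OF that] z(2) by simp
    moreover have "a \<subseteq># c" if "a \<in># zc"
      using sum_mset.remove[OF that] z(4) by simp
    ultimately show False using bc by auto
  qed
  then have atoms: "mset_atoms R = set_mset x \<union> set_mset y" using xy by auto
  have "(\<forall>u. count x u \<le> 1) \<or> (\<forall>v. count y v \<le> 1)"
  proof (rule ccontr)
    assume "\<not> ?thesis"
    then obtain u v where uv: "count x u \<ge> 2" "count y v \<ge> 2" by (auto simp: not_le numeral_2_eq_2 Suc_le_eq)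
    have ux: "u \<in># x" and vy: "v \<in># y" using uv by (auto simp: count_greater_zero_iff[symmetric] simp del: count_greater_zero_iff)
    then have nu: "count y u = 0" and nv: "count x v = 0" using xy(3) by (auto simp: count_eq_zero_iff)
    have "{#u, u#} \<subseteq># x" "{#v, v#} \<subseteq># y"
      using uv by (auto simp: subseteq_mset_def)
    then obtain x' y' where xy': "x = {#u, u#} + x'" "y = {#v, v#} + y'"
      unfolding mset_subset_eq_exists_conv by blast
    have *: "\<Sum>\<^sub># x = u + u + \<Sum>\<^sub># x'" using arg_cong[OF xy'(1), of sum_mset] by (simp add: add.assoc)
    have **: "\<Sum>\<^sub># x = v + v + \<Sum>\<^sub># y'" using xy(4) arg_cong[OF xy'(2), of sum_mset] by (simp add: add.assoc)
    \<comment> \<open>At each \<open>p\<close> the total count is at least twice that of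
      \<open>u\<close> and at least twice that of \<open>v\<close>, hence at least the sum of the
      two.\<close>
    have le: "u + v \<subseteq># \<Sum>\<^sub># x"
    proof (intro mset_subset_eqI)
      fix p
      have "count (\<Sum>\<^sub># x) p = 2 * count u p + count (\<Sum>\<^sub># x') p" "count (\<Sum>\<^sub># x) p = 2 * count v p + count (\<Sum>\<^sub># y') p"
        using arg_cong[OF *, of "\<lambda>m. count m p"] arg_cong[OF **, of "\<lambda>m. count m p"] by simp_all
      then show "count (u + v) p \<le> count (\<Sum>\<^sub># x) p" by simp
    qed
    have uvR: "u \<in> R" "v \<in> R" using ux vy xy(1,2) atoms_subset by blast+
    have "\<Sum>\<^sub># x - (u + v) \<in> R"
      using le uvR xy(1) atoms_subset by (intro diff add sum_mset_closed) auto
    then obtain w where w: "set_mset w \<subseteq> mset_atoms R" "\<Sum>\<^sub># w = \<Sum>\<^sub># x - (u + v)"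
      using factorization_exists by blast
    have "\<Sum>\<^sub># x = \<Sum>\<^sub># (add_mset u (add_mset v w))"
      using subset_mset.add_diff_inverse[OF le] w(2) by (simp add: add.assoc)
    moreover have "set_mset (add_mset u (add_mset v w)) \<subseteq> mset_atoms R" using w ux vy xy(1,2) by auto
    ultimately obtain l :: int where l: "\<And>a. int (count x a) - int (count (add_mset u (add_mset v w)) a)
        = l * (int (count x a) - int (count y a))"
      using mult xy(1) by blast
    \<comment> \<open>The atom \<open>v\<close> does not occur in \<open>x\<close> but does occur on
      the other side, which makes \<open>l\<close> positive. The atom \<open>u\<close> occurs on the
      other side as well, so \<open>l\<close> times its multiplicity in \<open>x\<close> is less
      than that multiplicity.\<close>
    have "l * int (count y v) \<ge> 1" using l[of v] nv by (auto split: if_splits)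
    then have "l \<ge> 1" by (cases "l \<le> 0") (auto dest: mult_nonpos_nonneg[of l "int (count y v)"])
    moreover have "l * int (count x u) < int (count x u)" using l[of u] nu by (auto split: if_splits)
    ultimately show False using mult_right_mono[of 1 l "int (count x u)"] by simp
  qed
  then show thesis
  proof
    assume "\<forall>u. count x u \<le> 1"
    with atoms xy(3-5) show thesis by (intro that[of x y] mult) auto
  next
    assume "\<forall>u. count y u \<le> 1"
    moreover have "\<exists>l::int. \<forall>u. int (count z u) - int (count z' u) = l * (int (count y u) - int (count x u))"
      if zz: "set_mset z \<subseteq> mset_atoms R" "set_mset z' \<subseteq> mset_atoms R" "\<Sum>\<^sub># z = \<Sum>\<^sub># z'" for z z'
    proof -
      obtain l where "\<forall>u. int (count z u) - int (count z' u) = l * (int (count x u) - int (count y u))"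
        using mult[OF zz] by blast
      then show ?thesis by (intro exI[of _ "- l"]) (auto simp: algebra_simps)
    qed
    ultimately show thesis using atoms xy(3-5) by (intro that[of y x]) auto
  qed
qed

section \<open>The grid of prime divisors\<close>

definition mset_of_fun :: "'a set \<Rightarrow> ('a \<Rightarrow> nat) \<Rightarrow> 'a multiset" where
  "mset_of_fun A f = (\<Sum>a\<in>A. replicate_mset (f a) a)"

lemma count_mset_of_fun: "finite A \<Longrightarrow> count (mset_of_fun A f) a = (if a \<in> A then f a else 0)"
  by (simp add: mset_of_fun_def count_sum)

lemma set_mset_of_fun: "finite A \<Longrightarrow> set_mset (mset_of_fun A f) \<subseteq> A"
  by (metis count_mset_of_fun not_in_iff subsetI)

text \<open>Because gcds are additive, the gcd condition has to be checked only for single basis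
  elements.\<close>

lemma mset_glb_all:
  assumes add: "\<And>a b. a \<in> H \<Longrightarrow> b \<in> H \<Longrightarrow> \<exists>c\<in>H. \<phi> c = \<phi> a + \<phi> b"
    and zero: "z \<in> H" "\<phi> z = {#}"
    and single: "\<And>p. p \<in> P \<Longrightarrow> \<exists>A\<subseteq>H. mset_glb (\<phi> ` A) {#p#}"
    and d: "set_mset d \<subseteq> P"
  shows "\<exists>A\<subseteq>H. mset_glb (\<phi> ` A) d"
  using d
proof (induction d)
  case empty
  show ?case using zero by (intro exI[of _ "{z}"]) (auto simp: mset_glb_singleton)
next
  case (add p d)
  then obtain A B where A: "A \<subseteq> H" "mset_glb (\<phi> ` A) {#p#}" and B: "B \<subseteq> H" "mset_glb (\<phi> ` B) d"
    using single[of p] by auto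
  define C where "C = {c \<in> H. \<exists>a\<in>A. \<exists>b\<in>B. \<phi> c = \<phi> a + \<phi> b}"
  have "\<phi> ` C = {a + b |a b. a \<in> \<phi> ` A \<and> b \<in> \<phi> ` B}"
  proof
    show "{a + b |a b. a \<in> \<phi> ` A \<and> b \<in> \<phi> ` B} \<subseteq> \<phi> ` C"
    proof clarify
      fix a b assume "a \<in> A" "b \<in> B"
      then obtain c where "c \<in> H" "\<phi> c = \<phi> a + \<phi> b" using assms(1)[of a b] A B by blast
      then show "\<phi> a + \<phi> b \<in> \<phi> ` C" using \<open>a \<in> A\<close> \<open>b \<in> B\<close> by (force simp: C_def image_iff)
    qed
  qed (auto simp: C_def)
  then have "mset_glb (\<phi> ` C) (add_mset p d)"
    using mset_glb_add[OF A(2) B(2)] by simp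
  then show ?case by (intro exI[of _ C]) (auto simp: C_def)
qed

text \<open>There are \<open>k + 1\<close> rows and \<open>t + 1\<close> columns. In the class
  group, row 0 will carry the classes defined as inverses of products and column 0 the classes
  \<open>g i\<close>.\<close>

definition grid :: "nat \<Rightarrow> nat \<Rightarrow> (nat \<times> nat) set" where
  "grid k t = {0..k} \<times> {0..t}"

lemma finite_grid: "finite (grid k t)" by (simp add: grid_def)

text \<open>With \<open>V i\<close> the element of multiplicity \<open>s j\<close> at the points \<open>(i, j)\<close> of row \<open>i\<close>, and \<open>U j\<close> the sum
  of column \<open>j\<close>, these are the sums of \<open>c i\<close> copies of \<open>V i\<close> and \<open>d j\<close> copies of \<open>U j\<close>.\<close>

definition grid_monoid :: "nat \<Rightarrow> nat \<Rightarrow> (nat \<Rightarrow> nat) \<Rightarrow> (nat \<times> nat) multiset set" where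
  "grid_monoid k t s = {m. set_mset m \<subseteq> grid k t \<and>
     (\<exists>c d. \<forall>i\<le>k. \<forall>j\<le>t. count m (i, j) = c i * s j + d j)}"

text \<open>This is the image of a divisor theory with basis \<open>Q\<close>, viewed without the
  monoid that it comes from.\<close>

locale krull_set = saturated R for R :: "'q multiset set" +
  fixes Q :: "'q set"
  assumes supp: "r \<in> R \<Longrightarrow> set_mset r \<subseteq> Q"
    and glb: "set_mset d \<subseteq> Q \<Longrightarrow> \<exists>A\<subseteq>R. mset_glb A d"

text \<open>The atoms of the squarefree side of the generating relation become the weighted rows and
  those of the other side the columns. This respects the relation: both of its sides are sent to the
  multiset with multiplicity \<open>s j\<close> at every point \<open>(i, j)\<close>.\<close>

theorem (in krull_set) grid_structure:
  assumes lf: "unique_length_fact R" and nf: "\<not> unique_fact R"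
    and no_prime: "\<And>a. a \<in> mset_atoms R \<Longrightarrow> \<exists>b\<in>R. \<exists>c\<in>R. a \<subseteq># b + c \<and> \<not> a \<subseteq># b \<and> \<not> a \<subseteq># c"
  obtains k t s \<beta> where "k \<ge> 1" "\<And>j. j \<le> t \<Longrightarrow> s j \<ge> 1" "k + 1 \<noteq> (\<Sum>j=0..t. s j)" "(\<Sum>j=0..t. s j) \<ge> 2"
    "bij_betw \<beta> (grid k t) Q" "R = image_mset \<beta> ` grid_monoid k t s"
proof -
  obtain x y where atoms: "mset_atoms R = set_mset x \<union> set_mset y"
    and xy: "set_mset x \<inter> set_mset y = {}" "\<Sum>\<^sub># x = \<Sum>\<^sub># y" "size x \<noteq> size y" "\<And>u. count x u \<le> 1"
    and mult: "\<And>z z'. set_mset z \<subseteq> mset_atoms R \<Longrightarrow> set_mset z' \<subseteq> mset_atoms R \<Longrightarrow> \<Sum>\<^sub># z = \<Sum>\<^sub># z' \<Longrightarrow>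
       \<exists>l::int. \<forall>u. int (count z u) - int (count z' u) = l * (int (count x u) - int (count y u))"
    by (rule generating_relation_squarefree[OF lf nf no_prime]) (assumption, rule that)
  have ne: "a \<noteq> {#}" if "a \<in> mset_atoms R" for a using that by (auto simp: mset_atoms_def)
  \<comment> \<open>A side of length 0 makes the other side empty. A side of length 1 is a single
    atom, which factors only as itself and would then occur on both sides.\<close>
  have big: "size a \<ge> 2" if ab: "set_mset a \<subseteq> mset_atoms R" "set_mset b \<subseteq> mset_atoms R"
    "set_mset a \<inter> set_mset b = {}" "\<Sum>\<^sub># a = \<Sum>\<^sub># b" "size a \<noteq> size b" for a b :: "'q multiset multiset"
  proof (rule ccontr)
    assume "\<not> size a \<ge> 2"
    then consider "size a = 0" | "size a = 1" by linarith
    then show False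
    proof cases
      case 1
      then have "\<Sum>\<^sub># b = {#}" using ab(4) by simp
      then have "\<forall>u\<in>#b. u = {#}" by (metis insert_DiffM sum_mset.add_mset union_eq_empty)
      then have "b = {#}" using ne ab(2) by (meson multiset_nonemptyE subsetD)
      then show False using 1 ab(5) by simp
    next
      case 2
      then obtain v where v: "a = {#v#}" by (metis One_nat_def size_1_singleton_mset)
      then have va: "v \<in> mset_atoms R" "v = \<Sum>\<^sub># b" using ab by auto
      obtain u b' where b': "b = add_mset u b'"
        using va ne by (metis multiset_cases sum_mset.empty)
      then have "u \<in> R" "u \<noteq> {#}" "u \<subseteq># v" using va ab(2) ne atoms_subset by auto
      then have "u = v" using va(1) by (auto simp: mset_atoms_def)
      then show False using ab(3) v b' by auto
    qed
  qed
  have szx: "size x \<ge> 2" and szy: "size y \<ge> 2"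
    using big[of x y] big[of y x] xy(1,2,3) atoms by (auto simp: Int_commute)
  define k where "k = card (set_mset x) - 1"
  define t where "t = card (set_mset y) - 1"
  \<comment> \<open>As \<open>x\<close> is squarefree, its length is the number of its atoms; this
    is the origin of \<open>k + 1\<close>.\<close>
  have cx: "card (set_mset x) = size x"
    unfolding size_multiset_overloaded_eq using xy(4)
    by (metis (no_types, lifting) card_eq_sum count_greater_eq_one_iff le_antisym sum.cong)
  have k1: "k \<ge> 1" "size x = k + 1" using szx cx by (auto simp: k_def)
  have "set_mset y \<noteq> {}" using szy by auto
  then have ct: "card (set_mset y) = t + 1" unfolding t_def by (simp add: card_gt_0_iff Suc_leI)
  obtain V where V0: "bij_betw V {0..<card (set_mset x)} (set_mset x)"
    using ex_bij_betw_nat_finite by blast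
  obtain U where U0: "bij_betw U {0..<card (set_mset y)} (set_mset y)"
    using ex_bij_betw_nat_finite by blast
  have V: "bij_betw V {0..k} (set_mset x)" using V0 unfolding cx k1 by (simp add: atLeastLessThanSuc_atLeastAtMost)
  have U: "bij_betw U {0..t} (set_mset y)" using U0 unfolding ct by (simp add: atLeastLessThanSuc_atLeastAtMost)
  define s where "s = (\<lambda>j. count y (U j))"
  have Vx: "V i \<in># x" if "i \<le> k" for i using V that by (auto simp: bij_betw_def)
  have Uy: "U j \<in># y" if "j \<le> t" for j using U that by (auto simp: bij_betw_def)
  have cxV: "count x (V i) = 1" "count y (V i) = 0" if "i \<le> k" for i
    using Vx[OF that] xy(1) xy(4)[of "V i"] by (auto simp: not_in_iff[symmetric] le_Suc_eq)
  have cxU: "count x (U j) = 0" if "j \<le> t" for j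
    using Uy[OF that] xy(1) by (auto simp: not_in_iff[symmetric])
  have s1: "s j \<ge> 1" if "j \<le> t" for j using Uy[OF that] by (auto simp: s_def)
  have sums: "(\<Sum>j=0..t. s j) = size y"
    unfolding size_multiset_overloaded_eq s_def using sum.reindex_bij_betw[OF U] by simp
  define \<theta> where "\<theta> = (\<lambda>z. mset_of_fun (grid k t) (\<lambda>(i, j). count z (V i) * s j + count z (U j)))"
  have cnt: "count (\<theta> z) (i, j) = (if i \<le> k \<and> j \<le> t then count z (V i) * s j + count z (U j) else 0)" for z i j
    unfolding \<theta>_def count_mset_of_fun[OF finite_grid] by (auto simp: grid_def)
  define Z where "Z = {z. set_mset z \<subseteq> mset_atoms R}"
  have \<theta>add: "\<theta> (a + b) = \<theta> a + \<theta> b" for a b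
    by (rule multiset_eqI) (auto simp: cnt algebra_simps)
  have \<theta>0: "\<theta> {#} = {#}" by (rule multiset_eqI) (auto simp: cnt)
  have inter: "equivalent_divisors Z (grid k t) Q \<theta> sum_mset"
  proof
    fix a b assume "a \<in> Z" "b \<in> Z"
    then show "\<exists>c\<in>Z. \<theta> c = \<theta> a + \<theta> b \<and> \<Sum>\<^sub># c = \<Sum>\<^sub># a + \<Sum>\<^sub># b"
      by (intro bexI[of _ "a + b"]) (auto simp: Z_def \<theta>add)
  next
    fix z z' assume z: "z \<in> Z" "z' \<in> Z"
    show "\<theta> z \<subseteq># \<theta> z' \<longleftrightarrow> \<Sum>\<^sub># z \<subseteq># \<Sum>\<^sub># z'"
    proof
      assume le: "\<theta> z \<subseteq># \<theta> z'"
      define \<gamma> where "\<gamma> = (\<lambda>u. int (count z' u) - int (count z u))"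
      \<comment> \<open>The excess \<open>\<gamma>\<close> of \<open>z'\<close> over
        \<open>z\<close> is to be made nonnegative by a multiple of the relation. The least excess
        \<open>l\<close> among the \<open>V i\<close> does so: at the \<open>V i\<close> by
        minimality, and at the \<open>U j\<close> because the inclusion holds in the row
        \<open>i0\<close> where the minimum is attained.\<close>
      define l where "l = Min ((\<lambda>i. \<gamma> (V i)) ` {0..k})"
      have "l \<in> (\<lambda>i. \<gamma> (V i)) ` {0..k}" unfolding l_def by (intro Min_in) auto
      then obtain i0 where i0: "i0 \<le> k" "l = \<gamma> (V i0)" by auto
      have lmin: "l \<le> \<gamma> (V i)" if "i \<le> k" for i unfolding l_def using that by auto
      define f where "f = (\<lambda>u. \<gamma> u - l * (int (count x u) - int (count y u)))"
      have fpos: "f u \<ge> 0" if u: "u \<in> mset_atoms R" for u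
      proof -
        consider i where "i \<le> k" "u = V i" | j where "j \<le> t" "u = U j"
          using u V U unfolding atoms bij_betw_def by fastforce
        then show ?thesis
        proof cases
          case 1 then show ?thesis using lmin[of i] cxV[of i] by (simp add: f_def)
        next
          case 2
          have "count z (V i0) * s j + count z (U j) \<le> count z' (V i0) * s j + count z' (U j)"
            using mset_subset_eq_count[OF le, of "(i0, j)"] i0 2 by (simp add: cnt)
          then have "0 \<le> \<gamma> (V i0) * int (s j) + \<gamma> (U j)"
            unfolding \<gamma>_def by (simp add: algebra_simps flip: of_nat_mult of_nat_add)
          then show ?thesis using 2 cxU[of j] i0 by (simp add: f_def s_def)
        qed
      qed
      define w where "w = mset_of_fun (mset_atoms R) (\<lambda>u. nat (f u))"
      have fa: "finite (mset_atoms R)" by (simp add: atoms)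
      \<comment> \<open>The relation is placed on both sides with natural multiplicities according
        to the sign of \<open>l\<close>. Its two sides have equal sums, so it disappears after
        summation.\<close>
      have "z + w + repeat_mset (nat l) x + repeat_mset (nat (- l)) y
          = z' + repeat_mset (nat l) y + repeat_mset (nat (- l)) x" (is "?a = ?b")
      proof (rule multiset_eqI)
        fix u
        have "int (count ?a u) = int (count ?b u)"
        proof (cases "u \<in> mset_atoms R")
          case True
          then show ?thesis using fpos[OF True]
            by (cases "l \<ge> 0") (auto simp: w_def count_mset_of_fun[OF fa] f_def \<gamma>_def algebra_simps)
        next
          case False
          then have "count z u = 0" "count z' u = 0" "count x u = 0" "count y u = 0"
            using z unfolding Z_def atoms by (auto simp: not_in_iff[symmetric])
          then show ?thesis using False by (simp add: w_def count_mset_of_fun[OF fa])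
        qed
        then show "count ?a u = count ?b u" by linarith
      qed
      then have "\<Sum>\<^sub># ?a = \<Sum>\<^sub># ?b" by (rule arg_cong)
      moreover have "\<Sum>\<^sub># (repeat_mset n x) = \<Sum>\<^sub># (repeat_mset n y)" for n
        by (induction n) (auto simp: xy(2))
      ultimately have "\<Sum>\<^sub># z + \<Sum>\<^sub># w = \<Sum>\<^sub># z'" by (simp add: add.assoc)
      then show "\<Sum>\<^sub># z \<subseteq># \<Sum>\<^sub># z'" by (metis mset_subset_eq_add_left)
    next
      assume le: "\<Sum>\<^sub># z \<subseteq># \<Sum>\<^sub># z'"
      have "\<Sum>\<^sub># z' - \<Sum>\<^sub># z \<in> R"
        using z atoms_subset le unfolding Z_def by (intro diff sum_mset_closed) auto
      then obtain w where w: "set_mset w \<subseteq> mset_atoms R" "\<Sum>\<^sub># w = \<Sum>\<^sub># z' - \<Sum>\<^sub># z"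
        using factorization_exists by blast
      then have "\<Sum>\<^sub># (z + w) = \<Sum>\<^sub># z'" using le by simp
      then obtain l :: int where l: "\<And>u. int (count (z + w) u) - int (count z' u) = l * (int (count x u) - int (count y u))"
        using mult[of "z + w" z'] z w unfolding Z_def by auto
      \<comment> \<open>Adding \<open>l\<close> times the relation raises every row coefficient by
        \<open>l\<close> and lowers that of column \<open>j\<close> by \<open>l * s j\<close>, so no
        count of the image changes.\<close>
      have "\<theta> (z + w) = \<theta> z'"
      proof (rule multiset_eqI)
        fix p :: "nat \<times> nat"
        obtain i j where p: "p = (i, j)" by fastforce
        show "count (\<theta> (z + w)) p = count (\<theta> z') p"
        proof (cases "i \<le> k \<and> j \<le> t")
          case True
          have 1: "int (count (z + w) (V i)) = int (count z' (V i)) + l"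
            using l[of "V i"] True cxV[of i] by simp
          have 2: "int (count (z + w) (U j)) = int (count z' (U j)) - l * int (s j)"
            using l[of "U j"] True cxU[of j] by (simp add: s_def)
          have "int (count (\<theta> (z + w)) p) = int (count (z + w) (V i)) * int (s j) + int (count (z + w) (U j))"
            unfolding p cnt using True by (simp only: of_nat_add of_nat_mult if_True simp_thms)
          also have "\<dots> = int (count z' (V i)) * int (s j) + int (count z' (U j))"
            unfolding 1 2 by (simp add: algebra_simps)
          also have "\<dots> = int (count (\<theta> z') p)" unfolding p cnt using True by simp
          finally show ?thesis by simp
        next
          case False
          then show ?thesis unfolding p cnt by auto
        qed
      qed
      then show "\<theta> z \<subseteq># \<theta> z'" unfolding \<theta>add by (metis mset_subset_eq_add_left)
    qed
  next
    fix a show "set_mset (\<theta> a) \<subseteq> grid k t"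
      unfolding \<theta>_def by (rule set_mset_of_fun[OF finite_grid])
  next
    fix a assume "a \<in> Z"
    then show "set_mset (\<Sum>\<^sub># a) \<subseteq> Q"
      using sum_mset_closed[of a] atoms_subset supp unfolding Z_def by blast
  next
    fix d assume d: "set_mset d \<subseteq> grid k t"
    show "\<exists>A\<subseteq>Z. mset_glb (\<theta> ` A) d"
    proof (rule mset_glb_all[OF _ _ _ _ d])
      show "\<exists>c\<in>Z. \<theta> c = \<theta> a + \<theta> b" if "a \<in> Z" "b \<in> Z" for a b
        using that by (intro bexI[of _ "a + b"]) (auto simp: Z_def \<theta>add)
      show "{#} \<in> Z" "\<theta> {#} = {#}" by (auto simp: Z_def \<theta>0)
    next
      fix p assume "p \<in> grid k t"
      then obtain i j where p: "p = (i, j)" "i \<le> k" "j \<le> t" by (auto simp: grid_def)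
      have VU: "V i' \<noteq> U j'" if "i' \<le> k" "j' \<le> t" for i' j' using Vx Uy xy(1) that by fastforce
      have injV: "V i' = V i \<longleftrightarrow> i' = i" if "i' \<le> k" for i' using V p that by (auto simp: bij_betw_def inj_on_def)
      have injU: "U j' = U j \<longleftrightarrow> j' = j" if "j' \<le> t" for j' using U p that by (auto simp: bij_betw_def inj_on_def)
      have cV: "count (\<theta> {#V i#}) (i', j') = (if i' = i \<and> j' \<le> t then s j' else 0)" for i' j'
        unfolding cnt using p(2,3) by (auto simp: VU VU[symmetric] injV eq_commute[of "V i"])
      have cU: "count (\<theta> {#U j#}) (i', j') = (if i' \<le> k \<and> j' = j then 1 else 0)" for i' j'
        unfolding cnt using p(2,3) by (auto simp: VU VU[symmetric] injU eq_commute[of "U j"])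
      \<comment> \<open>Row \<open>i\<close> and column \<open>j\<close> meet only in
        \<open>(i, j)\<close>, where the column has multiplicity 1. Their gcd is this single point
        whatever the weight \<open>s j\<close> is.\<close>
      have "mset_glb (\<theta> ` {{#V i#}, {#U j#}}) {#p#}"
        unfolding mset_glb_def
      proof (intro conjI ballI allI)
        fix a assume "a \<in> \<theta> ` {{#V i#}, {#U j#}}"
        moreover have "0 < count (\<theta> {#V i#}) p" "0 < count (\<theta> {#U j#}) p"
          using p s1[of j] by (auto simp: p(1) cV cU)
        ultimately show "{#p#} \<subseteq># a" by (auto simp: count_greater_zero_iff)
      next
        fix q :: "nat \<times> nat"
        obtain i' j' where q: "q = (i', j')" by fastforce
        show "\<exists>a\<in>\<theta> ` {{#V i#}, {#U j#}}. count a q = count {#p#} q"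
        proof (cases "i' = i")
          case True
          then have "count (\<theta> {#U j#}) q = count {#p#} q" unfolding q cU using p by auto
          then show ?thesis by blast
        next
          case False
          then have "count (\<theta> {#V i#}) q = count {#p#} q" unfolding q cV using p by auto
          then show ?thesis by blast
        qed
      qed
      moreover have "{{#V i#}, {#U j#}} \<subseteq> Z" using Vx[of i] Uy[of j] p by (auto simp: Z_def atoms)
      ultimately show "\<exists>A\<subseteq>Z. mset_glb (\<theta> ` A) {#p#}" by blast
    qed
  next
    fix e assume "set_mset e \<subseteq> Q"
    then obtain A where A: "A \<subseteq> R" "mset_glb A e" using glb by blast
    have "sum_mset ` {z \<in> Z. \<Sum>\<^sub># z \<in> A} = A"
    proof (intro equalityI subsetI)
      fix a assume "a \<in> A"
      then obtain z where "z \<in> Z" "\<Sum>\<^sub># z = a" using factorization_exists[of a] A(1) unfolding Z_def by blast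
      then show "a \<in> sum_mset ` {z \<in> Z. \<Sum>\<^sub># z \<in> A}" using \<open>a \<in> A\<close> by blast
    qed auto
    then show "\<exists>A\<subseteq>Z. mset_glb (sum_mset ` A) e" using A(2)
      by (intro exI[of _ "{z \<in> Z. \<Sum>\<^sub># z \<in> A}"]) auto
  qed
  then obtain \<beta> where \<beta>: "bij_betw \<beta> (grid k t) Q" "\<And>z. z \<in> Z \<Longrightarrow> \<Sum>\<^sub># z = image_mset \<beta> (\<theta> z)"
    using equivalent_divisors.bijection_exists[OF inter] by blast
  have R: "R = sum_mset ` Z"
  proof (intro equalityI subsetI)
    fix r assume "r \<in> R"
    then obtain z where "z \<in> Z" "\<Sum>\<^sub># z = r" using factorization_exists[of r] unfolding Z_def by blast
    then show "r \<in> sum_mset ` Z" by blast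
  next
    fix r assume "r \<in> sum_mset ` Z"
    then show "r \<in> R" using sum_mset_closed atoms_subset unfolding Z_def by blast
  qed
  have "\<theta> ` Z = grid_monoid k t s"
  proof
    show "\<theta> ` Z \<subseteq> grid_monoid k t s"
    proof
      fix m assume "m \<in> \<theta> ` Z"
      then obtain z where m: "m = \<theta> z" by auto
      have "set_mset m \<subseteq> grid k t"
        unfolding m \<theta>_def by (rule set_mset_of_fun[OF finite_grid])
      moreover have "\<exists>c d. \<forall>i\<le>k. \<forall>j\<le>t. count m (i, j) = c i * s j + d j"
        by (intro exI[of _ "\<lambda>i. count z (V i)"] exI[of _ "\<lambda>j. count z (U j)"]) (auto simp: m cnt)
      ultimately show "m \<in> grid_monoid k t s" by (auto simp: grid_monoid_def)
    qed
    show "grid_monoid k t s \<subseteq> \<theta> ` Z"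
    proof
      fix m assume "m \<in> grid_monoid k t s"
      then obtain c d where m: "set_mset m \<subseteq> grid k t"
        and cd: "\<And>i j. i \<le> k \<Longrightarrow> j \<le> t \<Longrightarrow> count m (i, j) = c i * s j + d j"
        unfolding grid_monoid_def by blast
      define z where "z = mset_of_fun (mset_atoms R)
        (\<lambda>u. if u \<in># x then c (the_inv_into {0..k} V u) else d (the_inv_into {0..t} U u))"
      have fa: "finite (mset_atoms R)" by (simp add: atoms)
      have zZ: "z \<in> Z" unfolding Z_def z_def using set_mset_of_fun[OF fa] by blast
      have zV: "count z (V i) = c i" if "i \<le> k" for i
        unfolding z_def count_mset_of_fun[OF fa] using Vx[OF that] V that
        by (simp add: atoms bij_betw_def the_inv_into_f_f)
      have zU: "count z (U j) = d j" if "j \<le> t" for j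
      proof -
        have "U j \<notin># x" using Uy[OF that] xy(1) by blast
        then show ?thesis unfolding z_def count_mset_of_fun[OF fa] using Uy[OF that] U that
          by (simp add: atoms bij_betw_def the_inv_into_f_f)
      qed
      have "m = \<theta> z"
      proof (rule multiset_eqI)
        fix p :: "nat \<times> nat"
        obtain i j where p: "p = (i, j)" by fastforce
        show "count m p = count (\<theta> z) p"
        proof (cases "i \<le> k \<and> j \<le> t")
          case True then show ?thesis unfolding p cnt by (simp add: cd zV zU)
        next
          case False
          then have "p \<notin># m" using m p by (auto simp: grid_def)
          then show ?thesis using False unfolding p cnt by (auto simp: not_in_iff)
        qed
      qed
      then show "m \<in> \<theta> ` Z" using zZ by blast
    qed
  qed
  then have "R = image_mset \<beta> ` grid_monoid k t s"
    unfolding R by (subst image_cong[OF refl \<beta>(2)]) (auto simp flip: image_image)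
  then show thesis
    using that[of k t s \<beta>] k1 s1 sums szy xy(3) \<beta>(1) by simp
qed

section \<open>Transport of unique factorization, and length-factoriality of the grid monoid\<close>

text \<open>An additive bijection between saturated sets preserves inclusion in both directions,
  because cofactors belong to the sets. Hence it preserves atoms, formal products of atoms and their
  lengths.\<close>

lemma unique_factorization_iso:
  assumes R: "saturated R" and R': "saturated R'" and bij: "bij_betw f R R'"
    and f_add: "\<And>x y. x \<in> R \<Longrightarrow> y \<in> R \<Longrightarrow> f (x + y) = f x + f y"
  shows "unique_fact R' \<longleftrightarrow> unique_fact R" "unique_length_fact R' \<longleftrightarrow> unique_length_fact R"
proof -
  interpret R: saturated R by fact
  interpret R': saturated R' by fact
  have fR: "f x \<in> R'" if "x \<in> R" for x using bij that by (auto simp: bij_betw_def)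
  have inj: "f x = f y \<longleftrightarrow> x = y" if "x \<in> R" "y \<in> R" for x y
    using bij that by (auto simp: bij_betw_def inj_on_def)
  have surj: "\<exists>x\<in>R. f x = y" if "y \<in> R'" for y using bij that by (auto simp: bij_betw_def)
  have f0: "f {#} = {#}" using f_add[OF R.zero R.zero] by simp
  have le: "f x \<subseteq># f y \<longleftrightarrow> x \<subseteq># y" if xy: "x \<in> R" "y \<in> R" for x y
  proof
    assume "x \<subseteq># y"
    then have "f y = f x + f (y - x)" using f_add[of x "y - x"] R.diff xy by simp
    then show "f x \<subseteq># f y" by simp
  next
    assume le: "f x \<subseteq># f y"
    obtain w where w: "w \<in> R" "f w = f y - f x" using surj R'.diff[OF fR[OF xy(1)] fR[OF xy(2)] le] by blast
    then have "f (x + w) = f y" using f_add xy le by simp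
    then have "x + w = y" using inj R.add xy w by blast
    then show "x \<subseteq># y" by auto
  qed
  have atom: "f u \<in> mset_atoms R' \<longleftrightarrow> u \<in> mset_atoms R" if u: "u \<in> R" for u
  proof -
    have "(\<forall>b\<in>R'. b \<subseteq># f u \<longrightarrow> b = {#} \<or> b = f u) \<longleftrightarrow> (\<forall>b\<in>R. f b \<subseteq># f u \<longrightarrow> f b = {#} \<or> f b = f u)"
      using surj fR by metis
    also have "\<dots> \<longleftrightarrow> (\<forall>b\<in>R. b \<subseteq># u \<longrightarrow> b = {#} \<or> b = u)"
      using le u inj f0 R.zero by (metis (no_types, lifting))
    finally show ?thesis
      unfolding mset_atoms_def using u fR inj[OF u R.zero] f0 by auto
  qed
  have sumf: "\<Sum>\<^sub># (image_mset f z) = f (\<Sum>\<^sub># z)" if "set_mset z \<subseteq> R" for z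
    using that by (induction z) (auto simp: f0 f_add R.sum_mset_closed)
  have lift: "\<exists>w. set_mset w \<subseteq> mset_atoms R \<and> image_mset f w = z" if "set_mset z \<subseteq> mset_atoms R'" for z
    using that
  proof (induction z)
    case (add u z)
    then obtain w where w: "set_mset w \<subseteq> mset_atoms R" "image_mset f w = z" by auto
    obtain v where v: "v \<in> R" "f v = u" using surj[of u] add.prems R'.atoms_subset by auto
    then have "v \<in> mset_atoms R" using atom add.prems by auto
    then show ?case using w v by (intro exI[of _ "add_mset v w"]) auto
  qed auto
  have injm: "z = z'" if "set_mset z \<subseteq> R" "set_mset z' \<subseteq> R" "image_mset f z = image_mset f z'" for z z'
  proof -
    have "image_mset (the_inv_into R f) (image_mset f z) = z" if "set_mset z \<subseteq> R" for z
    proof -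
      have "image_mset (\<lambda>x. the_inv_into R f (f x)) z = image_mset (\<lambda>x. x) z"
        using that bij by (intro image_mset_cong) (auto simp: bij_betw_def the_inv_into_f_f)
      then show ?thesis by (simp add: image_mset.compositionality o_def)
    qed
    then show ?thesis using that by metis
  qed
  have sub: "set_mset z \<subseteq> R" if "set_mset z \<subseteq> mset_atoms R" for z
    using that R.atoms_subset by blast
  have im: "set_mset (image_mset f z) \<subseteq> mset_atoms R'" if "set_mset z \<subseteq> mset_atoms R" for z
    using that sub[OF that] atom by auto
  have sum_eq: "\<Sum>\<^sub># (image_mset f z) = \<Sum>\<^sub># (image_mset f z') \<longleftrightarrow> \<Sum>\<^sub># z = \<Sum>\<^sub># z'"
    if "set_mset z \<subseteq> R" "set_mset z' \<subseteq> R" for z z'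
    using that by (simp add: sumf inj R.sum_mset_closed)
  show "unique_fact R' \<longleftrightarrow> unique_fact R"
  proof
    assume "unique_fact R'"
    then show "unique_fact R"
      unfolding unique_fact_def using im sub sum_eq injm by metis
  next
    assume u: "unique_fact R"
    show "unique_fact R'"
      unfolding unique_fact_def
    proof (intro allI impI)
      fix z z' assume z: "set_mset z \<subseteq> mset_atoms R'" "set_mset z' \<subseteq> mset_atoms R'" "\<Sum>\<^sub># z = \<Sum>\<^sub># z'"
      obtain w w' where w: "set_mset w \<subseteq> mset_atoms R" "image_mset f w = z"
        "set_mset w' \<subseteq> mset_atoms R" "image_mset f w' = z'" using lift z by metis
      then have "\<Sum>\<^sub># w = \<Sum>\<^sub># w'" using z sum_eq sub by metis
      then show "z = z'" using u w unfolding unique_fact_def by metis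
    qed
  qed
  show "unique_length_fact R' \<longleftrightarrow> unique_length_fact R"
  proof
    assume "unique_length_fact R'"
    then show "unique_length_fact R"
      unfolding unique_length_fact_def using im sub sum_eq injm by (metis size_image_mset)
  next
    assume u: "unique_length_fact R"
    show "unique_length_fact R'"
      unfolding unique_length_fact_def
    proof (intro allI impI)
      fix z z' assume z: "set_mset z \<subseteq> mset_atoms R'" "set_mset z' \<subseteq> mset_atoms R'" "\<Sum>\<^sub># z = \<Sum>\<^sub># z'"
        "size z = size z'"
      obtain w w' where w: "set_mset w \<subseteq> mset_atoms R" "image_mset f w = z"
        "set_mset w' \<subseteq> mset_atoms R" "image_mset f w' = z'" using lift z by metis
      then have "\<Sum>\<^sub># w = \<Sum>\<^sub># w'" "size w = size w'" using z sum_eq sub by (metis, metis size_image_mset)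
      then show "z = z'" using u w unfolding unique_length_fact_def by metis
    qed
  qed
qed

text \<open>Integral coefficients suffice: adding \<open>l\<close> to all \<open>c i\<close> and subtracting \<open>l s j\<close> from \<open>d j\<close>
  changes nothing, so the least \<open>c i\<close> may be assumed to be \<open>0\<close>.\<close>

lemma grid_monoidI:
  fixes c d :: "nat \<Rightarrow> int"
  assumes "set_mset m \<subseteq> grid k t"
    and cd: "\<And>i j. i \<le> k \<Longrightarrow> j \<le> t \<Longrightarrow> int (count m (i, j)) = c i * int (s j) + d j"
  shows "m \<in> grid_monoid k t s"
proof -
  define l where "l = Min (c ` {0..k})"
  have "l \<in> c ` {0..k}" unfolding l_def by (intro Min_in) auto
  then obtain i0 where i0: "i0 \<le> k" "l = c i0" by auto
  have lmin: "l \<le> c i" if "i \<le> k" for i unfolding l_def using that by auto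
  have dpos: "0 \<le> d j + l * int (s j)" if "j \<le> t" for j
    using cd[OF i0(1) that] i0(2) by (metis add.commute of_nat_0_le_iff)
  have "count m (i, j) = nat (c i - l) * s j + nat (d j + l * int (s j))" if "i \<le> k" "j \<le> t" for i j
  proof -
    have "int (count m (i, j)) = (c i - l) * int (s j) + (d j + l * int (s j))"
      using cd[OF that] by (simp add: algebra_simps)
    also have "\<dots> = int (nat (c i - l) * s j + nat (d j + l * int (s j)))"
      using lmin[OF that(1)] dpos[OF that(2)] by simp
    finally show ?thesis by (simp only: of_nat_eq_iff)
  qed
  with assms(1) show ?thesis
    unfolding grid_monoid_def
    by (intro CollectI conjI exI[of _ "\<lambda>i. nat (c i - l)"] exI[of _ "\<lambda>j. nat (d j + l * int (s j))"]) auto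
qed

text \<open>Closure under differences is the reason for the integral criterion: the coefficients of
  \<open>y - x\<close> are differences and may be negative although the counts are not.\<close>

lemma saturated_grid_monoid: "saturated (grid_monoid k t s)"
proof
  show "{#} \<in> grid_monoid k t s"
    by (rule grid_monoidI[of _ _ _ "\<lambda>_. 0" _ "\<lambda>_. 0"]) auto
next
  fix x y assume xy: "x \<in> grid_monoid k t s" "y \<in> grid_monoid k t s"
  then obtain c d c' d' where *: "\<And>i j. i \<le> k \<Longrightarrow> j \<le> t \<Longrightarrow> count x (i, j) = c i * s j + d j"
    "\<And>i j. i \<le> k \<Longrightarrow> j \<le> t \<Longrightarrow> count y (i, j) = c' i * s j + d' j"
    and sub: "set_mset x \<subseteq> grid k t" "set_mset y \<subseteq> grid k t"
    unfolding grid_monoid_def by blast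
  show "x + y \<in> grid_monoid k t s"
    using sub * by (intro grid_monoidI[of _ _ _ "\<lambda>i. int (c i) + int (c' i)" _ "\<lambda>i. int (d i) + int (d' i)"])
      (auto simp: algebra_simps)
  assume le: "x \<subseteq># y"
  show "y - x \<in> grid_monoid k t s"
  proof (rule grid_monoidI[of _ _ _ "\<lambda>i. int (c' i) - int (c i)" _ "\<lambda>j. int (d' j) - int (d j)"])
    show "set_mset (y - x) \<subseteq> grid k t" using sub by (auto dest: in_diffD)
  next
    fix i j assume ij: "i \<le> k" "j \<le> t"
    have "int (count (y - x) (i, j)) = int (count y (i, j)) - int (count x (i, j))"
      using mset_subset_eq_count[OF le, of "(i, j)"] by simp
    also have "\<dots> = (int (c' i) - int (c i)) * int (s j) + (int (d' j) - int (d j))"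
      unfolding *(1)[OF ij] *(2)[OF ij] by (simp add: algebra_simps)
    finally show "int (count (y - x) (i, j)) = (int (c' i) - int (c i)) * int (s j) + (int (d' j) - int (d j))" .
  qed
qed

text \<open>The atoms are the weighted rows and the columns. Two factorizations of one element
  differ by a shift \<open>l\<close> of the row coefficients and \<open>- l * s j\<close> of the
  column coefficients, which changes the length by \<open>l\<close> times the difference of
  \<open>k + 1\<close> and the sum of the \<open>s j\<close>. By \<open>ks\<close> equal lengths
  force \<open>l = 0\<close>.\<close>

theorem grid_monoid_length_factorial:
  assumes k: "k \<ge> 1" and s1: "\<And>j. j \<le> t \<Longrightarrow> s j \<ge> 1" and ks: "k + 1 \<noteq> (\<Sum>j=0..t. s j)"
    and s2: "(\<Sum>j=0..t. s j) \<ge> 2"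
  shows "unique_length_fact (grid_monoid k t s)" "\<not> unique_fact (grid_monoid k t s)"
proof -
  let ?M = "grid_monoid k t s"
  interpret saturated ?M by (rule saturated_grid_monoid)
  define row where "row = (\<lambda>i. mset_of_fun (grid k t) (\<lambda>(a, b). if a = i then s b else 0))"
  define col where "col = (\<lambda>j. mset_of_fun (grid k t) (\<lambda>(a, b). if b = j then 1 else 0 :: nat))"
  have crow: "count (row i) (a, b) = (if a = i \<and> a \<le> k \<and> b \<le> t then s b else 0)" for i a b
    unfolding row_def count_mset_of_fun[OF finite_grid] by (auto simp: grid_def)
  have ccol: "count (col j) (a, b) = (if b = j \<and> a \<le> k \<and> b \<le> t then 1 else 0)" for j a b
    unfolding col_def count_mset_of_fun[OF finite_grid] by (auto simp: grid_def)
  have rowM: "row i \<in> ?M" for i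
    using set_mset_of_fun[OF finite_grid] unfolding row_def[THEN fun_cong, of i]
    by (rule grid_monoidI[of _ _ _ "\<lambda>a. if a = i then 1 else 0" _ "\<lambda>_. 0"]) (auto simp: crow[unfolded row_def])
  have colM: "col j \<in> ?M" for j
    using set_mset_of_fun[OF finite_grid] unfolding col_def[THEN fun_cong, of j]
    by (rule grid_monoidI[of _ _ _ "\<lambda>_. 0" _ "\<lambda>b. if b = j then 1 else 0"]) (auto simp: ccol[unfolded col_def])
  have grid_eqI: "m = m'" if "set_mset m \<subseteq> grid k t" "set_mset m' \<subseteq> grid k t"
    "\<And>i j. i \<le> k \<Longrightarrow> j \<le> t \<Longrightarrow> count m (i, j) = count m' (i, j)" for m m'
  proof (rule multiset_eqI)
    fix p :: "nat \<times> nat"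
    obtain i j where p: "p = (i, j)" by fastforce
    show "count m p = count m' p"
    proof (cases "p \<in> grid k t")
      case True then show ?thesis using that(3)[of i j] p by (auto simp: grid_def)
    next
      case False then show ?thesis using that(1,2) by (metis not_in_iff subsetD)
    qed
  qed
  have Msub: "set_mset m \<subseteq> grid k t" if "m \<in> ?M" for m using that by (simp add: grid_monoid_def)
  have row_ne: "row i \<noteq> {#}" if "i \<le> k" for i
    using crow[of i i 0] s1[of 0] that by (metis count_empty le0 not_one_le_zero)
  have col_ne: "col j \<noteq> {#}" if "j \<le> t" for j
    using ccol[of j 0 j] that by (metis count_empty le0 zero_neq_one)
  have other: "\<exists>i'\<le>k. i' \<noteq> i" for i
    using k by (cases "i = 0") (auto intro: exI[of _ 0] exI[of _ 1])
  have row_atom: "row i \<in> mset_atoms ?M" if i: "i \<le> k" for i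
    unfolding mset_atoms_def
  proof (intro CollectI conjI rowM row_ne[OF i] ballI impI)
    fix b assume b: "b \<in> ?M" "b \<subseteq># row i"
    then obtain c d where cd: "\<And>i j. i \<le> k \<Longrightarrow> j \<le> t \<Longrightarrow> count b (i, j) = c i * s j + d j"
      unfolding grid_monoid_def by blast
    \<comment> \<open>A second row exists since \<open>k >= 1\<close>. The multiset
      \<open>row i\<close> vanishes on it, which removes all column coefficients of a
      divisor.\<close>
    obtain i' where i': "i' \<le> k" "i' \<noteq> i" using other by blast
    have d0: "d j = 0" if "j \<le> t" for j
      using mset_subset_eq_count[OF b(2), of "(i', j)"] cd[OF i'(1) that] i' by (simp add: crow)
    have c0: "c a = 0" if "a \<le> k" "a \<noteq> i" for a
      using mset_subset_eq_count[OF b(2), of "(a, 0)"] cd[OF that(1), of 0] that s1[of 0] by (simp add: crow)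
    have "c i * s 0 \<le> s 0"
      using mset_subset_eq_count[OF b(2), of "(i, 0)"] cd[OF i, of 0] i d0[of 0] by (simp add: crow)
    then have "c i = 0 \<or> c i = 1" using s1[of 0] by (cases "c i") auto
    then show "b = {#} \<or> b = row i"
    proof
      assume "c i = 0"
      then have "c a = 0" if "a \<le> k" for a using c0 that by (cases "a = i") auto
      then have "b = {#}" using d0 cd Msub[OF b(1)] by (intro grid_eqI) auto
      then show ?thesis ..
    next
      assume "c i = 1"
      then have "b = row i" using c0 d0 cd Msub[OF b(1)] Msub[OF rowM[of i]]
        by (intro grid_eqI) (auto simp: crow)
      then show ?thesis ..
    qed
  qed
  have col_atom: "col j \<in> mset_atoms ?M" if j: "j \<le> t" for j
    unfolding mset_atoms_def
  proof (intro CollectI conjI colM col_ne[OF j] ballI impI)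
    fix b assume b: "b \<in> ?M" "b \<subseteq># col j"
    then obtain c d where cd: "\<And>i j. i \<le> k \<Longrightarrow> j \<le> t \<Longrightarrow> count b (i, j) = c i * s j + d j"
      unfolding grid_monoid_def by blast
    \<comment> \<open>With a single column, a row of weight 1 would be contained in it; this is
      excluded by \<open>s2\<close>, which gives \<open>s 0 >= 2\<close>. With several columns, a
      row meets a column other than \<open>j\<close>.\<close>
    have c0: "c i = 0" if "i \<le> k" for i
    proof (cases "t = 0")
      case True
      then have "c i * s 0 + d 0 \<le> 1"
        using mset_subset_eq_count[OF b(2), of "(i, 0)"] cd[OF that, of 0] j that True by (simp add: ccol)
      moreover have "s 0 \<ge> 2" using s2 True by simp
      ultimately show ?thesis by (cases "c i") auto
    next
      case False
      then obtain j' where j': "j' \<le> t" "j' \<noteq> j" by (metis le0 le_refl)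
      then show ?thesis
        using mset_subset_eq_count[OF b(2), of "(i, j')"] cd[OF that j'(1)] s1[OF j'(1)] by (simp add: ccol)
    qed
    have d0: "d b' = 0" if "b' \<le> t" "b' \<noteq> j" for b'
      using mset_subset_eq_count[OF b(2), of "(0, b')"] cd[of 0 b'] that by (simp add: ccol)
    have "d j \<le> 1"
      using mset_subset_eq_count[OF b(2), of "(0, j)"] cd[of 0 j] j c0[of 0] by (simp add: ccol)
    then have "d j = 0 \<or> d j = 1" by auto
    then show "b = {#} \<or> b = col j"
    proof
      assume "d j = 0"
      then have "d b' = 0" if "b' \<le> t" for b' using d0 that by (cases "b' = j") auto
      then have "b = {#}" using c0 cd Msub[OF b(1)] by (intro grid_eqI) auto
      then show ?thesis ..
    next
      assume "d j = 1"
      then have "b = col j" using c0 d0 cd Msub[OF b(1)] Msub[OF colM[of j]]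
        by (intro grid_eqI) (auto simp: ccol)
      then show ?thesis ..
    qed
  qed
  have atoms: "u \<in> mset_atoms ?M \<Longrightarrow> (\<exists>i\<le>k. u = row i) \<or> (\<exists>j\<le>t. u = col j)" for u
  proof -
    assume u: "u \<in> mset_atoms ?M"
    then have uM: "u \<in> ?M" "u \<noteq> {#}" and min: "\<And>b. b \<in> ?M \<Longrightarrow> b \<subseteq># u \<Longrightarrow> b = {#} \<or> b = u"
      by (auto simp: mset_atoms_def)
    obtain c d where cd: "\<And>i j. i \<le> k \<Longrightarrow> j \<le> t \<Longrightarrow> count u (i, j) = c i * s j + d j"
      using uM unfolding grid_monoid_def by blast
    have "\<exists>i\<le>k. \<exists>j\<le>t. count u (i, j) \<noteq> 0"
    proof (rule ccontr)
      assume "\<not> ?thesis"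
      then have "u = {#}" using Msub[OF uM(1)] by (intro grid_eqI) (auto simp: not_in_iff)
      then show False using uM by simp
    qed
    then consider i where "i \<le> k" "c i \<noteq> 0" | j where "j \<le> t" "d j \<noteq> 0"
      using cd by (metis add_is_0 mult_0)
    then show ?thesis
    proof cases
      case 1
      have "row i \<subseteq># u"
      proof (rule mset_subset_eqI)
        fix p :: "nat \<times> nat"
        obtain a b where p: "p = (a, b)" by fastforce
        show "count (row i) p \<le> count u p"
          using 1 by (cases "c i") (auto simp: p crow cd)
      qed
      then show ?thesis using min[OF rowM] row_ne 1 by blast
    next
      case 2
      have "col j \<subseteq># u"
      proof (rule mset_subset_eqI)
        fix p :: "nat \<times> nat"
        obtain a b where p: "p = (a, b)" by fastforce
        show "count (col j) p \<le> count u p"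
          using 2 by (auto simp: p ccol cd)
      qed
      then show ?thesis using min[OF colM] col_ne 2 by blast
    qed
  qed
  have row_inj: "row i = row i' \<longleftrightarrow> i = i'" if "i \<le> k" for i i'
    using crow[of i i 0] crow[of i' i 0] s1[of 0] that by (metis le0 not_one_le_zero)
  have col_inj: "col j = col j' \<longleftrightarrow> j = j'" if "j \<le> t" for j j'
    using ccol[of j 0 j] ccol[of j' 0 j] that by (metis le0 zero_neq_one)
  have row_col: "row i \<noteq> col j" if "i \<le> k" "j \<le> t" for i j
  proof -
    obtain i' where "i' \<le> k" "i' \<noteq> i" using other by blast
    then show ?thesis using crow[of i i' j] ccol[of j i' j] that by auto
  qed
  have sum_count: "count (\<Sum>\<^sub># z) (i, j) = count z (row i) * s j + count z (col j)"
    if "set_mset z \<subseteq> mset_atoms ?M" "i \<le> k" "j \<le> t" for z i j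
    using that(1)
  proof (induction z)
    case (add u z)
    then consider a where "a \<le> k" "u = row a" | b where "b \<le> t" "u = col b" using atoms by fastforce
    then show ?case
      using add that(2,3) by cases (auto simp: crow ccol row_inj col_inj row_col row_col[symmetric] algebra_simps)
  qed auto
  have sum_size: "size z = (\<Sum>i=0..k. count z (row i)) + (\<Sum>j=0..t. count z (col j))"
    if "set_mset z \<subseteq> mset_atoms ?M" for z
    using that
  proof (induction z)
    case (add u z)
    then consider a where "a \<le> k" "u = row a" | b where "b \<le> t" "u = col b" using atoms by fastforce
    then show ?case
    proof cases
      case 1
      have "(\<Sum>i=0..k. count (add_mset u z) (row i)) = (\<Sum>i=0..k. count z (row i) + (if i = a then 1 else 0))"
        using 1 by (intro sum.cong) (auto simp: row_inj)
      moreover have "(\<Sum>j=0..t. count (add_mset u z) (col j)) = (\<Sum>j=0..t. count z (col j))"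
        using 1 by (intro sum.cong) (auto simp: row_col)
      ultimately show ?thesis using add 1 by (simp add: sum.distrib)
    next
      case 2
      have "(\<Sum>j=0..t. count (add_mset u z) (col j)) = (\<Sum>j=0..t. count z (col j) + (if j = b then 1 else 0))"
        using 2 by (intro sum.cong) (auto simp: col_inj)
      moreover have "(\<Sum>i=0..k. count (add_mset u z) (row i)) = (\<Sum>i=0..k. count z (row i))"
        using 2 by (intro sum.cong) (auto simp: row_col[symmetric])
      ultimately show ?thesis using add 2 by (simp add: sum.distrib)
    qed
  qed auto
  show "unique_length_fact ?M"
    unfolding unique_length_fact_def
  proof (intro allI impI)
    fix z z' assume z: "set_mset z \<subseteq> mset_atoms ?M" "set_mset z' \<subseteq> mset_atoms ?M"
      and eq: "\<Sum>\<^sub># z = \<Sum>\<^sub># z'" and sz: "size z = size z'"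
    define l where "l = int (count z (row 0)) - int (count z' (row 0))"
    have *: "(int (count z (row i)) - int (count z' (row i))) * int (s j) = int (count z' (col j)) - int (count z (col j))"
      if "i \<le> k" "j \<le> t" for i j
    proof -
      have "count z (row i) * s j + count z (col j) = count z' (row i) * s j + count z' (col j)"
        using sum_count[OF z(1) that] sum_count[OF z(2) that] eq by simp
      then have "int (count z (row i)) * int (s j) + int (count z (col j))
        = int (count z' (row i)) * int (s j) + int (count z' (col j))"
        by (metis of_nat_add of_nat_mult)
      then show ?thesis by (simp add: algebra_simps)
    qed
    \<comment> \<open>Comparing the entries of column 0 shows that all rows have the same excess
      \<open>l\<close>, since \<open>s 0\<close> is positive.\<close>
    have rowd: "int (count z (row i)) = int (count z' (row i)) + l" if "i \<le> k" for i
    proof -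
      have "(int (count z (row i)) - int (count z' (row i))) * int (s 0) = l * int (s 0)"
        using *[OF that, of 0] *[of 0 0] unfolding l_def by simp
      then show ?thesis using s1[of 0] by simp
    qed
    have cold: "int (count z (col j)) = int (count z' (col j)) - l * int (s j)" if "j \<le> t" for j
      using *[of 0 j] that unfolding l_def by simp
    have "int (size z) = (\<Sum>i=0..k. int (count z' (row i)) + l) + (\<Sum>j=0..t. int (count z' (col j)) - l * int (s j))"
      unfolding sum_size[OF z(1)] by (simp add: rowd cold)
    also have "\<dots> = int (size z') + l * (int (k + 1) - int (\<Sum>j=0..t. s j))"
      unfolding sum_size[OF z(2)] by (simp add: sum.distrib sum_subtractf sum_distrib_left algebra_simps)
    finally have "l * (int (k + 1) - int (\<Sum>j=0..t. s j)) = 0" using sz by simp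
    moreover have "int (k + 1) - int (\<Sum>j=0..t. s j) \<noteq> 0"
      using ks by (metis eq_iff_diff_eq_0 of_nat_eq_iff)
    ultimately have l0: "l = 0" by (metis mult_eq_0_iff)
    show "z = z'"
    proof (rule multiset_eqI)
      fix u
      show "count z u = count z' u"
      proof (cases "u \<in> mset_atoms ?M")
        case True
        then show ?thesis using atoms[OF True] rowd cold l0 by auto
      next
        case False
        then show ?thesis using z by (metis not_in_iff subsetD)
      qed
    qed
  qed
  show "\<not> unique_fact ?M"
  proof
    assume uf: "unique_fact ?M"
    \<comment> \<open>All rows once against the columns with multiplicities \<open>s j\<close>: this
      is the generating relation, now read in the grid.\<close>
    define z where "z = (\<Sum>i=0..k. {#row i#})"
    define z' where "z' = (\<Sum>j=0..t. replicate_mset (s j) (col j))"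
    have cz: "count z (row i) = 1" "count z (col j) = 0" if "i \<le> k" "j \<le> t" for i j
      using that by (auto simp: z_def count_sum row_inj row_col eq_commute[of _ "row i"] cong: if_cong)
    have cz': "count z' (row i) = 0" "count z' (col j) = s j" if "i \<le> k" "j \<le> t" for i j
      using that by (auto simp: z'_def count_sum col_inj row_col row_col[symmetric] eq_commute[of _ "col j"])
    have z: "set_mset z \<subseteq> mset_atoms ?M" "set_mset z' \<subseteq> mset_atoms ?M"
      using row_atom col_atom by (auto simp: z_def z'_def set_mset_sum split: if_splits)
    have "\<Sum>\<^sub># z = \<Sum>\<^sub># z'"
      using Msub[OF sum_mset_closed] z atoms_subset
      by (intro grid_eqI) (auto simp: sum_count cz cz')
    then have "z = z'" using uf z unfolding unique_fact_def by blast
    then show False using cz(1)[of 0 0] cz'(1)[of 0 0] by simp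
  qed
qed

section \<open>Products of multisets\<close>

context comm_monoid
begin

lemma mset_prod_empty [simp]: "mset_prod G {#} = \<one>"
  by (simp add: mset_prod_def)

text \<open>The factor at \<open>x\<close> is isolated whether or not \<open>x\<close> occurs in
  \<open>M\<close>. So the passage from \<open>M\<close> to \<open>add_mset x M\<close> needs no
  case distinction, although it may enlarge the index set of the product.\<close>

lemma mset_prod_remove:
  assumes "set_mset M \<subseteq> carrier G" "x \<in> carrier G"
  shows "mset_prod G M = x [^] count M x \<otimes> finprod G (\<lambda>y. y [^] count M y) (set_mset M - {x})"
proof (cases "x \<in># M")
  case True
  have "mset_prod G M = finprod G (\<lambda>y. y [^] count M y) (insert x (set_mset M - {x}))"
    using True by (simp add: mset_prod_def insert_absorb)
  also have "\<dots> = x [^] count M x \<otimes> finprod G (\<lambda>y. y [^] count M y) (set_mset M - {x})"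
    using assms by (intro finprod_insert) auto
  finally show ?thesis .
next
  case False
  then have "set_mset M - {x} = set_mset M" "count M x = 0" by (auto simp: not_in_iff)
  moreover have "finprod G (\<lambda>y. y [^] count M y) (set_mset M) \<in> carrier G"
    using assms by (intro finprod_closed) auto
  ultimately show ?thesis by (simp add: mset_prod_def)
qed

lemma mset_prod_closed [simp]: "set_mset M \<subseteq> carrier G \<Longrightarrow> mset_prod G M \<in> carrier G"
  unfolding mset_prod_def by (intro finprod_closed) auto

lemma mset_prod_add_mset [simp]:
  assumes "set_mset M \<subseteq> carrier G" "x \<in> carrier G"
  shows "mset_prod G (add_mset x M) = x \<otimes> mset_prod G M"
proof -
  have cl: "finprod G (\<lambda>y. y [^] count M y) (set_mset M - {x}) \<in> carrier G"
    using assms by (intro finprod_closed) auto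
  have "mset_prod G (add_mset x M) = x [^] count (add_mset x M) x \<otimes>
      finprod G (\<lambda>y. y [^] count (add_mset x M) y) (set_mset (add_mset x M) - {x})"
    using assms by (intro mset_prod_remove) auto
  also have "finprod G (\<lambda>y. y [^] count (add_mset x M) y) (set_mset (add_mset x M) - {x})
      = finprod G (\<lambda>y. y [^] count M y) (set_mset M - {x})"
    using assms by (intro finprod_cong') auto
  also have "x [^] count (add_mset x M) x = x \<otimes> x [^] count M x"
    using assms by (simp add: m_comm)
  finally show ?thesis
    using assms cl by (simp add: mset_prod_remove[OF assms] m_assoc)
qed

lemma mset_prod_union:
  assumes "set_mset M \<subseteq> carrier G" "set_mset N \<subseteq> carrier G"
  shows "mset_prod G (M + N) = mset_prod G M \<otimes> mset_prod G N"
  using assms by (induction M) (auto simp: m_assoc)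

end

lemma mset_prod_hom:
  assumes "comm_monoid G" "comm_monoid D" "h \<in> hom G D" "h \<one>\<^bsub>G\<^esub> = \<one>\<^bsub>D\<^esub>" "set_mset M \<subseteq> carrier G"
  shows "h (mset_prod G M) = mset_prod D (image_mset h M)"
proof -
  interpret G: comm_monoid G by fact
  interpret D: comm_monoid D by fact
  have h: "h x \<in> carrier D" if "x \<in> carrier G" for x using assms(3) that by (auto simp: hom_def)
  show ?thesis using assms(5)
  proof (induction M)
    case empty
    then show ?case by (simp add: assms(4))
  next
    case (add x M)
    have "set_mset (image_mset h M) \<subseteq> carrier D" using add.prems h by auto
    then show ?case using add hom_mult[OF assms(3), of x "mset_prod G M"] h by simp
  qed
qed

lemma free_abelian_monoid_simps [simp]:
  "M \<in> carrier (free_abelian_monoid P) \<longleftrightarrow> set_mset M \<subseteq> P"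
  "x \<otimes>\<^bsub>free_abelian_monoid P\<^esub> y = x + y" "\<one>\<^bsub>free_abelian_monoid P\<^esub> = {#}"
  by (auto simp: free_abelian_monoid_def)

lemma comm_monoid_free_abelian_monoid: "comm_monoid (free_abelian_monoid P)"
  by (intro comm_monoidI) (auto simp: add_ac)

lemma mset_prod_free_abelian_monoid:
  assumes "\<And>x. x \<in># z \<Longrightarrow> set_mset x \<subseteq> P"
  shows "mset_prod (free_abelian_monoid P) z = \<Sum>\<^sub># z"
proof -
  interpret comm_monoid "free_abelian_monoid P" by (rule comm_monoid_free_abelian_monoid)
  show ?thesis using assms
  proof (induction z)
    case (add x z)
    then have "set_mset z \<subseteq> carrier (free_abelian_monoid P)" "x \<in> carrier (free_abelian_monoid P)"
      by auto
    then show ?case using add mset_prod_add_mset by auto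
  qed (use mset_prod_empty in simp)
qed

section \<open>Divisor homomorphisms into free abelian monoids\<close>

locale free_divisor_hom = comm_monoid_cancel H for H :: "('a, 'm) monoid_scheme" (structure) +
  fixes P :: "'p set" and \<phi> :: "'a \<Rightarrow> 'p multiset"
  assumes div_hom: "divisor_homomorphism H (free_abelian_monoid P) \<phi>"
begin

lemma phi_mult [simp]: "a \<in> carrier H \<Longrightarrow> b \<in> carrier H \<Longrightarrow> \<phi> (a \<otimes> b) = \<phi> a + \<phi> b"
  using div_hom by (auto simp: divisor_homomorphism_def hom_def)

lemma phi_one [simp]: "\<phi> \<one> = {#}"
  using div_hom by (auto simp: divisor_homomorphism_def)

lemma phi_supp: "a \<in> carrier H \<Longrightarrow> set_mset (\<phi> a) \<subseteq> P"
  using div_hom by (auto simp: divisor_homomorphism_def hom_def Pi_def)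

lemma divides_iff: "a \<in> carrier H \<Longrightarrow> b \<in> carrier H \<Longrightarrow> a divides b \<longleftrightarrow> \<phi> a \<subseteq># \<phi> b"
  using div_hom divides_free_abelian_monoid_iff[OF phi_supp, of b "\<phi> a"]
  by (auto simp: divisor_homomorphism_def factor_def)

lemma saturated_image: "saturated (\<phi> ` carrier H)"
proof
  show "{#} \<in> \<phi> ` carrier H" by (metis image_eqI one_closed phi_one)
next
  fix x y assume "x \<in> \<phi> ` carrier H" "y \<in> \<phi> ` carrier H"
  then obtain a b where ab: "a \<in> carrier H" "b \<in> carrier H" "x = \<phi> a" "y = \<phi> b" by auto
  then show "x + y \<in> \<phi> ` carrier H" by (metis image_eqI m_closed phi_mult)
  assume "x \<subseteq># y"
  then obtain c where "c \<in> carrier H" "b = a \<otimes> c"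
    using divides_iff[of a b] ab by (auto simp: factor_def)
  then show "y - x \<in> \<phi> ` carrier H" using ab by auto
qed

lemma unit_iff: "a \<in> carrier H \<Longrightarrow> a \<in> Units H \<longleftrightarrow> \<phi> a = {#}"
proof
  assume "a \<in> Units H"
  then have "\<phi> a + \<phi> (inv a) = {#}"
    using phi_mult[of a "inv a"] by (simp add: Units_closed)
  then show "\<phi> a = {#}" by simp
next
  assume a: "a \<in> carrier H" "\<phi> a = {#}"
  then have "a divides \<one>" by (simp add: divides_iff)
  then show "a \<in> Units H" using a unit_divides Unit_eq_dividesone by blast
qed

lemma associated_iff_phi: "a \<in> carrier H \<Longrightarrow> b \<in> carrier H \<Longrightarrow> a \<sim> b \<longleftrightarrow> \<phi> a = \<phi> b"
  by (auto simp: associated_def divides_iff subset_mset.eq_iff)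

lemma phi_eq_ex_unit:
  assumes "a \<in> carrier H" "b \<in> carrier H" "\<phi> a = \<phi> b"
  shows "\<exists>u\<in>Units H. b = u \<otimes> a"
proof -
  have "b \<sim> a" using assms associated_iff_phi by simp
  then obtain u where "u \<in> Units H" "b = a \<otimes> u"
    using associatedE2[of b a] assms by blast
  then show ?thesis using assms m_comm by auto
qed

lemma coset_eq_iff:
  assumes "a \<in> carrier H" "b \<in> carrier H"
  shows "Units H #> a = Units H #> b \<longleftrightarrow> \<phi> a = \<phi> b"
proof
  assume "Units H #> a = Units H #> b"
  moreover have "a \<in> Units H #> a" using assms by (force simp: r_coset_def)
  ultimately obtain u where "u \<in> Units H" "a = u \<otimes> b" by (auto simp: r_coset_def)
  then show "\<phi> a = \<phi> b" using assms unit_iff[of u] by (simp add: Units_closed)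
next
  have "Units H #> b \<subseteq> Units H #> a"
    if ab: "a \<in> carrier H" "b \<in> carrier H" and "\<phi> a = \<phi> b" for a b
  proof
    fix x assume "x \<in> Units H #> b"
    then obtain v where v: "v \<in> Units H" "x = v \<otimes> b" by (auto simp: r_coset_def)
    obtain u where "u \<in> Units H" "b = u \<otimes> a" using phi_eq_ex_unit \<open>\<phi> a = \<phi> b\<close> ab by blast
    then have "x = (v \<otimes> u) \<otimes> a" "v \<otimes> u \<in> Units H" using v ab by (auto simp: m_assoc Units_closed)
    then show "x \<in> Units H #> a" by (auto simp: r_coset_def)
  qed
  then show "\<phi> a = \<phi> b \<Longrightarrow> Units H #> a = Units H #> b" using assms by (metis subset_antisym)
qed

lemma carrier_red: "carrier (red_monoid H) = (\<lambda>a. Units H #> a) ` carrier H"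
  by (simp add: red_monoid_def carrier_FactGroup)

lemma one_red: "\<one>\<^bsub>red_monoid H\<^esub> = Units H #> \<one>"
  by (auto simp: red_monoid_def r_coset_def Units_closed)

lemma mult_red:
  assumes "a \<in> carrier H" "b \<in> carrier H"
  shows "(Units H #> a) \<otimes>\<^bsub>red_monoid H\<^esub> (Units H #> b) = Units H #> (a \<otimes> b)"
proof -
  have "(Units H #> a) <#> (Units H #> b) = Units H #> (a \<otimes> b)"
  proof (intro equalityI subsetI)
    fix x assume "x \<in> (Units H #> a) <#> (Units H #> b)"
    then obtain u v where uv: "u \<in> Units H" "v \<in> Units H" "x = (u \<otimes> a) \<otimes> (v \<otimes> b)"
      by (auto simp: set_mult_def r_coset_def)
    then have "x = (u \<otimes> v) \<otimes> (a \<otimes> b)" using assms by (simp add: Units_closed m_ac)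
    then show "x \<in> Units H #> (a \<otimes> b)" using uv by (auto simp: r_coset_def)
  next
    fix x assume "x \<in> Units H #> (a \<otimes> b)"
    then obtain u where u: "u \<in> Units H" "x = u \<otimes> (a \<otimes> b)" by (auto simp: r_coset_def)
    then have "x = (u \<otimes> a) \<otimes> (\<one> \<otimes> b)" using assms by (simp add: Units_closed m_assoc)
    then show "x \<in> (Units H #> a) <#> (Units H #> b)"
      using u Units_one_closed by (auto simp: set_mult_def r_coset_def)
  qed
  then show ?thesis by (simp add: red_monoid_def)
qed

lemma comm_monoid_red: "comm_monoid (red_monoid H)"
proof (intro comm_monoidI)
  show "\<one>\<^bsub>red_monoid H\<^esub> \<in> carrier (red_monoid H)" by (auto simp: one_red carrier_red)
qed (auto simp: one_red carrier_red mult_red m_ac)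

text \<open>The map \<open>\<phi>\<close> is constant on the cosets of the units, so the chosen
  representative does not matter.\<close>

definition red_phi :: "'a set \<Rightarrow> 'p multiset" where
  "red_phi X = \<phi> (SOME a. a \<in> carrier H \<and> X = Units H #> a)"

lemma red_phi_coset: "a \<in> carrier H \<Longrightarrow> red_phi (Units H #> a) = \<phi> a"
  unfolding red_phi_def
  by (rule someI2[of _ a]) (auto simp: coset_eq_iff)

lemma red_phi_hom: "red_phi \<in> hom (red_monoid H) (free_abelian_monoid P)"
  unfolding hom_def using phi_supp by (auto simp: carrier_red mult_red red_phi_coset)

lemma red_phi_inj: "X \<in> carrier (red_monoid H) \<Longrightarrow> Y \<in> carrier (red_monoid H) \<Longrightarrow> red_phi X = red_phi Y \<longleftrightarrow> X = Y"
  unfolding carrier_red by (elim imageE) (simp add: red_phi_coset coset_eq_iff)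

lemma red_divides:
  assumes "X \<in> carrier (red_monoid H)" "Y \<in> carrier (red_monoid H)"
  shows "X divides\<^bsub>red_monoid H\<^esub> Y \<longleftrightarrow> red_phi X \<subseteq># red_phi Y"
proof -
  obtain a b where ab: "a \<in> carrier H" "b \<in> carrier H" "X = Units H #> a" "Y = Units H #> b"
    using assms by (auto simp: carrier_red)
  have "X divides\<^bsub>red_monoid H\<^esub> Y \<longleftrightarrow> (\<exists>c\<in>carrier H. Y = X \<otimes>\<^bsub>red_monoid H\<^esub> (Units H #> c))"
    by (auto simp: factor_def carrier_red)
  also have "\<dots> \<longleftrightarrow> (\<exists>c\<in>carrier H. \<phi> b = \<phi> a + \<phi> c)"
    using ab by (auto simp: mult_red coset_eq_iff)
  also have "\<dots> \<longleftrightarrow> \<phi> a \<subseteq># \<phi> b"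
    using divides_iff[OF ab(1,2)] by (auto simp: factor_def ab)
  finally show ?thesis using ab by (simp add: red_phi_coset)
qed

lemma red_units:
  assumes "X \<in> carrier (red_monoid H)"
  shows "X \<in> Units (red_monoid H) \<longleftrightarrow> red_phi X = {#}"
proof
  interpret red: comm_monoid "red_monoid H" by (rule comm_monoid_red)
  assume "X \<in> Units (red_monoid H)"
  then have "X divides\<^bsub>red_monoid H\<^esub> \<one>\<^bsub>red_monoid H\<^esub>" by (rule red.unit_divides) simp
  then show "red_phi X = {#}" using assms red_divides[OF assms red.one_closed]
    by (simp add: one_red red_phi_coset)
next
  interpret red: comm_monoid "red_monoid H" by (rule comm_monoid_red)
  assume "red_phi X = {#}"
  then have "X = \<one>\<^bsub>red_monoid H\<^esub>"
    using red_phi_inj[OF assms red.one_closed] by (simp add: one_red red_phi_coset)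
  then show "X \<in> Units (red_monoid H)" by simp
qed

lemma red_phi_image: "red_phi ` carrier (red_monoid H) = \<phi> ` carrier H"
  by (force simp: carrier_red red_phi_coset image_iff)

text \<open>By \<open>red_divides\<close>, a proper factor in the reduced monoid is a divisor whose
  value is strictly smaller. Irreducibility therefore becomes minimality among the nonempty
  values.\<close>

lemma red_atoms:
  assumes X: "X \<in> carrier (red_monoid H)"
  shows "X \<in> atoms (red_monoid H) \<longleftrightarrow> red_phi X \<in> mset_atoms (\<phi> ` carrier H)"
proof -
  have "X \<in> atoms (red_monoid H) \<longleftrightarrow> red_phi X \<noteq> {#} \<and>
    (\<forall>Y\<in>carrier (red_monoid H). red_phi Y \<subseteq># red_phi X \<and> \<not> red_phi X \<subseteq># red_phi Y \<longrightarrow> red_phi Y = {#})"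
    using X by (auto simp: atoms_def irreducible_def properfactor_def red_divides red_units)
  also have "\<dots> \<longleftrightarrow> red_phi X \<noteq> {#} \<and>
    (\<forall>b\<in>\<phi> ` carrier H. b \<subseteq># red_phi X \<and> \<not> red_phi X \<subseteq># b \<longrightarrow> b = {#})"
    unfolding red_phi_image[symmetric] by blast
  also have "\<dots> \<longleftrightarrow> red_phi X \<in> mset_atoms (\<phi> ` carrier H)"
    unfolding mset_atoms_def red_phi_image[symmetric] using X
    by (auto dest: subset_mset.antisym)
  finally show ?thesis .
qed

lemma factorization_iff:
  assumes "a \<in> carrier H"
  shows "z \<in> factorizations H a \<longleftrightarrow> set_mset z \<subseteq> atoms (red_monoid H) \<and> \<Sum>\<^sub># (image_mset red_phi z) = \<phi> a"
proof -
  have "mset_prod (red_monoid H) z = Units H #> a \<longleftrightarrow> \<Sum>\<^sub># (image_mset red_phi z) = \<phi> a"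
    if z: "set_mset z \<subseteq> atoms (red_monoid H)"
  proof -
    have zc: "set_mset z \<subseteq> carrier (red_monoid H)" using z by (auto simp: atoms_def)
    have "red_phi (mset_prod (red_monoid H) z) = mset_prod (free_abelian_monoid P) (image_mset red_phi z)"
      using mset_prod_hom[OF comm_monoid_red comm_monoid_free_abelian_monoid red_phi_hom _ zc]
      by (simp add: one_red red_phi_coset)
    also have "\<dots> = \<Sum>\<^sub># (image_mset red_phi z)"
      using zc red_phi_hom by (intro mset_prod_free_abelian_monoid) (auto simp: hom_def Pi_def subset_iff)
    finally show ?thesis
      using red_phi_inj[of "mset_prod (red_monoid H) z" "Units H #> a"] assms red_phi_coset[OF assms]
        comm_monoid.mset_prod_closed[OF comm_monoid_red zc] by (auto simp: carrier_red)
  qed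
  then show ?thesis by (auto simp: factorizations_def)
qed

lemma lift_factorization:
  assumes "set_mset w \<subseteq> mset_atoms (\<phi> ` carrier H)"
  shows "\<exists>z. set_mset z \<subseteq> atoms (red_monoid H) \<and> image_mset red_phi z = w"
  using assms
proof (induction w)
  case (add u w)
  then obtain z where z: "set_mset z \<subseteq> atoms (red_monoid H)" "image_mset red_phi z = w" by auto
  have "u \<in> red_phi ` carrier (red_monoid H)"
    unfolding red_phi_image using add.prems by (auto simp: mset_atoms_def)
  then obtain X where X: "X \<in> carrier (red_monoid H)" "u = red_phi X" by auto
  then have "X \<in> atoms (red_monoid H)" using add.prems red_atoms by auto
  then show ?case using z X by (intro exI[of _ "add_mset X z"]) auto
qed auto

lemma image_red_phi_inj:
  assumes "set_mset z \<subseteq> atoms (red_monoid H)" "set_mset z' \<subseteq> atoms (red_monoid H)"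
    "image_mset red_phi z = image_mset red_phi z'"
  shows "z = z'"
proof -
  have inj: "inj_on red_phi (carrier (red_monoid H))" by (auto simp: inj_on_def red_phi_inj)
  have "image_mset (the_inv_into (carrier (red_monoid H)) red_phi) (image_mset red_phi z) = z"
    if "set_mset z \<subseteq> atoms (red_monoid H)" for z
  proof -
    have "image_mset (\<lambda>x. the_inv_into (carrier (red_monoid H)) red_phi (red_phi x)) z = image_mset (\<lambda>x. x) z"
      using that inj by (intro image_mset_cong) (auto simp: the_inv_into_f_f atoms_def)
    then show ?thesis by (simp add: image_mset.compositionality o_def)
  qed
  then show ?thesis using assms by metis
qed

lemma atoms_image_red_phi:
  "set_mset z \<subseteq> atoms (red_monoid H) \<Longrightarrow> set_mset (image_mset red_phi z) \<subseteq> mset_atoms (\<phi> ` carrier H)"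
  using red_atoms by (auto simp: atoms_def)

lemma sum_in_image:
  assumes "set_mset z \<subseteq> atoms (red_monoid H)"
  shows "\<exists>a\<in>carrier H. \<Sum>\<^sub># (image_mset red_phi z) = \<phi> a"
proof -
  interpret R: saturated "\<phi> ` carrier H" by (rule saturated_image)
  show ?thesis
    using R.sum_mset_closed[of "image_mset red_phi z"] atoms_image_red_phi[OF assms] R.atoms_subset by blast
qed

lemma factorization_ex: "a \<in> carrier H \<Longrightarrow> factorizations H a \<noteq> {}"
proof -
  interpret R: saturated "\<phi> ` carrier H" by (rule saturated_image)
  assume a: "a \<in> carrier H"
  then obtain w where "set_mset w \<subseteq> mset_atoms (\<phi> ` carrier H)" "\<Sum>\<^sub># w = \<phi> a"
    using R.factorization_exists[of "\<phi> a"] by auto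
  then show ?thesis using lift_factorization factorization_iff[OF a] by (metis empty_iff)
qed

text \<open>The map \<open>red_phi\<close> is a bijection from the atoms of the reduced monoid to
  those of the image of \<open>\<phi>\<close>. Applied entrywise it matches factorizations of
  \<open>a\<close> with formal sums of total \<open>\<phi> a\<close> and keeps their
  lengths.\<close>

theorem length_factorial_iff: "length_factorial H \<longleftrightarrow> unique_length_fact (\<phi> ` carrier H)"
proof
  assume lf: "length_factorial H"
  show "unique_length_fact (\<phi> ` carrier H)"
    unfolding unique_length_fact_def
  proof (intro allI impI)
    fix w w' assume w: "set_mset w \<subseteq> mset_atoms (\<phi> ` carrier H)" "set_mset w' \<subseteq> mset_atoms (\<phi> ` carrier H)"
      "\<Sum>\<^sub># w = \<Sum>\<^sub># w'" "size w = size w'"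
    obtain z z' where z: "set_mset z \<subseteq> atoms (red_monoid H)" "image_mset red_phi z = w"
      "set_mset z' \<subseteq> atoms (red_monoid H)" "image_mset red_phi z' = w'"
      using lift_factorization w by metis
    obtain a where a: "a \<in> carrier H" "\<Sum>\<^sub># w = \<phi> a" using sum_in_image[OF z(1)] z by auto
    then have "z \<in> factorizations H a" "z' \<in> factorizations H a" using factorization_iff z w by auto
    moreover have "size z = size z'" using z w by (metis size_image_mset)
    ultimately have "z = z'" using lf a unfolding length_factorial_def by blast
    then show "w = w'" using z by simp
  qed
next
  assume u: "unique_length_fact (\<phi> ` carrier H)"
  have "size z \<noteq> size z'" if "a \<in> carrier H" "z \<in> factorizations H a" "z' \<in> factorizations H a" "z \<noteq> z'" for a z z'
  proof
    assume "size z = size z'"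
    then have "image_mset red_phi z = image_mset red_phi z'"
      using that u atoms_image_red_phi unfolding unique_length_fact_def
      by (simp add: factorization_iff)
    then show False using that image_red_phi_inj by (auto simp: factorization_iff)
  qed
  then show "length_factorial H"
    unfolding length_factorial_def atomic_def using factorization_ex by blast
qed

theorem factorial_iff: "factorial H \<longleftrightarrow> unique_fact (\<phi> ` carrier H)"
proof
  assume lf: "factorial H"
  show "unique_fact (\<phi> ` carrier H)"
    unfolding unique_fact_def
  proof (intro allI impI)
    fix w w' assume w: "set_mset w \<subseteq> mset_atoms (\<phi> ` carrier H)" "set_mset w' \<subseteq> mset_atoms (\<phi> ` carrier H)"
      "\<Sum>\<^sub># w = \<Sum>\<^sub># w'"
    obtain z z' where z: "set_mset z \<subseteq> atoms (red_monoid H)" "image_mset red_phi z = w"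
      "set_mset z' \<subseteq> atoms (red_monoid H)" "image_mset red_phi z' = w'"
      using lift_factorization w by metis
    obtain a where a: "a \<in> carrier H" "\<Sum>\<^sub># w = \<phi> a" using sum_in_image[OF z(1)] z by auto
    then have "z \<in> factorizations H a" "z' \<in> factorizations H a" using factorization_iff z w by auto
    then have "z = z'" using lf a unfolding factorial_def by blast
    then show "w = w'" using z by simp
  qed
next
  assume u: "unique_fact (\<phi> ` carrier H)"
  have "z = z'" if "a \<in> carrier H" "z \<in> factorizations H a" "z' \<in> factorizations H a" for a z z'
  proof -
    have "image_mset red_phi z = image_mset red_phi z'"
      using that u atoms_image_red_phi unfolding unique_fact_def
      by (simp add: factorization_iff)
    then show ?thesis using that image_red_phi_inj by (auto simp: factorization_iff)
  qed
  then show "factorial H"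
    unfolding factorial_def using factorization_ex by blast
qed

end

section \<open>The gcd condition of divisor theories, and prime elements\<close>

text \<open>Outside the support of one value \<open>f a0\<close> the minimum is 0 and attained by
  \<open>a0\<close> itself. Only the finitely many points of the support require further
  witnesses.\<close>

lemma mset_glb_finite:
  assumes "mset_glb (f ` A) d"
  shows "\<exists>B\<subseteq>A. finite B \<and> B \<noteq> {} \<and> mset_glb (f ` B) d"
proof -
  obtain a0 where a0: "a0 \<in> A" using mset_glb_nonempty[OF assms] by auto
  have "\<forall>p. \<exists>a\<in>A. count (f a) p = count d p" using assms by (auto simp: mset_glb_def)
  then obtain g where g: "\<And>p. g p \<in> A" "\<And>p. count (f (g p)) p = count d p" by metis
  define B where "B = insert a0 (g ` set_mset (f a0))"
  have BA: "B \<subseteq> A" using a0 g by (auto simp: B_def)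
  have "\<exists>a\<in>f ` B. count a p = count d p" for p
  proof (cases "p \<in># f a0")
    case True
    then show ?thesis using g(2)[of p] by (auto simp: B_def)
  next
    case False
    have "d \<subseteq># f a0" using assms a0 by (auto simp: mset_glb_def)
    then have "count d p \<le> count (f a0) p" by (rule mset_subset_eq_count)
    then show ?thesis using False by (auto simp: B_def not_in_iff)
  qed
  then have "mset_glb (f ` B) d" using assms BA by (auto simp: mset_glb_def)
  moreover have "finite B" "B \<noteq> {}" by (auto simp: B_def)
  ultimately show ?thesis using BA by blast
qed

text \<open>If a common divisor \<open>d\<close> missed the minimum at \<open>p\<close>, it could be
  enlarged by \<open>p\<close> and would still divide all values. Arbitrary sets can be traded for
  finite ones by \<open>mset_glb_finite\<close>.\<close>

lemma (in free_divisor_hom) divisor_theory_iff_glb: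
  "divisor_theory H P \<phi> \<longleftrightarrow> (\<forall>d. set_mset d \<subseteq> P \<longrightarrow> (\<exists>A\<subseteq>carrier H. mset_glb (\<phi> ` A) d))"
proof -
  have gcd_iff: "is_gcd_of (free_abelian_monoid P) d (\<phi> ` A) \<longleftrightarrow> mset_glb (\<phi> ` A) d"
    if A: "A \<noteq> {}" "A \<subseteq> carrier H" and d: "set_mset d \<subseteq> P" for A d
  proof -
    have *: "y divides\<^bsub>free_abelian_monoid P\<^esub> \<phi> a \<longleftrightarrow> y \<subseteq># \<phi> a" if "a \<in> A" for y a
      using that A phi_supp by (intro divides_free_abelian_monoid_iff) auto
    have "is_gcd_of (free_abelian_monoid P) d (\<phi> ` A) \<longleftrightarrow>
      (\<forall>a\<in>A. d \<subseteq># \<phi> a) \<and> (\<forall>y. set_mset y \<subseteq> P \<longrightarrow> (\<forall>a\<in>A. y \<subseteq># \<phi> a) \<longrightarrow> y \<subseteq># d)"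
      using d by (auto simp: is_gcd_of_def * divides_free_abelian_monoid_iff[OF d])
    also have "\<dots> \<longleftrightarrow> mset_glb (\<phi> ` A) d"
    proof
      assume h: "(\<forall>a\<in>A. d \<subseteq># \<phi> a) \<and> (\<forall>y. set_mset y \<subseteq> P \<longrightarrow> (\<forall>a\<in>A. y \<subseteq># \<phi> a) \<longrightarrow> y \<subseteq># d)"
      have "\<exists>a\<in>A. count (\<phi> a) p = count d p" for p
      proof (rule ccontr)
        assume "\<not> ?thesis"
        then have lt: "count d p < count (\<phi> a) p" if "a \<in> A" for a
          using h that mset_subset_eq_count[of d "\<phi> a" p] by fastforce
        have le: "add_mset p d \<subseteq># \<phi> a" if "a \<in> A" for a
          using lt[OF that] h that by (auto simp: subseteq_mset_def Suc_le_eq)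
        obtain a where a: "a \<in> A" using A by auto
        then have "set_mset (add_mset p d) \<subseteq> P"
          using le[OF a] phi_supp[of a] A by (meson set_mset_mono subset_iff subset_trans)
        then have "add_mset p d \<subseteq># d" using h le by blast
        then show False using size_mset_mono by fastforce
      qed
      then show "mset_glb (\<phi> ` A) d" using h by (auto simp: mset_glb_def)
    next
      assume g: "mset_glb (\<phi> ` A) d"
      show "(\<forall>a\<in>A. d \<subseteq># \<phi> a) \<and> (\<forall>y. set_mset y \<subseteq> P \<longrightarrow> (\<forall>a\<in>A. y \<subseteq># \<phi> a) \<longrightarrow> y \<subseteq># d)"
      proof (intro conjI allI impI)
        show "\<forall>a\<in>A. d \<subseteq># \<phi> a" using g by (auto simp: mset_glb_def)
      next
        fix y assume "\<forall>a\<in>A. y \<subseteq># \<phi> a"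
        then have "y \<subseteq># {#} + d" by (intro mset_glb_greatest[OF g]) auto
        then show "y \<subseteq># d" by simp
      qed
    qed
    finally show ?thesis .
  qed
  show ?thesis
  proof
    assume dt: "divisor_theory H P \<phi>"
    show "\<forall>d. set_mset d \<subseteq> P \<longrightarrow> (\<exists>A\<subseteq>carrier H. mset_glb (\<phi> ` A) d)"
    proof (intro allI impI)
      fix d assume d: "set_mset d \<subseteq> P"
      then obtain A where "A \<noteq> {}" "A \<subseteq> carrier H" "is_gcd_of (free_abelian_monoid P) d (\<phi> ` A)"
        using dt free_abelian_monoid_simps(1)[of d P] unfolding divisor_theory_def by blast
      then show "\<exists>A\<subseteq>carrier H. mset_glb (\<phi> ` A) d" using gcd_iff d by blast
    qed
  next
    assume h: "\<forall>d. set_mset d \<subseteq> P \<longrightarrow> (\<exists>A\<subseteq>carrier H. mset_glb (\<phi> ` A) d)"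
    show "divisor_theory H P \<phi>"
      unfolding divisor_theory_def
    proof (intro conjI div_hom ballI)
      fix d assume "d \<in> carrier (free_abelian_monoid P)"
      then have d: "set_mset d \<subseteq> P" by simp
      then obtain A where A: "A \<subseteq> carrier H" "mset_glb (\<phi> ` A) d" using h by blast
      then obtain B where "B \<subseteq> A" "finite B" "B \<noteq> {}" "mset_glb (\<phi> ` B) d"
        using mset_glb_finite[OF A(2)] by blast
      then show "\<exists>A. finite A \<and> A \<noteq> {} \<and> A \<subseteq> carrier H \<and> is_gcd_of (free_abelian_monoid P) d (\<phi> ` A)"
        using gcd_iff[of B d] A d by (intro exI[of _ B]) auto
    qed
  qed
qed

text \<open>The gcd condition is kept in its pointwise form with arbitrary sets, which is the form
  in which it is manipulated; \<open>divisor_theory_iff_glb\<close> links it with the original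
  one.\<close>

locale krull_with_theory = free_divisor_hom +
  assumes glb_ex: "set_mset d \<subseteq> P \<Longrightarrow> \<exists>A\<subseteq>carrier H. mset_glb (\<phi> ` A) d"

lemma krull_with_theoryI:
  assumes "comm_monoid_cancel H" "divisor_theory H P \<phi>"
  shows "krull_with_theory H P \<phi>"
proof -
  interpret comm_monoid_cancel H by fact
  interpret free_divisor_hom H P \<phi>
    by unfold_locales (use assms in \<open>simp add: divisor_theory_def\<close>)
  show ?thesis
    by unfold_locales (use assms divisor_theory_iff_glb in blast)
qed

context krull_with_theory
begin

lemma krull_set_image: "krull_set (\<phi> ` carrier H) P"
proof -
  interpret saturated "\<phi> ` carrier H" by (rule saturated_image)
  show ?thesis
  proof
    fix r assume "r \<in> \<phi> ` carrier H" then show "set_mset r \<subseteq> P" using phi_supp by auto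
  next
    fix d assume "set_mset d \<subseteq> P"
    then obtain A where "A \<subseteq> carrier H" "mset_glb (\<phi> ` A) d" using glb_ex by blast
    then show "\<exists>A\<subseteq>\<phi> ` carrier H. mset_glb A d" by (intro exI[of _ "\<phi> ` A"]) auto
  qed
qed

text \<open>Split \<open>\<phi> p\<close> into \<open>{#q#}\<close> and \<open>d\<close> and write
  both parts as gcds, over \<open>A\<close> and over \<open>B\<close>. Then \<open>p\<close> divides
  every product of an element of \<open>A\<close> with one of \<open>B\<close>, so by primality it
  divides all of \<open>A\<close> or all of \<open>B\<close>. In the second case
  \<open>\<phi> p\<close> would divide \<open>d\<close>, which is too small.\<close>

lemma phi_prime:
  assumes p: "p \<in> carrier H" "prime H p"
  shows "\<exists>q\<in>P. \<phi> p = {#q#}"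
proof -
  have "p \<notin> Units H" using p by (simp add: prime_def)
  then have "\<phi> p \<noteq> {#}" using unit_iff p by blast
  then obtain q where q: "q \<in># \<phi> p" by blast
  define d where "d = \<phi> p - {#q#}"
  have pd: "\<phi> p = {#q#} + d" using q by (simp add: d_def)
  have sub: "set_mset {#q#} \<subseteq> P" "set_mset d \<subseteq> P" using phi_supp[OF p(1)] pd by auto
  obtain A B where A: "A \<subseteq> carrier H" "mset_glb (\<phi> ` A) {#q#}" and B: "B \<subseteq> carrier H" "mset_glb (\<phi> ` B) d"
    using glb_ex[OF sub(1)] glb_ex[OF sub(2)] by blast
  have "p divides a \<or> p divides b" if "a \<in> A" "b \<in> B" for a b
  proof -
    have ab: "a \<in> carrier H" "b \<in> carrier H" using that A B by auto
    have "{#q#} \<subseteq># \<phi> a" "d \<subseteq># \<phi> b"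
      using that A(2) B(2) by (auto simp: mset_glb_def)
    then have "\<phi> p \<subseteq># \<phi> (a \<otimes> b)" unfolding pd phi_mult[OF ab] by (rule subset_mset.add_mono)
    then show ?thesis using p ab divides_iff[of p "a \<otimes> b"] by (auto simp: prime_def)
  qed
  then consider "\<forall>a\<in>A. p divides a" | "\<forall>b\<in>B. p divides b" by blast
  then have "\<phi> p = {#q#}"
  proof cases
    case 1
    then have "\<phi> p \<subseteq># {#} + \<phi> a" if "a \<in> A" for a using divides_iff[of p a] p that A by auto
    then have "\<phi> p \<subseteq># {#} + {#q#}" using mset_glb_greatest[OF A(2), of "\<phi> p" "{#}"] by auto
    then show ?thesis using pd by (metis add_0 mset_subset_eq_add_left subset_mset.antisym)
  next
    case 2
    then have "\<phi> p \<subseteq># {#} + \<phi> b" if "b \<in> B" for b using divides_iff[of p b] p that B by auto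
    then have "\<phi> p \<subseteq># {#} + d" using mset_glb_greatest[OF B(2), of "\<phi> p" "{#}"] by auto
    then have "size (\<phi> p) \<le> size d" using size_mset_mono by fastforce
    then show ?thesis using pd by simp
  qed
  then show ?thesis using q phi_supp[OF p(1)] by blast
qed

end

section \<open>Splitting off prime elements\<close>

text \<open>The singletons over \<open>P1\<close> are atoms whose multiplicities in a formal sum are
  visible in the total, since no element of \<open>RS\<close> meets \<open>P1\<close>. Two
  factorizations of one element thus share this part and differ only in atoms of
  \<open>RS\<close>.\<close>

lemma unique_factorization_split:
  assumes RS: "saturated RS" and supp: "\<And>r. r \<in> RS \<Longrightarrow> set_mset r \<inter> P1 = {}"
    and R: "R = {g + r |g r. set_mset g \<subseteq> P1 \<and> r \<in> RS}"
  shows "unique_fact R \<longleftrightarrow> unique_fact RS" "unique_length_fact R \<longleftrightarrow> unique_length_fact RS"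
proof -
  interpret RS: saturated RS by fact
  have R_iff: "x \<in> R \<longleftrightarrow> (\<exists>g r. x = g + r \<and> set_mset g \<subseteq> P1 \<and> r \<in> RS)" for x unfolding R by blast
  have RSR: "RS \<subseteq> R"
  proof
    fix r assume "r \<in> RS"
    then show "r \<in> R" unfolding R_iff by (intro exI[of _ "{#}"] exI[of _ r]) auto
  qed
  have PR: "{#q#} \<in> R" if "q \<in> P1" for q
    unfolding R_iff using that RS.zero by (intro exI[of _ "{#q#}"] exI[of _ "{#}"]) auto
  have atoms: "mset_atoms R = (\<lambda>q. {#q#}) ` P1 \<union> mset_atoms RS"
  proof (intro equalityI subsetI)
    fix a assume a: "a \<in> mset_atoms R"
    then obtain g r where gr: "a = g + r" "set_mset g \<subseteq> P1" "r \<in> RS" unfolding mset_atoms_def by (auto simp: R_iff)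
    show "a \<in> (\<lambda>q. {#q#}) ` P1 \<union> mset_atoms RS"
    proof (cases "g = {#}")
      case True
      then have "a \<in> RS" using gr by simp
      then show ?thesis using a RSR by (auto simp: mset_atoms_def)
    next
      case False
      then obtain q where q: "q \<in># g" by blast
      then have "{#q#} \<subseteq># a" using gr by simp
      moreover have "{#q#} \<in> R" using PR[of q] q gr by blast
      moreover have "b = {#} \<or> b = a" if "b \<in> R" "b \<subseteq># a" for b
        using a that by (simp add: mset_atoms_def)
      ultimately have "a = {#q#}" by (metis empty_not_add_mset)
      then show ?thesis using q gr by auto
    qed
  next
    fix a assume "a \<in> (\<lambda>q. {#q#}) ` P1 \<union> mset_atoms RS"
    then show "a \<in> mset_atoms R"
    proof
      assume "a \<in> (\<lambda>q. {#q#}) ` P1"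
      then obtain q where q: "q \<in> P1" "a = {#q#}" by blast
      have "b = {#} \<or> b = {#q#}" if "b \<subseteq># {#q#}" for b
        using that by (metis mset_subset_eq_exists_conv single_is_union)
      then show ?thesis using PR q by (auto simp: mset_atoms_def)
    next
      assume a: "a \<in> mset_atoms RS"
      have "b = {#} \<or> b = a" if b: "b \<in> R" "b \<subseteq># a" for b
      proof -
        obtain g r where gr: "b = g + r" "set_mset g \<subseteq> P1" "r \<in> RS" using b R_iff by blast
        have "set_mset g \<subseteq> set_mset a" using b gr by (metis mset_subset_eq_add_left set_mset_mono subset_mset.trans)
        then have "set_mset g = {}" using supp[of a] gr a RS.atoms_subset by blast
        then show ?thesis using a gr b by (auto simp: mset_atoms_def)
      qed
      then show ?thesis using a RSR by (auto simp: mset_atoms_def)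
    qed
  qed
  have cnt: "count (\<Sum>\<^sub># z) q = count z {#q#}" if "set_mset z \<subseteq> mset_atoms R" "q \<in> P1" for z q
    using that(1)
  proof (induction z)
    case (add u z)
    then consider q' where "q' \<in> P1" "u = {#q'#}" | "u \<in> mset_atoms RS" using atoms by auto
    then show ?case
    proof cases
      case 1
      then show ?thesis using add by auto
    next
      case 2
      then have "q \<notin># u" using supp[of u] RS.atoms_subset that(2) by blast
      then show ?thesis using add by (auto simp: not_in_iff)
    qed
  qed auto
  have key: "\<exists>w v v'. z = w + v \<and> z' = w + v' \<and> set_mset v \<subseteq> mset_atoms RS \<and> set_mset v' \<subseteq> mset_atoms RS \<and> \<Sum>\<^sub># v = \<Sum>\<^sub># v'"
    if z: "set_mset z \<subseteq> mset_atoms R" "set_mset z' \<subseteq> mset_atoms R" "\<Sum>\<^sub># z = \<Sum>\<^sub># z'" for z z'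
  proof -
    let ?S = "(\<lambda>q. {#q#}) ` P1"
    have "filter_mset (\<lambda>u. u \<in> ?S) z = filter_mset (\<lambda>u. u \<in> ?S) z'"
      using cnt[OF z(1)] cnt[OF z(2)] z(3) by (intro multiset_eqI) auto
    moreover have "z = filter_mset (\<lambda>u. u \<in> ?S) z + filter_mset (\<lambda>u. u \<notin> ?S) z"
      "z' = filter_mset (\<lambda>u. u \<in> ?S) z' + filter_mset (\<lambda>u. u \<notin> ?S) z'"
      by (rule multiset_partition)+
    moreover have "set_mset (filter_mset (\<lambda>u. u \<notin> ?S) z) \<subseteq> mset_atoms RS"
      "set_mset (filter_mset (\<lambda>u. u \<notin> ?S) z') \<subseteq> mset_atoms RS"
      using z(1,2) atoms by auto
    ultimately obtain w v v' where "z = w + v" "z' = w + v'" "set_mset v \<subseteq> mset_atoms RS" "set_mset v' \<subseteq> mset_atoms RS"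
      by metis
    then show ?thesis using z(3) by (intro exI[of _ w] exI[of _ v] exI[of _ v']) auto
  qed
  show "unique_fact R \<longleftrightarrow> unique_fact RS"
  proof
    assume "unique_fact R" then show "unique_fact RS" unfolding unique_fact_def atoms by blast
  next
    assume u: "unique_fact RS"
    show "unique_fact R"
      unfolding unique_fact_def
    proof (intro allI impI)
      fix z z' assume "set_mset z \<subseteq> mset_atoms R" "set_mset z' \<subseteq> mset_atoms R" "\<Sum>\<^sub># z = \<Sum>\<^sub># z'"
      then obtain w v v' where *: "z = w + v" "z' = w + v'" "set_mset v \<subseteq> mset_atoms RS" "set_mset v' \<subseteq> mset_atoms RS" "\<Sum>\<^sub># v = \<Sum>\<^sub># v'"
        using key by blast
      then have "v = v'" using u unfolding unique_fact_def by blast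
      then show "z = z'" using * by simp
    qed
  qed
  show "unique_length_fact R \<longleftrightarrow> unique_length_fact RS"
  proof
    assume "unique_length_fact R" then show "unique_length_fact RS" unfolding unique_length_fact_def atoms by blast
  next
    assume u: "unique_length_fact RS"
    show "unique_length_fact R"
      unfolding unique_length_fact_def
    proof (intro allI impI)
      fix z z' assume z: "set_mset z \<subseteq> mset_atoms R" "set_mset z' \<subseteq> mset_atoms R" "\<Sum>\<^sub># z = \<Sum>\<^sub># z'" "size z = size z'"
      then obtain w v v' where *: "z = w + v" "z' = w + v'" "set_mset v \<subseteq> mset_atoms RS" "set_mset v' \<subseteq> mset_atoms RS" "\<Sum>\<^sub># v = \<Sum>\<^sub># v'"
        using key by blast
      then have "size v = size v'" using z(4) by simp
      then have "v = v'" using u * unfolding unique_length_fact_def by blast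
      then show "z = z'" using * by simp
    qed
  qed
qed

locale krull_prime_reps = krull_with_theory H P \<phi>
  for H :: "('a, 'm) monoid_scheme" (structure) and P :: "'p set" and \<phi> +
  fixes P0 :: "'a set"
  assumes reps: "prime_representatives H P0"
begin

definition prime_divisor :: "'a \<Rightarrow> 'p" where
  "prime_divisor p = (SOME q. q \<in> P \<and> \<phi> p = {#q#})"

lemma rep_prime: "p \<in> P0 \<Longrightarrow> p \<in> carrier H \<and> prime H p"
  using reps by (auto simp: prime_representatives_def)

lemma phi_rep: "p \<in> P0 \<Longrightarrow> prime_divisor p \<in> P \<and> \<phi> p = {#prime_divisor p#}"
  unfolding prime_divisor_def by (rule someI_ex) (use phi_prime rep_prime in blast)

lemma prime_divisor_inj: "inj_on prime_divisor P0"
proof (rule inj_onI)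
  fix p p' assume pp: "p \<in> P0" "p' \<in> P0" "prime_divisor p = prime_divisor p'"
  have "\<phi> p = \<phi> p'" using phi_rep[OF pp(1)] phi_rep[OF pp(2)] pp(3) by simp
  then have "p \<sim> p'" using associated_iff_phi rep_prime pp by blast
  moreover have "p' \<sim> p'" using rep_prime pp by simp
  ultimately show "p = p'" using reps pp rep_prime[OF pp(2)] unfolding prime_representatives_def by blast
qed

lemma phi_mset_prod: "set_mset f \<subseteq> P0 \<Longrightarrow> \<phi> (mset_prod H f) = image_mset prime_divisor f"
proof (induction f)
  case (add p f)
  then have "set_mset f \<subseteq> carrier H" "p \<in> carrier H" using rep_prime by auto
  then show ?case using add phi_rep[of p] by auto
qed simp

lemma reps_carrier: "set_mset f \<subseteq> P0 \<Longrightarrow> set_mset f \<subseteq> carrier H"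
  using rep_prime by blast

definition split_primes :: "'p set" where
  "split_primes = prime_divisor ` P0"

lemma split_primes_lift:
  assumes "set_mset g \<subseteq> split_primes"
  shows "\<exists>f. set_mset f \<subseteq> P0 \<and> \<phi> (mset_prod H f) = g"
proof -
  have "\<exists>f. set_mset f \<subseteq> P0 \<and> image_mset prime_divisor f = g"
    using assms
  proof (induction g)
    case (add q g)
    then obtain f p where "set_mset f \<subseteq> P0" "image_mset prime_divisor f = g" "p \<in> P0" "prime_divisor p = q"
      by (auto simp: split_primes_def)
    then show ?case by (intro exI[of _ "add_mset p f"]) auto
  qed auto
  then show ?thesis using phi_mset_prod by blast
qed

end

section \<open>Properties of an arbitrary complement of the units and primes\<close>

locale krull_splitting = krull_prime_reps H P \<phi> P0
  for H :: "('a, 'm) monoid_scheme" (structure) and P :: "'p set" and \<phi> and P0 +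
  fixes S :: "'a set"
  assumes splits: "splits_as H P0 S"
begin

abbreviation Hs where "Hs \<equiv> H\<lparr>carrier := S\<rparr>"

lemma S_sub: "S \<subseteq> carrier H" and S_one: "\<one> \<in> S" and S_mult: "a \<in> S \<Longrightarrow> b \<in> S \<Longrightarrow> a \<otimes> b \<in> S"
  using splits by (auto simp: splits_as_def submonoid_def)

lemma S_carrier: "a \<in> S \<Longrightarrow> a \<in> carrier H" using S_sub by blast

lemma split_bij: "bij_betw (\<lambda>(u, f, h). u \<otimes> mset_prod H f \<otimes> h) (Units H \<times> {f. set_mset f \<subseteq> P0} \<times> S) (carrier H)"
  using splits by (simp add: splits_as_def iso_def DirProd_def units_of_def free_abelian_monoid_def)

lemma decomp:
  assumes "x \<in> carrier H"
  obtains u f h where "u \<in> Units H" "set_mset f \<subseteq> P0" "h \<in> S" "x = u \<otimes> mset_prod H f \<otimes> h"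
proof -
  have "x \<in> (\<lambda>(u, f, h). u \<otimes> mset_prod H f \<otimes> h) ` (Units H \<times> {f. set_mset f \<subseteq> P0} \<times> S)"
    using split_bij assms by (simp add: bij_betw_def)
  then show thesis using that by auto
qed

lemma decomp_unique:
  assumes "u \<in> Units H" "set_mset f \<subseteq> P0" "h \<in> S" "u' \<in> Units H" "set_mset f' \<subseteq> P0" "h' \<in> S"
    "u \<otimes> mset_prod H f \<otimes> h = u' \<otimes> mset_prod H f' \<otimes> h'"
  shows "u = u' \<and> f = f' \<and> h = h'"
  using inj_onD[OF bij_betw_imp_inj_on[OF split_bij], of "(u, f, h)" "(u', f', h')"] assms by auto

lemma decomp_phi:
  assumes "u \<in> Units H" "set_mset f \<subseteq> P0" "h \<in> S"
  shows "\<phi> (u \<otimes> mset_prod H f \<otimes> h) = image_mset prime_divisor f + \<phi> h"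
  using assms reps_carrier[OF assms(2)] S_carrier unit_iff[of u] by (simp add: phi_mset_prod Units_closed)

text \<open>A unit in \<open>S\<close> has two decompositions, one with the unit as first component
  and one with it as last.\<close>

lemma S_unit:
  assumes "h \<in> S" "h \<in> Units H"
  shows "h = \<one>"
proof -
  have "h \<otimes> mset_prod H {#} \<otimes> \<one> = \<one> \<otimes> mset_prod H {#} \<otimes> h"
    using S_carrier[OF assms(1)] by simp
  moreover have "set_mset {#} \<subseteq> P0" by simp
  ultimately show ?thesis using decomp_unique assms S_one Units_one_closed by blast
qed

text \<open>If a representative divided \<open>h\<close>, decomposing the cofactor would give
  \<open>h\<close> a nonempty middle component, against the decomposition with \<open>h\<close> as
  last component.\<close>

lemma S_off:
  assumes "h \<in> S"
  shows "set_mset (\<phi> h) \<inter> split_primes = {}"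
proof (rule ccontr)
  assume "\<not> ?thesis"
  then obtain p where p: "p \<in> P0" "prime_divisor p \<in># \<phi> h" by (auto simp: split_primes_def)
  have pc: "p \<in> carrier H" using p rep_prime by blast
  have "\<phi> p \<subseteq># \<phi> h" using p phi_rep[of p] by auto
  then obtain c where c: "c \<in> carrier H" "h = p \<otimes> c"
    using divides_iff[of p h] pc S_carrier[OF assms] by (auto simp: factor_def)
  obtain u f h' where d: "u \<in> Units H" "set_mset f \<subseteq> P0" "h' \<in> S" "c = u \<otimes> mset_prod H f \<otimes> h'"
    using decomp[OF c(1)] by blast
  have "mset_prod H f \<in> carrier H" using reps_carrier[OF d(2)] by simp
  then have "u \<otimes> mset_prod H (add_mset p f) \<otimes> h' = h"
    using c d pc reps_carrier[OF d(2)] S_carrier[OF d(3)] by (simp add: Units_closed m_ac)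
  also have "h = \<one> \<otimes> mset_prod H {#} \<otimes> h" using S_carrier[OF assms] by simp
  finally have eq: "u \<otimes> mset_prod H (add_mset p f) \<otimes> h' = \<one> \<otimes> mset_prod H {#} \<otimes> h" .
  have "set_mset (add_mset p f) \<subseteq> P0" "set_mset {#} \<subseteq> P0" using d p by auto
  then have "add_mset p f = {#}"
    using decomp_unique[OF d(1) _ d(3) Units_one_closed _ assms eq] by blast
  then show False by simp
qed

text \<open>A cofactor found in \<open>H\<close> may lie outside \<open>S\<close>. Its component in
  \<open>S\<close> is a cofactor too, by uniqueness of the decomposition of
  \<open>b\<close>.\<close>

lemma S_divides:
  assumes "a \<in> S" "b \<in> S" "\<phi> a \<subseteq># \<phi> b"
  shows "a divides\<^bsub>Hs\<^esub> b"
proof -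
  obtain c where c: "c \<in> carrier H" "b = a \<otimes> c"
    using divides_iff[of a b] assms S_carrier by (auto simp: factor_def)
  obtain u f h' where d: "u \<in> Units H" "set_mset f \<subseteq> P0" "h' \<in> S" "c = u \<otimes> mset_prod H f \<otimes> h'"
    using decomp[OF c(1)] by blast
  have "mset_prod H f \<in> carrier H" using reps_carrier[OF d(2)] by simp
  then have "u \<otimes> mset_prod H f \<otimes> (a \<otimes> h') = b"
    using c d S_carrier[OF assms(1)] S_carrier[OF d(3)] by (simp add: Units_closed m_ac)
  also have "b = \<one> \<otimes> mset_prod H {#} \<otimes> b" using S_carrier[OF assms(2)] by simp
  finally have eq: "u \<otimes> mset_prod H f \<otimes> (a \<otimes> h') = \<one> \<otimes> mset_prod H {#} \<otimes> b" .
  have "set_mset {#} \<subseteq> P0" by simp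
  then have "a \<otimes> h' = b"
    using decomp_unique[OF d(1,2) S_mult[OF assms(1) d(3)] Units_one_closed _ assms(2) eq] by blast
  then show ?thesis using d by (auto simp: factor_def)
qed

lemma Hs_comm_monoid_cancel: "comm_monoid_cancel Hs"
proof -
  have "comm_monoid Hs"
    by (intro comm_monoidI) (use S_carrier S_one S_mult in \<open>auto simp: m_ac\<close>)
  then show ?thesis
  proof (rule comm_monoid_cancelI)
    fix a b c assume "a \<in> carrier Hs" "b \<in> carrier Hs" "c \<in> carrier Hs" "a \<otimes>\<^bsub>Hs\<^esub> c = b \<otimes>\<^bsub>Hs\<^esub> c"
    then show "a = b" using r_cancel[of a c b] S_carrier by simp
  qed
qed

lemma Hs_free_divisor_hom: "free_divisor_hom Hs (P - split_primes) \<phi>"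
proof -
  interpret Hs: comm_monoid_cancel Hs by (rule Hs_comm_monoid_cancel)
  have supp: "set_mset (\<phi> a) \<subseteq> P - split_primes" if "a \<in> S" for a
    using S_off[OF that] phi_supp[OF S_carrier[OF that]] by blast
  show ?thesis
  proof
    show "divisor_homomorphism Hs (free_abelian_monoid (P - split_primes)) \<phi>"
      unfolding divisor_homomorphism_def
    proof (intro conjI ballI impI)
      show "\<phi> \<in> hom Hs (free_abelian_monoid (P - split_primes))"
        using supp S_carrier unfolding hom_def by auto
      show "\<phi> \<one>\<^bsub>Hs\<^esub> = \<one>\<^bsub>free_abelian_monoid (P - split_primes)\<^esub>" by simp
      fix a b assume ab: "a \<in> carrier Hs" "b \<in> carrier Hs" "\<phi> a divides\<^bsub>free_abelian_monoid (P - split_primes)\<^esub> \<phi> b"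
      then show "a divides\<^bsub>Hs\<^esub> b"
        using S_divides divides_free_abelian_monoid_iff[OF supp, of b "\<phi> a"] by auto
    qed
  qed
qed

text \<open>For \<open>d\<close> supported off \<open>split_primes\<close>, take elements of
  \<open>H\<close> whose values have gcd \<open>d\<close> and replace each by its component in
  \<open>S\<close>. This only deletes the part of the value on \<open>split_primes\<close>, where
  \<open>d\<close> vanishes.\<close>

lemma Hs_krull_with_theory: "krull_with_theory Hs (P - split_primes) \<phi>"
proof -
  interpret Hs: free_divisor_hom Hs "P - split_primes" \<phi> by (rule Hs_free_divisor_hom)
  show ?thesis
  proof
    fix d assume d: "set_mset d \<subseteq> P - split_primes"
    then obtain A where A: "A \<subseteq> carrier H" "mset_glb (\<phi> ` A) d" using glb_ex[of d] by blast
    have part: "\<exists>h\<in>S. \<exists>f. set_mset f \<subseteq> split_primes \<and> \<phi> a = f + \<phi> h" if aA: "a \<in> A" for a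
    proof -
      obtain u f h where "u \<in> Units H" "set_mset f \<subseteq> P0" "h \<in> S" "a = u \<otimes> mset_prod H f \<otimes> h"
        using decomp[OF subsetD[OF A(1) aA]] by blast
      moreover from this have "\<phi> a = image_mset prime_divisor f + \<phi> h" using decomp_phi by simp
      moreover have "set_mset (image_mset prime_divisor f) \<subseteq> split_primes"
        using \<open>set_mset f \<subseteq> P0\<close> by (auto simp: split_primes_def)
      ultimately show ?thesis by blast
    qed
    define B where "B = {h \<in> S. \<exists>a\<in>A. \<exists>f. set_mset f \<subseteq> split_primes \<and> \<phi> a = f + \<phi> h}"
    have "mset_glb (\<phi> ` B) d"
      unfolding mset_glb_def
    proof (intro conjI ballI allI)
      fix b assume "b \<in> \<phi> ` B"
      then obtain h a f where h: "b = \<phi> h" "h \<in> S" "a \<in> A" "set_mset f \<subseteq> split_primes" "\<phi> a = f + \<phi> h"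
        by (auto simp: B_def)
      have le: "d \<subseteq># f + \<phi> h" using A(2) h by (auto simp: mset_glb_def)
      show "d \<subseteq># b"
        unfolding h(1)
      proof (rule mset_subset_eqI)
        fix p
        show "count d p \<le> count (\<phi> h) p"
        proof (cases "p \<in> split_primes")
          case True
          then have "count d p = 0" using d by (auto simp: not_in_iff[symmetric])
          then show ?thesis by simp
        next
          case False
          then have "count f p = 0" using h by (auto simp: not_in_iff[symmetric])
          then show ?thesis using mset_subset_eq_count[OF le, of p] by simp
        qed
      qed
    next
      fix p
      obtain a where a: "a \<in> A" "count (\<phi> a) p = count d p" using A(2) by (auto simp: mset_glb_def)
      obtain h f where h: "h \<in> S" "set_mset f \<subseteq> split_primes" "\<phi> a = f + \<phi> h" using part[OF a(1)] by blast
      have hB: "h \<in> B" using a h by (auto simp: B_def)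
      have "count (\<phi> h) p = count d p"
      proof (cases "p \<in> split_primes")
        case True
        then have "count d p = 0" "count (\<phi> h) p = 0"
          using d S_off[OF h(1)] by (auto simp: not_in_iff[symmetric])
        then show ?thesis by simp
      next
        case False
        then have "count f p = 0" using h by (auto simp: not_in_iff[symmetric])
        then show ?thesis using a h by simp
      qed
      then show "\<exists>b\<in>\<phi> ` B. count b p = count d p" using hB by blast
    qed
    moreover have "B \<subseteq> carrier Hs" by (auto simp: B_def)
    ultimately show "\<exists>A\<subseteq>carrier Hs. mset_glb (\<phi> ` A) d" by blast
  qed
qed

lemma Hs_divisor_theory: "divisor_theory Hs (P - split_primes) \<phi>"
proof -
  interpret Hs: krull_with_theory Hs "P - split_primes" \<phi> by (rule Hs_krull_with_theory)
  show ?thesis unfolding Hs.divisor_theory_iff_glb using Hs.glb_ex by blast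
qed

lemma Hs_krull: "krull_monoid Hs"
  by (rule krull_monoidI[OF Hs_comm_monoid_cancel Hs_divisor_theory])

lemma Hs_reduced: "reduced Hs"
proof -
  interpret Hs: comm_monoid_cancel Hs by (rule Hs_comm_monoid_cancel)
  have "Units Hs = {\<one>}"
  proof (intro equalityI subsetI)
    fix x assume "x \<in> Units Hs"
    then have "x \<in> S" "x \<in> Units H" using S_carrier by (auto simp: Units_def)
    then show "x \<in> {\<one>}" using S_unit by blast
  next
    fix x assume "x \<in> {\<one>}"
    then show "x \<in> Units Hs" using Hs.Units_one_closed by simp
  qed
  then show ?thesis by (simp add: reduced_def)
qed

text \<open>Divisibility by an element of \<open>S\<close> depends only on the components in
  \<open>S\<close>, so a prime of \<open>Hs\<close> is prime in \<open>H\<close>. It would then be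
  associated to a representative, but values on \<open>S\<close> avoid
  \<open>split_primes\<close>.\<close>

lemma Hs_no_prime:
  assumes p: "p \<in> carrier Hs"
  shows "\<not> prime Hs p"
proof
  assume pr: "prime Hs p"
  interpret Hs: free_divisor_hom Hs "P - split_primes" \<phi> by (rule Hs_free_divisor_hom)
  have pS: "p \<in> S" and pc: "p \<in> carrier H" using p S_carrier by auto
  have nu: "p \<notin> Units H"
    using pr pS S_unit Hs.Units_one_closed unfolding prime_def by fastforce
  have "prime H p"
    unfolding prime_def
  proof (intro conjI nu ballI impI)
    fix a b assume ab: "a \<in> carrier H" "b \<in> carrier H" "p divides a \<otimes> b"
    obtain u f h where a: "u \<in> Units H" "set_mset f \<subseteq> P0" "h \<in> S" "a = u \<otimes> mset_prod H f \<otimes> h"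
      using decomp[OF ab(1)] by blast
    obtain u' f' h' where b: "u' \<in> Units H" "set_mset f' \<subseteq> P0" "h' \<in> S" "b = u' \<otimes> mset_prod H f' \<otimes> h'"
      using decomp[OF ab(2)] by blast
    have phi_a: "\<phi> a = image_mset prime_divisor f + \<phi> h" using decomp_phi[OF a(1-3)] a(4) by simp
    have phi_b: "\<phi> b = image_mset prime_divisor f' + \<phi> h'" using decomp_phi[OF b(1-3)] b(4) by simp
    have "\<phi> p \<subseteq># \<phi> a + \<phi> b" using ab divides_iff[OF pc, of "a \<otimes> b"] by simp
    have "\<phi> p \<subseteq># \<phi> h + \<phi> h'"
    proof (rule mset_subset_eqI)
      fix q
      show "count (\<phi> p) q \<le> count (\<phi> h + \<phi> h') q"
      proof (cases "q \<in> split_primes")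
        case True
        then have "count (\<phi> p) q = 0" using S_off[OF pS] by (auto simp: not_in_iff[symmetric])
        then show ?thesis by simp
      next
        case False
        have "set_mset (image_mset prime_divisor f + image_mset prime_divisor f') \<subseteq> split_primes"
          using a b by (auto simp: split_primes_def)
        then have "count (image_mset prime_divisor f + image_mset prime_divisor f') q = 0"
          using False by (metis not_in_iff subsetD)
        then show ?thesis using mset_subset_eq_count[OF \<open>\<phi> p \<subseteq># \<phi> a + \<phi> b\<close>, of q] phi_a phi_b by simp
      qed
    qed
    then have "p divides\<^bsub>Hs\<^esub> h \<otimes> h'" using S_divides[OF pS S_mult] a b S_carrier by simp
    then have "p divides\<^bsub>Hs\<^esub> h \<or> p divides\<^bsub>Hs\<^esub> h'"
      using pr a b unfolding prime_def by simp
    then have "\<phi> p \<subseteq># \<phi> h \<or> \<phi> p \<subseteq># \<phi> h'" using Hs.divides_iff pS a b by auto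
    then have "\<phi> p \<subseteq># \<phi> a \<or> \<phi> p \<subseteq># \<phi> b"
      unfolding phi_a phi_b by (metis add.commute mset_subset_eq_add_left subset_mset.order_trans)
    then show "p divides a \<or> p divides b" using divides_iff pc ab by blast
  qed
  then obtain q where q: "q \<in> P0" "q \<sim> p" using reps pc unfolding prime_representatives_def by blast
  then have "\<phi> p = {#prime_divisor q#}" using associated_iff_phi[of q p] pc rep_prime phi_rep by auto
  then show False using S_off[OF pS] q by (auto simp: split_primes_def)
qed

lemma image_decomp: "\<phi> ` carrier H = {g + r |g r. set_mset g \<subseteq> split_primes \<and> r \<in> \<phi> ` S}"
proof (intro equalityI subsetI)
  fix r assume "r \<in> \<phi> ` carrier H"
  then obtain x where x: "x \<in> carrier H" "r = \<phi> x" by blast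
  obtain u f h where d: "u \<in> Units H" "set_mset f \<subseteq> P0" "h \<in> S" "x = u \<otimes> mset_prod H f \<otimes> h"
    using decomp[OF x(1)] by blast
  then have "r = image_mset prime_divisor f + \<phi> h" using decomp_phi x by simp
  moreover have "set_mset (image_mset prime_divisor f) \<subseteq> split_primes" using d by (auto simp: split_primes_def)
  ultimately show "r \<in> {g + r |g r. set_mset g \<subseteq> split_primes \<and> r \<in> \<phi> ` S}" using d by blast
next
  fix r assume "r \<in> {g + r |g r. set_mset g \<subseteq> split_primes \<and> r \<in> \<phi> ` S}"
  then obtain g h where gh: "set_mset g \<subseteq> split_primes" "h \<in> S" "r = g + \<phi> h" by blast
  obtain f where f: "set_mset f \<subseteq> P0" "\<phi> (mset_prod H f) = g" using split_primes_lift[OF gh(1)] by blast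
  then have "r = \<phi> (mset_prod H f \<otimes> h)" using gh reps_carrier[OF f(1)] S_carrier by simp
  moreover have "mset_prod H f \<otimes> h \<in> carrier H" using reps_carrier[OF f(1)] S_carrier[OF gh(2)] by simp
  ultimately show "r \<in> \<phi> ` carrier H" by blast
qed

lemma length_factorial_Hs: "length_factorial H \<longleftrightarrow> length_factorial Hs"
  and factorial_Hs: "factorial H \<longleftrightarrow> factorial Hs"
proof -
  interpret Hs: free_divisor_hom Hs "P - split_primes" \<phi> by (rule Hs_free_divisor_hom)
  have "saturated (\<phi> ` S)" using Hs.saturated_image by simp
  moreover have "set_mset r \<inter> split_primes = {}" if "r \<in> \<phi> ` S" for r using that S_off by auto
  ultimately show "length_factorial H \<longleftrightarrow> length_factorial Hs" "factorial H \<longleftrightarrow> factorial Hs"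
    using unique_factorization_split[OF _ _ image_decomp]
    by (simp_all add: length_factorial_iff Hs.length_factorial_iff factorial_iff Hs.factorial_iff)
qed

lemma red_iso: "free_abelian_monoid P0 \<times>\<times> Hs \<cong> red_monoid H"
proof -
  let ?F = "\<lambda>(f, h). Units H #> (mset_prod H f \<otimes> h)"
  have cl: "mset_prod H f \<otimes> h \<in> carrier H" if "set_mset f \<subseteq> P0" "h \<in> S" for f h
    using that reps_carrier S_carrier by auto
  have phi: "\<phi> (mset_prod H f \<otimes> h) = image_mset prime_divisor f + \<phi> h" if "set_mset f \<subseteq> P0" "h \<in> S" for f h
    using that reps_carrier S_carrier by (auto simp: phi_mset_prod)
  have hom: "?F \<in> hom (free_abelian_monoid P0 \<times>\<times> Hs) (red_monoid H)"
  proof (rule homI)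
    fix x assume "x \<in> carrier (free_abelian_monoid P0 \<times>\<times> Hs)"
    then show "?F x \<in> carrier (red_monoid H)" using cl by (auto simp: carrier_red DirProd_def)
  next
    fix x y assume "x \<in> carrier (free_abelian_monoid P0 \<times>\<times> Hs)" "y \<in> carrier (free_abelian_monoid P0 \<times>\<times> Hs)"
    then obtain f h f' h' where xy: "x = (f, h)" "y = (f', h')" "set_mset f \<subseteq> P0" "h \<in> S" "set_mset f' \<subseteq> P0" "h' \<in> S"
      by (auto simp: DirProd_def)
    have "mset_prod H (f + f') \<otimes> (h \<otimes> h') = (mset_prod H f \<otimes> h) \<otimes> (mset_prod H f' \<otimes> h')"
      using xy(3-6) reps_carrier S_carrier by (simp add: mset_prod_union m_ac)
    then show "?F (x \<otimes>\<^bsub>free_abelian_monoid P0 \<times>\<times> Hs\<^esub> y) = ?F x \<otimes>\<^bsub>red_monoid H\<^esub> ?F y"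
      using xy cl by (simp add: DirProd_def mult_red)
  qed
  moreover have "inj_on ?F (carrier (free_abelian_monoid P0 \<times>\<times> Hs))"
  proof (rule inj_onI)
    fix x y assume "x \<in> carrier (free_abelian_monoid P0 \<times>\<times> Hs)" "y \<in> carrier (free_abelian_monoid P0 \<times>\<times> Hs)"
      and eq: "?F x = ?F y"
    then obtain f h f' h' where xy: "x = (f, h)" "y = (f', h')"
      and *: "set_mset f \<subseteq> P0" "h \<in> S" "set_mset f' \<subseteq> P0" "h' \<in> S"
      by (auto simp: DirProd_def)
    have "\<phi> (mset_prod H f \<otimes> h) = \<phi> (mset_prod H f' \<otimes> h')"
      using eq coset_eq_iff[OF cl[OF *(1,2)] cl[OF *(3,4)]] unfolding xy by simp
    then obtain u where u: "u \<in> Units H" "mset_prod H f' \<otimes> h' = u \<otimes> (mset_prod H f \<otimes> h)"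
      using phi_eq_ex_unit[OF cl[OF *(1,2)] cl[OF *(3,4)]] by blast
    have "u \<otimes> mset_prod H f \<otimes> h = \<one> \<otimes> mset_prod H f' \<otimes> h'"
      using u * reps_carrier S_carrier by (simp add: m_assoc Units_closed)
    then show "x = y"
      using decomp_unique[OF u(1) *(1,2) Units_one_closed *(3,4)] xy by blast
  qed
  moreover have "carrier (red_monoid H) \<subseteq> ?F ` carrier (free_abelian_monoid P0 \<times>\<times> Hs)"
  proof
    fix X assume "X \<in> carrier (red_monoid H)"
    then obtain x where x: "x \<in> carrier H" "X = Units H #> x" unfolding carrier_red by blast
    obtain u f h where d: "u \<in> Units H" "set_mset f \<subseteq> P0" "h \<in> S" "x = u \<otimes> mset_prod H f \<otimes> h"
      using decomp[OF x(1)] by blast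
    then have "\<phi> x = \<phi> (mset_prod H f \<otimes> h)" using decomp_phi phi by simp
    then have "X = ?F (f, h)" using x cl[OF d(2,3)] coset_eq_iff[OF x(1) cl[OF d(2,3)]] by simp
    then show "X \<in> ?F ` carrier (free_abelian_monoid P0 \<times>\<times> Hs)"
      using d by (intro image_eqI[of _ _ "(f, h)"]) (auto simp: DirProd_def)
  qed
  moreover have "?F ` carrier (free_abelian_monoid P0 \<times>\<times> Hs) \<subseteq> carrier (red_monoid H)"
    using hom hom_carrier by blast
  ultimately have "bij_betw ?F (carrier (free_abelian_monoid P0 \<times>\<times> Hs)) (carrier (red_monoid H))"
    unfolding bij_betw_def by blast
  then show ?thesis unfolding is_iso_def using isoI[OF hom] by blast
qed

end

section \<open>Class groups\<close>

lemma mset_to_frag_empty [simp]: "mset_to_frag {#} = 0"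
  by (simp add: mset_to_frag_def)

lemma mset_to_frag_add_mset [simp]: "mset_to_frag (add_mset p M) = frag_of p + mset_to_frag M"
  by (simp add: mset_to_frag_def)

lemma mset_to_frag_union [simp]: "mset_to_frag (M + N) = mset_to_frag M + mset_to_frag N"
  by (simp add: mset_to_frag_def)

lemma lookup_mset_to_frag: "poly_mapping.lookup (mset_to_frag M) p = int (count M p)"
  by (induction M) (auto simp: lookup_add)

lemma keys_mset_to_frag: "Poly_Mapping.keys (mset_to_frag M) = set_mset M"
  by (auto simp: in_keys_iff lookup_mset_to_frag not_in_iff)

lemma mset_to_frag_inj: "mset_to_frag M = mset_to_frag N \<longleftrightarrow> M = N"
  by (metis lookup_mset_to_frag multiset_eqI of_nat_eq_iff)

lemma frag_diff_msets:
  assumes "Poly_Mapping.keys x \<subseteq> S"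
  shows "\<exists>g g'. set_mset g \<subseteq> S \<and> set_mset g' \<subseteq> S \<and> x = mset_to_frag g - mset_to_frag g'"
  using assms
proof (induction x rule: frag_induction)
  case zero
  show ?case by (intro exI[of _ "{#}"]) auto
next
  case (one p)
  then show ?case by (intro exI[of _ "{#p#}"] exI[of _ "{#}"]) auto
next
  case (diff a b)
  then obtain g g' h h' where "set_mset g \<subseteq> S" "set_mset g' \<subseteq> S" "a = mset_to_frag g - mset_to_frag g'"
    "set_mset h \<subseteq> S" "set_mset h' \<subseteq> S" "b = mset_to_frag h - mset_to_frag h'" by blast
  then show ?case by (intro exI[of _ "g + h'"] exI[of _ "g' + h"]) auto
qed

lemma keys_diff_subset: "Poly_Mapping.keys x \<subseteq> S \<Longrightarrow> Poly_Mapping.keys y \<subseteq> S \<Longrightarrow> Poly_Mapping.keys (x - y) \<subseteq> S"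
  for x y :: "'a \<Rightarrow>\<^sub>0 int"
  using keys_diff[of x y] by blast

text \<open>The first isomorphism theorem for \<open>F\<close> followed by the projection; the
  kernel condition is phrased on elements so that it can be checked without computing
  preimages.\<close>

lemma quotient_iso:
  assumes G: "comm_group G" and G': "comm_group G'"
    and N: "subgroup N G" and N': "subgroup N' G'"
    and F: "F \<in> hom G G'" "F ` carrier G = carrier G'"
    and ker: "\<And>x. x \<in> carrier G \<Longrightarrow> F x \<in> N' \<longleftrightarrow> x \<in> N"
  shows "G Mod N \<cong> G' Mod N'"
proof -
  interpret G: comm_group G by fact
  interpret G': comm_group G' by fact
  have n': "N' \<lhd> G'" using N' G'.normal_iff_subgroup by blast
  interpret n': normal N' G' by (rule n')
  let ?h = "\<lambda>x. N' #>\<^bsub>G'\<^esub> F x"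
  have hom: "?h \<in> hom G (G' Mod N')"
    using hom_compose[OF F(1) n'.r_coset_hom_Mod] by (simp add: o_def)
  interpret h: group_hom G "G' Mod N'" ?h
    using hom n'.factorgroup_is_group by (simp add: group_hom_def group_hom_axioms_def)
  have "?h ` carrier G = carrier (G' Mod N')"
    unfolding carrier_FactGroup F(2)[symmetric] by (simp add: image_image)
  then have "G Mod kernel G (G' Mod N') ?h \<cong> G' Mod N'" by (rule h.FactGroup_iso)
  moreover have "kernel G (G' Mod N') ?h = N"
  proof -
    have "?h x = N' \<longleftrightarrow> x \<in> N" if x: "x \<in> carrier G" for x
    proof -
      have Fx: "F x \<in> carrier G'" using F x by (auto simp: hom_def)
      have "?h x = N' \<longleftrightarrow> F x \<in> N'"
        using G'.coset_join1[OF _ Fx N'] G'.coset_join2[OF Fx N'] by blast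
      then show ?thesis using ker[OF x] by blast
    qed
    then show ?thesis using subgroup.subset[OF N] by (auto simp: kernel_def)
  qed
  ultimately show ?thesis by simp
qed

context free_divisor_hom
begin

abbreviation "PS \<equiv> principal_subgroup H P \<phi>"
abbreviation "CG \<equiv> class_group H P \<phi>"

text \<open>The values are closed under addition, so their differences already form a
  subgroup.\<close>

lemma principal_iff:
  "x \<in> PS \<longleftrightarrow> (\<exists>a\<in>carrier H. \<exists>b\<in>carrier H. x = mset_to_frag (\<phi> a) - mset_to_frag (\<phi> b))"
proof -
  interpret F: comm_group "free_Abelian_group P" by (rule abelian_free_Abelian_group)
  let ?D = "{mset_to_frag (\<phi> a) - mset_to_frag (\<phi> b) |a b. a \<in> carrier H \<and> b \<in> carrier H}"
  let ?X = "(\<lambda>a. mset_to_frag (\<phi> a)) ` carrier H"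
  have X: "?X \<subseteq> carrier (free_Abelian_group P)" by (simp add: image_subset_iff keys_mset_to_frag phi_supp)
  have D: "x \<in> carrier (free_Abelian_group P)" if xD: "x \<in> ?D" for x
  proof -
    obtain a b where ab: "a \<in> carrier H" "b \<in> carrier H" "x = mset_to_frag (\<phi> a) - mset_to_frag (\<phi> b)"
      using xD by blast
    have "Poly_Mapping.keys x \<subseteq> P"
      unfolding ab(3) by (intro keys_diff_subset) (simp_all add: keys_mset_to_frag phi_supp ab)
    then show ?thesis by simp
  qed
  have sub: "subgroup (generate (free_Abelian_group P) ?X) (free_Abelian_group P)"
    using F.generate_is_subgroup[OF X] .
  have "subgroup ?D (free_Abelian_group P)"
  proof
    show "?D \<subseteq> carrier (free_Abelian_group P)" using D by blast
    have eq: "0 = mset_to_frag (\<phi> \<one>) - mset_to_frag (\<phi> \<one>)" by simp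
    show "\<one>\<^bsub>free_Abelian_group P\<^esub> \<in> ?D"
      unfolding one_free_Abelian_group using eq one_closed by blast
  next
    fix x y assume "x \<in> ?D" "y \<in> ?D"
    then obtain a b c d where *: "a \<in> carrier H" "b \<in> carrier H" "c \<in> carrier H" "d \<in> carrier H"
      "x = mset_to_frag (\<phi> a) - mset_to_frag (\<phi> b)" "y = mset_to_frag (\<phi> c) - mset_to_frag (\<phi> d)" by blast
    then have eq: "x + y = mset_to_frag (\<phi> (a \<otimes> c)) - mset_to_frag (\<phi> (b \<otimes> d))" by simp
    show "x \<otimes>\<^bsub>free_Abelian_group P\<^esub> y \<in> ?D"
      unfolding mult_free_Abelian_group eq using *(1-4) m_closed by blast
  next
    fix x assume "x \<in> ?D"
    then have xP: "Poly_Mapping.keys x \<subseteq> P" using D[of x] by simp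
    obtain a b where *: "a \<in> carrier H" "b \<in> carrier H" "x = mset_to_frag (\<phi> a) - mset_to_frag (\<phi> b)"
      using \<open>x \<in> ?D\<close> by blast
    have eq: "- x = mset_to_frag (\<phi> b) - mset_to_frag (\<phi> a)" using * by simp
    show "inv\<^bsub>free_Abelian_group P\<^esub> x \<in> ?D"
      unfolding inv_free_Abelian_group[OF xP] eq using *(1,2) by blast
  qed
  moreover have "?X \<subseteq> ?D"
  proof
    fix x assume "x \<in> ?X"
    then obtain a where a: "a \<in> carrier H" "x = mset_to_frag (\<phi> a)" by blast
    then have "x = mset_to_frag (\<phi> a) - mset_to_frag (\<phi> \<one>)" by simp
    then show "x \<in> ?D" using one_closed a(1) by blast
  qed
  ultimately have "PS \<subseteq> ?D"
    unfolding principal_subgroup_def using F.generate_subgroup_incl by blast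
  moreover have "mset_to_frag (\<phi> a) - mset_to_frag (\<phi> b) \<in> PS" if "a \<in> carrier H" "b \<in> carrier H" for a b
  proof -
    have "mset_to_frag (\<phi> a) \<in> PS" "mset_to_frag (\<phi> b) \<in> PS"
      unfolding principal_subgroup_def using that by (auto intro: generate.incl)
    moreover from this(2) have "inv\<^bsub>free_Abelian_group P\<^esub> mset_to_frag (\<phi> b) \<in> PS"
      unfolding principal_subgroup_def by (rule subgroup.m_inv_closed[OF sub])
    ultimately have "mset_to_frag (\<phi> a) \<otimes>\<^bsub>free_Abelian_group P\<^esub> inv\<^bsub>free_Abelian_group P\<^esub> mset_to_frag (\<phi> b) \<in> PS"
      unfolding principal_subgroup_def by (intro subgroup.m_closed[OF sub])
    then show ?thesis using phi_supp[OF that(2)] by (simp add: keys_mset_to_frag)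
  qed
  ultimately show ?thesis by blast
qed

lemma principal_subgroup: "subgroup PS (free_Abelian_group P)"
proof -
  interpret F: comm_group "free_Abelian_group P" by (rule abelian_free_Abelian_group)
  show ?thesis unfolding principal_subgroup_def
    using phi_supp by (intro F.generate_is_subgroup) (auto simp: keys_mset_to_frag)
qed

lemma class_group_comm_group: "comm_group CG"
  unfolding class_group_def by (rule comm_group.abelian_FactGroup[OF abelian_free_Abelian_group principal_subgroup])

definition frag_class :: "('p \<Rightarrow>\<^sub>0 int) \<Rightarrow> ('p \<Rightarrow>\<^sub>0 int) set" where
  "frag_class x = PS #>\<^bsub>free_Abelian_group P\<^esub> x"

lemma principal_normal: "PS \<lhd> free_Abelian_group P"
  using comm_group.normal_iff_subgroup[OF abelian_free_Abelian_group] principal_subgroup by blast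

lemma frag_class_hom: "frag_class \<in> hom (free_Abelian_group P) CG"
  using normal.r_coset_hom_Mod[OF principal_normal] unfolding class_group_def frag_class_def[abs_def] by simp

lemma carrier_class_group: "carrier CG = frag_class ` {x. Poly_Mapping.keys x \<subseteq> P}"
proof -
  have "carrier (free_Abelian_group P) = {x. Poly_Mapping.keys x \<subseteq> P}" by auto
  then show ?thesis unfolding class_group_def carrier_FactGroup frag_class_def by simp
qed

lemma divisor_class_eq: "divisor_class H P \<phi> p = frag_class (frag_of p)"
  by (simp add: divisor_class_def frag_class_def)

lemma frag_class_eq_one:
  assumes "Poly_Mapping.keys x \<subseteq> P"
  shows "frag_class x = \<one>\<^bsub>CG\<^esub> \<longleftrightarrow> x \<in> PS"
proof -
  have x: "x \<in> carrier (free_Abelian_group P)" using assms by simp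
  have "PS #>\<^bsub>free_Abelian_group P\<^esub> x = PS \<longleftrightarrow> x \<in> PS"
    using group.coset_join1[OF group_free_Abelian_group _ x principal_subgroup]
      group.coset_join2[OF group_free_Abelian_group x principal_subgroup] by blast
  then show ?thesis by (simp add: frag_class_def class_group_def)
qed

interpretation hom: group_hom "free_Abelian_group P" CG frag_class
  using frag_class_hom comm_group.axioms(2)[OF class_group_comm_group]
  by (simp add: group_hom_def group_hom_axioms_def)

lemma frag_class_closed: "Poly_Mapping.keys x \<subseteq> P \<Longrightarrow> frag_class x \<in> carrier CG"
  by (auto simp: carrier_class_group)

lemma frag_class_add: "Poly_Mapping.keys x \<subseteq> P \<Longrightarrow> Poly_Mapping.keys y \<subseteq> P \<Longrightarrow> frag_class (x + y) = frag_class x \<otimes>\<^bsub>CG\<^esub> frag_class y"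
  using hom.hom_mult[of x y] by simp

lemma frag_class_zero: "frag_class 0 = \<one>\<^bsub>CG\<^esub>"
  using hom.hom_one by simp

lemma frag_class_cmul: "Poly_Mapping.keys x \<subseteq> P \<Longrightarrow> frag_class (frag_cmul n x) = frag_class x [^]\<^bsub>CG\<^esub> n" for n :: int
  using hom.hom_int_pow[of x n] by simp

text \<open>If a difference of two values has no negative coefficients, then the subtracted value
  divides the other one, and saturation makes the difference itself a value.\<close>

lemma mset_to_frag_in_principal:
  assumes "set_mset d \<subseteq> P"
  shows "mset_to_frag d \<in> PS \<longleftrightarrow> d \<in> \<phi> ` carrier H"
proof
  assume "mset_to_frag d \<in> PS"
  then obtain a b where ab: "a \<in> carrier H" "b \<in> carrier H" "mset_to_frag d = mset_to_frag (\<phi> a) - mset_to_frag (\<phi> b)"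
    using principal_iff by blast
  then have "mset_to_frag (d + \<phi> b) = mset_to_frag (\<phi> a)" by simp
  then have eq: "d + \<phi> b = \<phi> a" by (simp only: mset_to_frag_inj)
  interpret R: saturated "\<phi> ` carrier H" by (rule saturated_image)
  have "\<phi> b \<subseteq># \<phi> a" unfolding eq[symmetric] by simp
  then have "\<phi> a - \<phi> b \<in> \<phi> ` carrier H" using ab(1,2) by (intro R.diff) blast+
  moreover have "\<phi> a - \<phi> b = d" unfolding eq[symmetric] by simp
  ultimately show "d \<in> \<phi> ` carrier H" by simp
next
  assume "d \<in> \<phi> ` carrier H"
  then obtain a where a: "a \<in> carrier H" "d = \<phi> a" by blast
  then have "mset_to_frag d = mset_to_frag (\<phi> a) - mset_to_frag (\<phi> \<one>)" by simp
  then show "mset_to_frag d \<in> PS" unfolding principal_iff using a(1) one_closed by blast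
qed

lemma mset_prod_divisor_class:
  assumes "set_mset d \<subseteq> P"
  shows "mset_prod CG (image_mset (divisor_class H P \<phi>) d) = frag_class (mset_to_frag d)"
proof -
  interpret C: comm_group CG by (rule class_group_comm_group)
  show ?thesis using assms
  proof (induction d)
    case empty
    then show ?case by (simp add: frag_class_zero)
  next
    case (add p d)
    have "set_mset (image_mset (divisor_class H P \<phi>) d) \<subseteq> carrier CG"
      using add.prems by (auto simp: divisor_class_eq intro!: frag_class_closed)
    moreover have "divisor_class H P \<phi> p \<in> carrier CG"
      using add.prems by (auto simp: divisor_class_eq intro!: frag_class_closed)
    ultimately show ?case
      using add by (simp add: frag_class_add keys_mset_to_frag divisor_class_eq)
  qed
qed

end

text \<open>Uniqueness of divisor theories on \<open>Hs\<close> provides a bijection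
  \<open>\<beta>\<close> from the prime divisors off \<open>split_primes\<close> to
  \<open>Q\<close>. The map \<open>F\<close> applies it and forgets \<open>split_primes\<close>;
  nothing is lost in the class group, because the forgotten prime divisors are values of prime
  elements.\<close>

lemma (in krull_splitting) class_group_iso:
  assumes dt: "divisor_theory Hs Q \<psi>"
  shows "class_group H P \<phi> \<cong> class_group Hs Q \<psi>"
proof -
  let ?P' = "P - split_primes"
  interpret A: krull_with_theory Hs ?P' \<phi> by (rule Hs_krull_with_theory)
  interpret B: krull_with_theory Hs Q \<psi> by (rule krull_with_theoryI[OF Hs_comm_monoid_cancel dt])
  have "equivalent_divisors S ?P' Q \<phi> \<psi>"
  proof
    fix a b assume ab: "a \<in> S" "b \<in> S"
    then show "\<exists>c\<in>S. \<phi> c = \<phi> a + \<phi> b \<and> \<psi> c = \<psi> a + \<psi> b"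
      using B.phi_mult[of a b] S_carrier S_mult by (intro bexI[of _ "a \<otimes> b"]) auto
    show "\<phi> a \<subseteq># \<phi> b \<longleftrightarrow> \<psi> a \<subseteq># \<psi> b" using A.divides_iff[of a b] B.divides_iff[of a b] ab by simp
  next
    fix a assume "a \<in> S"
    then show "set_mset (\<phi> a) \<subseteq> ?P'" "set_mset (\<psi> a) \<subseteq> Q" using A.phi_supp[of a] B.phi_supp[of a] by simp_all
  next
    fix d assume "set_mset d \<subseteq> ?P'"
    then show "\<exists>A\<subseteq>S. mset_glb (\<phi> ` A) d" using A.glb_ex[of d] by simp
  next
    fix d assume "set_mset d \<subseteq> Q"
    then show "\<exists>A\<subseteq>S. mset_glb (\<psi> ` A) d" using B.glb_ex[of d] by simp
  qed
  then obtain \<beta> where \<beta>: "bij_betw \<beta> ?P' Q" "\<And>a. a \<in> S \<Longrightarrow> \<psi> a = image_mset \<beta> (\<phi> a)"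
    using equivalent_divisors.bijection_exists by blast
  define F where "F = frag_extend (\<lambda>p. if p \<in> split_primes then 0 else frag_of (\<beta> p))"
  have F1: "F (mset_to_frag M) = 0" if "set_mset M \<subseteq> split_primes" for M
    using that by (induction M) (auto simp: F_def frag_extend_add)
  have F2: "F (mset_to_frag M) = mset_to_frag (image_mset \<beta> M)" if "set_mset M \<subseteq> ?P'" for M
    using that by (induction M) (auto simp: F_def frag_extend_add)
  have Fdiff: "F (x - y) = F x - F y" and Fadd: "F (x + y) = F x + F y" for x y
    by (simp_all add: F_def frag_extend_diff frag_extend_add)
  have F_lookup: "poly_mapping.lookup (F x) (\<beta> p) = poly_mapping.lookup x p"
    if x: "Poly_Mapping.keys x \<subseteq> P" and p: "p \<in> ?P'" for x p
    using x
  proof (induction x rule: frag_induction)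
    case zero
    then show ?case by (simp add: F_def)
  next
    case (one r)
    then show ?case using p \<beta>(1) by (auto simp: F_def bij_betw_def inj_on_def)
  next
    case (diff a b)
    then show ?case by (simp add: Fdiff lookup_minus)
  qed
  have F_keys: "Poly_Mapping.keys (F x) \<subseteq> Q" if x: "Poly_Mapping.keys x \<subseteq> P" for x
    using x
  proof (induction x rule: frag_induction)
    case zero
    then show ?case by (simp add: F_def)
  next
    case (one r)
    then show ?case using \<beta>(1) by (auto simp: F_def bij_betw_def)
  next
    case (diff a b)
    then show ?case unfolding Fdiff by (rule keys_diff_subset)
  qed
  have F_phi: "F (mset_to_frag (\<phi> (u \<otimes> mset_prod H f \<otimes> h))) = mset_to_frag (\<psi> h)"
    if "u \<in> Units H" "set_mset f \<subseteq> P0" "h \<in> S" for u f h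
  proof -
    have "set_mset (image_mset prime_divisor f) \<subseteq> split_primes" using that by (auto simp: split_primes_def)
    moreover have "set_mset (\<phi> h) \<subseteq> ?P'" using A.phi_supp[of h] that by simp
    ultimately show ?thesis
      unfolding decomp_phi[OF that] \<beta>(2)[OF that(3)] by (simp add: Fadd F1 F2)
  qed
  have "free_Abelian_group P Mod principal_subgroup H P \<phi> \<cong> free_Abelian_group Q Mod principal_subgroup Hs Q \<psi>"
  proof (rule quotient_iso[OF abelian_free_Abelian_group abelian_free_Abelian_group principal_subgroup B.principal_subgroup])
    show "F \<in> hom (free_Abelian_group P) (free_Abelian_group Q)"
      using F_keys by (intro homI) (auto simp: Fadd)
    show "F ` carrier (free_Abelian_group P) = carrier (free_Abelian_group Q)"
    proof (intro equalityI subsetI)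
      fix y assume "y \<in> F ` carrier (free_Abelian_group P)"
      then obtain x where "y = F x" "Poly_Mapping.keys x \<subseteq> P" by auto
      then show "y \<in> carrier (free_Abelian_group Q)" using F_keys[of x] by simp
    next
      fix y assume "y \<in> carrier (free_Abelian_group Q)"
      then have "Poly_Mapping.keys y \<subseteq> Q" by simp
      then have "\<exists>x. Poly_Mapping.keys x \<subseteq> P \<and> F x = y"
      proof (induction y rule: frag_induction)
        case zero
        show ?case by (intro exI[of _ 0]) (simp add: F_def)
      next
        case (one q)
        then obtain p where "p \<in> ?P'" "\<beta> p = q" using \<beta>(1) by (auto simp: bij_betw_def)
        then show ?case by (intro exI[of _ "frag_of p"]) (auto simp: F_def)
      next
        case (diff a b)
        then obtain x y where "Poly_Mapping.keys x \<subseteq> P" "F x = a" "Poly_Mapping.keys y \<subseteq> P" "F y = b" by blast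
        then show ?case by (intro exI[of _ "x - y"]) (simp add: Fdiff keys_diff_subset)
      qed
      then show "y \<in> F ` carrier (free_Abelian_group P)" by auto
    qed
    fix x assume "x \<in> carrier (free_Abelian_group P)"
    then have x: "Poly_Mapping.keys x \<subseteq> P" by simp
    show "F x \<in> principal_subgroup Hs Q \<psi> \<longleftrightarrow> x \<in> principal_subgroup H P \<phi>"
    proof
      assume "x \<in> principal_subgroup H P \<phi>"
      then obtain a b where ab: "a \<in> carrier H" "b \<in> carrier H" "x = mset_to_frag (\<phi> a) - mset_to_frag (\<phi> b)"
        using principal_iff by blast
      obtain u f h where a: "u \<in> Units H" "set_mset f \<subseteq> P0" "h \<in> S" "a = u \<otimes> mset_prod H f \<otimes> h"
        using decomp[OF ab(1)] by blast
      obtain u' f' h' where b: "u' \<in> Units H" "set_mset f' \<subseteq> P0" "h' \<in> S" "b = u' \<otimes> mset_prod H f' \<otimes> h'"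
        using decomp[OF ab(2)] by blast
      have "F x = mset_to_frag (\<psi> h) - mset_to_frag (\<psi> h')"
        unfolding ab(3) Fdiff a(4) b(4) F_phi[OF a(1-3)] F_phi[OF b(1-3)] ..
      then show "F x \<in> principal_subgroup Hs Q \<psi>" using B.principal_iff a b by auto
    next
      assume "F x \<in> principal_subgroup Hs Q \<psi>"
      then obtain h h' where h: "h \<in> S" "h' \<in> S" "F x = mset_to_frag (\<psi> h) - mset_to_frag (\<psi> h')"
        using B.principal_iff by auto
      \<comment> \<open>Subtracting a principal element with the same image leaves an element of the
        kernel of \<open>F\<close>. It is supported on \<open>split_primes\<close>, where everything
        lifts to products of primes.\<close>
      define y where "y = x - (mset_to_frag (\<phi> h) - mset_to_frag (\<phi> h'))"
      have hP: "set_mset (\<phi> h) \<subseteq> ?P'" "set_mset (\<phi> h') \<subseteq> ?P'"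
        using A.phi_supp[of h] A.phi_supp[of h'] h by simp_all
      then have hP': "set_mset (\<phi> h) \<subseteq> P" "set_mset (\<phi> h') \<subseteq> P" by auto
      have yP: "Poly_Mapping.keys y \<subseteq> P"
        unfolding y_def using x hP' by (intro keys_diff_subset) (auto simp: keys_mset_to_frag)
      have "F y = 0" unfolding y_def Fdiff F2[OF hP(1)] F2[OF hP(2)] using h by (simp add: \<beta>(2))
      then have "poly_mapping.lookup y p = 0" if "p \<in> ?P'" for p
        using F_lookup[OF yP that] by simp
      then have "Poly_Mapping.keys y \<subseteq> split_primes" using yP by (auto simp: in_keys_iff subset_iff)
      then obtain g g' where g: "set_mset g \<subseteq> split_primes" "set_mset g' \<subseteq> split_primes" "y = mset_to_frag g - mset_to_frag g'"
        using frag_diff_msets by blast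
      obtain f f' where f: "set_mset f \<subseteq> P0" "\<phi> (mset_prod H f) = g" "set_mset f' \<subseteq> P0" "\<phi> (mset_prod H f') = g'"
        using split_primes_lift[OF g(1)] split_primes_lift[OF g(2)] by blast
      have cl: "mset_prod H f \<in> carrier H" "mset_prod H f' \<in> carrier H" "h \<in> carrier H" "h' \<in> carrier H"
        using reps_carrier f h S_carrier by auto
      have "x = y + (mset_to_frag (\<phi> h) - mset_to_frag (\<phi> h'))" by (simp add: y_def)
      also have "\<dots> = mset_to_frag (\<phi> (mset_prod H f \<otimes> h)) - mset_to_frag (\<phi> (mset_prod H f' \<otimes> h'))"
        using cl f g(3) by simp
      finally show "x \<in> principal_subgroup H P \<phi>" using principal_iff cl m_closed by blast
    qed
  qed
  then show ?thesis by (simp add: class_group_def)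
qed

section \<open>Linear combinations in abelian groups\<close>

definition lincomb :: "('c, 'm) monoid_scheme \<Rightarrow> ('i \<Rightarrow> 'c) \<Rightarrow> 'i set \<Rightarrow> ('i \<Rightarrow> int) \<Rightarrow> 'c" where
  "lincomb G x I m = finprod G (\<lambda>i. x i [^]\<^bsub>G\<^esub> m i) I"

context comm_group
begin

lemma lincomb_closed [simp]: "x \<in> I \<rightarrow> carrier G \<Longrightarrow> lincomb G x I m \<in> carrier G"
  unfolding lincomb_def by (intro finprod_closed) auto

lemma lincomb_add:
  "x \<in> I \<rightarrow> carrier G \<Longrightarrow> lincomb G x I (\<lambda>i. m i + m' i) = lincomb G x I m \<otimes> lincomb G x I m'"
  unfolding lincomb_def
  by (subst finprod_multf[symmetric]) (auto simp: int_pow_mult Pi_iff simp del: finprod_multf intro!: finprod_cong')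

lemma lincomb_zero: "(\<And>i. i \<in> I \<Longrightarrow> m i = 0) \<Longrightarrow> lincomb G x I m = \<one>"
  unfolding lincomb_def by (intro finprod_one_eqI) auto

lemma lincomb_cong:
  "x \<in> I \<rightarrow> carrier G \<Longrightarrow> (\<And>i. i \<in> I \<Longrightarrow> m i = m' i) \<Longrightarrow> lincomb G x I m = lincomb G x I m'"
  unfolding lincomb_def by (intro finprod_cong') auto

lemma lincomb_diff:
  assumes "x \<in> I \<rightarrow> carrier G"
  shows "lincomb G x I (\<lambda>i. m i - m' i) = lincomb G x I m \<otimes> inv (lincomb G x I m')"
proof -
  have "lincomb G x I m = lincomb G x I (\<lambda>i. m i - m' i) \<otimes> lincomb G x I m'"
    using lincomb_add[OF assms, of "\<lambda>i. m i - m' i" m'] by simp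
  then show ?thesis using assms by (simp add: m_assoc)
qed

lemma lincomb_uminus:
  assumes "x \<in> I \<rightarrow> carrier G"
  shows "lincomb G x I (\<lambda>i. - m i) = inv (lincomb G x I m)"
  using lincomb_diff[OF assms, of "\<lambda>_. 0" m] assms by (simp add: lincomb_zero)

lemma lincomb_mono:
  assumes "finite I" "J \<subseteq> I" "x \<in> I \<rightarrow> carrier G" "\<And>i. i \<in> I - J \<Longrightarrow> m i = 0"
  shows "lincomb G x J m = lincomb G x I m"
  unfolding lincomb_def using assms by (intro finprod_mono_neutral_cong_left) auto

lemma lincomb_single:
  assumes "finite I" "x \<in> I \<rightarrow> carrier G" "a \<in> I"
  shows "lincomb G x I (\<lambda>i. if i = a then n else 0) = x a [^] n"
proof -
  have "lincomb G x I (\<lambda>i. if i = a then n else 0) = lincomb G x {a} (\<lambda>i. if i = a then n else 0)"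
    using assms by (intro lincomb_mono[symmetric]) auto
  also have "\<dots> = x a [^] n" using assms by (auto simp: lincomb_def Pi_iff)
  finally show ?thesis .
qed

lemma lincomb_reindex:
  assumes "inj_on h A" "x \<in> h ` A \<rightarrow> carrier G"
  shows "lincomb G x (h ` A) m = lincomb G (x \<circ> h) A (m \<circ> h)"
  unfolding lincomb_def using assms by (subst finprod_reindex) auto

lemma lincomb_Times:
  assumes "finite A" "finite B" "x \<in> A \<times> B \<rightarrow> carrier G"
  shows "lincomb G x (A \<times> B) m = finprod G (\<lambda>a. lincomb G (\<lambda>b. x (a, b)) B (\<lambda>b. m (a, b))) A"
proof -
  have "A \<times> B = (\<Union>a\<in>A. Pair a ` B)" by auto
  then have "lincomb G x (A \<times> B) m = finprod G (\<lambda>i. x i [^] m i) (\<Union>((\<lambda>a. Pair a ` B) ` A))"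
    by (simp add: lincomb_def)
  also have "\<dots> = finprod G (\<lambda>a. finprod G (\<lambda>i. x i [^] m i) (Pair a ` B)) A"
    using assms by (intro finprod_UN_disjoint) (auto simp: pairwise_def disjnt_def)
  also have "\<dots> = finprod G (\<lambda>a. lincomb G (\<lambda>b. x (a, b)) B (\<lambda>b. m (a, b))) A"
    using assms unfolding lincomb_def
    by (intro finprod_cong' refl) (auto intro!: finprod_closed finprod_reindex simp: inj_on_def Pi_iff)
  finally show ?thesis .
qed

lemma lincomb_subgroup:
  assumes "subgroup K G" "finite I" "\<And>i. i \<in> I \<Longrightarrow> x i \<in> K"
  shows "lincomb G x I m \<in> K"
  using assms(2,3)
proof (induction I)
  case empty
  then show ?case using assms(1) by (simp add: lincomb_def subgroup.one_closed)
next
  case (insert a I)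
  have K: "K \<subseteq> carrier G" using assms(1) by (rule subgroup.subset)
  have "lincomb G x (insert a I) m = x a [^] m a \<otimes> lincomb G x I m"
    unfolding lincomb_def using insert K by (intro finprod_insert) auto
  moreover have "x a [^] m a \<in> K" using insert assms(1) by (simp add: subgroup_int_pow_closed)
  ultimately show ?case using insert assms(1) by (simp add: subgroup.m_closed)
qed

lemma generate_image:
  assumes "finite I" "x \<in> I \<rightarrow> carrier G"
  shows "generate G (x ` I) = range (lincomb G x I)"
proof (intro equalityI subsetI)
  have sub: "x ` I \<subseteq> carrier G" using assms by auto
  fix y assume "y \<in> range (lincomb G x I)"
  then show "y \<in> generate G (x ` I)"
    using lincomb_subgroup[OF generate_is_subgroup[OF sub] assms(1)] by (auto intro: generate.incl)
next
  fix y assume "y \<in> generate G (x ` I)"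
  then show "y \<in> range (lincomb G x I)"
  proof (induction rule: generate.induct)
    case one
    then show ?case by (intro range_eqI[of _ _ "\<lambda>_. 0"]) (simp add: lincomb_zero)
  next
    case (incl h)
    then obtain a where a: "a \<in> I" "h = x a" by auto
    then show ?case using lincomb_single[OF assms a(1), of 1] assms
      by (intro range_eqI[of _ _ "\<lambda>i. if i = a then 1 else 0"]) (auto simp: Pi_iff)
  next
    case (inv h)
    then obtain a where a: "a \<in> I" "h = x a" by auto
    then show ?case using lincomb_single[OF assms a(1), of "-1"] assms
      by (intro range_eqI[of _ _ "\<lambda>i. if i = a then -1 else 0"]) (auto simp: Pi_iff int_pow_neg)
  next
    case (eng h1 h2)
    then obtain m1 m2 where "h1 = lincomb G x I m1" "h2 = lincomb G x I m2" by auto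
    then show ?case using lincomb_add[OF assms(2), of m1 m2] by (metis rangeI)
  qed
qed

text \<open>For subgroups, injectivity amounts to a trivial kernel. The functions \<open>y\<close>
  are arbitrary instead of extensional, which is harmless since \<open>finprod\<close> reads them
  only on \<open>I\<close> and which spares restrictions in applications.\<close>

lemma internal_direct_sum_iff:
  assumes A: "\<And>i. i \<in> I \<Longrightarrow> subgroup (A i) G"
  shows "internal_direct_sum G I A K \<longleftrightarrow> K = (\<lambda>y. finprod G y I) ` {y. \<forall>i\<in>I. y i \<in> A i} \<and>
    (\<forall>y. (\<forall>i\<in>I. y i \<in> A i) \<longrightarrow> finprod G y I = \<one> \<longrightarrow> (\<forall>i\<in>I. y i = \<one>))" (is "_ \<longleftrightarrow> ?R")
proof -
  let ?P = "product_group I (\<lambda>i. G\<lparr>carrier := A i\<rparr>)" and ?f = "\<lambda>x. finprod G x I"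
  have AG: "a \<in> A i \<Longrightarrow> i \<in> I \<Longrightarrow> a \<in> carrier G" for a i using A subgroup.mem_carrier by metis
  have im: "?f ` carrier ?P = ?f ` {y. \<forall>i\<in>I. y i \<in> A i}"
  proof (intro equalityI subsetI)
    fix z assume "z \<in> ?f ` {y. \<forall>i\<in>I. y i \<in> A i}"
    then obtain y where y: "\<forall>i\<in>I. y i \<in> A i" "z = ?f y" by auto
    have "?f (restrict y I) = ?f y" using y AG by (intro finprod_cong') auto
    moreover have "restrict y I \<in> carrier ?P" using y by auto
    ultimately show "z \<in> ?f ` carrier ?P" using y by (metis imageI)
  qed (auto simp: PiE_iff)
  have mult: "?f (x \<otimes>\<^bsub>?P\<^esub> y) = ?f x \<otimes> ?f y" if "x \<in> carrier ?P" "y \<in> carrier ?P" for x y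
  proof -
    have xy: "x \<in> I \<rightarrow> carrier G" "y \<in> I \<rightarrow> carrier G" using that AG by (auto simp: PiE_iff)
    have "?f (x \<otimes>\<^bsub>?P\<^esub> y) = finprod G (\<lambda>i. x i \<otimes> y i) I"
      using xy by (intro finprod_cong') auto
    then show ?thesis using xy by simp
  qed
  show ?thesis
  proof
    assume "internal_direct_sum G I A K"
    then have bij: "bij_betw ?f (carrier ?P) K"
      by (auto simp: internal_direct_sum_def iso_def)
    have "y i = \<one>" if y: "\<forall>i\<in>I. y i \<in> A i" "?f y = \<one>" "i \<in> I" for y i
    proof -
      have "?f (restrict y I) = ?f y" using y AG by (intro finprod_cong') auto
      also have "\<dots> = ?f (\<lambda>i\<in>I. \<one>)" using y(2) by (simp add: finprod_one_eqI)
      finally have "restrict y I = (\<lambda>i\<in>I. \<one>)"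
        using y A by (intro inj_onD[OF bij_betw_imp_inj_on[OF bij]]) (auto simp: subgroup.one_closed)
      then show ?thesis using y(3) by (metis restrict_apply')
    qed
    then show ?R using bij im by (auto simp: bij_betw_def)
  next
    assume R: ?R
    have "?f \<in> hom ?P (G\<lparr>carrier := K\<rparr>)"
      using R im mult by (intro homI) (auto simp del: carrier_product_group mult_product_group)
    moreover have "inj_on ?f (carrier ?P)"
    proof (rule inj_onI)
      fix x y assume xy: "x \<in> carrier ?P" "y \<in> carrier ?P" "?f x = ?f y"
      have c: "x \<in> I \<rightarrow> carrier G" "y \<in> I \<rightarrow> carrier G" using xy AG by (auto simp: PiE_iff)
      have "?f (\<lambda>i. x i \<otimes> inv y i) = ?f x \<otimes> ?f (\<lambda>i. inv y i)" using c by (intro finprod_multf) auto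
      moreover have "?f y \<otimes> ?f (\<lambda>i. inv y i) = ?f (\<lambda>i. y i \<otimes> inv y i)"
        using c by (intro finprod_multf[symmetric]) auto
      moreover have "?f (\<lambda>i. y i \<otimes> inv y i) = \<one>" using c by (intro finprod_one_eqI) (auto simp: Pi_iff)
      ultimately have "?f (\<lambda>i. x i \<otimes> inv y i) = \<one>" using xy(3) by simp
      moreover have "\<forall>i\<in>I. x i \<otimes> inv y i \<in> A i"
        using xy A by (auto simp: PiE_iff intro!: subgroup.m_closed subgroup.m_inv_closed)
      ultimately have 1: "x i \<otimes> inv y i = \<one>" if "i \<in> I" for i
        using R[THEN conjunct2, rule_format, of "\<lambda>i. x i \<otimes> inv y i" i] that by blast
      have "x i = y i" if "i \<in> I" for i
      proof -
        have "x i \<in> carrier G" "y i \<in> carrier G" using c that by auto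
        then show ?thesis using 1[OF that] by (metis inv_closed inv_equality inv_inv)
      qed
      then show "x = y" using xy by (auto simp: PiE_iff intro: extensionalityI)
    qed
    ultimately show "internal_direct_sum G I A K"
      using R im by (auto simp: internal_direct_sum_def iso_def bij_betw_def simp del: carrier_product_group)
  qed
qed

text \<open>Families in the cyclic subgroups are given by exponents. The conclusion is that the
  powers are trivial and not the exponents, as the elements may have finite order.\<close>

lemma independent_elements_iff:
  "independent_elements G I x \<longleftrightarrow> finite I \<and> (\<forall>i\<in>I. x i \<in> carrier G \<and> x i \<noteq> \<one>) \<and>
     (\<forall>m. lincomb G x I m = \<one> \<longrightarrow> (\<forall>i\<in>I. x i [^] m i = \<one>))"
proof (cases "finite I \<and> (\<forall>i\<in>I. x i \<in> carrier G)")
  case True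
  then have fin: "finite I" and xc: "x \<in> I \<rightarrow> carrier G" by auto
  have gen: "generate G {x i} = {x i [^] n | n::int. True}" if "i \<in> I" for i
    using generate_pow[of "x i"] xc that by auto
  have sub: "subgroup (generate G {x i}) G" if "i \<in> I" for i
    using xc that by (intro generate_is_subgroup) auto
  have ex: "\<exists>m. \<forall>i\<in>I. y i = x i [^] (m i::int)" if "\<forall>i\<in>I. y i \<in> generate G {x i}" for y
    using that gen by (intro bchoice) auto
  have eq: "finprod G y I = lincomb G x I m" if "\<forall>i\<in>I. y i = x i [^] (m i::int)" for y m
    unfolding lincomb_def using that xc by (intro finprod_cong') auto
  have "generate G (x ` I) = (\<lambda>y. finprod G y I) ` {y. \<forall>i\<in>I. y i \<in> generate G {x i}}"
    unfolding generate_image[OF fin xc]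
  proof (intro equalityI subsetI)
    fix z assume "z \<in> range (lincomb G x I)"
    then obtain m where "z = lincomb G x I m" by auto
    then have "z = finprod G (\<lambda>i. x i [^] m i) I" by (simp add: lincomb_def)
    then show "z \<in> (\<lambda>y. finprod G y I) ` {y. \<forall>i\<in>I. y i \<in> generate G {x i}}"
      using gen by (intro image_eqI[of _ _ "\<lambda>i. x i [^] m i"]) auto
  next
    fix z assume "z \<in> (\<lambda>y. finprod G y I) ` {y. \<forall>i\<in>I. y i \<in> generate G {x i}}"
    then obtain y where "\<forall>i\<in>I. y i \<in> generate G {x i}" "z = finprod G y I" by auto
    then show "z \<in> range (lincomb G x I)" using ex[of y] eq[of y] by auto
  qed
  moreover have "(\<forall>y. (\<forall>i\<in>I. y i \<in> generate G {x i}) \<longrightarrow> finprod G y I = \<one> \<longrightarrow> (\<forall>i\<in>I. y i = \<one>)) \<longleftrightarrow>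
     (\<forall>m. lincomb G x I m = \<one> \<longrightarrow> (\<forall>i\<in>I. x i [^] m i = \<one>))" (is "?L \<longleftrightarrow> ?R")
  proof
    assume L: ?L
    show ?R
    proof (intro allI impI)
      fix m assume "lincomb G x I m = \<one>"
      then have "finprod G (\<lambda>i. x i [^] m i) I = \<one>" by (simp add: lincomb_def)
      moreover have "\<forall>i\<in>I. x i [^] m i \<in> generate G {x i}" using gen by auto
      ultimately show "\<forall>i\<in>I. x i [^] m i = \<one>" using L[rule_format, of "\<lambda>i. x i [^] m i"] by blast
    qed
  next
    assume R: ?R
    show ?L
    proof (intro allI impI)
      fix y assume y: "\<forall>i\<in>I. y i \<in> generate G {x i}" "finprod G y I = \<one>"
      obtain m where m: "\<forall>i\<in>I. y i = x i [^] (m i::int)" using ex[OF y(1)] by blast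
      then have "lincomb G x I m = \<one>" using eq y by metis
      then show "\<forall>i\<in>I. y i = \<one>" using R m by simp
    qed
  qed
  ultimately show ?thesis
    using True internal_direct_sum_iff[where I = I and A = "\<lambda>i. generate G {x i}" and K = "generate G (x ` I)", OF sub]
    by (simp add: independent_elements_def)
next
  case False
  then show ?thesis by (auto simp: independent_elements_def)
qed

end

text \<open>A unimodular coordinate change of the first \<open>t + 1\<close> coordinates turning \<open>s\<close> into
  \<open>gcd(s) e\<^sub>0\<close>, built from 2 by 2 Bezout matrices.\<close>

lemma unimodular_gcd:
  fixes s :: "nat \<Rightarrow> nat"
  assumes s: "\<And>j. j \<le> t \<Longrightarrow> s j \<ge> 1"
  shows "\<exists>\<Theta> \<Theta>' :: (nat \<Rightarrow> int) \<Rightarrow> nat \<Rightarrow> int.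
    (\<forall>x y j. \<Theta> (\<lambda>i. x i + y i) j = \<Theta> x j + \<Theta> y j) \<and>
    (\<forall>x. \<Theta>' (\<Theta> x) = x) \<and> (\<forall>x. \<Theta> (\<Theta>' x) = x) \<and>
    (\<forall>x j. j > t \<longrightarrow> \<Theta> x j = x j) \<and> (\<forall>x. (\<forall>j\<le>t. x j = 0) \<longrightarrow> \<Theta> x = x) \<and>
    \<Theta> (\<lambda>i. if i \<le> t then int (s i) else 0) = (\<lambda>j. if j = 0 then int (Gcd (s ` {0..t})) else 0)"
  using s
proof (induction t)
  case 0
  show ?case
    by (intro exI[of _ "\<lambda>x. x"]) auto
next
  case (Suc t)
  from Suc.IH Suc.prems obtain \<Theta> \<Theta>' :: "(nat \<Rightarrow> int) \<Rightarrow> nat \<Rightarrow> int" where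
    *: "(\<forall>x y j. \<Theta> (\<lambda>i. x i + y i) j = \<Theta> x j + \<Theta> y j) \<and>
    (\<forall>x. \<Theta>' (\<Theta> x) = x) \<and> (\<forall>x. \<Theta> (\<Theta>' x) = x) \<and>
    (\<forall>x j. j > t \<longrightarrow> \<Theta> x j = x j) \<and> (\<forall>x. (\<forall>j\<le>t. x j = 0) \<longrightarrow> \<Theta> x = x) \<and>
    \<Theta> (\<lambda>i. if i \<le> t then int (s i) else 0) = (\<lambda>j. if j = 0 then int (Gcd (s ` {0..t})) else 0)"
    by (auto simp del: atLeastAtMost_iff image_iff)
  have add: "\<Theta> (\<lambda>i. x i + y i) j = \<Theta> x j + \<Theta> y j" for x y j using * by blast
  have inv: "\<Theta>' (\<Theta> x) = x" "\<Theta> (\<Theta>' x) = x" for x using * by blast+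
  \<comment> \<open>These two facts keep coordinate \<open>Suc t\<close> out of reach of
    \<open>\<Theta>\<close>: it is preserved, and a vector supported on it is fixed. So the new
    entry of \<open>s\<close> can be treated after the old ones.\<close>
  have off: "\<Theta> x j = x j" if "j > t" for x j using * that by blast
  have fix0: "\<Theta> x = x" if "\<And>j. j \<le> t \<Longrightarrow> x j = 0" for x using * that by blast
  have gs: "\<Theta> (\<lambda>i. if i \<le> t then int (s i) else 0) = (\<lambda>j. if j = 0 then int (Gcd (s ` {0..t})) else 0)"
    using * by blast
  define n where "n = int (Gcd (s ` {0..t}))"
  define q where "q = int (s (Suc t))"
  define d where "d = gcd n q"
  have q: "q \<ge> 1" using Suc.prems[of "Suc t"] by (simp add: q_def)
  then have d0: "d > 0" by (simp add: d_def)
  obtain a b where ab: "a * n + b * q = d" using bezout_int[of n q] by (auto simp: d_def)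
  obtain n' q' where n': "n = d * n'" and q': "q = d * q'"
    unfolding d_def by (meson dvdE gcd_dvd1 gcd_dvd2)
  have "d * (a * n' + b * q') = d * 1" using ab unfolding n' q' by (simp add: algebra_simps)
  then have det: "a * n' + b * q' = 1" using d0 by (metis less_irrefl mult_cancel_left)
  have gd: "int (Gcd (s ` {0..Suc t})) = d"
  proof -
    have "s ` {0..Suc t} = insert (s (Suc t)) (s ` {0..t})" by (auto simp: atLeastAtMostSuc_conv)
    then show ?thesis by (simp add: d_def n_def q_def gcd.commute)
  qed
  \<comment> \<open>On the coordinates 0 and \<open>Suc t\<close> this is the matrix with rows
    \<open>(a, b)\<close> and \<open>(- q', n')\<close>, whose determinant is 1 by
    \<open>det\<close>. It sends \<open>(n, q)\<close> to \<open>(d, 0)\<close>, and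
    \<open>M'\<close> is its inverse.\<close>
  define M where "M = (\<lambda>(x::nat \<Rightarrow> int) j. if j = 0 then a * x 0 + b * x (Suc t)
    else if j = Suc t then n' * x (Suc t) - q' * x 0 else x j)"
  define M' where "M' = (\<lambda>(x::nat \<Rightarrow> int) j. if j = 0 then n' * x 0 - b * x (Suc t)
    else if j = Suc t then q' * x 0 + a * x (Suc t) else x j)"
  have M1: "M' (M x) = x" for x
  proof
    fix j
    have "n' * (a * x 0 + b * x (Suc t)) - b * (n' * x (Suc t) - q' * x 0) = (a * n' + b * q') * x 0"
      "q' * (a * x 0 + b * x (Suc t)) + a * (n' * x (Suc t) - q' * x 0) = (a * n' + b * q') * x (Suc t)"
      by (simp_all add: algebra_simps)
    then show "M' (M x) j = x j" by (auto simp: M_def M'_def det)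
  qed
  have M2: "M (M' x) = x" for x
  proof
    fix j
    have "a * (n' * x 0 - b * x (Suc t)) + b * (q' * x 0 + a * x (Suc t)) = (a * n' + b * q') * x 0"
      "n' * (q' * x 0 + a * x (Suc t)) - q' * (n' * x 0 - b * x (Suc t)) = (a * n' + b * q') * x (Suc t)"
      by (simp_all add: algebra_simps)
    then show "M (M' x) j = x j" by (auto simp: M_def M'_def det)
  qed
  have Madd: "M (\<lambda>i. x i + y i) j = M x j + M y j" for x y j
    by (auto simp: M_def algebra_simps)
  have "(\<lambda>i. if i \<le> Suc t then int (s i) else 0) =
      (\<lambda>i. (if i \<le> t then int (s i) else 0) + (if i = Suc t then q else 0))"
    by (auto simp: q_def)
  then have "\<Theta> (\<lambda>i. if i \<le> Suc t then int (s i) else 0) j =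
      (if j = 0 then n else 0) + (if j = Suc t then q else 0)" for j
    using fix0[of "\<lambda>i. if i = Suc t then q else 0"] by (simp add: add gs n_def)
  then have "M (\<Theta> (\<lambda>i. if i \<le> Suc t then int (s i) else 0)) j = (if j = 0 then d else 0)" for j
    using ab by (auto simp: M_def n' q')
  then have "M (\<Theta> (\<lambda>i. if i \<le> Suc t then int (s i) else 0)) =
      (\<lambda>j. if j = 0 then int (Gcd (s ` {0..Suc t})) else 0)"
    unfolding gd by blast
  moreover have "M (\<Theta> x) j = x j" if "j > Suc t" for x j
    using that off[of j x] by (simp add: M_def)
  moreover have "M (\<Theta> x) = x" if "\<forall>j\<le>Suc t. x j = 0" for x
    using that fix0[of x] by (auto simp: M_def)
  ultimately show ?case
    by (intro exI[of _ "\<lambda>x. M (\<Theta> x)"] exI[of _ "\<lambda>x. \<Theta>' (M' x)"])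
      (simp add: M1 M2 inv add[THEN ext] Madd)
qed

section \<open>The relations of the classes\<close>

context comm_group
begin

lemma lincomb_const:
  assumes "finite I" "x \<in> I \<rightarrow> carrier G"
  shows "lincomb G x I (\<lambda>_. n) = finprod G x I [^] (n::int)"
  using assms
proof (induction I)
  case (insert a I)
  then have c: "x \<in> I \<rightarrow> carrier G" "x a \<in> carrier G" by auto
  have "lincomb G x (insert a I) (\<lambda>_. n) = x a [^] n \<otimes> lincomb G x I (\<lambda>_. n)"
    unfolding lincomb_def using insert c by (intro finprod_insert) auto
  then show ?case using insert c by (simp add: int_pow_distrib)
qed (simp add: lincomb_def)

lemma lincomb_swap:
  assumes "finite A" "finite B" "x \<in> A \<times> B \<rightarrow> carrier G"
  shows "lincomb G x (A \<times> B) m = finprod G (\<lambda>b. lincomb G (\<lambda>a. x (a, b)) A (\<lambda>a. m (a, b))) B"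
proof -
  have eq: "A \<times> B = prod.swap ` (B \<times> A)" by auto
  have "lincomb G x (A \<times> B) m = lincomb G (x \<circ> prod.swap) (B \<times> A) (m \<circ> prod.swap)"
    unfolding eq using assms(3) by (intro lincomb_reindex) auto
  also have "\<dots> = finprod G (\<lambda>b. lincomb G (\<lambda>a. (x \<circ> prod.swap) (b, a)) A (\<lambda>a. (m \<circ> prod.swap) (b, a))) B"
    using assms by (intro lincomb_Times) auto
  finally show ?thesis by simp
qed

end

section \<open>Abelian groups with the relations of a grid\<close>

text \<open>The relations in the asymmetric form suggested by the class structure:
  \<open>column\<close> expresses row 0 by the other rows, \<open>row_rel\<close> describes the
  relations within each of these, and \<open>rows\<close> excludes relations between them.\<close>

locale grid_group = comm_group C for C :: "('c, 'm) monoid_scheme" (structure) +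
  fixes \<gamma> :: "nat \<times> nat \<Rightarrow> 'c" and k t :: nat and s :: "nat \<Rightarrow> nat"
  assumes gamma: "\<gamma> \<in> grid k t \<rightarrow> carrier C"
    and row_rel: "a \<in> {1..k} \<Longrightarrow>
      lincomb C (\<lambda>j. \<gamma> (a, j)) {0..t} u = \<one> \<longleftrightarrow> (\<exists>c::int. \<forall>j\<le>t. u j = c * int (s j))"
    and rows: "finprod C (\<lambda>i. lincomb C (\<lambda>j. \<gamma> (i, j)) {0..t} (m i)) {1..k} = \<one> \<Longrightarrow>
      i \<in> {1..k} \<Longrightarrow> lincomb C (\<lambda>j. \<gamma> (i, j)) {0..t} (m i) = \<one>"
    and column: "j \<le> t \<Longrightarrow> finprod C (\<lambda>i. \<gamma> (i, j)) {0..k} = \<one>"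
begin

abbreviation row where "row i u \<equiv> lincomb C (\<lambda>j. \<gamma> (i, j)) {0..t} u"

lemma gamma_closed: "i \<le> k \<Longrightarrow> j \<le> t \<Longrightarrow> \<gamma> (i, j) \<in> carrier C"
  using gamma by (auto simp: grid_def)

lemma gamma_row: "i \<le> k \<Longrightarrow> (\<lambda>j. \<gamma> (i, j)) \<in> {0..t} \<rightarrow> carrier C"
  using gamma_closed by auto

text \<open>Subtracting the exponents of row 0 from all rows divides by powers of the column
  products, which are trivial; row 0 then disappears.\<close>

lemma grid_lincomb:
  "lincomb C \<gamma> (grid k t) m = finprod C (\<lambda>i. row i (\<lambda>j. m (i, j) - m (0, j))) {1..k}"
proof -
  have g: "\<gamma> \<in> {0..k} \<times> {0..t} \<rightarrow> carrier C" using gamma by (simp add: grid_def)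
  have "lincomb C \<gamma> (grid k t) (\<lambda>(i, j). m (0, j)) = finprod C (\<lambda>j. lincomb C (\<lambda>i. \<gamma> (i, j)) {0..k} (\<lambda>i. m (0, j))) {0..t}"
    unfolding grid_def by (subst lincomb_swap[OF _ _ g]) auto
  also have "\<dots> = \<one>"
  proof (rule finprod_one_eqI)
    fix j assume j: "j \<in> {0..t}"
    have "lincomb C (\<lambda>i. \<gamma> (i, j)) {0..k} (\<lambda>i. m (0, j)) = finprod C (\<lambda>i. \<gamma> (i, j)) {0..k} [^] m (0, j)"
      using j gamma_closed by (intro lincomb_const) auto
    then show "lincomb C (\<lambda>i. \<gamma> (i, j)) {0..k} (\<lambda>i. m (0, j)) = \<one>" using column[of j] j by simp
  qed
  finally have zero: "lincomb C \<gamma> (grid k t) (\<lambda>(i, j). m (0, j)) = \<one>" .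
  have "lincomb C \<gamma> (grid k t) (\<lambda>x. m x - (case x of (i, j) \<Rightarrow> m (0, j))) = lincomb C \<gamma> (grid k t) m"
    unfolding lincomb_diff[OF gamma] zero using gamma by simp
  then have "lincomb C \<gamma> (grid k t) m = lincomb C \<gamma> ({0..k} \<times> {0..t}) (\<lambda>x. m x - (case x of (i, j) \<Rightarrow> m (0, j)))"
    by (simp add: grid_def)
  also have "\<dots> = finprod C (\<lambda>i. row i (\<lambda>j. m (i, j) - m (0, j))) {0..k}"
    by (subst lincomb_Times[OF _ _ g]) auto
  also have "{0..k} = insert 0 {1..k}" by auto
  also have "finprod C (\<lambda>i. row i (\<lambda>j. m (i, j) - m (0, j))) (insert 0 {1..k}) =
      row 0 (\<lambda>j. m (0, j) - m (0, j)) \<otimes> finprod C (\<lambda>i. row i (\<lambda>j. m (i, j) - m (0, j))) {1..k}"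
    using gamma_row by (intro finprod_insert) auto
  also have "row 0 (\<lambda>j. m (0, j) - m (0, j)) = \<one>" by (rule lincomb_zero) simp
  finally show ?thesis using gamma_row by (simp add: Pi_iff)
qed

text \<open>The right-hand side says that \<open>m (i, j)\<close> is \<open>c i * s j\<close> plus a
  term depending only on \<open>j\<close>, which is the shape of the counts in
  \<open>grid_monoid\<close>. This symmetric form links class groups with grids of prime
  divisors.\<close>

lemma grid_rel:
  "lincomb C \<gamma> (grid k t) m = \<one> \<longleftrightarrow>
    (\<exists>c::nat \<Rightarrow> int. \<forall>i\<in>{1..k}. \<forall>j\<in>{0..t}. m (i, j) - m (0, j) = c i * int (s j))"
proof -
  have "lincomb C \<gamma> (grid k t) m = \<one> \<longleftrightarrow> (\<forall>i\<in>{1..k}. row i (\<lambda>j. m (i, j) - m (0, j)) = \<one>)"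
    unfolding grid_lincomb using rows[of "\<lambda>i j. m (i, j) - m (0, j)"] by (auto intro: finprod_one_eqI)
  also have "\<dots> \<longleftrightarrow> (\<forall>i\<in>{1..k}. \<exists>c::int. \<forall>j\<le>t. m (i, j) - m (0, j) = c * int (s j))"
    using row_rel by auto
  also have "\<dots> \<longleftrightarrow> (\<exists>c::nat \<Rightarrow> int. \<forall>i\<in>{1..k}. \<forall>j\<le>t. m (i, j) - m (0, j) = c i * int (s j))"
    by (rule bchoice_iff)
  finally show ?thesis by (simp add: Ball_def)
qed

end

text \<open>Converse of \<open>grid_rel\<close>: the conditions on rows are tested on exponents that
  vanish on row 0, and the condition on column \<open>j\<close> on the exponents that are 1 on this
  column and 0 elsewhere.\<close>

lemma grid_groupI:
  assumes C: "comm_group C" and gamma: "\<gamma> \<in> grid k t \<rightarrow> carrier C"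
    and rel: "\<And>m. lincomb C \<gamma> (grid k t) m = \<one>\<^bsub>C\<^esub> \<longleftrightarrow>
      (\<exists>c::nat \<Rightarrow> int. \<forall>i\<in>{1..k}. \<forall>j\<in>{0..t}. m (i, j) - m (0, j) = c i * int (s j))"
  shows "grid_group C \<gamma> k t s"
proof -
  interpret comm_group C by fact
  have g: "\<gamma> \<in> {0..k} \<times> {0..t} \<rightarrow> carrier C" using gamma by (simp add: grid_def)
  have grow: "(\<lambda>j. \<gamma> (i, j)) \<in> {0..t} \<rightarrow> carrier C" if "i \<le> k" for i using g that by auto
  let ?row = "\<lambda>i u. lincomb C (\<lambda>j. \<gamma> (i, j)) {0..t} u"
  have times: "lincomb C \<gamma> (grid k t) m = finprod C (\<lambda>i. ?row i (\<lambda>j. m (i, j))) {0..k}" for m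
    unfolding grid_def by (rule lincomb_Times[OF _ _ g]) auto
  have row_grid: "?row a u = lincomb C \<gamma> (grid k t) (\<lambda>(i, j). if i = a then u j else 0)" if a: "a \<le> k" for a u
  proof -
    have "lincomb C \<gamma> (grid k t) (\<lambda>(i, j). if i = a then u j else 0)
        = finprod C (\<lambda>i. if i = a then ?row i u else \<one>\<^bsub>C\<^esub>) {0..k}"
      unfolding times using grow by (intro finprod_cong') (auto simp: lincomb_zero)
    also have "\<dots> = ?row a u" using a grow by (intro finprod_singleton_swap) auto
    finally show ?thesis by simp
  qed
  show ?thesis
  proof
    show "\<gamma> \<in> grid k t \<rightarrow> carrier C" by fact
  next
    fix a u assume a: "a \<in> {1..k}"
    have "?row a u = \<one>\<^bsub>C\<^esub> \<longleftrightarrow> (\<exists>c::nat \<Rightarrow> int. \<forall>i\<in>{1..k}. \<forall>j\<in>{0..t}. (if i = a then u j else 0) = c i * int (s j))"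
      using a by (simp add: row_grid rel)
    also have "\<dots> \<longleftrightarrow> (\<exists>c::int. \<forall>j\<le>t. u j = c * int (s j))"
    proof
      assume "\<exists>c::nat \<Rightarrow> int. \<forall>i\<in>{1..k}. \<forall>j\<in>{0..t}. (if i = a then u j else 0) = c i * int (s j)"
      then obtain c :: "nat \<Rightarrow> int" where "\<forall>i\<in>{1..k}. \<forall>j\<in>{0..t}. (if i = a then u j else 0) = c i * int (s j)" by blast
      from bspec[OF this a] show "\<exists>c::int. \<forall>j\<le>t. u j = c * int (s j)" by auto
    next
      assume "\<exists>c::int. \<forall>j\<le>t. u j = c * int (s j)"
      then obtain c :: int where "\<forall>j\<le>t. u j = c * int (s j)" by blast
      then show "\<exists>c::nat \<Rightarrow> int. \<forall>i\<in>{1..k}. \<forall>j\<in>{0..t}. (if i = a then u j else 0) = c i * int (s j)"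
        by (intro exI[of _ "\<lambda>i. if i = a then c else 0"]) auto
    qed
    finally show "?row a u = \<one>\<^bsub>C\<^esub> \<longleftrightarrow> (\<exists>c::int. \<forall>j\<le>t. u j = c * int (s j))" .
  next
    fix m i assume one: "finprod C (\<lambda>i. ?row i (m i)) {1..k} = \<one>\<^bsub>C\<^esub>" and i: "i \<in> {1..k}"
    have "lincomb C \<gamma> (grid k t) (\<lambda>(i, j). if i = 0 then 0 else m i j) =
        finprod C (\<lambda>i. ?row i (\<lambda>j. if i = 0 then 0 else m i j)) {0..k}" unfolding times by simp
    also have "{0..k} = insert 0 {1..k}" by auto
    also have "finprod C (\<lambda>i. ?row i (\<lambda>j. if i = 0 then 0 else m i j)) (insert 0 {1..k}) =
        ?row 0 (\<lambda>j. if (0::nat) = 0 then 0 else m 0 j) \<otimes>\<^bsub>C\<^esub> finprod C (\<lambda>i. ?row i (\<lambda>j. if i = 0 then 0 else m i j)) {1..k}"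
      using grow by (intro finprod_insert) auto
    also have "?row 0 (\<lambda>j. if (0::nat) = 0 then 0 else m 0 j) = \<one>\<^bsub>C\<^esub>" by (rule lincomb_zero) simp
    also have "finprod C (\<lambda>i. ?row i (\<lambda>j. if i = 0 then 0 else m i j)) {1..k} = finprod C (\<lambda>i. ?row i (m i)) {1..k}"
      using grow by (intro finprod_cong') auto
    finally have "lincomb C \<gamma> (grid k t) (\<lambda>(i, j). if i = 0 then 0 else m i j) = \<one>\<^bsub>C\<^esub>" using one by simp
    then obtain c :: "nat \<Rightarrow> int" where c: "\<forall>i\<in>{1..k}. \<forall>j\<in>{0..t}. m i j = c i * int (s j)"
      unfolding rel by (auto split: if_splits)
    have "lincomb C \<gamma> (grid k t) (\<lambda>(i', j). if i' = i then m i j else 0) = \<one>\<^bsub>C\<^esub>"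
      unfolding rel using c i by (intro exI[of _ "\<lambda>i'. if i' = i then c i else 0"]) auto
    then show "?row i (m i) = \<one>\<^bsub>C\<^esub>" using row_grid[of i "m i"] i by simp
  next
    fix j assume j: "j \<le> t"
    have "lincomb C \<gamma> (grid k t) (\<lambda>(i, j'). if j' = j then 1 else 0) =
        finprod C (\<lambda>i. lincomb C (\<lambda>j. \<gamma> (i, j)) {0..t} (\<lambda>j'. if j' = j then 1 else 0)) {0..k}" unfolding times by simp
    also have "\<dots> = finprod C (\<lambda>i. \<gamma> (i, j)) {0..k}"
      using j g grow lincomb_single[OF _ grow, where a = j and n = 1] by (intro finprod_cong') (auto simp: Pi_iff)
    finally have "finprod C (\<lambda>i. \<gamma> (i, j)) {0..k} = lincomb C \<gamma> (grid k t) (\<lambda>(i, j'). if j' = j then 1 else 0)" by simp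
    also have "\<dots> = \<one>\<^bsub>C\<^esub>" unfolding rel by (intro exI[of _ "\<lambda>_. 0"]) simp
    finally show "finprod C (\<lambda>i. \<gamma> (i, j)) {0..k} = \<one>\<^bsub>C\<^esub>" .
  qed
qed

section \<open>Distinctness, orders and independence of the grid elements\<close>

locale proper_grid_group = grid_group +
  assumes k1: "k \<ge> 1" and s1: "j \<le> t \<Longrightarrow> s j \<ge> 1" and ks: "k + 1 \<noteq> (\<Sum>j=0..t. s j)"
    and s2: "(\<Sum>j=0..t. s j) \<ge> 2"
begin

definition ssum :: nat where "ssum = (\<Sum>j=0..t. s j)"

lemma ssum_sum: "(\<Sum>j\<in>{0..t}. c * int (s j)) = c * int ssum"
  by (simp add: ssum_def sum_distrib_left)

text \<open>In a relation, the exponents of a row minus those of row 0 sum to a multiple of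
  \<open>ssum\<close>. A single element contributes 1 or -1 to such a sum, so this excludes unwanted
  relations.\<close>

lemma ssum_not_1: "c * int ssum \<noteq> 1" "c * int ssum \<noteq> -1"
proof -
  have "int ssum > 1" using s2 unfolding ssum_def by linarith
  then show "c * int ssum \<noteq> 1" "c * int ssum \<noteq> -1"
    by (metis abs_zmult_eq_1 abs_1 abs_of_nat less_irrefl mult.commute, metis abs_zmult_eq_1 abs_1 abs_minus_cancel abs_of_nat less_irrefl mult.commute)
qed

text \<open>An equality of two grid elements is a relation with exponents 1 and -1. Within one row,
  the product of the two entries would be -1, but it is a square times a nonnegative number. In two
  rows other than row 0, one of them sums to 1. If row 0 is involved, a third row sums to 1 or -1;
  for \<open>k = 1\<close> there is no third row, and \<open>ks\<close> is used.\<close>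

theorem gamma_inj: "inj_on \<gamma> (grid k t)"
proof (rule inj_onI, rule ccontr)
  fix x y assume xy: "x \<in> grid k t" "y \<in> grid k t" "\<gamma> x = \<gamma> y" "x \<noteq> y"
  obtain a b a' b' where ab: "x = (a, b)" "y = (a', b')" "a \<le> k" "b \<le> t" "a' \<le> k" "b' \<le> t"
    using xy(1,2) unfolding grid_def by (elim SigmaE) simp
  define m where "m = (\<lambda>z. (if z = x then 1 else 0) - (if z = y then 1 else 0 :: int))"
  have "lincomb C \<gamma> (grid k t) m = \<gamma> x [^] (1::int) \<otimes> inv (\<gamma> y [^] (1::int))"
    unfolding m_def using lincomb_diff[OF gamma] lincomb_single[OF finite_grid gamma] xy by simp
  then have "lincomb C \<gamma> (grid k t) m = \<one>" using xy gamma by (auto simp: Pi_iff)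
  then obtain c :: "nat \<Rightarrow> int" where c: "\<And>i j. i \<in> {1..k} \<Longrightarrow> j \<le> t \<Longrightarrow> m (i, j) - m (0, j) = c i * int (s j)"
    unfolding grid_rel by fastforce
  have sum: "(if i = a then 1 else 0) - (if i = a' then 1 else 0) - (if 0 = a then 1 else 0) + (if 0 = a' then 1 else 0) = c i * int ssum"
    if i: "i \<in> {1..k}" for i
  proof -
    have ms: "(\<Sum>j\<in>{0..t}. m (i, j)) = (if i = a then 1 else 0) - (if i = a' then 1 else 0)" for i
      using ab(4,6) by (auto simp: m_def ab(1,2) sum_subtractf)
    have "(\<Sum>j\<in>{0..t}. m (i, j) - m (0, j)) = (\<Sum>j\<in>{0..t}. c i * int (s j))"
      using c[OF i] by (intro sum.cong) auto
    then show ?thesis unfolding sum_subtractf ms ssum_sum by simp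
  qed
  show False
  proof (cases "a = a'")
    case True
    then have bb: "b \<noteq> b'" using xy ab by auto
    \<comment> \<open>If both points lie in row 0, their exponents are seen with opposite sign in
      row 1.\<close>
    define i where "i = (if a = 0 then 1 else a)"
    have i: "i \<in> {1..k}" using k1 ab by (auto simp: i_def)
    have "(c i * int (s b)) * (c i * int (s b')) = -1"
      using c[OF i ab(4)] c[OF i ab(6)] bb True by (auto simp: m_def ab(1,2) i_def split: if_splits)
    moreover have "(c i * int (s b)) * (c i * int (s b')) = (c i * c i) * int (s b * s b')" by simp
    moreover have "\<dots> \<ge> 0" by simp
    ultimately show False by linarith
  next
    case False
    consider "a \<noteq> 0" "a' \<noteq> 0" | "a = 0 \<or> a' = 0" by auto
    then show False
    proof cases
      case 1
      then have "a \<in> {1..k}" using ab by auto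
      from sum[OF this] show False using 1 False ssum_not_1 by (auto split: if_splits)
    next
      case 2
      define o' where "o' = (if a = 0 then a' else a)"
      have o': "o' \<in> {1..k}" using 2 False ab by (auto simp: o'_def)
      show False
      proof (cases "k = 1")
        case True
        \<comment> \<open>With two rows only, one entry is counted positively and the subtracted row
          0 contributes the same sign once more. Then \<open>ssum\<close> divides 2, so it equals
          \<open>k + 1\<close>.\<close>
        have "c o' * int ssum = 2 \<or> c o' * int ssum = -2"
          using sum[OF o'] 2 False by (auto simp: o'_def split: if_splits)
        then have "int ssum dvd 2" by (metis dvd_minus_iff dvd_triv_right)
        then have "int ssum \<le> 2" by (rule zdvd_imp_le) simp
        then show False using s2 ks True unfolding ssum_def by linarith
      next
        case False
        then obtain i where i: "i \<in> {1..k}" "i \<noteq> o'"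
          using k1 by (cases "o' = 1") (auto intro: that[of 2] that[of 1])
        then have "c i * int ssum = 1 \<or> c i * int ssum = -1"
          using sum[OF i(1)] 2 \<open>a \<noteq> a'\<close> by (auto simp: o'_def split: if_splits)
        then show False using ssum_not_1 by blast
      qed
    qed
  qed
qed

end

context proper_grid_group
begin

lemma row_subset:
  assumes i: "i \<in> {1..k}" and J: "J \<subseteq> {0..t}"
  shows "lincomb C (\<lambda>j. \<gamma> (i, j)) J u = row i (\<lambda>j. if j \<in> J then u j else 0)"
proof -
  have c: "(\<lambda>j. \<gamma> (i, j)) \<in> {0..t} \<rightarrow> carrier C" "(\<lambda>j. \<gamma> (i, j)) \<in> J \<rightarrow> carrier C"
    using i J gamma_closed by auto
  have "lincomb C (\<lambda>j. \<gamma> (i, j)) J u = lincomb C (\<lambda>j. \<gamma> (i, j)) J (\<lambda>j. if j \<in> J then u j else 0)"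
    by (rule lincomb_cong[OF c(2)]) simp
  also have "\<dots> = row i (\<lambda>j. if j \<in> J then u j else 0)"
    using J c by (intro lincomb_mono) auto
  finally show ?thesis .
qed

lemma row_single: "i \<in> {1..k} \<Longrightarrow> j \<le> t \<Longrightarrow> \<gamma> (i, j) [^] (n::int) = row i (\<lambda>j'. if j' = j then n else 0)"
  using gamma_row[of i] by (subst lincomb_single) auto

lemma gamma_pow_eq_one:
  assumes i: "i \<in> {1..k}" and j: "j \<le> t"
  shows "\<gamma> (i, j) [^] (n::int) = \<one> \<longleftrightarrow> (\<exists>c::int. \<forall>j'\<le>t. (if j' = j then n else 0) = c * int (s j'))"
  unfolding row_single[OF assms] by (rule row_rel[OF i])

text \<open>For \<open>t > 0\<close> the row has a second column, whose exponent is 0. This forces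
  the multiple of \<open>s\<close> in \<open>row_rel\<close> to be trivial.\<close>

lemma gamma_pow_eq_one_pos:
  assumes i: "i \<in> {1..k}" and j: "j \<le> t" and t: "t > 0"
  shows "\<gamma> (i, j) [^] (n::int) = \<one> \<longleftrightarrow> n = 0"
proof
  assume "\<gamma> (i, j) [^] n = \<one>"
  then obtain c :: int where c: "\<And>j'. j' \<le> t \<Longrightarrow> (if j' = j then n else 0) = c * int (s j')"
    unfolding gamma_pow_eq_one[OF i j] by blast
  obtain j' where j': "j' \<le> t" "j' \<noteq> j" using t by (metis le0 less_irrefl order_refl)
  have "c = 0" using c[OF j'(1)] j'(2) s1[OF j'(1)] by simp
  then show "n = 0" using c[OF j] by simp
next
  assume "n = 0"
  then show "\<gamma> (i, j) [^] n = \<one>" using i j gamma_closed by simp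
qed

lemma gamma_not_one:
  assumes i: "i \<in> {1..k}" and j: "j \<le> t"
  shows "\<gamma> (i, j) \<noteq> \<one>"
proof
  assume "\<gamma> (i, j) = \<one>"
  then have "\<gamma> (i, j) [^] (1::int) = \<one>" by simp
  then obtain c :: int where c: "\<And>j'. j' \<le> t \<Longrightarrow> (if j' = j then 1 else 0) = c * int (s j')"
    unfolding gamma_pow_eq_one[OF i j] by blast
  have "(\<Sum>j'\<in>{0..t}. if j' = j then 1 else 0) = (\<Sum>j'\<in>{0..t}. c * int (s j'))"
    using c by (intro sum.cong) auto
  then have "c * int ssum = 1" using j unfolding ssum_sum by simp
  then show False using ssum_not_1 by blast
qed

lemma generate_row: "i \<in> {1..k} \<Longrightarrow> generate C ((\<lambda>j. \<gamma> (i, j)) ` {1..t} \<union> {\<gamma> (i, 0)}) = range (row i)"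
proof -
  assume i: "i \<in> {1..k}"
  have "{0..t} = insert 0 {1..t}" by auto
  then have "(\<lambda>j. \<gamma> (i, j)) ` {1..t} \<union> {\<gamma> (i, 0)} = (\<lambda>j. \<gamma> (i, j)) ` {0..t}" by auto
  then show ?thesis using generate_image[OF _ gamma_row, of i] i by simp
qed

lemma row_range_subgroup: "i \<in> {1..k} \<Longrightarrow> subgroup (range (row i)) C"
  using generate_image[OF _ gamma_row, of i] generate_is_subgroup[of "(\<lambda>j. \<gamma> (i, j)) ` {0..t}"] gamma_row[of i]
  by (auto simp: Pi_iff image_subset_iff)

lemma range_row_ex: "\<forall>i\<in>{1..k}. y i \<in> range (row i) \<Longrightarrow> \<exists>m. \<forall>i\<in>{1..k}. y i = row i (m i)"
  by (intro bchoice) auto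

lemma direct_sum_rows:
  assumes gen: "carrier C = range (lincomb C \<gamma> (grid k t))"
  shows "internal_direct_sum C {1..k} (\<lambda>i. range (row i)) (carrier C)"
proof -
  have A: "carrier C = (\<lambda>y. finprod C y {1..k}) ` {y. \<forall>i\<in>{1..k}. y i \<in> range (row i)}"
  proof (intro equalityI subsetI)
    fix x assume "x \<in> carrier C"
    then obtain m where "x = lincomb C \<gamma> (grid k t) m" using gen by auto
    then show "x \<in> (\<lambda>y. finprod C y {1..k}) ` {y. \<forall>i\<in>{1..k}. y i \<in> range (row i)}"
      unfolding grid_lincomb by blast
  next
    fix x assume "x \<in> (\<lambda>y. finprod C y {1..k}) ` {y. \<forall>i\<in>{1..k}. y i \<in> range (row i)}"
    then show "x \<in> carrier C"
      using subgroup.mem_carrier[OF row_range_subgroup] by (auto intro!: finprod_closed)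
  qed
  have B: "\<forall>i\<in>{1..k}. y i = \<one>"
    if y: "\<forall>i\<in>{1..k}. y i \<in> range (row i)" "finprod C y {1..k} = \<one>" for y
  proof -
    obtain m where m: "\<forall>i\<in>{1..k}. y i = row i (m i)" using range_row_ex[OF y(1)] by blast
    have "finprod C (\<lambda>i. row i (m i)) {1..k} = finprod C y {1..k}"
      using m subgroup.mem_carrier[OF row_range_subgroup] y(1) by (intro finprod_cong') auto
    then show ?thesis using rows[of m] m y(2) by auto
  qed
  show ?thesis
  proof (rule iffD2[OF internal_direct_sum_iff])
    show "carrier C = (\<lambda>y. finprod C y {1..k}) ` {y. \<forall>i\<in>{1..k}. y i \<in> range (row i)} \<and>
      (\<forall>y. (\<forall>i\<in>{1..k}. y i \<in> range (row i)) \<longrightarrow> finprod C y {1..k} = \<one> \<longrightarrow> (\<forall>i\<in>{1..k}. y i = \<one>))"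
      using A B by blast
  qed (rule row_range_subgroup)
qed

lemma independent_e: "independent_elements C ({1..k} \<times> {1..t}) (\<lambda>(i, j). \<gamma> (i, j))"
proof -
  have g: "\<gamma> \<in> {1..k} \<times> {1..t} \<rightarrow> carrier C" using gamma_closed by auto
  have "\<gamma> (i, j) [^] m (i, j) = \<one>"
    if one: "lincomb C \<gamma> ({1..k} \<times> {1..t}) m = \<one>" and ij: "i \<in> {1..k}" "j \<in> {1..t}" for m i j
  proof -
    let ?u = "\<lambda>i j. if j \<in> {1..t} then m (i, j) else 0"
    have "finprod C (\<lambda>i. row i (?u i)) {1..k} = finprod C (\<lambda>i. lincomb C (\<lambda>j. \<gamma> (i, j)) {1..t} (\<lambda>j. m (i, j))) {1..k}"
      using gamma_row gamma_closed row_subset[of _ "{1..t}"]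
      by (intro finprod_cong' refl) (auto intro!: lincomb_closed)
    also have "\<dots> = \<one>" using one lincomb_Times[OF _ _ g, of m] by simp
    finally have "row i (?u i) = \<one>" using rows[of ?u i] ij by blast
    then obtain c :: int where c: "\<And>j. j \<le> t \<Longrightarrow> ?u i j = c * int (s j)"
      using row_rel[OF ij(1), of "?u i"] by blast
    \<comment> \<open>Column 0 is left out of the combination, so it has exponent 0.\<close>
    have "c = 0" using c[of 0] s1[of 0] by simp
    then have "m (i, j) = 0" using c[of j] ij by simp
    then show ?thesis by simp
  qed
  moreover have "(\<lambda>(i, j). \<gamma> (i, j)) = \<gamma>" by auto
  ultimately show ?thesis
    unfolding independent_elements_iff using gamma_closed gamma_not_one by auto
qed

lemma independent_g: "independent_elements C {1..k} (\<lambda>i. \<gamma> (i, 0))"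
proof -
  have "\<gamma> (i, 0) [^] m i = \<one>"
    if one: "lincomb C (\<lambda>i. \<gamma> (i, 0)) {1..k} m = \<one>" and i: "i \<in> {1..k}" for m i
  proof -
    have "finprod C (\<lambda>i. row i (\<lambda>j. if j = 0 then m i else 0)) {1..k} = lincomb C (\<lambda>i. \<gamma> (i, 0)) {1..k} m"
      unfolding lincomb_def[of C "\<lambda>i. \<gamma> (i, 0)"] using row_single[of _ 0] gamma_closed
      by (intro finprod_cong' refl) auto
    then have "row i (\<lambda>j. if j = 0 then m i else 0) = \<one>" using rows[of "\<lambda>i j. if j = 0 then m i else 0" i] one i by simp
    then show ?thesis using row_single[OF i, of 0 "m i"] by simp
  qed
  then show ?thesis
    unfolding independent_elements_iff using gamma_closed gamma_not_one by auto
qed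

lemma ord_gamma_pos: "i \<in> {1..k} \<Longrightarrow> j \<le> t \<Longrightarrow> t > 0 \<Longrightarrow> ord (\<gamma> (i, j)) = 0"
  using gamma_pow_eq_one_pos[of i j "int n" for n] gamma_closed[of i j]
  by (subst ord_eq_0) (auto simp: int_pow_int)

lemma row_s: "i \<in> {1..k} \<Longrightarrow> row i (\<lambda>j. int (s j)) = \<one>"
  by (subst row_rel) (auto intro: exI[of _ 1])

lemma row_s_split:
  assumes i: "i \<in> {1..k}"
  shows "\<gamma> (i, 0) [^] s 0 \<otimes> finprod C (\<lambda>j. \<gamma> (i, j) [^] s j) {1..t} = \<one>"
proof -
  have "row i (\<lambda>j. int (s j)) = finprod C (\<lambda>j. \<gamma> (i, j) [^] s j) {0..t}"
    by (simp add: lincomb_def int_pow_int)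
  also have "\<dots> = finprod C (\<lambda>j. \<gamma> (i, j) [^] s j) (insert 0 {1..t})"
    by (rule arg_cong[of _ _ "finprod C (\<lambda>j. \<gamma> (i, j) [^] s j)"]) auto
  also have "finprod C (\<lambda>j. \<gamma> (i, j) [^] s j) (insert 0 {1..t}) = \<gamma> (i, 0) [^] s 0 \<otimes> finprod C (\<lambda>j. \<gamma> (i, j) [^] s j) {1..t}"
    using gamma_closed i by (intro finprod_insert) auto
  finally show ?thesis using row_s[OF i] by simp
qed

lemma ord_gamma_zero:
  assumes "i \<in> {1..k}" "t = 0"
  shows "ord (\<gamma> (i, 0)) \<noteq> 0"
  using row_s_split[OF assms(1)] assms s1[of 0] gamma_closed[of i 0] ord_eq_0[of "\<gamma> (i, 0)"] by auto

lemma inv_pow_s: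
  assumes i: "i \<in> {1..k}"
  shows "inv (\<gamma> (i, 0) [^] s 0) = finprod C (\<lambda>j. \<gamma> (i, j) [^] s j) {1..t}"
proof -
  have "finprod C (\<lambda>j. \<gamma> (i, j) [^] s j) {1..t} \<in> carrier C" using gamma_closed i by (intro finprod_closed) auto
  then show ?thesis
    using row_s_split[OF i] gamma_closed[of i 0] i by (metis atLeastAtMost_iff inv_equality inv_inv le0 m_comm nat_pow_closed)
qed

lemma generate_e: "i \<in> {1..k} \<Longrightarrow> generate C ((\<lambda>j. \<gamma> (i, j)) ` {1..t}) = range (lincomb C (\<lambda>j. \<gamma> (i, j)) {1..t})"
  using gamma_closed by (intro generate_image) auto

text \<open>A relation of row \<open>i\<close> has an exponent divisible by \<open>s 0\<close> at
  column 0, and the basic relation of the row realizes \<open>s 0\<close>. The divisibility form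
  yields both the membership and the minimality required of \<open>s 0\<close>, and for
  \<open>t = 0\<close> also the order.\<close>

lemma pow_in_generate:
  fixes n :: nat
  assumes i: "i \<in> {1..k}"
  shows "\<gamma> (i, 0) [^] n \<in> generate C ((\<lambda>j. \<gamma> (i, j)) ` {1..t}) \<longleftrightarrow> s 0 dvd n"
proof
  assume "\<gamma> (i, 0) [^] n \<in> generate C ((\<lambda>j. \<gamma> (i, j)) ` {1..t})"
  then obtain u where "\<gamma> (i, 0) [^] n = lincomb C (\<lambda>j. \<gamma> (i, j)) {1..t} u"
    unfolding generate_e[OF i] by blast
  then have u: "\<gamma> (i, 0) [^] int n = lincomb C (\<lambda>j. \<gamma> (i, j)) {1..t} u" by (simp only: int_pow_int)
  have gi: "(\<lambda>j. \<gamma> (i, j)) \<in> {0..t} \<rightarrow> carrier C" using gamma_row[of i] i by simp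
  have "row i (\<lambda>j. (if j = 0 then int n else 0) - (if j \<in> {1..t} then u j else 0)) = \<one>"
  proof -
    have "row i (\<lambda>j. (if j = 0 then int n else 0) - (if j \<in> {1..t} then u j else 0)) =
      row i (\<lambda>j. if j = 0 then int n else 0) \<otimes> inv (row i (\<lambda>j. if j \<in> {1..t} then u j else 0))"
      by (rule lincomb_diff[OF gi])
    also have "row i (\<lambda>j. if j = 0 then int n else 0) = lincomb C (\<lambda>j. \<gamma> (i, j)) {1..t} u"
      unfolding u[symmetric] by (rule row_single[OF i le0, symmetric])
    also have "\<dots> = row i (\<lambda>j. if j \<in> {1..t} then u j else 0)" by (rule row_subset[OF i]) auto
    finally show ?thesis using lincomb_closed[OF gi] by (simp only: r_inv)
  qed
  then obtain c :: int where "\<And>j. j \<le> t \<Longrightarrow> (if j = 0 then int n else 0) - (if j \<in> {1..t} then u j else 0) = c * int (s j)"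
    using iffD1[OF row_rel[OF i]] by blast
  from this[of 0] have "int n = c * int (s 0)" by simp
  then show "s 0 dvd n" by (metis dvd_triv_right of_nat_dvd_iff)
next
  assume "s 0 dvd n"
  then obtain q where q: "n = s 0 * q" by blast
  have sub: "subgroup (generate C ((\<lambda>j. \<gamma> (i, j)) ` {1..t})) C"
    using gamma_closed i by (intro generate_is_subgroup) auto
  have "finprod C (\<lambda>j. \<gamma> (i, j) [^] s j) {1..t} = lincomb C (\<lambda>j. \<gamma> (i, j)) {1..t} (\<lambda>j. int (s j))"
    by (simp add: lincomb_def int_pow_int)
  then have "inv (\<gamma> (i, 0) [^] s 0) \<in> generate C ((\<lambda>j. \<gamma> (i, j)) ` {1..t})"
    unfolding inv_pow_s[OF i] generate_e[OF i] by simp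
  then have "inv (inv (\<gamma> (i, 0) [^] s 0)) \<in> generate C ((\<lambda>j. \<gamma> (i, j)) ` {1..t})"
    by (rule subgroup.m_inv_closed[OF sub])
  then have "\<gamma> (i, 0) [^] s 0 \<in> generate C ((\<lambda>j. \<gamma> (i, j)) ` {1..t})"
    using gamma_closed[of i 0] i by simp
  then have "(\<gamma> (i, 0) [^] s 0) [^] int q \<in> generate C ((\<lambda>j. \<gamma> (i, j)) ` {1..t})"
    using subgroup_int_pow_closed[OF sub] by blast
  then show "\<gamma> (i, 0) [^] n \<in> generate C ((\<lambda>j. \<gamma> (i, j)) ` {1..t})"
    using gamma_closed[of i 0] i by (simp add: q int_pow_int nat_pow_pow)
qed

lemma column_inv:
  assumes "j \<le> t"
  shows "\<gamma> (0, j) = inv (finprod C (\<lambda>i. \<gamma> (i, j)) {1..k})"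
proof -
  have "{0..k} = insert 0 {1..k}" by auto
  then have "finprod C (\<lambda>i. \<gamma> (i, j)) {0..k} = \<gamma> (0, j) \<otimes> finprod C (\<lambda>i. \<gamma> (i, j)) {1..k}"
    using gamma_closed assms by (simp only:) (intro finprod_insert, auto)
  moreover have "finprod C (\<lambda>i. \<gamma> (i, j)) {1..k} \<in> carrier C" using gamma_closed assms by (intro finprod_closed) auto
  ultimately show ?thesis using column[OF assms] gamma_closed[of 0 j] assms by (metis inv_equality le0)
qed

lemma gamma_image:
  "\<gamma> ` grid k t = {\<gamma> (i, j) | i j. i \<in> {1..k} \<and> j \<in> {1..t}} \<union> {\<gamma> (i, 0) | i. i \<in> {1..k}} \<union>
          {\<gamma> (0, j) | j. j \<in> {1..t}} \<union> {\<gamma> (0, 0)}" (is "_ = ?R")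
proof (intro equalityI subsetI)
  fix x assume "x \<in> \<gamma> ` grid k t"
  then obtain i j where "x = \<gamma> (i, j)" "i \<le> k" "j \<le> t" by (auto simp: grid_def)
  then show "x \<in> ?R" by (cases "i = 0"; cases "j = 0") fastforce+
next
  fix x assume "x \<in> ?R"
  then show "x \<in> \<gamma> ` grid k t" by (auto simp: grid_def)
qed

end

section \<open>The isomorphism type of the group\<close>

lemma frag_with_lookup:
  fixes m :: "'a \<Rightarrow> int"
  assumes "finite A"
  shows "\<exists>x. Poly_Mapping.keys x \<subseteq> A \<and> (\<forall>p\<in>A. poly_mapping.lookup x p = m p)"
proof (intro exI conjI)
  let ?x = "\<Sum>p\<in>A. frag_cmul (m p) (frag_of p)"
  have l: "poly_mapping.lookup ?x q = (if q \<in> A then m q else 0)" for q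
  proof -
    have "poly_mapping.lookup ?x q = (\<Sum>p\<in>A. if p = q then m p else 0)"
      unfolding lookup_sum by (intro sum.cong) auto
    then show ?thesis using assms by simp
  qed
  show "Poly_Mapping.keys ?x \<subseteq> A"
  proof
    fix q assume "q \<in> Poly_Mapping.keys ?x"
    then have "poly_mapping.lookup ?x q \<noteq> 0" unfolding in_keys_iff .
    then show "q \<in> A" unfolding l by (simp split: if_splits)
  qed
  show "\<forall>p\<in>A. poly_mapping.lookup ?x p = m p" unfolding l by simp
qed

lemma additive_scale:
  fixes \<Theta> :: "(nat \<Rightarrow> int) \<Rightarrow> nat \<Rightarrow> int"
  assumes add: "\<And>x y j. \<Theta> (\<lambda>i. x i + y i) j = \<Theta> x j + \<Theta> y j"
  shows "\<Theta> (\<lambda>i. c * x i) j = c * \<Theta> x j"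
proof -
  have zero: "\<Theta> (\<lambda>i. 0) j = 0" using add[of "\<lambda>i. 0" "\<lambda>i. 0" j] by simp
  have neg: "\<Theta> (\<lambda>i. - x i) j = - \<Theta> x j" for x
    using add[of x "\<lambda>i. - x i" j] zero by simp
  have nat: "\<Theta> (\<lambda>i. int n * x i) j = int n * \<Theta> x j" for n x
  proof (induction n)
    case (Suc n)
    have "\<Theta> (\<lambda>i. int (Suc n) * x i) j = \<Theta> (\<lambda>i. x i + int n * x i) j" by (simp add: algebra_simps)
    then show ?case using Suc add[of x "\<lambda>i. int n * x i" j] by (simp add: algebra_simps)
  qed (simp add: zero)
  show ?thesis
  proof (cases "c \<ge> 0")
    case True
    then show ?thesis using nat[of "nat c" x] by simp
  next
    case False
    then have "\<Theta> (\<lambda>i. c * x i) j = \<Theta> (\<lambda>i. - (int (nat (- c)) * x i)) j" by simp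
    also have "\<dots> = c * \<Theta> x j" using nat[of "nat (- c)" x] False neg[of "\<lambda>i. int (nat (- c)) * x i"] by simp
    finally show ?thesis .
  qed
qed

text \<open>Both groups are quotients of the free abelian group on the grid. The map
  \<open>\<pi>\<close> subtracts row 0 from each row, applies \<open>\<Theta>\<close> and reduces
  coordinate 0 modulo \<open>n\<close>. Since \<open>\<Theta>\<close> turns \<open>s\<close> into
  \<open>n\<close> times the first unit vector, the kernel of \<open>\<pi>\<close> consists of the
  relations in \<open>grid_rel\<close>.\<close>

theorem (in proper_grid_group) iso_product:
  assumes gen: "carrier C = range (lincomb C \<gamma> (grid k t))"
  shows "C \<cong> product_group {1..k} (\<lambda>_. product_group {1..t} (\<lambda>_. integer_group)
    \<times>\<times> integer_mod_group (Gcd (s ` {0..t})))" (is "C \<cong> ?Prod")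
proof -
  define n where "n = Gcd (s ` {0..t})"
  have npos: "n > 0"
  proof -
    have "n dvd s 0" unfolding n_def by (rule Gcd_dvd) auto
    then show ?thesis using s1[of 0] by (cases "n = 0") auto
  qed
  obtain \<Theta> \<Theta>' :: "(nat \<Rightarrow> int) \<Rightarrow> nat \<Rightarrow> int" where
    Th: "(\<forall>x y j. \<Theta> (\<lambda>i. x i + y i) j = \<Theta> x j + \<Theta> y j) \<and>
    (\<forall>x. \<Theta>' (\<Theta> x) = x) \<and> (\<forall>x. \<Theta> (\<Theta>' x) = x) \<and>
    (\<forall>x j. j > t \<longrightarrow> \<Theta> x j = x j) \<and> (\<forall>x. (\<forall>j\<le>t. x j = 0) \<longrightarrow> \<Theta> x = x) \<and>
    \<Theta> (\<lambda>i. if i \<le> t then int (s i) else 0) = (\<lambda>j. if j = 0 then int (Gcd (s ` {0..t})) else 0)"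
    using unimodular_gcd[of t s] s1 by (auto simp del: atLeastAtMost_iff image_iff)
  have add: "\<Theta> (\<lambda>i. x i + y i) j = \<Theta> x j + \<Theta> y j" for x y j using Th by blast
  have inv: "\<Theta>' (\<Theta> x) = x" "\<Theta> (\<Theta>' x) = x" for x using Th by blast+
  have off: "\<Theta> x j = x j" if "j > t" for x j using Th that by blast
  have gs: "\<Theta> (\<lambda>i. if i \<le> t then int (s i) else 0) = (\<lambda>j. if j = 0 then int n else 0)"
    using Th unfolding n_def by blast
  have scale: "\<Theta> (\<lambda>i. c * x i) j = c * \<Theta> x j" for c x j
    by (rule additive_scale) (rule add)
  let ?F = "free_Abelian_group (grid k t)"
  let ?lk = "poly_mapping.lookup :: (nat \<times> nat \<Rightarrow>\<^sub>0 int) \<Rightarrow> _"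
  \<comment> \<open>Vectors with \<open>t + 1\<close> entries are coded as functions on all
    naturals, so the values beyond \<open>t\<close> are set to 0. There \<open>\<Theta>\<close>
    preserves them, which makes its inverse usable for the surjectivity of
    \<open>\<pi>\<close>.\<close>
  define u where "u = (\<lambda>x i j. if j \<le> t then ?lk x (i, j) - ?lk x (0, j) else 0)"
  define \<pi> where "\<pi> = (\<lambda>x. \<lambda>i\<in>{1..k}. (\<lambda>j\<in>{1..t}. \<Theta> (u x i) j, \<Theta> (u x i) 0 mod int n))"
  let ?lc = "\<lambda>x. lincomb C \<gamma> (grid k t) (?lk x)"
  have uadd: "u (x + y) i = (\<lambda>j. u x i j + u y i j)" for x y i by (auto simp: u_def lookup_add)
  have grpProd: "group ?Prod" by (intro product_group DirProd_group) auto
  interpret p1: group_hom ?F C ?lc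
  proof (unfold group_hom_def group_hom_axioms_def, intro conjI group_free_Abelian_group is_group homI)
    fix x y
    show "?lc x \<in> carrier C" using gamma by simp
    show "?lc (x \<otimes>\<^bsub>?F\<^esub> y) = ?lc x \<otimes> ?lc y"
    proof -
      have "?lk (x + y) = (\<lambda>i. ?lk x i + ?lk y i)" by (auto simp: lookup_add)
      then show ?thesis using lincomb_add[OF gamma, of "?lk x" "?lk y"] by simp
    qed
  qed
  interpret p2: group_hom ?F ?Prod \<pi>
  proof (unfold group_hom_def group_hom_axioms_def, intro conjI group_free_Abelian_group grpProd homI)
    fix x y
    show "\<pi> x \<in> carrier ?Prod"
      using npos by (auto simp: \<pi>_def DirProd_def carrier_integer_mod_group n_def[symmetric])
    show "\<pi> (x \<otimes>\<^bsub>?F\<^esub> y) = \<pi> x \<otimes>\<^bsub>?Prod\<^esub> \<pi> y"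
      by (auto simp: \<pi>_def DirProd_def uadd add n_def[symmetric] mod_add_eq fun_eq_iff)
  qed
  have "?lc ` carrier ?F = carrier C"
  proof (intro equalityI subsetI)
    fix y assume "y \<in> carrier C"
    then obtain m where m: "y = lincomb C \<gamma> (grid k t) m" using gen by auto
    obtain x where x: "Poly_Mapping.keys x \<subseteq> grid k t" "\<forall>p\<in>grid k t. ?lk x p = m p"
      using frag_with_lookup[OF finite_grid, of k t m] by blast
    have "y = ?lc x" unfolding m using x by (intro lincomb_cong[OF gamma]) auto
    then show "y \<in> ?lc ` carrier ?F" using x by auto
  qed auto
  then have i1: "?F Mod kernel ?F C ?lc \<cong> C" by (rule p1.FactGroup_iso)
  have "\<pi> ` carrier ?F = carrier ?Prod"
  proof (intro equalityI subsetI)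
    fix z assume "z \<in> \<pi> ` carrier ?F"
    then show "z \<in> carrier ?Prod" using p2.hom_closed by blast
  next
    fix z assume z: "z \<in> carrier ?Prod"
    then have zi: "fst (z i) \<in> {1..t} \<rightarrow>\<^sub>E UNIV" "snd (z i) \<in> {0..<int n}" if "i \<in> {1..k}" for i
    proof -
      have "z i \<in> ({1..t} \<rightarrow>\<^sub>E UNIV) \<times> {0..<int n}"
        using PiE_mem[OF z[unfolded carrier_product_group] that] npos
        by (simp add: DirProd_def carrier_integer_mod_group n_def[symmetric])
      then show "fst (z i) \<in> {1..t} \<rightarrow>\<^sub>E UNIV" "snd (z i) \<in> {0..<int n}" by (simp_all add: mem_Times_iff)
    qed
    define v where "v = (\<lambda>i j. if j = 0 then snd (z i) else if j \<le> t then fst (z i) j else 0)"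
    have v0: "\<Theta>' (v i) j = 0" if "j > t" for i j
      using off[OF that, of "\<Theta>' (v i)"] that by (simp add: inv v_def)
    obtain x where x: "Poly_Mapping.keys x \<subseteq> grid k t"
      "\<forall>p\<in>grid k t. ?lk x p = (case p of (i, j) \<Rightarrow> if i = 0 then 0 else \<Theta>' (v i) j)"
      using frag_with_lookup[OF finite_grid, of k t "\<lambda>(i, j). if i = 0 then 0 else \<Theta>' (v i) j"] by blast
    have "u x i = \<Theta>' (v i)" if "i \<in> {1..k}" for i
    proof
      fix j show "u x i j = \<Theta>' (v i) j"
        using that x(2) v0[of j i] by (auto simp: u_def grid_def)
    qed
    then have Thu: "\<Theta> (u x i) = v i" if "i \<in> {1..k}" for i using that inv(2) by simp
    have "\<pi> x i = z i" if i: "i \<in> {1..k}" for i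
    proof (rule prod_eqI)
      have "(\<lambda>j\<in>{1..t}. v i j) = fst (z i)"
        using zi(1)[OF i] by (intro extensionalityI[of _ "{1..t}"]) (auto simp: v_def PiE_iff)
      then show "fst (\<pi> x i) = fst (z i)" using i Thu[OF i] by (simp add: \<pi>_def)
      show "snd (\<pi> x i) = snd (z i)" using i zi(2)[OF i] Thu[OF i] by (simp add: \<pi>_def v_def)
    qed
    moreover have "\<pi> x \<in> carrier ?Prod" using x by (intro p2.hom_closed) simp
    ultimately have "\<pi> x = z"
      using z unfolding carrier_product_group by (intro PiE_ext) auto
    then show "z \<in> \<pi> ` carrier ?F" using x by auto
  qed
  then have i2: "?F Mod kernel ?F ?Prod \<pi> \<cong> ?Prod" by (rule p2.FactGroup_iso)
  have "?lc x = \<one> \<longleftrightarrow> \<pi> x = \<one>\<^bsub>?Prod\<^esub>" for x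
  proof -
    have one: "\<pi> x = \<one>\<^bsub>?Prod\<^esub> \<longleftrightarrow> (\<forall>i\<in>{1..k}. (\<forall>j\<in>{1..t}. \<Theta> (u x i) j = 0) \<and> int n dvd \<Theta> (u x i) 0)"
      by (auto simp: \<pi>_def DirProd_def fun_eq_iff restrict_def dvd_eq_mod_eq_0)
    have row: "(\<forall>j\<in>{1..t}. \<Theta> (u x i) j = 0) \<and> int n dvd \<Theta> (u x i) 0 \<longleftrightarrow>
      (\<exists>c::int. \<forall>j\<in>{0..t}. ?lk x (i, j) - ?lk x (0, j) = c * int (s j))" for i
    proof
      assume h: "(\<forall>j\<in>{1..t}. \<Theta> (u x i) j = 0) \<and> int n dvd \<Theta> (u x i) 0"
      then obtain c where c: "\<Theta> (u x i) 0 = c * int n" by (metis dvdE mult.commute)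
      have "\<Theta> (u x i) = \<Theta> (\<lambda>j. c * (if j \<le> t then int (s j) else 0))"
      proof
        fix j
        show "\<Theta> (u x i) j = \<Theta> (\<lambda>j. c * (if j \<le> t then int (s j) else 0)) j"
          unfolding scale gs using h c off[of j "u x i"] by (cases "j \<le> t") (auto simp: u_def)
      qed
      then have "u x i = (\<lambda>j. c * (if j \<le> t then int (s j) else 0))" by (metis inv(1))
      then have "u x i j = c * (if j \<le> t then int (s j) else 0)" for j by simp
      then show "\<exists>c::int. \<forall>j\<in>{0..t}. ?lk x (i, j) - ?lk x (0, j) = c * int (s j)"
        unfolding u_def by (intro exI[of _ c]) (metis atLeastAtMost_iff)
    next
      assume "\<exists>c::int. \<forall>j\<in>{0..t}. ?lk x (i, j) - ?lk x (0, j) = c * int (s j)"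
      then obtain c :: int where c: "\<forall>j\<in>{0..t}. ?lk x (i, j) - ?lk x (0, j) = c * int (s j)" by blast
      then have "u x i = (\<lambda>j. c * (if j \<le> t then int (s j) else 0))" by (auto simp: u_def)
      then have "\<Theta> (u x i) j = c * (if j = 0 then int n else 0)" for j by (simp add: scale gs)
      then show "(\<forall>j\<in>{1..t}. \<Theta> (u x i) j = 0) \<and> int n dvd \<Theta> (u x i) 0" by auto
    qed
    show ?thesis unfolding one row grid_rel by (rule bchoice_iff[symmetric])
  qed
  then have "kernel ?F C ?lc = kernel ?F ?Prod \<pi>" by (auto simp: kernel_def)
  then have "?F Mod kernel ?F C ?lc \<cong> ?Prod" using i2 by simp
  moreover have "C \<cong> ?F Mod kernel ?F C ?lc"
    using i1 group.iso_sym normal.factorgroup_is_group[OF p1.normal_kernel] by blast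
  ultimately show ?thesis using iso_trans by blast
qed

theorem (in proper_grid_group) class_structureI:
  assumes gen: "carrier C = range (lincomb C \<gamma> (grid k t))"
  shows "class_structure C (\<gamma> ` grid k t) t k s (\<lambda>i j. \<gamma> (i, j)) (\<lambda>i. \<gamma> (i, 0))"
  unfolding class_structure_def
proof (intro conjI)
  show "1 \<le> k" "\<forall>j\<in>{0..t}. 1 \<le> s j" "k + 1 \<noteq> (\<Sum>j = 0..t. s j)" "2 \<le> (\<Sum>j = 0..t. s j)"
    using k1 s1 ks s2 by auto
  show "independent_elements C ({1..k} \<times> {1..t}) (\<lambda>(i, j). \<gamma> (i, j))" by (rule independent_e)
  show "\<forall>i\<in>{1..k}. \<forall>j\<in>{1..t}. ord (\<gamma> (i, j)) = 0" using ord_gamma_pos by auto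
  show "independent_elements C {1..k} (\<lambda>i. \<gamma> (i, 0))" by (rule independent_g)
  show "\<forall>i\<in>{1..k}. if 0 < t then ord (\<gamma> (i, 0)) = 0 else ord (\<gamma> (i, 0)) \<noteq> 0"
    using ord_gamma_pos ord_gamma_zero by auto
  show "\<gamma> ` grid k t = {\<gamma> (i, j) |i j. i \<in> {1..k} \<and> j \<in> {1..t}} \<union> {\<gamma> (i, 0) |i. i \<in> {1..k}} \<union>
    {\<gamma> (0, j) |j. j \<in> {1..t}} \<union> {\<gamma> (0, 0)}" by (rule gamma_image)
  have eq: "generate C ((\<lambda>j. \<gamma> (i, j)) ` {1..t} \<union> {\<gamma> (i, 0)}) = range (row i)" if "i \<in> {1..k}" for i
    by (rule generate_row[OF that])
  \<comment> \<open>The two families of subgroups agree only for indices in \<open>{1..k}\<close>,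
    so the equality is passed through the extensional carrier of the product group.\<close>
  have "product_group {1..k} (\<lambda>i. C\<lparr>carrier := generate C ((\<lambda>j. \<gamma> (i, j)) ` {1..t} \<union> {\<gamma> (i, 0)})\<rparr>)
    = product_group {1..k} (\<lambda>i. C\<lparr>carrier := range (row i)\<rparr>)"
  proof -
    have "(\<Pi>\<^sub>E i\<in>{1..k}. generate C ((\<lambda>j. \<gamma> (i, j)) ` {1..t} \<union> {\<gamma> (i, 0)})) = (\<Pi>\<^sub>E i\<in>{1..k}. range (row i))"
      by (rule PiE_cong) (rule eq)
    then show ?thesis unfolding product_group_def by simp
  qed
  then show "internal_direct_sum C {1..k} (\<lambda>i. generate C ((\<lambda>j. \<gamma> (i, j)) ` {1..t} \<union> {\<gamma> (i, 0)})) (carrier C)"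
    using direct_sum_rows[OF gen] by (simp add: internal_direct_sum_def)
  show "C \<cong> product_group {1..k} (\<lambda>_. product_group {1..t} (\<lambda>_. integer_group) \<times>\<times> integer_mod_group (Gcd (s ` {0..t})))"
    by (rule iso_product[OF gen])
  show "\<forall>i\<in>{1..k}. \<gamma> (i, 0) [^] s 0 \<in> generate C ((\<lambda>j. \<gamma> (i, j)) ` {1..t}) \<and>
    (\<forall>m. 0 < m \<and> m < s 0 \<longrightarrow> \<gamma> (i, 0) [^] m \<notin> generate C ((\<lambda>j. \<gamma> (i, j)) ` {1..t})) \<and>
    inv (\<gamma> (i, 0) [^] s 0) = finprod C (\<lambda>j. \<gamma> (i, j) [^] s j) {1..t}"
  proof (intro ballI conjI allI impI)
    fix i assume i: "i \<in> {1..k}"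
    show "\<gamma> (i, 0) [^] s 0 \<in> generate C ((\<lambda>j. \<gamma> (i, j)) ` {1..t})" using pow_in_generate[OF i] by simp
    show "inv (\<gamma> (i, 0) [^] s 0) = finprod C (\<lambda>j. \<gamma> (i, j) [^] s j) {1..t}" by (rule inv_pow_s[OF i])
    fix m :: nat assume "0 < m \<and> m < s 0"
    then show "\<gamma> (i, 0) [^] m \<notin> generate C ((\<lambda>j. \<gamma> (i, j)) ` {1..t})"
      using pow_in_generate[OF i] by (auto dest: dvd_imp_le)
  qed
  show "\<forall>j\<in>{1..t}. \<gamma> (0, j) = inv (finprod C (\<lambda>i. \<gamma> (i, j)) {1..k})" using column_inv by auto
  show "\<gamma> (0, 0) = inv (finprod C (\<lambda>i. \<gamma> (i, 0)) {1..k})" by (rule column_inv) simp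
qed

section \<open>From the class structure back to the grid\<close>

lemma (in comm_group) lincomb_scale:
  assumes "finite I" "x \<in> I \<rightarrow> carrier G"
  shows "lincomb G x I (\<lambda>i. c * m i) = lincomb G x I m [^] (c::int)"
  using assms
proof (induction I)
  case (insert a I)
  then have c: "x \<in> I \<rightarrow> carrier G" "x a \<in> carrier G" by auto
  have ins: "lincomb G x (insert a I) m = x a [^] m a \<otimes> lincomb G x I m" for m
    unfolding lincomb_def using insert c by (intro finprod_insert) auto
  show ?case unfolding ins using insert c by (simp add: int_pow_distrib int_pow_pow mult.commute)
qed (simp add: lincomb_def)

text \<open>The point is to find all relations of a row. Division of the exponent of
  \<open>g a\<close> by \<open>s 0\<close> leaves a power of \<open>g a\<close> with exponent below
  \<open>s 0\<close> in the subgroup generated by the \<open>e a j\<close>; minimality of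
  \<open>s 0\<close> makes it trivial. What remains is a relation between independent elements of
  infinite order.\<close>

theorem class_structureD:
  assumes C: "comm_group C" and cs: "class_structure C G0 t k s e g"
  defines "\<gamma> \<equiv> \<lambda>(i, j). if j = 0 then g i else e i j"
  shows "proper_grid_group C \<gamma> k t s" "\<gamma> ` grid k t = G0"
proof -
  interpret comm_group C by fact
  have k1: "k \<ge> 1" and s1: "\<And>j. j \<le> t \<Longrightarrow> s j \<ge> 1" and ks: "k + 1 \<noteq> (\<Sum>j=0..t. s j)" and s2: "(\<Sum>j=0..t. s j) \<ge> 2"
    and ie: "independent_elements C ({1..k} \<times> {1..t}) (\<lambda>(i, j). e i j)"
    and oe: "\<And>i j. i \<in> {1..k} \<Longrightarrow> j \<in> {1..t} \<Longrightarrow> ord (e i j) = 0"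
    and ig: "independent_elements C {1..k} g"
    and G0: "G0 = {e i j | i j. i \<in> {1..k} \<and> j \<in> {1..t}} \<union> {g i | i. i \<in> {1..k}} \<union> {e 0 j | j. j \<in> {1..t}} \<union> {g 0}"
    and ds: "internal_direct_sum C {1..k} (\<lambda>i. generate C (e i ` {1..t} \<union> {g i})) (carrier C)"
    and min: "\<And>i m. i \<in> {1..k} \<Longrightarrow> 0 < m \<Longrightarrow> m < s 0 \<Longrightarrow> g i [^]\<^bsub>C\<^esub> m \<notin> generate C (e i ` {1..t})"
    and rel: "\<And>i. i \<in> {1..k} \<Longrightarrow> inv\<^bsub>C\<^esub> (g i [^]\<^bsub>C\<^esub> s 0) = finprod C (\<lambda>j. e i j [^]\<^bsub>C\<^esub> s j) {1..t}"
    and e0: "\<And>j. j \<in> {1..t} \<Longrightarrow> e 0 j = inv\<^bsub>C\<^esub> (finprod C (\<lambda>i. e i j) {1..k})"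
    and g0: "g 0 = inv\<^bsub>C\<^esub> (finprod C g {1..k})"
    using cs unfolding class_structure_def by auto
  have ec: "e i j \<in> carrier C" if "i \<in> {1..k}" "j \<in> {1..t}" for i j
    using ie that unfolding independent_elements_iff by fastforce
  have gc: "g i \<in> carrier C" if "i \<in> {1..k}" for i
    using ig that unfolding independent_elements_iff by blast
  have e0c: "e 0 j \<in> carrier C" if "j \<in> {1..t}" for j
    unfolding e0[OF that] using ec that by (intro inv_closed finprod_closed) auto
  have g0c: "g 0 \<in> carrier C"
    unfolding g0 using gc by (intro inv_closed finprod_closed) auto
  have gamma: "\<gamma> (i, j) \<in> carrier C" if "i \<le> k" "j \<le> t" for i j
    using that ec gc e0c g0c by (cases "i = 0"; cases "j = 0") (auto simp: \<gamma>_def)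
  have ins: "{0..t} = insert 0 {1..t}" by auto
  have row_split: "lincomb C (\<lambda>j. \<gamma> (a, j)) {0..t} u = g a [^]\<^bsub>C\<^esub> u 0 \<otimes>\<^bsub>C\<^esub> lincomb C (e a) {1..t} u"
    if a: "a \<in> {1..k}" for a u
  proof -
    have "lincomb C (\<lambda>j. \<gamma> (a, j)) (insert 0 {1..t}) u = \<gamma> (a, 0) [^]\<^bsub>C\<^esub> u 0 \<otimes>\<^bsub>C\<^esub> lincomb C (\<lambda>j. \<gamma> (a, j)) {1..t} u"
      unfolding lincomb_def using gamma a by (intro finprod_insert) auto
    also have "lincomb C (\<lambda>j. \<gamma> (a, j)) {1..t} u = lincomb C (e a) {1..t} u"
      unfolding lincomb_def using ec a by (intro finprod_cong') (auto simp: \<gamma>_def)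
    finally show ?thesis unfolding ins by (simp add: \<gamma>_def)
  qed
  have eac: "e a \<in> {1..t} \<rightarrow> carrier C" if "a \<in> {1..k}" for a using ec that by auto
  have growc: "(\<lambda>j. \<gamma> (a, j)) \<in> {0..t} \<rightarrow> carrier C" if "a \<in> {1..k}" for a using gamma that by auto
  have row_s: "lincomb C (\<lambda>j. \<gamma> (a, j)) {0..t} (\<lambda>j. int (s j)) = \<one>\<^bsub>C\<^esub>" if a: "a \<in> {1..k}" for a
  proof -
    have "lincomb C (e a) {1..t} (\<lambda>j. int (s j)) = inv\<^bsub>C\<^esub> (g a [^]\<^bsub>C\<^esub> s 0)"
      unfolding rel[OF a] by (simp add: lincomb_def int_pow_int)
    then show ?thesis using gc[OF a] by (simp add: row_split[OF a] int_pow_int)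
  qed
  have grid: "grid_group C \<gamma> k t s"
  proof
    show "\<gamma> \<in> grid k t \<rightarrow> carrier C" using gamma by (auto simp: grid_def)
  next
    fix a u assume a: "a \<in> {1..k}"
    show "lincomb C (\<lambda>j. \<gamma> (a, j)) {0..t} u = \<one>\<^bsub>C\<^esub> \<longleftrightarrow> (\<exists>c::int. \<forall>j\<le>t. u j = c * int (s j))"
    proof
      assume "\<exists>c::int. \<forall>j\<le>t. u j = c * int (s j)"
      then obtain c :: int where c: "\<forall>j\<le>t. u j = c * int (s j)" by blast
      have "lincomb C (\<lambda>j. \<gamma> (a, j)) {0..t} u = lincomb C (\<lambda>j. \<gamma> (a, j)) {0..t} (\<lambda>j. c * int (s j))"
        using c by (intro lincomb_cong[OF growc[OF a]]) auto
      also have "\<dots> = \<one>\<^bsub>C\<^esub>" unfolding lincomb_scale[OF finite_atLeastAtMost growc[OF a]] row_s[OF a] by simp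
      finally show "lincomb C (\<lambda>j. \<gamma> (a, j)) {0..t} u = \<one>\<^bsub>C\<^esub>" .
    next
      assume one: "lincomb C (\<lambda>j. \<gamma> (a, j)) {0..t} u = \<one>\<^bsub>C\<^esub>"
      \<comment> \<open>Subtracting \<open>q\<close> times the relation of the row leaves the
        remainder \<open>r\<close> at column 0.\<close>
      define q where "q = u 0 div int (s 0)"
      define r where "r = nat (u 0 mod int (s 0))"
      define v where "v = (\<lambda>j. u j - q * int (s j))"
      have s0: "s 0 \<ge> 1" using s1 by simp
      have r: "u 0 mod int (s 0) = int r" "r < s 0" using s0 by (auto simp: r_def nat_less_iff)
      have v0: "v 0 = int r" unfolding v_def q_def r(1)[symmetric] by (simp add: minus_div_mult_eq_mod)
      have "lincomb C (\<lambda>j. \<gamma> (a, j)) {0..t} v = \<one>\<^bsub>C\<^esub>"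
        unfolding v_def lincomb_diff[OF growc[OF a]] lincomb_scale[OF finite_atLeastAtMost growc[OF a]] row_s[OF a] one by simp
      then have one': "g a [^]\<^bsub>C\<^esub> r \<otimes>\<^bsub>C\<^esub> lincomb C (e a) {1..t} v = \<one>\<^bsub>C\<^esub>"
        unfolding row_split[OF a] v0 by (simp add: int_pow_int)
      have lc: "lincomb C (e a) {1..t} v \<in> carrier C" by (rule lincomb_closed[OF eac[OF a]])
      have "g a [^]\<^bsub>C\<^esub> r = inv\<^bsub>C\<^esub> lincomb C (e a) {1..t} v"
        using one' lc gc[OF a] by (metis inv_equality nat_pow_closed inv_inv)
      also have "\<dots> = lincomb C (e a) {1..t} (\<lambda>j. - v j)" by (rule lincomb_uminus[OF eac[OF a], symmetric])
      finally have "g a [^]\<^bsub>C\<^esub> r \<in> generate C (e a ` {1..t})"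
        unfolding generate_image[OF finite_atLeastAtMost eac[OF a]] by simp
      then have r0: "r = 0" using min[OF a, of r] r(2) by blast
      then have "lincomb C (e a) {1..t} v = \<one>\<^bsub>C\<^esub>" using one' lc by simp
      moreover have "lincomb C (\<lambda>(i, j). e i j) ({1..k} \<times> {1..t}) (\<lambda>(i, j). if i = a then v j else 0)
          = finprod C (\<lambda>i. if i = a then lincomb C (e i) {1..t} v else \<one>\<^bsub>C\<^esub>) {1..k}"
        using ec eac by (subst lincomb_Times) (auto intro!: finprod_cong' simp: lincomb_zero lincomb_closed)
      moreover have "\<dots> = lincomb C (e a) {1..t} v"
        using a eac by (intro finprod_singleton_swap) auto
      ultimately have "lincomb C (\<lambda>(i, j). e i j) ({1..k} \<times> {1..t}) (\<lambda>(i, j). if i = a then v j else 0) = \<one>\<^bsub>C\<^esub>" by simp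
      then have "\<forall>x\<in>{1..k} \<times> {1..t}. (case x of (i, j) \<Rightarrow> e i j) [^]\<^bsub>C\<^esub> (case x of (i, j) \<Rightarrow> if i = a then v j else 0) = \<one>\<^bsub>C\<^esub>"
        using ie unfolding independent_elements_iff by blast
      then have "e a j [^]\<^bsub>C\<^esub> v j = \<one>\<^bsub>C\<^esub>" if "j \<in> {1..t}" for j using a that by force
      then have "v j = 0" if "j \<in> {1..t}" for j
        using int_pow_eq_id[OF ec[OF a that], of "v j"] oe[OF a that] that by simp
      then have "v j = 0" if "j \<le> t" for j using that v0 r0 by (cases "j = 0") auto
      then show "\<exists>c::int. \<forall>j\<le>t. u j = c * int (s j)" by (intro exI[of _ q]) (simp add: v_def)
    qed
  next
    fix m i assume fin: "finprod C (\<lambda>i. lincomb C (\<lambda>j. \<gamma> (i, j)) {0..t} (m i)) {1..k} = \<one>\<^bsub>C\<^esub>" and i: "i \<in> {1..k}"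
    have sub: "subgroup (generate C (e i ` {1..t} \<union> {g i})) C" if "i \<in> {1..k}" for i
      using ec gc that by (intro generate_is_subgroup) auto
    have mem: "lincomb C (\<lambda>j. \<gamma> (i, j)) {0..t} (m i) \<in> generate C (e i ` {1..t} \<union> {g i})" if "i \<in> {1..k}" for i
    proof (rule lincomb_subgroup[OF sub[OF that]])
      fix j assume "j \<in> {0..t}"
      then show "\<gamma> (i, j) \<in> generate C (e i ` {1..t} \<union> {g i})"
        by (auto simp: \<gamma>_def intro!: generate.incl)
    qed simp
    have *: "carrier C = (\<lambda>y. finprod C y {1..k}) ` {y. \<forall>i\<in>{1..k}. y i \<in> generate C (e i ` {1..t} \<union> {g i})} \<and>
      (\<forall>y. (\<forall>i\<in>{1..k}. y i \<in> generate C (e i ` {1..t} \<union> {g i})) \<longrightarrow> finprod C y {1..k} = \<one>\<^bsub>C\<^esub> \<longrightarrow> (\<forall>i\<in>{1..k}. y i = \<one>\<^bsub>C\<^esub>))"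
      by (rule iffD1[OF internal_direct_sum_iff[OF sub] ds])
    show "lincomb C (\<lambda>j. \<gamma> (i, j)) {0..t} (m i) = \<one>\<^bsub>C\<^esub>"
      using *[THEN conjunct2, rule_format, of "\<lambda>i. lincomb C (\<lambda>j. \<gamma> (i, j)) {0..t} (m i)" i] mem fin i by blast
  next
    fix j assume j: "j \<le> t"
    have "{0..k} = insert 0 {1..k}" by auto
    then have "finprod C (\<lambda>i. \<gamma> (i, j)) {0..k} = \<gamma> (0, j) \<otimes>\<^bsub>C\<^esub> finprod C (\<lambda>i. \<gamma> (i, j)) {1..k}"
      using gamma j by (simp only:) (intro finprod_insert, auto)
    moreover have "\<gamma> (0, j) = inv\<^bsub>C\<^esub> (finprod C (\<lambda>i. \<gamma> (i, j)) {1..k})"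
      using e0[of j] g0 j by (cases "j = 0") (auto simp: \<gamma>_def)
    moreover have "finprod C (\<lambda>i. \<gamma> (i, j)) {1..k} \<in> carrier C" using gamma j by (intro finprod_closed) auto
    ultimately show "finprod C (\<lambda>i. \<gamma> (i, j)) {0..k} = \<one>\<^bsub>C\<^esub>" by simp
  qed
  then interpret grid_group C \<gamma> k t s .
  show "proper_grid_group C \<gamma> k t s"
    by unfold_locales (fact k1 s1 ks s2)+
  then interpret proper_grid_group C \<gamma> k t s .
  show "\<gamma> ` grid k t = G0"
  proof -
    have ge: "\<gamma> (i, j) = e i j" if "j \<in> {1..t}" for i j using that by (simp add: \<gamma>_def)
    have gg: "\<gamma> (i, 0) = g i" for i by (simp add: \<gamma>_def)
    have "{\<gamma> (i, j) |i j. i \<in> {1..k} \<and> j \<in> {1..t}} = {e i j | i j. i \<in> {1..k} \<and> j \<in> {1..t}}"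
      by (rule Collect_cong) (metis ge)
    moreover have "{\<gamma> (0, j) |j. j \<in> {1..t}} = {e 0 j | j. j \<in> {1..t}}" by (rule Collect_cong) (metis ge)
    moreover note gg
    ultimately show ?thesis unfolding gamma_image G0 by simp
  qed
qed

section \<open>Length-factorial reduced Krull monoids without primes\<close>

lemma count_image_mset_inj_on:
  assumes "inj_on f A" "set_mset d \<subseteq> A" "x \<in> A"
  shows "count (image_mset f d) (f x) = count d x"
  using assms(2)
proof (induction d)
  case (add a d)
  then have "f a = f x \<longleftrightarrow> a = x" using assms(1,3) by (auto simp: inj_on_def)
  then show ?case using add by auto
qed simp

lemma image_mset_inj_on_eq:
  assumes "inj_on f A" "set_mset d \<subseteq> A" "set_mset d' \<subseteq> A" "image_mset f d = image_mset f d'"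
  shows "d = d'"
proof (rule multiset_eqI)
  fix x
  show "count d x = count d' x"
  proof (cases "x \<in> A")
    case True
    then show ?thesis using count_image_mset_inj_on[OF assms(1)] assms by metis
  next
    case False
    then show ?thesis using assms(2,3) by (metis not_in_iff subsetD)
  qed
qed

lemma image_mset_lift:
  assumes "set_mset d \<subseteq> f ` A"
  shows "\<exists>d'. set_mset d' \<subseteq> A \<and> image_mset f d' = d"
  using assms
proof (induction d)
  case (add x d)
  then obtain d' a where "set_mset d' \<subseteq> A" "image_mset f d' = d" "a \<in> A" "f a = x" by auto
  then show ?case by (intro exI[of _ "add_mset a d'"]) auto
qed auto

context free_divisor_hom
begin

abbreviation "cl \<equiv> divisor_class H P \<phi>"

lemma cl_closed: "p \<in> P \<Longrightarrow> cl p \<in> carrier CG"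
  unfolding divisor_class_eq by (rule frag_class_closed) simp

definition frag_comb :: "('i \<Rightarrow> 'p) \<Rightarrow> 'i set \<Rightarrow> ('i \<Rightarrow> int) \<Rightarrow> 'p \<Rightarrow>\<^sub>0 int" where
  "frag_comb \<beta> I m = (\<Sum>x\<in>I. frag_cmul (m x) (frag_of (\<beta> x)))"

lemma frag_comb_keys: "\<beta> ` I \<subseteq> P \<Longrightarrow> Poly_Mapping.keys (frag_comb \<beta> I m) \<subseteq> P"
  unfolding frag_comb_def
proof (rule order_trans[OF keys_sum], rule UN_least)
  fix x assume "\<beta> ` I \<subseteq> P" "x \<in> I"
  then show "Poly_Mapping.keys (frag_cmul (m x) (frag_of (\<beta> x))) \<subseteq> P"
    using keys_cmul[of "m x" "frag_of (\<beta> x)"] by auto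
qed

lemma frag_comb_lookup:
  assumes "finite I" "inj_on \<beta> I" "x \<in> I"
  shows "poly_mapping.lookup (frag_comb \<beta> I m) (\<beta> x) = m x"
proof -
  have "poly_mapping.lookup (frag_comb \<beta> I m) (\<beta> x) = (\<Sum>y\<in>I. if y = x then m y else 0)"
    unfolding frag_comb_def lookup_sum using assms by (intro sum.cong) (auto simp: inj_on_def)
  then show ?thesis using assms by simp
qed

lemma lincomb_class:
  assumes "finite I" "\<beta> ` I \<subseteq> P"
  shows "lincomb CG (\<lambda>x. cl (\<beta> x)) I m = frag_class (frag_comb \<beta> I m)"
  using assms
proof (induction I)
  case empty
  interpret C: comm_group CG by (rule class_group_comm_group)
  show ?case by (simp add: lincomb_def frag_comb_def frag_class_zero)
next
  case (insert a I)
  interpret C: comm_group CG by (rule class_group_comm_group)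
  have "lincomb CG (\<lambda>x. cl (\<beta> x)) (insert a I) m = cl (\<beta> a) [^]\<^bsub>CG\<^esub> m a \<otimes>\<^bsub>CG\<^esub> lincomb CG (\<lambda>x. cl (\<beta> x)) I m"
    unfolding lincomb_def using insert cl_closed by (intro C.finprod_insert) auto
  also have "\<dots> = frag_class (frag_cmul (m a) (frag_of (\<beta> a))) \<otimes>\<^bsub>CG\<^esub> frag_class (frag_comb \<beta> I m)"
    using insert by (simp add: divisor_class_eq frag_class_cmul)
  also have "\<dots> = frag_class (frag_cmul (m a) (frag_of (\<beta> a)) + frag_comb \<beta> I m)"
    using insert frag_comb_keys[of \<beta> I m] keys_cmul[of "m a" "frag_of (\<beta> a)"]
    by (intro frag_class_add[symmetric]) auto
  finally show ?case using insert by (simp add: frag_comb_def)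
qed

lemma class_group_generated:
  assumes "finite I" "\<beta> ` I = P" "inj_on \<beta> I"
  shows "carrier CG = range (lincomb CG (\<lambda>x. cl (\<beta> x)) I)"
proof (intro equalityI subsetI)
  fix y assume "y \<in> carrier CG"
  then obtain x where x: "Poly_Mapping.keys x \<subseteq> P" "y = frag_class x" by (auto simp: carrier_class_group)
  have "x = frag_comb \<beta> I (\<lambda>i. poly_mapping.lookup x (\<beta> i))"
  proof (rule poly_mapping_eqI)
    fix q
    show "poly_mapping.lookup x q = poly_mapping.lookup (frag_comb \<beta> I (\<lambda>i. poly_mapping.lookup x (\<beta> i))) q"
    proof (cases "q \<in> P")
      case True
      then obtain i where "i \<in> I" "q = \<beta> i" using assms(2) by blast
      then show ?thesis by (simp add: frag_comb_lookup[OF assms(1,3)])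
    next
      case False
      then have "q \<notin> Poly_Mapping.keys x" "q \<notin> Poly_Mapping.keys (frag_comb \<beta> I (\<lambda>i. poly_mapping.lookup x (\<beta> i)))"
        using x(1) frag_comb_keys[of \<beta> I "\<lambda>i. poly_mapping.lookup x (\<beta> i)"] assms(2) by blast+
      then show ?thesis by (simp add: in_keys_iff)
    qed
  qed
  then have "y = lincomb CG (\<lambda>x. cl (\<beta> x)) I (\<lambda>i. poly_mapping.lookup x (\<beta> i))"
    using lincomb_class[of I \<beta>] assms x by simp
  then show "y \<in> range (lincomb CG (\<lambda>x. cl (\<beta> x)) I)" by blast
next
  fix y assume "y \<in> range (lincomb CG (\<lambda>x. cl (\<beta> x)) I)"
  then obtain m where "y = lincomb CG (\<lambda>x. cl (\<beta> x)) I m" by blast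
  then have "y = frag_class (frag_comb \<beta> I m)" using lincomb_class[of I \<beta>] assms by simp
  then show "y \<in> carrier CG" using frag_class_closed frag_comb_keys assms(2) by blast
qed

lemma frag_comb_eq_diff:
  assumes "finite I" "\<beta> ` I \<subseteq> P" "inj_on \<beta> I" "set_mset d \<subseteq> I" "set_mset d' \<subseteq> I"
  shows "frag_comb \<beta> I m = mset_to_frag (image_mset \<beta> d) - mset_to_frag (image_mset \<beta> d') \<longleftrightarrow>
    (\<forall>x\<in>I. m x = int (count d x) - int (count d' x))"
proof
  assume eq: "frag_comb \<beta> I m = mset_to_frag (image_mset \<beta> d) - mset_to_frag (image_mset \<beta> d')"
  show "\<forall>x\<in>I. m x = int (count d x) - int (count d' x)"
  proof
    fix x assume x: "x \<in> I"
    have "m x = poly_mapping.lookup (frag_comb \<beta> I m) (\<beta> x)" using frag_comb_lookup[OF assms(1,3) x] by simp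
    then show "m x = int (count d x) - int (count d' x)"
      unfolding eq by (simp add: lookup_minus lookup_mset_to_frag count_image_mset_inj_on[OF assms(3) _ x] assms(4,5))
  qed
next
  assume m: "\<forall>x\<in>I. m x = int (count d x) - int (count d' x)"
  show "frag_comb \<beta> I m = mset_to_frag (image_mset \<beta> d) - mset_to_frag (image_mset \<beta> d')"
  proof (rule poly_mapping_eqI)
    fix q
    show "poly_mapping.lookup (frag_comb \<beta> I m) q =
      poly_mapping.lookup (mset_to_frag (image_mset \<beta> d) - mset_to_frag (image_mset \<beta> d')) q"
    proof (cases "q \<in> \<beta> ` I")
      case True
      then obtain x where x: "x \<in> I" "q = \<beta> x" by blast
      then show ?thesis using m
        by (simp add: frag_comb_lookup[OF assms(1,3)] lookup_minus lookup_mset_to_frag count_image_mset_inj_on[OF assms(3) _ x(1)] assms(4,5))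
    next
      case False
      then have "q \<notin># image_mset \<beta> d" "q \<notin># image_mset \<beta> d'" using assms(4,5) by auto
      then have "count (image_mset \<beta> d) q = 0" "count (image_mset \<beta> d') q = 0" by (simp_all only: not_in_iff)
      moreover have "poly_mapping.lookup (frag_comb \<beta> I m) q = 0"
        unfolding frag_comb_def lookup_sum using False by (intro sum.neutral) auto
      ultimately show ?thesis by (simp add: lookup_minus lookup_mset_to_frag)
    qed
  qed
qed

text \<open>A combination of classes is trivial if and only if its exponents form a difference of
  two values. Differences of elements of the grid monoid have the shape in \<open>grid_rel\<close>,
  and splitting integral coefficients into positive and negative parts gives the converse.\<close>

lemma grid_group_of_grid_monoid:
  assumes bij: "bij_betw \<beta> (grid k t) P" and im: "\<phi> ` carrier H = image_mset \<beta> ` grid_monoid k t s"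
  shows "grid_group CG (\<lambda>x. cl (\<beta> x)) k t s"
proof (rule grid_groupI)
  show "comm_group CG" by (rule class_group_comm_group)
  have inj: "inj_on \<beta> (grid k t)" and img: "\<beta> ` grid k t = P" using bij by (auto simp: bij_betw_def)
  show "(\<lambda>x. cl (\<beta> x)) \<in> grid k t \<rightarrow> carrier CG" using cl_closed img by auto
  fix m :: "nat \<times> nat \<Rightarrow> int"
  have "lincomb CG (\<lambda>x. cl (\<beta> x)) (grid k t) m = \<one>\<^bsub>CG\<^esub> \<longleftrightarrow> frag_comb \<beta> (grid k t) m \<in> PS"
    using lincomb_class[OF finite_grid, of \<beta> k t m] frag_class_eq_one[OF frag_comb_keys, of \<beta> "grid k t" m] img by simp
  also have "\<dots> \<longleftrightarrow> (\<exists>d\<in>grid_monoid k t s. \<exists>d'\<in>grid_monoid k t s. \<forall>x\<in>grid k t. m x = int (count d x) - int (count d' x))"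
  proof -
    have "frag_comb \<beta> (grid k t) m \<in> PS \<longleftrightarrow> (\<exists>r\<in>\<phi> ` carrier H. \<exists>r'\<in>\<phi> ` carrier H.
        frag_comb \<beta> (grid k t) m = mset_to_frag r - mset_to_frag r')"
      unfolding principal_iff by blast
    also have "\<dots> \<longleftrightarrow> (\<exists>d\<in>grid_monoid k t s. \<exists>d'\<in>grid_monoid k t s.
        frag_comb \<beta> (grid k t) m = mset_to_frag (image_mset \<beta> d) - mset_to_frag (image_mset \<beta> d'))"
      unfolding im by blast
    also have "\<dots> \<longleftrightarrow> (\<exists>d\<in>grid_monoid k t s. \<exists>d'\<in>grid_monoid k t s. \<forall>x\<in>grid k t. m x = int (count d x) - int (count d' x))"
    proof (intro bex_cong refl)
      fix d d' assume "d \<in> grid_monoid k t s" "d' \<in> grid_monoid k t s"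
      then show "frag_comb \<beta> (grid k t) m = mset_to_frag (image_mset \<beta> d) - mset_to_frag (image_mset \<beta> d') \<longleftrightarrow>
          (\<forall>x\<in>grid k t. m x = int (count d x) - int (count d' x))"
        using img by (intro frag_comb_eq_diff[OF finite_grid _ inj]) (auto simp: grid_monoid_def)
    qed
    finally show ?thesis .
  qed
  also have "\<dots> \<longleftrightarrow> (\<exists>c::nat \<Rightarrow> int. \<forall>i\<in>{1..k}. \<forall>j\<in>{0..t}. m (i, j) - m (0, j) = c i * int (s j))"
  proof
    assume "\<exists>d\<in>grid_monoid k t s. \<exists>d'\<in>grid_monoid k t s. \<forall>x\<in>grid k t. m x = int (count d x) - int (count d' x)"
    then obtain d d' where d: "d \<in> grid_monoid k t s" "d' \<in> grid_monoid k t s"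
      and m: "\<forall>x\<in>grid k t. m x = int (count d x) - int (count d' x)" by blast
    obtain c b where cb: "\<forall>i\<le>k. \<forall>j\<le>t. count d (i, j) = c i * s j + b j"
      using d(1) unfolding grid_monoid_def by blast
    obtain c' b' where cb': "\<forall>i\<le>k. \<forall>j\<le>t. count d' (i, j) = c' i * s j + b' j"
      using d(2) unfolding grid_monoid_def by blast
    have mij: "m (i, j) = (int (c i) - int (c' i)) * int (s j) + (int (b j) - int (b' j))" if "i \<le> k" "j \<le> t" for i j
    proof -
      have "m (i, j) = int (count d (i, j)) - int (count d' (i, j))" using m that by (simp add: grid_def)
      then show ?thesis using cb cb' that by (simp add: algebra_simps)
    qed
    show "\<exists>c::nat \<Rightarrow> int. \<forall>i\<in>{1..k}. \<forall>j\<in>{0..t}. m (i, j) - m (0, j) = c i * int (s j)"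
    proof (intro exI[of _ "\<lambda>i. int (c i) - int (c' i) - (int (c 0) - int (c' 0))"] ballI)
      fix i j assume "i \<in> {1..k}" "j \<in> {0..t}"
      then have ij: "i \<le> k" "j \<le> t" by auto
      show "m (i, j) - m (0, j) = (int (c i) - int (c' i) - (int (c 0) - int (c' 0))) * int (s j)"
        unfolding mij[OF ij] mij[OF le0 ij(2)] by (simp add: algebra_simps)
    qed
  next
    assume "\<exists>c::nat \<Rightarrow> int. \<forall>i\<in>{1..k}. \<forall>j\<in>{0..t}. m (i, j) - m (0, j) = c i * int (s j)"
    then obtain c :: "nat \<Rightarrow> int" where c: "\<forall>i\<in>{1..k}. \<forall>j\<in>{0..t}. m (i, j) - m (0, j) = c i * int (s j)" by blast
    \<comment> \<open>The columns absorb row 0, which can therefore be given row coefficient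
      0.\<close>
    define c0 where "c0 = (\<lambda>i. if i = 0 then 0 else c i)"
    have c0: "m (i, j) = c0 i * int (s j) + m (0, j)" if "i \<le> k" "j \<le> t" for i j
    proof (cases "i = 0")
      case False
      then have "m (i, j) - m (0, j) = c i * int (s j)" using c that by auto
      then show ?thesis using False by (simp add: c0_def)
    qed (simp add: c0_def)
    have cnt: "count (mset_of_fun (grid k t) f) (i, j) = f (i, j)" if "i \<le> k" "j \<le> t" for f i j
      unfolding count_mset_of_fun[OF finite_grid] using that by (simp add: grid_def)
    define d where "d = mset_of_fun (grid k t) (\<lambda>(i, j). nat (c0 i) * s j + nat (m (0, j)))"
    define d' where "d' = mset_of_fun (grid k t) (\<lambda>(i, j). nat (- c0 i) * s j + nat (- m (0, j)))"
    have "d \<in> grid_monoid k t s"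
      unfolding d_def using set_mset_of_fun[OF finite_grid]
      by (rule grid_monoidI[where c = "\<lambda>i. int (nat (c0 i))" and d = "\<lambda>j. int (nat (m (0, j)))"])
        (simp add: cnt)
    moreover have "d' \<in> grid_monoid k t s"
      unfolding d'_def using set_mset_of_fun[OF finite_grid]
      by (rule grid_monoidI[where c = "\<lambda>i. int (nat (- c0 i))" and d = "\<lambda>j. int (nat (- m (0, j)))"])
        (simp add: cnt)
    moreover have "m x = int (count d x) - int (count d' x)" if xg: "x \<in> grid k t" for x
    proof -
      obtain i j where x: "x = (i, j)" "i \<le> k" "j \<le> t" using xg unfolding grid_def by auto
      have "int (count d x) - int (count d' x) = (int (nat (c0 i)) - int (nat (- c0 i))) * int (s j)
          + (int (nat (m (0, j))) - int (nat (- m (0, j))))"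
        unfolding d_def d'_def x(1) cnt[OF x(2,3)] by (simp add: left_diff_distrib)
      also have "int (nat (c0 i)) - int (nat (- c0 i)) = c0 i" by simp
      also have "int (nat (m (0, j))) - int (nat (- m (0, j))) = m (0, j)" by simp
      finally show ?thesis using c0[OF x(2,3)] x(1) by simp
    qed
    ultimately show "\<exists>d\<in>grid_monoid k t s. \<exists>d'\<in>grid_monoid k t s. \<forall>x\<in>grid k t. m x = int (count d x) - int (count d' x)" by blast
  qed
  finally show "lincomb CG (\<lambda>x. cl (\<beta> x)) (grid k t) m = \<one>\<^bsub>CG\<^esub> \<longleftrightarrow>
    (\<exists>c::nat \<Rightarrow> int. \<forall>i\<in>{1..k}. \<forall>j\<in>{0..t}. m (i, j) - m (0, j) = c i * int (s j))" .
qed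

text \<open>A multiset of prime divisors is a value if and only if its class is trivial. So the
  relations of the classes alone determine the image of \<open>\<phi>\<close>, and
  \<open>grid_rel\<close> together with \<open>grid_monoidI\<close> identifies it.\<close>

lemma grid_monoid_of_grid_group:
  assumes bij: "bij_betw \<beta> (grid k t) P" and gg: "grid_group CG \<gamma> k t s"
    and \<gamma>: "\<And>x. x \<in> grid k t \<Longrightarrow> \<gamma> x = cl (\<beta> x)"
  shows "\<phi> ` carrier H = image_mset \<beta> ` grid_monoid k t s"
proof -
  interpret g: grid_group CG \<gamma> k t s by fact
  have inj: "inj_on \<beta> (grid k t)" and img: "\<beta> ` grid k t = P" using bij by (auto simp: bij_betw_def)
  have key: "image_mset \<beta> d \<in> \<phi> ` carrier H \<longleftrightarrow> d \<in> grid_monoid k t s" if d: "set_mset d \<subseteq> grid k t" for d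
  proof -
    have sub: "set_mset (image_mset \<beta> d) \<subseteq> P" using d img by auto
    have "mset_to_frag (image_mset \<beta> d) = frag_comb \<beta> (grid k t) (\<lambda>x. int (count d x))"
      using frag_comb_eq_diff[OF finite_grid _ inj d, of "{#}" "\<lambda>x. int (count d x)"] img by simp
    then have "image_mset \<beta> d \<in> \<phi> ` carrier H \<longleftrightarrow> frag_class (frag_comb \<beta> (grid k t) (\<lambda>x. int (count d x))) = \<one>\<^bsub>CG\<^esub>"
      using mset_to_frag_in_principal[OF sub] frag_class_eq_one[OF frag_comb_keys] img by auto
    also have "\<dots> \<longleftrightarrow> lincomb CG \<gamma> (grid k t) (\<lambda>x. int (count d x)) = \<one>\<^bsub>CG\<^esub>"
    proof -
      have "lincomb CG \<gamma> (grid k t) (\<lambda>x. int (count d x)) = lincomb CG (\<lambda>x. cl (\<beta> x)) (grid k t) (\<lambda>x. int (count d x))"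
      proof -
        have "cl (\<beta> x) \<in> carrier CG" if "x \<in> grid k t" for x using that img by (intro cl_closed) blast
        then show ?thesis unfolding lincomb_def by (intro g.finprod_cong') (auto simp: \<gamma>)
      qed
      then show ?thesis using lincomb_class[OF finite_grid, of \<beta> k t] img by simp
    qed
    also have "\<dots> \<longleftrightarrow> d \<in> grid_monoid k t s"
      unfolding g.grid_rel
    proof
      assume "\<exists>c::nat \<Rightarrow> int. \<forall>i\<in>{1..k}. \<forall>j\<in>{0..t}. int (count d (i, j)) - int (count d (0, j)) = c i * int (s j)"
      then obtain c :: "nat \<Rightarrow> int" where c: "\<forall>i\<in>{1..k}. \<forall>j\<in>{0..t}. int (count d (i, j)) - int (count d (0, j)) = c i * int (s j)" by blast
      show "d \<in> grid_monoid k t s"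
      proof (rule grid_monoidI[OF d, where c = "\<lambda>i. if i = 0 then 0 else c i" and d = "\<lambda>j. int (count d (0, j))"])
        fix i j assume ij: "i \<le> k" "j \<le> t"
        show "int (count d (i, j)) = (if i = 0 then 0 else c i) * int (s j) + int (count d (0, j))"
        proof (cases "i = 0")
          case False
          then have "int (count d (i, j)) - int (count d (0, j)) = c i * int (s j)" using c ij by auto
          then show ?thesis using False by simp
        qed simp
      qed
    next
      assume "d \<in> grid_monoid k t s"
      then obtain c b where cb: "\<forall>i\<le>k. \<forall>j\<le>t. count d (i, j) = c i * s j + b j"
        unfolding grid_monoid_def by blast
      show "\<exists>c::nat \<Rightarrow> int. \<forall>i\<in>{1..k}. \<forall>j\<in>{0..t}. int (count d (i, j)) - int (count d (0, j)) = c i * int (s j)"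
        using cb by (intro exI[of _ "\<lambda>i. int (c i) - int (c 0)"]) (simp add: algebra_simps)
    qed
    finally show ?thesis .
  qed
  show ?thesis
  proof (intro equalityI subsetI)
    fix r assume r: "r \<in> \<phi> ` carrier H"
    then have "set_mset r \<subseteq> \<beta> ` grid k t" using phi_supp img by auto
    then obtain d where "set_mset d \<subseteq> grid k t" "image_mset \<beta> d = r" using image_mset_lift by blast
    then show "r \<in> image_mset \<beta> ` grid_monoid k t s" using key[of d] r by blast
  next
    fix r assume "r \<in> image_mset \<beta> ` grid_monoid k t s"
    then obtain d where d: "d \<in> grid_monoid k t s" "r = image_mset \<beta> d" by blast
    then have "set_mset d \<subseteq> grid k t" by (simp add: grid_monoid_def)
    then show "r \<in> \<phi> ` carrier H" using key d by blast
  qed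
qed

text \<open>The map replaces prime divisors by their classes. It is injective because classes
  separate prime divisors and \<open>\<phi>\<close> separates the elements of a reduced monoid, and
  it reaches every zero-sum sequence because multisets with trivial class are values.\<close>

lemma zero_sum_iso:
  assumes red: "reduced H" and inj: "inj_on cl P"
  shows "H \<cong> zero_sum_monoid CG (cl ` P)"
proof -
  let ?f = "\<lambda>a. image_mset cl (\<phi> a)"
  have "?f \<in> hom H (zero_sum_monoid CG (cl ` P))"
  proof (rule homI)
    fix a assume a: "a \<in> carrier H"
    have "mset_to_frag (\<phi> a) \<in> PS" using mset_to_frag_in_principal[OF phi_supp[OF a]] a by blast
    then have "mset_prod CG (?f a) = \<one>\<^bsub>CG\<^esub>"
      using mset_prod_divisor_class[OF phi_supp[OF a]] frag_class_eq_one[of "mset_to_frag (\<phi> a)"] phi_supp[OF a]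
      by (simp add: keys_mset_to_frag)
    then show "?f a \<in> carrier (zero_sum_monoid CG (cl ` P))"
      using phi_supp[OF a] by (auto simp: zero_sum_monoid_def)
  qed (simp add: zero_sum_monoid_def)
  moreover have "bij_betw ?f (carrier H) (carrier (zero_sum_monoid CG (cl ` P)))"
  proof (rule bij_betw_imageI)
    show "inj_on ?f (carrier H)"
    proof (rule inj_onI)
      fix a b assume ab: "a \<in> carrier H" "b \<in> carrier H" "?f a = ?f b"
      then have "\<phi> a = \<phi> b"
        using image_mset_inj_on_eq[OF inj phi_supp[OF ab(1)] phi_supp[OF ab(2)]] by blast
      then obtain u where "u \<in> Units H" "b = u \<otimes> a" using phi_eq_ex_unit ab by blast
      then show "a = b" using red ab by (auto simp: reduced_def)
    qed
    show "?f ` carrier H = carrier (zero_sum_monoid CG (cl ` P))"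
    proof (intro equalityI subsetI)
      fix S assume "S \<in> ?f ` carrier H"
      then show "S \<in> carrier (zero_sum_monoid CG (cl ` P))"
        using \<open>?f \<in> hom H (zero_sum_monoid CG (cl ` P))\<close> hom_carrier by blast
    next
      fix S assume S: "S \<in> carrier (zero_sum_monoid CG (cl ` P))"
      then have S': "set_mset S \<subseteq> cl ` P" "mset_prod CG S = \<one>\<^bsub>CG\<^esub>" by (simp_all add: zero_sum_monoid_def)
      obtain d where d: "set_mset d \<subseteq> P" "image_mset cl d = S" using image_mset_lift[OF S'(1)] by blast
      have "frag_class (mset_to_frag d) = \<one>\<^bsub>CG\<^esub>"
        using mset_prod_divisor_class[OF d(1)] S'(2) d(2) by simp
      then have "mset_to_frag d \<in> PS"
        using frag_class_eq_one[of "mset_to_frag d"] d(1) unfolding keys_mset_to_frag by blast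
      then obtain a where "a \<in> carrier H" "d = \<phi> a" using mset_to_frag_in_principal[OF d(1)] by blast
      then show "S \<in> ?f ` carrier H" using d by blast
    qed
  qed
  ultimately show ?thesis unfolding is_iso_def using isoI by blast
qed

end

text \<open>Forward, the grid of prime divisors is carried to the class group, where
  \<open>gamma_inj\<close> makes its classes distinct. Backward, the grid of classes lifts to prime
  divisors because each class contains only one, and the image of \<open>\<phi>\<close> becomes a
  copy of the grid monoid.\<close>

theorem (in krull_with_theory) length_factorial_characterization:
  assumes red: "reduced H" and np: "\<forall>p\<in>carrier H. \<not> prime H p"
  shows "length_factorial H \<and> \<not> factorial H \<longleftrightarrow>
    (\<forall>c\<in>cl ` P. \<exists>!q. q \<in> P \<and> cl q = c) \<and> H \<cong> zero_sum_monoid CG (cl ` P) \<and>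
    (\<exists>t k s e g. class_structure CG (cl ` P) t k s e g)"
proof
  assume lf: "length_factorial H \<and> \<not> factorial H"
  interpret R: krull_set "\<phi> ` carrier H" P by (rule krull_set_image)
  have np': "\<exists>b\<in>\<phi> ` carrier H. \<exists>c\<in>\<phi> ` carrier H. a \<subseteq># b + c \<and> \<not> a \<subseteq># b \<and> \<not> a \<subseteq># c"
    if a: "a \<in> mset_atoms (\<phi> ` carrier H)" for a
  proof -
    obtain p where p: "p \<in> carrier H" "a = \<phi> p" "\<phi> p \<noteq> {#}"
      using a unfolding mset_atoms_def by blast
    have "p \<notin> Units H" using unit_iff p by blast
    then obtain x y where xy: "x \<in> carrier H" "y \<in> carrier H" "p divides x \<otimes> y" "\<not> p divides x" "\<not> p divides y"
      using np p(1) unfolding prime_def by blast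
    then have "\<phi> p \<subseteq># \<phi> x + \<phi> y" "\<not> \<phi> p \<subseteq># \<phi> x" "\<not> \<phi> p \<subseteq># \<phi> y"
      using divides_iff[OF p(1)] phi_mult[of x y] m_closed[of x y] by metis+
    then show ?thesis using xy p by blast
  qed
  have ulf: "unique_length_fact (\<phi> ` carrier H)" and nuf: "\<not> unique_fact (\<phi> ` carrier H)"
    using lf length_factorial_iff factorial_iff by auto
  obtain k t s \<beta> where ks: "k \<ge> 1" "\<And>j. j \<le> t \<Longrightarrow> s j \<ge> 1" "k + 1 \<noteq> (\<Sum>j=0..t. s j)" "(\<Sum>j=0..t. s j) \<ge> 2"
    and bij: "bij_betw \<beta> (grid k t) P" and im: "\<phi> ` carrier H = image_mset \<beta> ` grid_monoid k t s"
    by (rule R.grid_structure[OF ulf nuf np']) (assumption, rule that)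
  interpret g: grid_group CG "\<lambda>x. cl (\<beta> x)" k t s by (rule grid_group_of_grid_monoid[OF bij im])
  interpret g: proper_grid_group CG "\<lambda>x. cl (\<beta> x)" k t s
    by unfold_locales (fact ks)+
  have injb: "inj_on \<beta> (grid k t)" and img: "\<beta> ` grid k t = P" using bij by (auto simp: bij_betw_def)
  have inj: "inj_on cl P"
  proof (rule inj_onI)
    fix p q assume pq: "p \<in> P" "q \<in> P" "cl p = cl q"
    then obtain x y where "x \<in> grid k t" "y \<in> grid k t" "p = \<beta> x" "q = \<beta> y" using img by blast
    then show "p = q" using inj_onD[OF g.gamma_inj, of x y] pq by blast
  qed
  have imc: "(\<lambda>x. cl (\<beta> x)) ` grid k t = cl ` P" unfolding img[symmetric] by (simp add: image_image)
  have "class_structure CG (cl ` P) t k s (\<lambda>i j. cl (\<beta> (i, j))) (\<lambda>i. cl (\<beta> (i, 0)))"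
    using g.class_structureI[OF class_group_generated[OF finite_grid img injb]] unfolding imc .
  moreover have "\<forall>c\<in>cl ` P. \<exists>!q. q \<in> P \<and> cl q = c" using inj by (metis imageE inj_onD)
  ultimately show "(\<forall>c\<in>cl ` P. \<exists>!q. q \<in> P \<and> cl q = c) \<and> H \<cong> zero_sum_monoid CG (cl ` P) \<and>
    (\<exists>t k s e g. class_structure CG (cl ` P) t k s e g)"
    using zero_sum_iso[OF red inj] by blast
next
  assume h: "(\<forall>c\<in>cl ` P. \<exists>!q. q \<in> P \<and> cl q = c) \<and> H \<cong> zero_sum_monoid CG (cl ` P) \<and>
    (\<exists>t k s e g. class_structure CG (cl ` P) t k s e g)"
  then have "\<exists>t k s e g. class_structure CG (cl ` P) t k s e g" by (elim conjE)
  then obtain t k s e g where cs: "class_structure CG (cl ` P) t k s e g" by (elim exE)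
  define \<gamma> where "\<gamma> = (\<lambda>(i, j). if j = 0 then g i else e i j)"
  interpret g: proper_grid_group CG \<gamma> k t s
    unfolding \<gamma>_def by (rule class_structureD[OF class_group_comm_group cs])
  have im\<gamma>: "\<gamma> ` grid k t = cl ` P"
    unfolding \<gamma>_def by (rule class_structureD(2)[OF class_group_comm_group cs])
  define \<beta> where "\<beta> = (\<lambda>x. the_inv_into P cl (\<gamma> x))"
  have "\<forall>c\<in>cl ` P. \<exists>!q. q \<in> P \<and> cl q = c" using h by (rule conjunct1)
  then have inj: "inj_on cl P" by (intro inj_onI) (metis imageI)
  have cl\<beta>: "cl (\<beta> x) = \<gamma> x" "\<beta> x \<in> P" if "x \<in> grid k t" for x
  proof -
    have "\<gamma> x \<in> cl ` P" using im\<gamma> that by blast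
    then show "cl (\<beta> x) = \<gamma> x" "\<beta> x \<in> P"
      unfolding \<beta>_def using f_the_inv_into_f[OF inj] the_inv_into_into[OF inj] by blast+
  qed
  have bij: "bij_betw \<beta> (grid k t) P"
  proof (rule bij_betw_imageI)
    show "inj_on \<beta> (grid k t)"
    proof (rule inj_onI)
      fix x y assume xy: "x \<in> grid k t" "y \<in> grid k t" "\<beta> x = \<beta> y"
      then have "\<gamma> x = \<gamma> y" using cl\<beta>(1) by metis
      then show "x = y" using inj_onD[OF g.gamma_inj] xy by blast
    qed
    show "\<beta> ` grid k t = P"
    proof (intro equalityI subsetI)
      fix p assume p: "p \<in> P"
      then obtain x where x: "x \<in> grid k t" "\<gamma> x = cl p" using im\<gamma> by (metis imageE imageI)
      then have "\<beta> x = p" using cl\<beta>[OF x(1)] p inj by (metis inj_onD)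
      then show "p \<in> \<beta> ` grid k t" using x by blast
    qed (use cl\<beta>(2) in blast)
  qed
  have im: "\<phi> ` carrier H = image_mset \<beta> ` grid_monoid k t s"
    by (rule grid_monoid_of_grid_group[OF bij g.grid_group_axioms]) (simp add: cl\<beta>)
  have injb: "inj_on \<beta> (grid k t)" using bij by (auto simp: bij_betw_def)
  have "bij_betw (image_mset \<beta>) (grid_monoid k t s) (\<phi> ` carrier H)"
    unfolding im using image_mset_inj_on_eq[OF injb]
    by (intro bij_betw_imageI) (auto simp: inj_on_def grid_monoid_def)
  from unique_factorization_iso[OF saturated_grid_monoid saturated_image this]
  have "unique_length_fact (\<phi> ` carrier H)" "\<not> unique_fact (\<phi> ` carrier H)"
    using grid_monoid_length_factorial[of k t s] g.k1 g.s1 g.ks g.s2 by auto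
  then show "length_factorial H \<and> \<not> factorial H" using length_factorial_iff factorial_iff by blast
qed

section \<open>Subgroups of free abelian groups are free\<close>

lemma lookup_sum_mset:
  assumes "finite S" "set_mset M \<subseteq> S"
  shows "poly_mapping.lookup (\<Sum>p\<in>#M. b p) q = (\<Sum>p\<in>S. int (count M p) * poly_mapping.lookup (b p :: 'q \<Rightarrow>\<^sub>0 int) q)"
  using assms(2)
proof (induction M)
  case (add a M)
  have "(\<Sum>p\<in>S. int (count (add_mset a M) p) * poly_mapping.lookup (b p) q) =
      (\<Sum>p\<in>S. int (count M p) * poly_mapping.lookup (b p) q + (if p = a then poly_mapping.lookup (b p) q else 0))"
    by (intro sum.cong) (auto simp: algebra_simps)
  also have "\<dots> = (\<Sum>p\<in>S. int (count M p) * poly_mapping.lookup (b p) q) + poly_mapping.lookup (b a) q"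
    using add.prems assms(1) by (simp add: sum.distrib)
  finally show ?case using add by (simp add: lookup_add)
qed simp

text \<open>Well-order the ambient basis. A basis of the subgroup consists of elements with minimal positive
  leading coefficient, one for each index that occurs as the leading index of an element.\<close>

theorem subgroup_of_frags_free:
  fixes K :: "('p \<Rightarrow>\<^sub>0 int) set"
  assumes zero: "0 \<in> K" and diff: "\<And>x y. x \<in> K \<Longrightarrow> y \<in> K \<Longrightarrow> x - y \<in> K"
  obtains B :: "'p set" and b where "\<And>p. p \<in> B \<Longrightarrow> b p \<in> K"
    "\<And>x. x \<in> K \<Longrightarrow> \<exists>M N. set_mset M \<subseteq> B \<and> set_mset N \<subseteq> B \<and> x = (\<Sum>p\<in>#M. b p) - (\<Sum>p\<in>#N. b p)"
    "\<And>M N. set_mset M \<subseteq> B \<Longrightarrow> set_mset N \<subseteq> B \<Longrightarrow> (\<Sum>p\<in>#M. b p) = (\<Sum>p\<in>#N. b p) \<Longrightarrow> M = N"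
proof -
  obtain r :: "'p rel" where r: "well_order_on UNIV r" using well_order_on by blast
  define lt where "lt = (\<lambda>p q. (p, q) \<in> r - Id)"
  have wf: "wfP lt"
  proof -
    have "{(p, q). lt p q} = r - Id" by (auto simp: lt_def)
    then show ?thesis using r unfolding well_order_on_def wfp_def by simp
  qed
  have lin: "lt p q \<or> p = q \<or> lt q p" for p q
    using r unfolding well_order_on_def linear_order_on_def total_on_def lt_def by auto
  have ltrans: "lt p q \<Longrightarrow> lt q s \<Longrightarrow> lt p s" for p q s
    using r unfolding well_order_on_def linear_order_on_def partial_order_on_def preorder_on_def lt_def
    by (auto dest: transD antisymD)
  have lirr: "\<not> lt p p" for p by (simp add: lt_def)
  have maxi: "\<exists>p\<in>D. \<forall>q\<in>D. q = p \<or> lt q p" if "finite D" "D \<noteq> {}" for D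
    using that
  proof (induction D rule: finite_ne_induct)
    case (insert a D)
    then obtain p where p: "p \<in> D" "\<forall>q\<in>D. q = p \<or> lt q p" by blast
    show ?case
    proof (cases "lt a p")
      case True then show ?thesis using p by blast
    next
      case False
      then have pa: "a = p \<or> lt p a" using lin by blast
      have "q = a \<or> lt q a" if "q \<in> insert a D" for q
        using that p(2) pa ltrans[of q p a] by auto
      then show ?thesis by blast
    qed
  qed auto
  let ?lk = "poly_mapping.lookup :: ('p \<Rightarrow>\<^sub>0 int) \<Rightarrow> _"
  have add: "x + y \<in> K" if "x \<in> K" "y \<in> K" for x y
    using diff[OF that(1) diff[OF zero that(2)]] by simp
  have cmul: "frag_cmul c x \<in> K" if x: "x \<in> K" for c x
  proof -
    have nat: "frag_cmul (int n) x \<in> K" for n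
    proof (induction n)
      case (Suc n)
      have "frag_cmul (int (Suc n)) x = x + frag_cmul (int n) x" by (simp add: frag_cmul_distrib)
      then show ?case using add[OF x Suc] by simp
    qed (simp add: zero)
    show ?thesis
    proof (cases "c \<ge> 0")
      case True
      then show ?thesis using nat[of "nat c"] by simp
    next
      case False
      then have "frag_cmul c x = 0 - frag_cmul (int (nat (- c))) x" by simp
      then show ?thesis using diff[OF zero nat[of "nat (- c)"]] by simp
    qed
  qed
  define lead where "lead = (\<lambda>x p n. x \<in> K \<and> (\<forall>q\<in>Poly_Mapping.keys x. q = p \<or> lt q p) \<and> ?lk x p = int n \<and> n > 0)"
  define B where "B = {p. \<exists>n x. lead x p n}"
  define nn where "nn = (\<lambda>p. LEAST n. \<exists>x. lead x p n)"
  define b where "b = (\<lambda>p. SOME x. lead x p (nn p))"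
  have b: "lead (b p) p (nn p)" if "p \<in> B" for p
  proof -
    have "\<exists>x. lead x p (nn p)" unfolding nn_def by (rule LeastI_ex) (use that in \<open>simp add: B_def\<close>)
    then show ?thesis unfolding b_def by (rule someI_ex)
  qed
  have nmin: "nn p \<le> n" if "lead x p n" for x p n unfolding nn_def by (rule Least_le) (use that in blast)
  have span: "\<exists>M N. set_mset M \<subseteq> B \<and> set_mset N \<subseteq> B \<and> x = (\<Sum>p\<in>#M. b p) - (\<Sum>p\<in>#N. b p)"
    if "x \<in> K" "\<forall>q\<in>Poly_Mapping.keys x. q = p \<or> lt q p" for p x
    using wf that
  proof (induction p arbitrary: x rule: wfp_induct_rule)
    case (less p)
    \<comment> \<open>An element supported strictly below \<open>p\<close> is 0 or has its leading
      index below \<open>p\<close>, where the induction hypothesis applies.\<close>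
    have step: "\<exists>M N. set_mset M \<subseteq> B \<and> set_mset N \<subseteq> B \<and> y = (\<Sum>p\<in>#M. b p) - (\<Sum>p\<in>#N. b p)"
      if y: "y \<in> K" "\<forall>q\<in>Poly_Mapping.keys y. lt q p" for y
    proof (cases "y = 0")
      case True
      then show ?thesis by (intro exI[of _ "{#}"]) auto
    next
      case False
      then have "Poly_Mapping.keys y \<noteq> {}" by simp
      then obtain q where q: "q \<in> Poly_Mapping.keys y" "\<forall>q'\<in>Poly_Mapping.keys y. q' = q \<or> lt q' q"
        using maxi[of "Poly_Mapping.keys y"] by auto
      then show ?thesis using less.IH[of q y] y by blast
    qed
    show ?case
    proof (cases "?lk x p = 0")
      case True
      then have "\<forall>q\<in>Poly_Mapping.keys x. lt q p" using less.prems by (auto simp: in_keys_iff)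
      then show ?thesis using step less.prems by blast
    next
      case False
      have pB: "p \<in> B"
      proof (cases "?lk x p > 0")
        case True
        then have "lead x p (nat (?lk x p))" using less.prems by (auto simp: lead_def)
        then show ?thesis by (auto simp: B_def)
      next
        case neg: False
        have "- x \<in> K" using diff[OF zero less.prems(1)] by simp
        then have "lead (- x) p (nat (- ?lk x p))" using less.prems False neg by (auto simp: lead_def)
        then show ?thesis by (auto simp: B_def)
      qed
      define n where "n = int (nn p)"
      have bp: "b p \<in> K" "\<forall>q\<in>Poly_Mapping.keys (b p). q = p \<or> lt q p" "?lk (b p) p = n" "n > 0"
        using b[OF pB] by (auto simp: lead_def n_def)
      \<comment> \<open>Division with remainder by the least positive leading coefficient at
        \<open>p\<close>. A nonzero remainder would be a smaller leading coefficient of an element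
        of \<open>K\<close>, so the index \<open>p\<close> is eliminated.\<close>
      define c where "c = ?lk x p div n"
      define y where "y = x - frag_cmul c (b p)"
      have yK: "y \<in> K" unfolding y_def by (rule diff[OF less.prems(1) cmul[OF bp(1)]])
      have ykeys: "q = p \<or> lt q p" if "q \<in> Poly_Mapping.keys y" for q
        using that less.prems(2) bp(2) keys_diff[of x "frag_cmul c (b p)"] keys_cmul[of c "b p"]
        unfolding y_def by blast
      have yp: "?lk y p = ?lk x p mod n"
        unfolding y_def c_def by (simp add: lookup_minus bp(3) minus_div_mult_eq_mod)
      have "?lk y p = 0"
      proof (rule ccontr)
        assume "?lk y p \<noteq> 0"
        then have "?lk y p > 0" "?lk y p < n"
          unfolding yp using bp(4) pos_mod_sign[of n "?lk x p"] pos_mod_bound[of n "?lk x p"] by linarith+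
        then have "lead y p (nat (?lk y p))" using yK ykeys by (auto simp: lead_def)
        then have "nn p \<le> nat (?lk y p)" by (rule nmin)
        then show False using \<open>?lk y p < n\<close> \<open>?lk y p > 0\<close> by (simp add: n_def)
      qed
      then have "\<forall>q\<in>Poly_Mapping.keys y. lt q p" using ykeys by (auto simp: in_keys_iff)
      then obtain M N where MN: "set_mset M \<subseteq> B" "set_mset N \<subseteq> B" "y = (\<Sum>p\<in>#M. b p) - (\<Sum>p\<in>#N. b p)"
        using step[OF yK] by blast
      have rep: "\<Sum>\<^sub># (replicate_mset k (b p)) = frag_cmul (int k) (b p)" for k
        by (induction k) (auto simp: frag_cmul_distrib)
      have split: "frag_cmul c (b p) = frag_cmul (int (nat c)) (b p) - frag_cmul (int (nat (- c))) (b p)"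
        unfolding frag_cmul_diff_distrib[symmetric] by simp
      have "(\<Sum>p\<in>#M + replicate_mset (nat c) p. b p) - (\<Sum>p\<in>#N + replicate_mset (nat (- c)) p. b p) =
          ((\<Sum>p\<in>#M. b p) - (\<Sum>p\<in>#N. b p)) + (frag_cmul (int (nat c)) (b p) - frag_cmul (int (nat (- c))) (b p))"
        by (simp add: rep del: int_nat_eq)
      also have "\<dots> = x" unfolding MN(3)[symmetric] split[symmetric] y_def by simp
      finally have "x = (\<Sum>p\<in>#M + replicate_mset (nat c) p. b p) - (\<Sum>p\<in>#N + replicate_mset (nat (- c)) p. b p)" ..
      moreover have "set_mset (M + replicate_mset (nat c) p) \<subseteq> B" "set_mset (N + replicate_mset (nat (- c)) p) \<subseteq> B"
        using MN pB by auto
      ultimately show ?thesis by blast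
    qed
  qed
  have indep: "M = N"
    if MN: "set_mset M \<subseteq> B" "set_mset N \<subseteq> B" "(\<Sum>p\<in>#M. b p) = (\<Sum>p\<in>#N. b p)" for M N
  proof (rule ccontr)
    assume "M \<noteq> N"
    let ?S = "set_mset M \<union> set_mset N"
    define D where "D = {p\<in>?S. count M p \<noteq> count N p}"
    have "D \<noteq> {}"
    proof
      assume D: "D = {}"
      have "count M p = count N p" for p
      proof (cases "p \<in> ?S")
        case True then show ?thesis using D by (auto simp: D_def)
      next
        case False then show ?thesis by (simp add: not_in_iff)
      qed
      then show False using \<open>M \<noteq> N\<close> by (simp add: multiset_eq_iff)
    qed
    moreover have "finite D" by (simp add: D_def)
    \<comment> \<open>At the largest index whose multiplicities differ, the other basis elements
      with differing multiplicities vanish, because their leading indices are smaller. The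
      coefficient at \<open>p\<close> then isolates \<open>b p\<close>.\<close>
    ultimately obtain p where p: "p \<in> D" "\<forall>q\<in>D. q = p \<or> lt q p" using maxi by blast
    have "(\<Sum>q\<in>?S. int (count M q) * ?lk (b q) p) = (\<Sum>q\<in>?S. int (count N q) * ?lk (b q) p)"
      using arg_cong[OF MN(3), of "\<lambda>x. ?lk x p"] by (simp add: lookup_sum_mset[of ?S])
    then have "(\<Sum>q\<in>?S. (int (count M q) - int (count N q)) * ?lk (b q) p) = 0"
      by (simp add: left_diff_distrib sum_subtractf)
    moreover have "(\<Sum>q\<in>?S. (int (count M q) - int (count N q)) * ?lk (b q) p) =
        (\<Sum>q\<in>?S. if q = p then (int (count M q) - int (count N q)) * ?lk (b q) p else 0)"
    proof (intro sum.cong refl)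
      fix q assume q: "q \<in> ?S"
      have "(int (count M q) - int (count N q)) * ?lk (b q) p = 0" if "q \<noteq> p"
      proof (cases "q \<in> D")
        case True
        then have "lt q p" using p that by blast
        have "q \<in> B" using q MN by auto
        then have "p \<notin> Poly_Mapping.keys (b q)"
          using b[of q] \<open>lt q p\<close> ltrans[of q p q] lirr[of q] that unfolding lead_def by auto
        then show ?thesis by (simp add: in_keys_iff)
      next
        case False
        then have "count M q = count N q" using q unfolding D_def by blast
        then show ?thesis by simp
      qed
      then show "(int (count M q) - int (count N q)) * ?lk (b q) p =
          (if q = p then (int (count M q) - int (count N q)) * ?lk (b q) p else 0)" by simp
    qed
    moreover have "p \<in> ?S" using p by (simp add: D_def)
    ultimately have "(int (count M p) - int (count N p)) * ?lk (b p) p = 0" by simp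
    moreover have "p \<in> B" using p MN by (auto simp: D_def)
    ultimately show False using b[of p] p by (auto simp: lead_def D_def)
  qed
  show thesis
  proof (rule that[of B b])
    show "b p \<in> K" if "p \<in> B" for p using b[OF that] by (simp add: lead_def)
    show "\<exists>M N. set_mset M \<subseteq> B \<and> set_mset N \<subseteq> B \<and> x = (\<Sum>p\<in>#M. b p) - (\<Sum>p\<in>#N. b p)" if x: "x \<in> K" for x
    proof (cases "x = 0")
      case True
      then show ?thesis by (intro exI[of _ "{#}"]) auto
    next
      case False
      then have "Poly_Mapping.keys x \<noteq> {}" by simp
      then obtain q where "q \<in> Poly_Mapping.keys x" "\<forall>q'\<in>Poly_Mapping.keys x. q' = q \<or> lt q' q"
        using maxi[of "Poly_Mapping.keys x"] by auto
      then show ?thesis using span[OF x] by blast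
    qed
    show "M = N" if "set_mset M \<subseteq> B" "set_mset N \<subseteq> B" "(\<Sum>p\<in>#M. b p) = (\<Sum>p\<in>#N. b p)" for M N
      using indep that by blast
  qed
qed

section \<open>Existence of the splitting\<close>

text \<open>As the group generated by \<open>\<phi>(H)\<close> is free, the units are a direct factor: the value \<open>\<rho> h\<close> is the
  quotient of \<open>h\<close> and the product of lifts of the basis elements occurring in \<open>\<phi> h\<close>.\<close>

lemma (in free_divisor_hom) unit_retraction:
  obtains \<rho> where "\<And>h. h \<in> carrier H \<Longrightarrow> \<rho> h \<in> Units H"
    "\<And>h h'. h \<in> carrier H \<Longrightarrow> h' \<in> carrier H \<Longrightarrow> \<rho> (h \<otimes> h') = \<rho> h \<otimes> \<rho> h'"
    "\<And>u. u \<in> Units H \<Longrightarrow> \<rho> u = u"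
proof -
  have zero: "0 \<in> PS" using subgroup.one_closed[OF principal_subgroup] by simp
  have diff: "x - y \<in> PS" if "x \<in> PS" "y \<in> PS" for x y
  proof -
    have "inv\<^bsub>free_Abelian_group P\<^esub> y \<in> PS" using subgroup.m_inv_closed[OF principal_subgroup that(2)] .
    moreover have "Poly_Mapping.keys y \<subseteq> P" using subsetD[OF subgroup.subset[OF principal_subgroup] that(2)] by simp
    ultimately show ?thesis using subgroup.m_closed[OF principal_subgroup that(1), of "- y"] by simp
  qed
  obtain B :: "'p set" and b where bK: "\<And>p. p \<in> B \<Longrightarrow> b p \<in> PS"
    and span: "\<And>x. x \<in> PS \<Longrightarrow> \<exists>M N. set_mset M \<subseteq> B \<and> set_mset N \<subseteq> B \<and> x = (\<Sum>p\<in>#M. b p) - (\<Sum>p\<in>#N. b p)"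
    and indep: "\<And>M N. set_mset M \<subseteq> B \<Longrightarrow> set_mset N \<subseteq> B \<Longrightarrow> (\<Sum>p\<in>#M. b p) = (\<Sum>p\<in>#N. b p) \<Longrightarrow> M = N"
    by (rule subgroup_of_frags_free[OF zero diff]) (assumption, assumption, rule that)
  \<comment> \<open>A basis element is a difference of values and need not be a value, so its lift
    is a fraction. The pair \<open>\<alpha> p\<close> holds numerator and denominator.\<close>
  have "\<forall>p\<in>B. \<exists>x. fst x \<in> carrier H \<and> snd x \<in> carrier H \<and> b p = mset_to_frag (\<phi> (fst x)) - mset_to_frag (\<phi> (snd x))"
    using bK unfolding principal_iff by fastforce
  then obtain \<alpha> where \<alpha>: "\<And>p. p \<in> B \<Longrightarrow> fst (\<alpha> p) \<in> carrier H \<and> snd (\<alpha> p) \<in> carrier H \<and>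
      b p = mset_to_frag (\<phi> (fst (\<alpha> p))) - mset_to_frag (\<phi> (snd (\<alpha> p)))"
    by (metis bchoice)
  define A where "A = (\<lambda>M. mset_prod H (image_mset (\<lambda>p. fst (\<alpha> p)) M))"
  define A' where "A' = (\<lambda>M. mset_prod H (image_mset (\<lambda>p. snd (\<alpha> p)) M))"
  have sub: "set_mset (image_mset (\<lambda>p. fst (\<alpha> p)) M) \<subseteq> carrier H" "set_mset (image_mset (\<lambda>p. snd (\<alpha> p)) M) \<subseteq> carrier H"
    if "set_mset M \<subseteq> B" for M using that \<alpha> by auto
  have Ac: "A M \<in> carrier H" "A' M \<in> carrier H" if "set_mset M \<subseteq> B" for M
    unfolding A_def A'_def using sub[OF that] by auto
  have Aadd: "A (M + N) = A M \<otimes> A N" "A' (M + N) = A' M \<otimes> A' N" if "set_mset M \<subseteq> B" "set_mset N \<subseteq> B" for M N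
    unfolding A_def A'_def using sub[OF that(1)] sub[OF that(2)] by (simp_all add: mset_prod_union)
  have Asum: "mset_to_frag (\<phi> (A M)) - mset_to_frag (\<phi> (A' M)) = (\<Sum>p\<in>#M. b p)" if "set_mset M \<subseteq> B" for M
    using that
  proof (induction M)
    case empty
    then show ?case by (simp add: A_def A'_def)
  next
    case (add p M)
    then have p: "p \<in> B" and M: "set_mset M \<subseteq> B" by auto
    have "A (add_mset p M) = fst (\<alpha> p) \<otimes> A M" "A' (add_mset p M) = snd (\<alpha> p) \<otimes> A' M"
      unfolding A_def A'_def using sub[OF M] \<alpha>[OF p] by simp_all
    then show ?case using add.IH[OF M] \<alpha>[OF p] Ac[OF M] by (simp add: algebra_simps)
  qed
  \<comment> \<open>For \<open>\<phi> h\<close> equal to the combination of \<open>M\<close> minus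
    that of \<open>N\<close>, its lift is \<open>A M\<close> times \<open>A' N\<close> over
    \<open>A N\<close> times \<open>A' M\<close>. The equation says that \<open>h\<close> is
    \<open>u\<close> times this lift, with the denominators cleared.\<close>
  define rr where "rr = (\<lambda>h u. u \<in> Units H \<and> (\<exists>M N. set_mset M \<subseteq> B \<and> set_mset N \<subseteq> B \<and>
    h \<otimes> (A N \<otimes> A' M) = u \<otimes> (A M \<otimes> A' N)))"
  have ex: "\<exists>u. rr h u" if h: "h \<in> carrier H" for h
  proof -
    have "mset_to_frag (\<phi> h) \<in> PS" using mset_to_frag_in_principal[OF phi_supp[OF h]] h by blast
    then obtain M N where MN: "set_mset M \<subseteq> B" "set_mset N \<subseteq> B" "mset_to_frag (\<phi> h) = (\<Sum>p\<in>#M. b p) - (\<Sum>p\<in>#N. b p)"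
      using span by blast
    have cl: "h \<otimes> (A N \<otimes> A' M) \<in> carrier H" "A M \<otimes> A' N \<in> carrier H" using Ac MN h by auto
    have "mset_to_frag (\<phi> (A M \<otimes> A' N)) = mset_to_frag (\<phi> (h \<otimes> (A N \<otimes> A' M)))"
      using MN(3) Ac[OF MN(1)] Ac[OF MN(2)] h by (simp add: Asum[OF MN(1), symmetric] Asum[OF MN(2), symmetric])
    then have "\<phi> (A M \<otimes> A' N) = \<phi> (h \<otimes> (A N \<otimes> A' M))" by (simp only: mset_to_frag_inj)
    then obtain u where "u \<in> Units H" "h \<otimes> (A N \<otimes> A' M) = u \<otimes> (A M \<otimes> A' N)"
      using phi_eq_ex_unit[OF cl(2,1)] by blast
    then show ?thesis unfolding rr_def using MN by blast
  qed
  have uniq: "u = u'" if h: "h \<in> carrier H" and u: "rr h u" and u': "rr h u'" for h u u'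
  proof -
    obtain M N where MN: "set_mset M \<subseteq> B" "set_mset N \<subseteq> B" "h \<otimes> (A N \<otimes> A' M) = u \<otimes> (A M \<otimes> A' N)"
      using u unfolding rr_def by blast
    obtain M' N' where MN': "set_mset M' \<subseteq> B" "set_mset N' \<subseteq> B" "h \<otimes> (A N' \<otimes> A' M') = u' \<otimes> (A M' \<otimes> A' N')"
      using u' unfolding rr_def by blast
    have uc: "u \<in> Units H" "u' \<in> Units H" using u u' by (auto simp: rr_def)
    note cl = Ac[OF MN(1)] Ac[OF MN(2)] Ac[OF MN'(1)] Ac[OF MN'(2)]
    have pu: "\<phi> u = {#}" "\<phi> u' = {#}" using uc unit_iff Units_closed by blast+
    have "mset_to_frag (\<phi> h) = (\<Sum>p\<in>#M. b p) - (\<Sum>p\<in>#N. b p)"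
      using arg_cong[OF MN(3), of "\<lambda>x. mset_to_frag (\<phi> x)"] cl h uc pu
      by (simp add: Units_closed Asum[OF MN(1), symmetric] Asum[OF MN(2), symmetric] algebra_simps)
    moreover have "mset_to_frag (\<phi> h) = (\<Sum>p\<in>#M'. b p) - (\<Sum>p\<in>#N'. b p)"
      using arg_cong[OF MN'(3), of "\<lambda>x. mset_to_frag (\<phi> x)"] cl h uc pu
      by (simp add: Units_closed Asum[OF MN'(1), symmetric] Asum[OF MN'(2), symmetric] algebra_simps)
    ultimately have "(\<Sum>p\<in>#M + N'. b p) = (\<Sum>p\<in>#M' + N. b p)" by (simp add: algebra_simps)
    \<comment> \<open>Freeness turns the equality of combinations into one of multisets. The
      products of lifts then agree, and multiplying the two equations crosswise reduces everything
      to a cancellation.\<close>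
    then have eq: "M + N' = M' + N" using MN MN' by (intro indep) auto
    have e1: "A M \<otimes> A N' = A M' \<otimes> A N" "A' M \<otimes> A' N' = A' M' \<otimes> A' N"
      using Aadd[OF MN(1) MN'(2)] Aadd[OF MN'(1) MN(2)] eq by simp_all
    have ucc: "u \<in> carrier H" "u' \<in> carrier H" using uc Units_closed by blast+
    define X where "X = h \<otimes> ((A M \<otimes> A N') \<otimes> (A' M \<otimes> A' N'))"
    have Xc: "(A M \<otimes> A N') \<otimes> (A' M \<otimes> A' N') \<in> carrier H" using cl by simp
    have "u \<otimes> (h \<otimes> ((A M \<otimes> A N') \<otimes> (A' M' \<otimes> A' N))) = u \<otimes> (A M \<otimes> A' N) \<otimes> (h \<otimes> (A N' \<otimes> A' M'))"
      using cl h ucc by (simp add: m_ac)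
    also have "\<dots> = (h \<otimes> (A N \<otimes> A' M)) \<otimes> (u' \<otimes> (A M' \<otimes> A' N'))" unfolding MN(3) MN'(3) ..
    also have "\<dots> = u' \<otimes> (h \<otimes> ((A M' \<otimes> A N) \<otimes> (A' M \<otimes> A' N')))"
      using cl h ucc by (simp add: m_ac)
    finally have "u \<otimes> X = u' \<otimes> X" unfolding X_def e1 .
    moreover have "X \<in> carrier H" unfolding X_def using Xc h by simp
    ultimately show ?thesis using ucc r_cancel[of u X u'] by blast
  qed
  define \<rho> where "\<rho> = (\<lambda>h. SOME u. rr h u)"
  have \<rho>: "rr h (\<rho> h)" if "h \<in> carrier H" for h unfolding \<rho>_def using ex[OF that] by (rule someI_ex)
  have \<rho>I: "\<rho> h = u" if "h \<in> carrier H" "rr h u" for h u using uniq[OF that(1) \<rho>[OF that(1)] that(2)] .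
  show thesis
  proof (rule that[of \<rho>])
    show "\<rho> h \<in> Units H" if "h \<in> carrier H" for h using \<rho>[OF that] by (simp add: rr_def)
    show "\<rho> u = u" if u: "u \<in> Units H" for u
    proof (rule \<rho>I)
      show "rr u u" unfolding rr_def
        using u by (intro conjI exI[of _ "{#}"]) auto
    qed (use u Units_closed in blast)
    show "\<rho> (h \<otimes> h') = \<rho> h \<otimes> \<rho> h'" if h: "h \<in> carrier H" "h' \<in> carrier H" for h h'
    proof (rule \<rho>I)
      obtain M N where MN: "set_mset M \<subseteq> B" "set_mset N \<subseteq> B" "h \<otimes> (A N \<otimes> A' M) = \<rho> h \<otimes> (A M \<otimes> A' N)"
        using \<rho>[OF h(1)] unfolding rr_def by blast
      obtain M' N' where MN': "set_mset M' \<subseteq> B" "set_mset N' \<subseteq> B" "h' \<otimes> (A N' \<otimes> A' M') = \<rho> h' \<otimes> (A M' \<otimes> A' N')"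
        using \<rho>[OF h(2)] unfolding rr_def by blast
      have uc: "\<rho> h \<in> Units H" "\<rho> h' \<in> Units H" using \<rho> h by (auto simp: rr_def)
      note cl = Ac[OF MN(1)] Ac[OF MN(2)] Ac[OF MN'(1)] Ac[OF MN'(2)]
      have "(h \<otimes> h') \<otimes> (A (N + N') \<otimes> A' (M + M')) = (h \<otimes> (A N \<otimes> A' M)) \<otimes> (h' \<otimes> (A N' \<otimes> A' M'))"
        using cl h by (simp add: Aadd MN MN' m_ac)
      also have "\<dots> = (\<rho> h \<otimes> (A M \<otimes> A' N)) \<otimes> (\<rho> h' \<otimes> (A M' \<otimes> A' N'))" unfolding MN(3) MN'(3) ..
      also have "\<dots> = (\<rho> h \<otimes> \<rho> h') \<otimes> (A (M + M') \<otimes> A' (N + N'))"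
        using cl uc by (simp add: Aadd MN MN' m_ac Units_closed)
      finally have "(h \<otimes> h') \<otimes> (A (N + N') \<otimes> A' (M + M')) = (\<rho> h \<otimes> \<rho> h') \<otimes> (A (M + M') \<otimes> A' (N + N'))" .
      moreover have "set_mset (M + M') \<subseteq> B" "set_mset (N + N') \<subseteq> B" using MN MN' by auto
      ultimately show "rr (h \<otimes> h') (\<rho> h \<otimes> \<rho> h')" unfolding rr_def using uc by blast
    qed (use h in simp)
  qed
qed

context krull_prime_reps
begin

lemma rep_divides_iff: "p \<in> P0 \<Longrightarrow> h \<in> carrier H \<Longrightarrow> p divides h \<longleftrightarrow> prime_divisor p \<in># \<phi> h"
  using divides_iff[of p h] phi_rep[of p] rep_prime[of p] by simp

lemma extract_primes:
  assumes "x \<in> carrier H"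
  shows "\<exists>f y. set_mset f \<subseteq> P0 \<and> y \<in> carrier H \<and> (\<forall>p\<in>P0. \<not> p divides y) \<and> x = mset_prod H f \<otimes> y"
  using assms
proof (induction "size (\<phi> x)" arbitrary: x rule: less_induct)
  case less
  show ?case
  proof (cases "\<forall>p\<in>P0. \<not> p divides x")
    case True
    then show ?thesis using less.prems by (intro exI[of _ "{#}"] exI[of _ x]) simp
  next
    case False
    then obtain p where p: "p \<in> P0" "p divides x" by blast
    have pc: "p \<in> carrier H" using rep_prime p by blast
    obtain c where c: "c \<in> carrier H" "x = p \<otimes> c" using p(2) by (auto simp: factor_def)
    have "size (\<phi> c) < size (\<phi> x)" using c pc phi_rep[OF p(1)] by simp
    then obtain f y where fy: "set_mset f \<subseteq> P0" "y \<in> carrier H" "\<forall>p\<in>P0. \<not> p divides y" "c = mset_prod H f \<otimes> y"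
      using less.hyps c(1) by blast
    have "x = mset_prod H (add_mset p f) \<otimes> y"
      using c fy pc reps_carrier[OF fy(1)] by (simp add: m_assoc)
    moreover have "set_mset (add_mset p f) \<subseteq> P0" using fy p by simp
    ultimately show ?thesis using fy by blast
  qed
qed

text \<open>The retraction removes the freedom in choosing associates: the complement consists of
  the elements with trivial retraction that no representative divides. The second condition is
  multiplicative because the representatives are prime.\<close>

theorem splits_exists: "\<exists>S. splits_as H P0 S"
proof -
  obtain \<rho> where \<rho>: "\<And>h. h \<in> carrier H \<Longrightarrow> \<rho> h \<in> Units H"
    "\<And>h h'. h \<in> carrier H \<Longrightarrow> h' \<in> carrier H \<Longrightarrow> \<rho> (h \<otimes> h') = \<rho> h \<otimes> \<rho> h'"
    "\<And>u. u \<in> Units H \<Longrightarrow> \<rho> u = u"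
    by (rule unit_retraction) (rule that)
  define S where "S = {h \<in> carrier H. \<rho> h = \<one> \<and> (\<forall>p\<in>P0. \<not> p divides h)}"
  have SH: "h \<in> carrier H" if "h \<in> S" for h using that by (simp add: S_def)
  have prime_mult: "p divides a \<or> p divides b"
    if "p \<in> P0" "a \<in> carrier H" "b \<in> carrier H" "p divides a \<otimes> b" for p a b
    using rep_prime[OF that(1)] that unfolding prime_def by blast
  have S_mult: "a \<otimes> b \<in> S" if ab: "a \<in> S" "b \<in> S" for a b
  proof -
    have "\<rho> (a \<otimes> b) = \<one>" using ab \<rho>(2)[of a b] by (simp add: S_def)
    then show ?thesis using ab prime_mult[of _ a b] by (auto simp: S_def)
  qed
  have S_one: "\<one> \<in> S"
  proof -
    have "\<not> p divides \<one>" if "p \<in> P0" for p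
      using rep_divides_iff[OF that, of \<one>] by simp
    then show ?thesis using \<rho>(3)[of \<one>] by (simp add: S_def)
  qed
  have S_off: "set_mset (\<phi> h) \<inter> split_primes = {}" if "h \<in> S" for h
    using that rep_divides_iff[of _ h] by (auto simp: S_def split_primes_def)
  let ?F = "\<lambda>(u, f, h). u \<otimes> mset_prod H f \<otimes> h"
  let ?D = "units_of H \<times>\<times> free_abelian_monoid P0 \<times>\<times> H\<lparr>carrier := S\<rparr>"
  have D: "x \<in> carrier ?D \<longleftrightarrow> (\<exists>u f h. x = (u, f, h) \<and> u \<in> Units H \<and> set_mset f \<subseteq> P0 \<and> h \<in> S)" for x
    by (auto simp: DirProd_def units_of_def)
  have fc: "mset_prod H f \<in> carrier H" if "set_mset f \<subseteq> P0" for f using reps_carrier[OF that] by simp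
  have "?F \<in> hom ?D H"
  proof (rule homI)
    fix x assume "x \<in> carrier ?D"
    then show "?F x \<in> carrier H" unfolding D using fc SH by (auto simp: Units_closed)
  next
    fix x y assume "x \<in> carrier ?D" "y \<in> carrier ?D"
    then obtain u f h u' f' h' where xy: "x = (u, f, h)" "y = (u', f', h')"
      and *: "u \<in> Units H" "set_mset f \<subseteq> P0" "h \<in> S" "u' \<in> Units H" "set_mset f' \<subseteq> P0" "h' \<in> S"
      unfolding D by blast
    have "(u \<otimes> u') \<otimes> mset_prod H (f + f') \<otimes> (h \<otimes> h') = (u \<otimes> mset_prod H f \<otimes> h) \<otimes> (u' \<otimes> mset_prod H f' \<otimes> h')"
      using * fc[OF *(2)] fc[OF *(5)] SH[OF *(3)] SH[OF *(6)]
      by (simp add: mset_prod_union reps_carrier Units_closed m_ac)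
    then show "?F (x \<otimes>\<^bsub>?D\<^esub> y) = ?F x \<otimes> ?F y"
      unfolding xy by (simp add: DirProd_def units_of_def)
  qed
  moreover have "bij_betw ?F (carrier ?D) (carrier H)"
  proof (rule bij_betw_imageI)
    show "inj_on ?F (carrier ?D)"
    proof (rule inj_onI)
      fix x y assume "x \<in> carrier ?D" "y \<in> carrier ?D" and eq: "?F x = ?F y"
      then obtain u f h u' f' h' where xy: "x = (u, f, h)" "y = (u', f', h')"
        and *: "u \<in> Units H" "set_mset f \<subseteq> P0" "h \<in> S" "u' \<in> Units H" "set_mset f' \<subseteq> P0" "h' \<in> S"
        unfolding D by blast
      note cl = fc[OF *(2)] fc[OF *(5)] SH[OF *(3)] SH[OF *(6)] Units_closed[OF *(1)] Units_closed[OF *(4)]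
      have eq': "u \<otimes> mset_prod H f \<otimes> h = u' \<otimes> mset_prod H f' \<otimes> h'" using eq xy by simp
      have "\<phi> u = {#}" "\<phi> u' = {#}" using unit_iff cl * by blast+
      then have phi_eq: "image_mset prime_divisor f + \<phi> h = image_mset prime_divisor f' + \<phi> h'"
        using arg_cong[OF eq', of \<phi>] cl * by (simp add: phi_mset_prod)
      have "image_mset prime_divisor f = image_mset prime_divisor f'"
      proof (rule multiset_eqI)
        fix q
        show "count (image_mset prime_divisor f) q = count (image_mset prime_divisor f') q"
        proof (cases "q \<in> split_primes")
          case True
          then have "count (\<phi> h) q = 0" "count (\<phi> h') q = 0"
            using S_off *(3,6) by (auto simp: not_in_iff[symmetric])
          then show ?thesis using arg_cong[OF phi_eq, of "\<lambda>m. count m q"] by simp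
        next
          case False
          then have "q \<notin># image_mset prime_divisor f" "q \<notin># image_mset prime_divisor f'"
            using * by (auto simp: split_primes_def)
          then show ?thesis by (simp only: not_in_iff)
        qed
      qed
      then have ff: "f = f'" by (rule image_mset_inj_on_eq[OF prime_divisor_inj *(2,5)])
      have "mset_prod H f \<otimes> (u \<otimes> h) = mset_prod H f \<otimes> (u' \<otimes> h')"
        using eq' cl unfolding ff by (simp add: m_ac)
      then have uh: "u \<otimes> h = u' \<otimes> h'" using l_cancel[of "mset_prod H f"] cl by simp
      have "\<rho> (u \<otimes> h) = u" "\<rho> (u' \<otimes> h') = u'"
        using \<rho>(2)[OF cl(5,3)] \<rho>(2)[OF cl(6,4)] \<rho>(3)[OF *(1)] \<rho>(3)[OF *(4)] *(3,6) cl by (simp_all add: S_def)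
      then have "u = u'" using uh by simp
      moreover from this have "h = h'" using uh l_cancel[of u h h'] cl by simp
      ultimately show "x = y" using ff xy by simp
    qed
    show "?F ` carrier ?D = carrier H"
    proof (intro equalityI subsetI)
      fix x assume "x \<in> ?F ` carrier ?D"
      then show "x \<in> carrier H" using \<open>?F \<in> hom ?D H\<close> hom_carrier by blast
    next
      fix x assume "x \<in> carrier H"
      then obtain f y where fy: "set_mset f \<subseteq> P0" "y \<in> carrier H" "\<forall>p\<in>P0. \<not> p divides y" "x = mset_prod H f \<otimes> y"
        using extract_primes by blast
      \<comment> \<open>The prime-free part \<open>y\<close> is normalized by dividing by its own
        retraction; a unit factor does not change which representatives divide.\<close>
      define u where "u = \<rho> y"
      have u: "u \<in> Units H" unfolding u_def by (rule \<rho>(1)[OF fy(2)])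
      define h where "h = inv u \<otimes> y"
      have hc: "h \<in> carrier H" unfolding h_def using u fy(2) by simp
      have y: "y = u \<otimes> h" unfolding h_def using u fy(2) by (simp add: m_assoc[symmetric] Units_closed)
      have "\<rho> h = inv u \<otimes> u"
        unfolding h_def using \<rho>(2)[of "inv u" y] \<rho>(3)[of "inv u"] u fy(2) by (simp add: u_def)
      then have "\<rho> h = \<one>" using u by simp
      moreover have "\<not> p divides h" if "p \<in> P0" for p
      proof
        assume "p divides h"
        then have "p divides y"
          unfolding y using u hc rep_prime[OF that] by (metis Units_closed divides_prod_r m_comm)
        then show False using fy(3) that by blast
      qed
      ultimately have hS: "h \<in> S" using hc by (simp add: S_def)
      have "x = u \<otimes> mset_prod H f \<otimes> h" unfolding fy(4) y using u fc[OF fy(1)] hc by (simp add: m_ac Units_closed)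
      then have "x = ?F (u, f, h)" by simp
      moreover have "(u, f, h) \<in> carrier ?D" unfolding D using u fy(1) hS by blast
      ultimately show "x \<in> ?F ` carrier ?D" by blast
    qed
  qed
  ultimately have "?F \<in> iso ?D H" by (rule isoI)
  moreover have "submonoid S H" using S_mult S_one SH by (simp add: submonoid_def subset_iff)
  ultimately show ?thesis unfolding splits_as_def by blast
qed

end

section \<open>The torsion case\<close>

text \<open>For \<open>t > 0\<close> the grid elements of row 1 have infinite order. For
  \<open>t = 0\<close> the free factor of the product is trivial, so \<open>C\<close> is a finite
  group, a power of the cyclic group of order \<open>s 0\<close>.\<close>

lemma class_structure_torsion:
  assumes C: "comm_group C" and cs: "class_structure C G0 t k s e g"
  shows "torsion_group C \<longleftrightarrow> t = 0"
    and "t = 0 \<Longrightarrow> C \<cong> product_group {1..k} (\<lambda>_. integer_mod_group (Gcd (s ` {0..t}))) \<and>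
      Gcd (s ` {0..t}) \<ge> 2 \<and> k \<ge> 1 \<and> k + 1 \<noteq> Gcd (s ` {0..t}) \<and> (\<forall>i\<in>{1..k}. group.ord C (g i) = Gcd (s ` {0..t}))"
proof -
  interpret comm_group C by fact
  define \<gamma> where "\<gamma> = (\<lambda>(i, j). if j = 0 then g i else e i j)"
  interpret g: proper_grid_group C \<gamma> k t s
    unfolding \<gamma>_def by (rule class_structureD[OF C cs])
  have iso: "C \<cong> product_group {1..k} (\<lambda>_. product_group {1..t} (\<lambda>_. integer_group) \<times>\<times> integer_mod_group (Gcd (s ` {0..t})))"
    using cs unfolding class_structure_def by blast
  have zero: "C \<cong> product_group {1..k} (\<lambda>_. integer_mod_group (Gcd (s ` {0..t}))) \<and>
      Gcd (s ` {0..t}) \<ge> 2 \<and> k \<ge> 1 \<and> k + 1 \<noteq> Gcd (s ` {0..t}) \<and> (\<forall>i\<in>{1..k}. ord (g i) = Gcd (s ` {0..t}))"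
    if t: "t = 0"
  proof -
    have n: "Gcd (s ` {0..t}) = s 0" using t by simp
    let ?A = "product_group {1..k} (\<lambda>_. product_group {1..t} (\<lambda>_. integer_group) \<times>\<times> integer_mod_group (Gcd (s ` {0..t})))"
    let ?B = "product_group {1..k} (\<lambda>_. integer_mod_group (Gcd (s ` {0..t})))"
    let ?h = "\<lambda>z. \<lambda>i\<in>{1..k}. snd (z i)"
    \<comment> \<open>For \<open>t = 0\<close> the free factor is a product over the empty set. Its
      only element is the function that is \<open>undefined\<close> everywhere, hence this witness
      in the inverse map.\<close>
    have c: "carrier ?A = (\<Pi>\<^sub>E i\<in>{1..k}. {\<lambda>_. undefined} \<times> carrier (integer_mod_group (Gcd (s ` {0..t}))))"
      using t by (simp add: DirProd_def)
    have "?h \<in> hom ?A ?B"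
    proof (rule homI)
      fix x assume "x \<in> carrier ?A"
      then show "?h x \<in> carrier ?B" unfolding c carrier_product_group by (auto dest: PiE_mem)
    next
      fix x y
      show "?h (x \<otimes>\<^bsub>?A\<^esub> y) = ?h x \<otimes>\<^bsub>?B\<^esub> ?h y"
        by (rule ext) (simp add: DirProd_def split: prod.splits)
    qed
    moreover have "bij_betw ?h (carrier ?A) (carrier ?B)"
    proof (rule bij_betw_byWitness[where f' = "\<lambda>w. \<lambda>i\<in>{1..k}. (\<lambda>_. undefined, w i)"])
      show "\<forall>a\<in>carrier ?A. (\<lambda>i\<in>{1..k}. (\<lambda>_. undefined, ?h a i)) = a"
      proof
        fix a assume a: "a \<in> carrier ?A"
        show "(\<lambda>i\<in>{1..k}. (\<lambda>_. undefined, ?h a i)) = a"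
        proof (rule PiE_ext[OF _ a[unfolded c]])
          show "(\<lambda>i\<in>{1..k}. (\<lambda>_. undefined, ?h a i)) \<in> (\<Pi>\<^sub>E i\<in>{1..k}. {\<lambda>_. undefined} \<times> carrier (integer_mod_group (Gcd (s ` {0..t}))))"
            using PiE_mem[OF a[unfolded c]] by (auto simp: mem_Times_iff)
          fix i assume i: "i \<in> {1..k}"
          then show "(\<lambda>i\<in>{1..k}. (\<lambda>_. undefined, ?h a i)) i = a i"
            using PiE_mem[OF a[unfolded c] i] by (simp add: mem_Times_iff prod_eq_iff)
        qed
      qed
      show "\<forall>w\<in>carrier ?B. ?h (\<lambda>i\<in>{1..k}. (\<lambda>_. undefined, w i)) = w"
      proof
        fix w assume w: "w \<in> carrier ?B"
        show "?h (\<lambda>i\<in>{1..k}. (\<lambda>_. undefined, w i)) = w"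
          using w unfolding carrier_product_group by (intro PiE_ext[OF _ w[unfolded carrier_product_group]]) auto
      qed
      show "?h ` carrier ?A \<subseteq> carrier ?B"
        using \<open>?h \<in> hom ?A ?B\<close> hom_carrier by blast
      show "(\<lambda>w. \<lambda>i\<in>{1..k}. (\<lambda>_. undefined, w i)) ` carrier ?B \<subseteq> carrier ?A"
      proof (rule image_subsetI)
        fix w assume "w \<in> carrier ?B"
        then have "w i \<in> carrier (integer_mod_group (Gcd (s ` {0..t})))" if "i \<in> {1..k}" for i
          using that unfolding carrier_product_group by (rule PiE_mem)
        then show "(\<lambda>i\<in>{1..k}. (\<lambda>_. undefined, w i)) \<in> carrier ?A"
          unfolding c by (intro restrict_PiE_iff[THEN iffD2] ballI SigmaI) simp_all
      qed
    qed
    ultimately have "?A \<cong> ?B" unfolding is_iso_def using isoI by blast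
    then have "C \<cong> ?B" using iso iso_trans by blast
    moreover have "s 0 \<ge> 2" "k + 1 \<noteq> s 0" using g.s2 g.ks t by auto
    moreover have "ord (g i) = s 0" if i: "i \<in> {1..k}" for i
    proof -
      have "\<gamma> (i, 0) = g i" by (simp add: \<gamma>_def)
      then have gi: "g i \<in> carrier C" using g.gamma_closed[of i 0] i by simp
      \<comment> \<open>Without any \<open>e i j\<close> the subgroup in
        \<open>pow_in_generate\<close> is trivial, so that lemma computes the order of
        \<open>g i\<close>.\<close>
      have "g i [^]\<^bsub>C\<^esub> m = \<one>\<^bsub>C\<^esub> \<longleftrightarrow> s 0 dvd m" for m :: nat
        using g.pow_in_generate[OF i, of m] t \<open>\<gamma> (i, 0) = g i\<close> by (simp add: generate_empty)
      then show ?thesis using ord_unique[OF gi] by blast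
    qed
    ultimately show ?thesis using g.k1 unfolding n by blast
  qed
  show "t = 0 \<Longrightarrow> C \<cong> product_group {1..k} (\<lambda>_. integer_mod_group (Gcd (s ` {0..t}))) \<and>
      Gcd (s ` {0..t}) \<ge> 2 \<and> k \<ge> 1 \<and> k + 1 \<noteq> Gcd (s ` {0..t}) \<and> (\<forall>i\<in>{1..k}. ord (g i) = Gcd (s ` {0..t}))"
    by (rule zero)
  show "torsion_group C \<longleftrightarrow> t = 0"
  proof
    assume tor: "torsion_group C"
    show "t = 0"
    proof (rule ccontr)
      assume "t \<noteq> 0"
      then have "ord (\<gamma> (1, 0)) = 0" using g.ord_gamma_pos[of 1 0] g.k1 by simp
      moreover have "\<gamma> (1, 0) \<in> carrier C" using g.gamma_closed[of 1 0] g.k1 by simp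
      ultimately show False using tor unfolding torsion_group_def by fastforce
    qed
  next
    assume t: "t = 0"
    let ?B = "product_group {1..k} (\<lambda>_. integer_mod_group (Gcd (s ` {0..t})))"
    have "Gcd (s ` {0..t}) \<noteq> 0" using zero[OF t] by linarith
    then have "finite (carrier (integer_mod_group (Gcd (s ` {0..t}))))"
      by (simp only: carrier_integer_mod_group) simp
    then have "finite (carrier ?B)" unfolding carrier_product_group by (intro finite_PiE) simp_all
    moreover obtain h where "bij_betw h (carrier C) (carrier ?B)"
      using zero[OF t] unfolding is_iso_def iso_def by blast
    ultimately have "finite (carrier C)" using bij_betw_finite by blast
    then show "torsion_group C" unfolding torsion_group_def using ord_ge_1 by (metis not_one_le_zero)
  qed
qed

section \<open>Assembly of the statement\<close>

lemma krull_prime_repsI: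
  assumes "comm_monoid_cancel H" "prime_representatives H P0" "divisor_theory H P \<phi>"
  shows "krull_prime_reps H P \<phi> P0"
  using krull_with_theoryI[OF assms(1,3)] assms(2)
  by (simp add: krull_prime_reps_def krull_prime_reps_axioms_def)

lemma krull_splittingI:
  assumes "comm_monoid_cancel H" "prime_representatives H P0" "divisor_theory H P \<phi>" "splits_as H P0 S"
  shows "krull_splitting H P \<phi> P0 S"
  using krull_prime_repsI[OF assms(1-3)] assms(4)
  by (simp add: krull_splitting_def krull_splitting_axioms_def)

theorem theorem1p1:
  fixes H :: "('a, 'm) monoid_scheme" and P0 :: "'a set"
  assumes "krull_monoid H"
    and "prime_representatives H P0"
  shows
    "(\<exists>S. splits_as H P0 S) \<and>
     (\<forall>S. splits_as H P0 S \<longrightarrow>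
       (let Hstar = H\<lparr>carrier := S\<rparr> in
          free_abelian_monoid P0 \<times>\<times> Hstar \<cong> red_monoid H \<and>
          reduced Hstar \<and> krull_monoid Hstar \<and> (\<forall>p\<in>carrier Hstar. \<not> prime Hstar p) \<and>
          (\<forall>(P :: 'p set) \<phi> (Q :: 'q set) \<psi>. divisor_theory H P \<phi> \<and> divisor_theory Hstar Q \<psi> \<longrightarrow>
             class_group H P \<phi> \<cong> class_group Hstar Q \<psi>) \<and>
          (length_factorial H \<longleftrightarrow> length_factorial Hstar) \<and>
          (\<forall>(Q :: 'q set) \<psi>. divisor_theory Hstar Q \<psi> \<longrightarrow>
             (let C = class_group Hstar Q \<psi>; GP = divisor_class Hstar Q \<psi> ` Q in
                (length_factorial H \<and> \<not> factorial H \<longleftrightarrow>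
                   (\<forall>c\<in>GP. \<exists>!q. q \<in> Q \<and> divisor_class Hstar Q \<psi> q = c) \<and>
                   Hstar \<cong> zero_sum_monoid C GP \<and>
                   (\<exists>t k s e g. class_structure C GP t k s e g)) \<and>
                (length_factorial H \<and> \<not> factorial H \<longrightarrow>
                   (\<forall>t k s e g. class_structure C GP t k s e g \<longrightarrow>
                      (torsion_group C \<longleftrightarrow> t = 0) \<and>
                      (t = 0 \<longrightarrow>
                         (let n = Gcd (s ` {0..t}) in
                            C \<cong> product_group {1..k} (\<lambda>_. integer_mod_group n) \<and>
                            n \<ge> 2 \<and> k \<ge> 1 \<and> k + 1 \<noteq> n \<and>
                            (\<forall>i\<in>{1..k}. group.ord C (g i) = n)))))))))"
proof -
  have H: "comm_monoid_cancel H" using assms(1) by (simp add: krull_monoid_def)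
  obtain P1 :: "'a set set" and \<phi>1 where dt1: "divisor_theory H P1 \<phi>1"
    using assms(1) by (auto simp: krull_monoid_def)
  have ex: "\<exists>S. splits_as H P0 S"
    by (rule krull_prime_reps.splits_exists[OF krull_prime_repsI[OF H assms(2) dt1]])
  show ?thesis
  proof (intro conjI ex allI impI, unfold Let_def, intro conjI allI impI)
    fix S assume S: "splits_as H P0 S"
    interpret S: krull_splitting H P1 \<phi>1 P0 S by (rule krull_splittingI[OF H assms(2) dt1 S])
    let ?Hs = "H\<lparr>carrier := S\<rparr>"
    show "free_abelian_monoid P0 \<times>\<times> ?Hs \<cong> red_monoid H" by (rule S.red_iso)
    show "reduced ?Hs" by (rule S.Hs_reduced)
    show "krull_monoid ?Hs" by (rule S.Hs_krull)
    show np: "\<forall>p\<in>carrier ?Hs. \<not> prime ?Hs p" using S.Hs_no_prime by blast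
    show "length_factorial H \<longleftrightarrow> length_factorial ?Hs" by (rule S.length_factorial_Hs)
    \<comment> \<open>The theory \<open>P1\<close> from the definition of Krull monoids serves the
      assertions that mention no divisor theory. Here the splitting is instantiated anew with the
      given theory of \<open>H\<close>, whose basis may have another type.\<close>
    show "class_group H P \<phi> \<cong> class_group ?Hs Q \<psi>"
      if "divisor_theory H P \<phi> \<and> divisor_theory ?Hs Q \<psi>"
      for P :: "'p set" and \<phi> and Q :: "'q set" and \<psi>
      using krull_splitting.class_group_iso[OF krull_splittingI[OF H assms(2) _ S]] that by blast
    fix Q :: "'q set" and \<psi>
    assume dt: "divisor_theory ?Hs Q \<psi>"
    interpret Q: krull_with_theory ?Hs Q \<psi> by (rule krull_with_theoryI[OF S.Hs_comm_monoid_cancel dt])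
    let ?C = "class_group ?Hs Q \<psi>" and ?GP = "divisor_class ?Hs Q \<psi> ` Q"
    show "length_factorial H \<and> \<not> factorial H \<longleftrightarrow>
      (\<forall>c\<in>?GP. \<exists>!q. q \<in> Q \<and> divisor_class ?Hs Q \<psi> q = c) \<and> ?Hs \<cong> zero_sum_monoid ?C ?GP \<and>
      (\<exists>t k s e g. class_structure ?C ?GP t k s e g)"
      unfolding S.length_factorial_Hs S.factorial_Hs
      by (rule Q.length_factorial_characterization[OF S.Hs_reduced np])
    fix t k s e g
    assume cs: "class_structure ?C ?GP t k s e g"
    note torsion = class_structure_torsion[OF Q.class_group_comm_group cs]
    show "torsion_group ?C \<longleftrightarrow> t = 0" by (rule torsion(1))
    assume "t = 0"
    note torsion = torsion(2)[OF this]
    show "?C \<cong> product_group {1..k} (\<lambda>_. integer_mod_group (Gcd (s ` {0..t})))"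
      "Gcd (s ` {0..t}) \<ge> 2" "k \<ge> 1" "k + 1 \<noteq> Gcd (s ` {0..t})"
      using torsion by blast+
    show "\<forall>i\<in>{1..k}. group.ord ?C (g i) = Gcd (s ` {0..t})" using torsion by blast
  qed
qed

end
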